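(* Let $n\ge3$ and let $u\in H^1_{loc}(\mathbb R^n)$ be a weak solution of $$-\Delta u+(u\cdot\nabla)u+\nabla p=f,\qquad\operatorname{div}u=0\quad\text{in }\mathbb R^n .$$ There exists $\varepsilon_0>0$ such that if for some $\epsilon\in(0,\varepsilon_0]$, $$|f(x)|\le\epsilon\langle x\rangle^{-a}\ \text{ with }a>n+1,\qquad\int_{\mathbb R^n}f(x)\,dx=0,$$ and $|u(x)|\le\epsilon\langle x\rangle^{1-n}$, then its asymptotics is given by $$u_i(x)=\sum_{(k,j)\ne(n,n)}\Phi^{jk}_i(x)a_{jk}+O(\epsilon\delta(x)),$$ where the sum is over $1\le j,k\le n$ with $(k,j)\ne(n,n)$, $\delta(x)=\langle x\rangle^{-\min\{a-2,n\}}(1+1_{a=n+2}\log\langle x\rangle)$, and $$a_{jk}=b_{jk}-\int_{\mathbb R^n}u_ju_k\,dy\ \ (j\ne k),\qquad a_{jj}=b_{jj}-\int_{\mathbb R^n}(u_j^2-u_n^2)\,dy,$$ with $$b_{jk}=-\int_{\mathbb R^n}y_kf_j(y)\,dy\ \ (j\neq k),\qquad b_{jj}=\int_{\mathbb R^n}(y_nf_n(y)-y_jf_j(y))\,dy .$$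
   Context: $\langle x\rangle=(2+|x|^2)^{1/2}$; $1_{a=n+2}$ is $1$ if $a=n+2$ and $0$ otherwise; $\omega_n=\frac{2\pi^{n/2}}{n\Gamma(n/2)}$ is the volume of the unit ball. $E(x)=\frac{1}{n(n-2)\omega_n}|x|^{2-n}$ ($n\ge3$). The Lorentz tensor is $U_{ij}(x)=\frac12\delta_{ij}E(x)+\frac1{2n\omega_n}\frac{x_ix_j}{|x|^n}$, and $\Phi^{jk}=(\Phi^{jk}_1,\dots,\Phi^{jk}_n)$ with $\Phi^{jk}_i=\partial_kU_{ij}$. The asymptotics are for large $|x|$. A weak solution is a divergence-free field in $W^{1,2}_{loc}$ satisfying the weak form of the equation against divergence-free test functions in $C_c^\infty(\mathbb R^n;\mathbb R^n)$; no global integrability is assumed beyond what is stated. *)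

theory Defs
  imports "HOL-Analysis.Analysis"
begin

text \<open>The space is \<open>real^'n\<close> with \<open>n = CARD('n)\<close>; functions known only almost everywhere
  are represented by Lebesgue measurable functions.\<close>

definition partial_deriv ::
  "'n::finite \<Rightarrow> (real^'n \<Rightarrow> 'b::real_normed_vector) \<Rightarrow> real^'n \<Rightarrow> 'b"
  where "partial_deriv k g x = frechet_derivative g (at x) (axis k 1)"

primrec Ck :: "nat \<Rightarrow> (real^'n::finite \<Rightarrow> 'b::real_normed_vector) \<Rightarrow> bool" where
  "Ck 0 g \<longleftrightarrow> continuous_on UNIV g"
| "Ck (Suc m) g \<longleftrightarrow> (\<forall>x. g differentiable (at x)) \<and> (\<forall>k. Ck m (partial_deriv k g))"

definition test_function :: "(real^'n::finite \<Rightarrow> 'b::real_normed_vector) \<Rightarrow> bool"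
  where "test_function \<phi> \<longleftrightarrow> (\<forall>m. Ck m \<phi>) \<and> compact (closure {x. \<phi> x \<noteq> 0})"

definition L1_loc :: "(real^'n::finite \<Rightarrow> real^'n) \<Rightarrow> bool"
  where "L1_loc g \<longleftrightarrow> (\<forall>K. compact K \<longrightarrow> set_integrable lebesgue K g)"

definition L2_loc :: "(real^'n::finite \<Rightarrow> real^'n) \<Rightarrow> bool"
  where "L2_loc g \<longleftrightarrow> g \<in> borel_measurable lebesgue \<and>
    (\<forall>K. compact K \<longrightarrow> set_integrable lebesgue K (\<lambda>x. (norm (g x))\<^sup>2))"

definition weak_partial_deriv ::
  "'n::finite \<Rightarrow> (real^'n \<Rightarrow> real^'n) \<Rightarrow> (real^'n \<Rightarrow> real^'n) \<Rightarrow> bool"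
  where "weak_partial_deriv k u v \<longleftrightarrow>
    (\<forall>\<phi> :: real^'n \<Rightarrow> real. test_function \<phi> \<longrightarrow>
       (LINT x|lebesgue. partial_deriv k \<phi> x *\<^sub>R u x) = - (LINT x|lebesgue. \<phi> x *\<^sub>R v x))"

text \<open>\<open>D k\<close> is the weak derivative \<open>\<partial>\<^sub>k u\<close>; it is determined by \<open>u\<close> up to null sets.\<close>

definition W12_loc_deriv ::
  "(real^'n::finite \<Rightarrow> real^'n) \<Rightarrow> ('n \<Rightarrow> real^'n \<Rightarrow> real^'n) \<Rightarrow> bool"
  where "W12_loc_deriv u D \<longleftrightarrow>
    L2_loc u \<and> (\<forall>k. L2_loc (D k) \<and> weak_partial_deriv k u (D k))"

text \<open>Weak solutions of \<open>-\<Delta>u + (u \<cdot> \<nabla>)u + \<nabla>p = f\<close>, \<open>div u = 0\<close> on the whole space; the pressure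
  is eliminated by testing with divergence-free fields only.\<close>

definition weak_solution ::
  "(real^'n::finite \<Rightarrow> real^'n) \<Rightarrow> (real^'n \<Rightarrow> real^'n) \<Rightarrow> bool"
  where "weak_solution f u \<longleftrightarrow>
    L1_loc f \<and>
    (\<exists>D. W12_loc_deriv u D \<and>
      (AE x in lebesgue. (\<Sum>k\<in>UNIV. D k x $ k) = 0) \<and>
      (\<forall>\<phi> :: real^'n \<Rightarrow> real^'n.
         test_function \<phi> \<longrightarrow> (\<forall>x. (\<Sum>k\<in>UNIV. partial_deriv k \<phi> x $ k) = 0) \<longrightarrow>
         (LINT x|lebesgue. (\<Sum>k\<in>UNIV. D k x \<bullet> partial_deriv k \<phi> x))
         + (LINT x|lebesgue. (\<Sum>k\<in>UNIV. u x $ k *\<^sub>R D k x) \<bullet> \<phi> x)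
         = (LINT x|lebesgue. f x \<bullet> \<phi> x)))"

definition bracket :: "real^'n::finite \<Rightarrow> real"
  where "bracket x = sqrt (2 + (norm x)\<^sup>2)"

definition omega :: "nat \<Rightarrow> real"
  where "omega n = 2 * pi powr (real n / 2) / (real n * Gamma (real n / 2))"

lemma omega_eq_unit_ball_vol:
  assumes "n > 0"
  shows "omega n = unit_ball_vol (real n)"
proof -
  have "Gamma (real n / 2 + 1) = real n / 2 * Gamma (real n / 2)"
    using assms by (intro Gamma_plus1) auto
  then show ?thesis
    by (simp only: omega_def unit_ball_vol_def) simp
qed

definition fund_sol :: "real^'n::finite \<Rightarrow> real"
  where "fund_sol x =
    1 / (real CARD('n) * (real CARD('n) - 2) * omega CARD('n)) * norm x powr (2 - real CARD('n))"

definition Lorentz :: "'n::finite \<Rightarrow> 'n \<Rightarrow> real^'n \<Rightarrow> real"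
  where "Lorentz i j x =
    1 / 2 * (if i = j then 1 else 0) * fund_sol x
    + 1 / (2 * real CARD('n) * omega CARD('n)) * (x $ i * x $ j / norm x ^ CARD('n))"

definition Phi :: "'n::finite \<Rightarrow> 'n \<Rightarrow> 'n \<Rightarrow> real^'n \<Rightarrow> real"
  where "Phi j k i x = partial_deriv k (Lorentz i j) x"

text \<open>The index type has no order, so the last coordinate \<open>n\<close> is represented by an
  index \<open>N :: 'n\<close>, which may be chosen arbitrarily.\<close>

definition coeff_b :: "'n::finite \<Rightarrow> (real^'n \<Rightarrow> real^'n) \<Rightarrow> 'n \<Rightarrow> 'n \<Rightarrow> real"
  where "coeff_b N f j k =
    (if j \<noteq> k then - (LINT y|lebesgue. y $ k * f y $ j)
     else (LINT y|lebesgue. y $ N * f y $ N - y $ j * f y $ j))"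

definition coeff_a ::
  "'n::finite \<Rightarrow> (real^'n \<Rightarrow> real^'n) \<Rightarrow> (real^'n \<Rightarrow> real^'n) \<Rightarrow> 'n \<Rightarrow> 'n \<Rightarrow> real"
  where "coeff_a N f u j k =
    (if j \<noteq> k then coeff_b N f j k - (LINT y|lebesgue. u y $ j * u y $ k)
     else coeff_b N f j j - (LINT y|lebesgue. (u y $ j)\<^sup>2 - (u y $ N)\<^sup>2))"

definition decay :: "real \<Rightarrow> real^'n::finite \<Rightarrow> real"
  where "decay a x = bracket x powr (- min (a - 2) (real CARD('n))) *
    (1 + (if a = real CARD('n) + 2 then ln (bracket x) else 0))"

end

theory Submission
  imports Defs
begin

text \<open>
  For a radial \<open>\<psi>\<close> the field \<open>\<phi>\<^sub>j = (\<partial>\<^sub>i\<partial>\<^sub>j - \<delta>\<^sub>i\<^sub>j\<Delta>)\<psi>\<close> is divergence free, and testing with it gives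
  \<open>\<integral>u\<^sub>i\<Delta>\<^sup>2\<psi> = \<integral>u\<^sub>ku\<^sub>j\<partial>\<^sub>k\<phi>\<^sub>j + \<integral>f\<^sub>j\<phi>\<^sub>j\<close>, with no pressure and no Liouville theorem. As a function of
  \<open>s = |x - x\<^sub>0|\<^sup>2\<close> take \<open>\<psi>' = (s + d\<^sup>2)\<^sup>q\<close> with \<open>q = (2 - n)/2\<close>, times a cutoff. Without the cutoff \<open>\<Delta>\<^sup>2\<psi>\<close>
  is exactly a multiple of the approximate identity \<open>d^4 (s + d^2)^(-(n + 4)/2)\<close>, while \<open>\<phi>\<close> tends to a
  multiple of the Lorentz tensor as \<open>d\<close> tends to 0. Removing first the cutoff and then \<open>d\<close> gives
  \<open>u = U * f - \<nabla>U * (u \<otimes> u)\<close> almost everywhere.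

  The expansion comes from Taylor expansions of the two kernels for \<open>|y| < |x|/2\<close>. For \<open>n = 3\<close> the bound
  \<open>|u|\<^sup>2 = O(|y|^(-4))\<close> alone would lose a logarithm. A first pass gives the expansion with the weaker error
  \<open>O(|x|^(1 - n - \<eta>))\<close>. Hence \<open>u \<otimes> u\<close> is the tensor square of the odd profile, which is even so that the
  first-order Taylor terms cancel, plus a remainder with integrable first moment.
\<close>

section \<open>Smooth test functions\<close>

text \<open>The velocity lies only in W^{1,2}_loc, so \<open>u\<^sub>j \<phi>\<close> is no test
  function, and the convective term cannot be integrated by parts by testing div u = 0 with it; that
  one step needs a mollifier. The exponent q = (2 - n)/2 is forced: with S = |z|^2 + d^2 and n = 2 -
  2q the bilaplacian of the regularised potential is 16 q (q - 1) (q - 2) S^(q - 3) times the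
  perfect square S^2 - 2 S (S - d^2) + (S - d^2)^2 = d^4. So the approximate identity is exact, with
  a mass that can be computed and that becomes the normalisation of the Lorentz tensor. The
  expansion naturally has n^2 coefficients. The columns of the kernel are divergence free, so the
  sum over j of \<open>\<Phi>\<^sup>j\<^sup>j\<close> vanishes, and subtracting the (n,n)
  coefficient from all diagonal ones changes nothing. This is why the diagonal coefficients are
  differences with the n-th entry and why (n,n) is missing from the sum. Every potential estimate is
  linear in the size of the density, with a constant fixed by n and a alone. The density u \<otimes>
  u has size \<epsilon>^2, and \<epsilon>^2 \<le> \<epsilon> is what smallness provides, so
  \<epsilon>0 = 1 serves.\<close>

lemma partial_deriv_gderiv:
  fixes g :: "real^'n::finite \<Rightarrow> real"
  assumes "GDERIV g x :> D"
  shows "partial_deriv k g x = D $ k"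
proof -
  have "frechet_derivative g (at x) = (\<lambda>h. inner h D)"
    using assms unfolding gderiv_def by (rule frechet_derivative_at[symmetric])
  then show ?thesis by (simp add: partial_deriv_def inner_axis')
qed

text \<open>A class closed under partial derivatives makes \<open>Ck\<close> of every order a plain
  induction. The radial generator carries the whole sequence of derivatives H 0, H 1, ..., so that
  its gradient is built from the shifted sequence and stays in the class. The range s > -c is open
  and contains all values of |y - x0|^2, so the centre s = 0 needs no one-sided derivative.\<close>

inductive smooth_alg :: "(real^'n::finite \<Rightarrow> real) \<Rightarrow> bool" where
  sa_const: "smooth_alg (\<lambda>_. c)"
| sa_coord: "smooth_alg (\<lambda>y. y $ i)"
| sa_radial: "0 < c \<Longrightarrow> \<forall>k s. s > - c \<longrightarrow> (H k has_real_derivative H (Suc k) s) (at s) \<Longrightarrow>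
    smooth_alg (\<lambda>y. H (0::nat) ((y - x0) \<bullet> (y - x0)))"
| sa_add: "smooth_alg f \<Longrightarrow> smooth_alg g \<Longrightarrow> smooth_alg (\<lambda>y. f y + g y)"
| sa_mult: "smooth_alg f \<Longrightarrow> smooth_alg g \<Longrightarrow> smooth_alg (\<lambda>y. f y * g y)"

lemma GDERIV_coord: "GDERIV (\<lambda>y::real^'n::finite. y $ i) x :> axis i 1"
  unfolding gderiv_def inner_axis
  by (simp add: bounded_linear.has_derivative[OF bounded_linear_vec_nth])

lemma GDERIV_radial:
  fixes x x0 :: "real^'n::finite"
  assumes "(H has_real_derivative d) (at ((x - x0) \<bullet> (x - x0)))"
  shows "GDERIV (\<lambda>y. H ((y - x0) \<bullet> (y - x0))) x :> (2 * d) *\<^sub>R (x - x0)"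
proof -
  have "((\<lambda>y. (y - x0) \<bullet> (y - x0)) has_derivative (\<lambda>h. 2 * (h \<bullet> (x - x0)))) (at x)"
    by (auto intro!: derivative_eq_intros simp: inner_commute)
  moreover have "(H has_derivative (\<lambda>t. d * t)) (at ((x - x0) \<bullet> (x - x0)))"
    using assms by (simp add: has_field_derivative_def)
  ultimately have "((\<lambda>y. H ((y - x0) \<bullet> (y - x0))) has_derivative (\<lambda>h. d * (2 * (h \<bullet> (x - x0))))) (at x)"
    using diff_chain_at by (fastforce simp: o_def)
  then show ?thesis
    unfolding gderiv_def by (simp add: mult.assoc mult.left_commute)
qed

lemma smooth_alg_gderiv:
  assumes "smooth_alg g"
  shows "\<exists>G. (\<forall>x. GDERIV g x :> G x) \<and> (\<forall>k. smooth_alg (\<lambda>x. G x $ k))"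
  using assms
proof induction
  case (sa_const c)
  show ?case
    by (rule exI[of _ "\<lambda>_. 0"]) (auto intro: GDERIV_const smooth_alg.sa_const)
next
  case (sa_coord i)
  show ?case
    by (rule exI[of _ "\<lambda>_. axis i 1"]) (auto intro: GDERIV_coord smooth_alg.sa_const)
next
  case (sa_radial c H x0)
  have 1: "GDERIV (\<lambda>y. H 0 ((y - x0) \<bullet> (y - x0))) x :> (2 * H 1 ((x - x0) \<bullet> (x - x0))) *\<^sub>R (x - x0)" for x
  proof (rule GDERIV_radial)
    have "(x - x0) \<bullet> (x - x0) > - c" using sa_radial(1) by (smt (verit) inner_ge_zero)
    then show "(H 0 has_real_derivative H 1 ((x - x0) \<bullet> (x - x0))) (at ((x - x0) \<bullet> (x - x0)))"
      using sa_radial(2) by auto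
  qed
  have 2: "smooth_alg (\<lambda>x. H 1 ((x - x0) \<bullet> (x - x0)))"
    using smooth_alg.sa_radial[of c "\<lambda>k. H (Suc k)" x0] sa_radial by simp
  have "smooth_alg (\<lambda>x. (2 * H 1 ((x - x0) \<bullet> (x - x0))) * (x $ k + - x0 $ k))" for k
    by (intro smooth_alg.intros 2)
  then show ?case using 1
    by (intro exI[of _ "\<lambda>x. (2 * H 1 ((x - x0) \<bullet> (x - x0))) *\<^sub>R (x - x0)"]) auto
next
  case (sa_add f g)
  then obtain F G where "\<forall>x. GDERIV f x :> F x" "\<forall>k. smooth_alg (\<lambda>x. F x $ k)"
    "\<forall>x. GDERIV g x :> G x" "\<forall>k. smooth_alg (\<lambda>x. G x $ k)" by blast
  then show ?case
    by (intro exI[of _ "\<lambda>x. F x + G x"]) (auto intro: GDERIV_add smooth_alg.sa_add)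
next
  case (sa_mult f g)
  then obtain F G where FG: "\<forall>x. GDERIV f x :> F x" "\<forall>k. smooth_alg (\<lambda>x. F x $ k)"
    "\<forall>x. GDERIV g x :> G x" "\<forall>k. smooth_alg (\<lambda>x. G x $ k)" by blast
  have "smooth_alg (\<lambda>x. (f x *\<^sub>R G x + g x *\<^sub>R F x) $ k)" for k
    using FG sa_mult by (auto intro!: smooth_alg.sa_add smooth_alg.sa_mult)
  then show ?case using FG
    by (intro exI[of _ "\<lambda>x. f x *\<^sub>R G x + g x *\<^sub>R F x"]) (auto intro: GDERIV_mult)
qed

lemma smooth_alg_differentiable: "smooth_alg g \<Longrightarrow> g differentiable (at x)"
  using smooth_alg_gderiv by (fastforce simp: gderiv_def differentiable_def)

lemma smooth_alg_continuous: "smooth_alg g \<Longrightarrow> continuous_on UNIV g"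
  by (simp add: smooth_alg_differentiable continuous_at_imp_continuous_on differentiable_imp_continuous_within)

lemma smooth_alg_partial: "smooth_alg g \<Longrightarrow> smooth_alg (partial_deriv k g)"
proof -
  assume "smooth_alg g"
  then obtain G where G: "\<forall>x. GDERIV g x :> G x" "\<forall>k. smooth_alg (\<lambda>x. G x $ k)"
    using smooth_alg_gderiv by blast
  then have "partial_deriv k g = (\<lambda>x. G x $ k)"
    by (auto intro: partial_deriv_gderiv)
  then show ?thesis using G by simp
qed

lemma smooth_alg_Ck: "smooth_alg g \<Longrightarrow> Ck m g"
  by (induction m arbitrary: g)
    (auto simp: smooth_alg_continuous smooth_alg_differentiable smooth_alg_partial)

lemma differentiable_vec:
  fixes \<phi> :: "real^'n::finite \<Rightarrow> real^'m::finite"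
  assumes "\<And>j. (\<lambda>x. \<phi> x $ j) differentiable (at x)"
  shows "\<phi> differentiable (at x)"
  using assms
  by (subst differentiable_componentwise_within) (auto simp: Basis_vec_def inner_axis)

lemma partial_deriv_component:
  fixes \<phi> :: "real^'n::finite \<Rightarrow> real^'m::finite"
  assumes "\<phi> differentiable (at x)"
  shows "partial_deriv k \<phi> x $ j = partial_deriv k (\<lambda>y. \<phi> y $ j) x"
proof -
  have d: "(\<phi> has_derivative frechet_derivative \<phi> (at x)) (at x)"
    using assms frechet_derivative_works by blast
  have "((\<lambda>y. \<phi> y $ j) has_derivative (\<lambda>v. frechet_derivative \<phi> (at x) v $ j)) (at x)"
    by (rule bounded_linear.has_derivative[OF bounded_linear_vec_nth d])
  then have "frechet_derivative (\<lambda>y. \<phi> y $ j) (at x) = (\<lambda>v. frechet_derivative \<phi> (at x) v $ j)"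
    by (rule frechet_derivative_at[symmetric])
  then show ?thesis by (simp add: partial_deriv_def)
qed

lemma smooth_alg_Ck_vec:
  fixes \<phi> :: "real^'n::finite \<Rightarrow> real^'m::finite"
  assumes "\<And>j. smooth_alg (\<lambda>x. \<phi> x $ j)"
  shows "Ck m \<phi>"
  using assms
proof (induction m arbitrary: \<phi>)
  case 0
  then show ?case
    using continuous_on_vec_lambda[of UNIV "\<lambda>i x. \<phi> x $ i"] smooth_alg_continuous by auto
next
  case (Suc m)
  have d: "\<phi> differentiable (at x)" for x
    by (intro differentiable_vec smooth_alg_differentiable Suc.prems)
  have "smooth_alg (\<lambda>x. partial_deriv k \<phi> x $ j)" for k j
    using smooth_alg_partial[OF Suc.prems[of j], of k] d by (simp add: partial_deriv_component)
  then show ?case using Suc.IH d by auto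
qed

lemma compact_support:
  fixes g :: "real^'n::finite \<Rightarrow> 'b::real_normed_vector"
  assumes "\<And>x. norm (x - x0) > r \<Longrightarrow> g x = 0"
  shows "compact (closure {x. g x \<noteq> 0})"
proof -
  have "{x. g x \<noteq> 0} \<subseteq> cball x0 r"
    using assms by (force simp: dist_norm norm_minus_commute not_le)
  then show ?thesis
    by (meson bounded_cball bounded_subset compact_closure)
qed

lemma test_function_scalar:
  assumes "smooth_alg g" "\<And>x. norm (x - x0) > r \<Longrightarrow> g x = 0"
  shows "test_function g"
  using assms unfolding test_function_def
  by (blast intro: smooth_alg_Ck compact_support[of r x0])

lemma test_function_vec:
  fixes \<phi> :: "real^'n::finite \<Rightarrow> real^'m::finite"
  assumes "\<And>j. smooth_alg (\<lambda>x. \<phi> x $ j)" "\<And>x. norm (x - x0) > r \<Longrightarrow> \<phi> x = 0"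
  shows "test_function \<phi>"
  using assms unfolding test_function_def
  by (blast intro: smooth_alg_Ck_vec compact_support[of r x0])

section \<open>The flat function exp(-1/t) and its derivatives\<close>

definition bump :: "real poly \<Rightarrow> real \<Rightarrow> real" where
  "bump p t = (if t > 0 then poly p (inverse t) * exp (- inverse t) else 0)"

lemma poly_exp_tendsto_0: "((\<lambda>x::real. poly p x * exp (- x)) \<longlongrightarrow> 0) at_top"
proof -
  have "((\<lambda>x. \<Sum>i\<le>degree p. coeff p i * (x ^ i / exp x)) \<longlongrightarrow> (\<Sum>i\<le>degree p. coeff p i * 0)) at_top"
    by (intro tendsto_sum tendsto_mult tendsto_const tendsto_power_div_exp_0)
  moreover have "(\<lambda>x. \<Sum>i\<le>degree p. coeff p i * (x ^ i / exp x)) = (\<lambda>x. poly p x * exp (- x))"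
    by (simp add: poly_altdef sum_distrib_right exp_minus divide_inverse mult.assoc)
  ultimately show ?thesis by simp
qed

text \<open>The derivative of p(1/t) exp(-1/t) is t^(-2) (p - p')(1/t) exp(-1/t), so the polynomial
  changes to X^2 (p - p'). Only t = 0 is delicate: there the right difference quotient is X p
  evaluated at 1/h, times exp(-1/h), and the exponential wins.\<close>

lemma DERIV_bump:
  "(bump p has_real_derivative bump ([:0, 0, 1:] * (p - pderiv p)) t) (at t)"
proof -
  consider "t > 0" | "t < 0" | "t = 0" by linarith
  then show ?thesis
  proof cases
    case 1
    have "((\<lambda>t. poly p (inverse t) * exp (- inverse t)) has_real_derivative
        bump ([:0, 0, 1:] * (p - pderiv p)) t) (at t)"
      using 1 by (auto intro!: derivative_eq_intros simp: bump_def algebra_simps power2_eq_square)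
    then show ?thesis
      by (rule has_field_derivative_transform_within_open[of _ _ _ "{0<..}"]) (use 1 in \<open>auto simp: bump_def\<close>)
  next
    case 2
    have "((\<lambda>t. 0) has_real_derivative bump ([:0, 0, 1:] * (p - pderiv p)) t) (at t)"
      using 2 by (auto simp: bump_def)
    then show ?thesis
      by (rule has_field_derivative_transform_within_open[of _ _ _ "{..<0}"]) (use 2 in \<open>auto simp: bump_def\<close>)
  next
    case 3
    have "((\<lambda>h. bump p h / h) \<longlongrightarrow> 0) (at_right 0)"
    proof -
      have "((\<lambda>h. poly (pCons 0 p) (inverse h) * exp (- inverse h)) \<longlongrightarrow> 0) (at_right (0::real))"
        using filterlim_compose[OF poly_exp_tendsto_0 filterlim_inverse_at_top_right] .
      then show ?thesis
        by (rule Lim_transform_eventually)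
          (auto simp: eventually_at_right_less bump_def field_simps intro!: eventually_mono[OF eventually_at_right_less[of 0]])
    qed
    moreover have "((\<lambda>h. bump p h / h) \<longlongrightarrow> 0) (at_left 0)"
      by (rule Lim_transform_eventually[OF tendsto_const])
        (auto simp: bump_def intro!: eventually_mono[OF eventually_at_left_real[of "-1" 0]])
    ultimately have "((\<lambda>h. bump p h / h) \<longlongrightarrow> 0) (at 0)"
      by (simp add: filterlim_split_at)
    then show ?thesis
      using 3 by (auto simp: has_field_derivative_iff bump_def)
  qed
qed

lemma continuous_bump: "continuous_on S (bump p)"
  by (meson DERIV_bump DERIV_isCont continuous_at_imp_continuous_on)

text \<open>The range t \<le> 1 is the one that occurs: cutoffs are evaluated at 1 - s/e^2 with s
  \<ge> 0.\<close>

lemma bump_bounded: "\<exists>B. \<forall>t\<le>1. \<bar>bump p t\<bar> \<le> B"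
proof -
  have "compact (bump p ` {0..1})"
    by (intro compact_continuous_image continuous_bump) auto
  then obtain B where B: "\<forall>t\<in>{0..1}. \<bar>bump p t\<bar> \<le> B"
    using compact_imp_bounded bounded_iff by (metis image_eqI real_norm_def)
  have "\<bar>bump p t\<bar> \<le> max B 0" if "t \<le> 1" for t
    using B that by (cases "t \<ge> 0") (auto simp: bump_def le_max_iff_disj)
  then show ?thesis by blast
qed

section \<open>Integrals of radial functions\<close>

lemma
  fixes f :: "'a::euclidean_space \<Rightarrow> 'b::{banach, second_countable_topology}"
  assumes f[measurable]: "f \<in> borel_measurable borel" and "c \<noteq> 0"
  shows integrable_lborel_affine:
      "integrable lborel (\<lambda>x. f (t + c *\<^sub>R x)) \<longleftrightarrow> integrable lborel f" (is ?P)
    and integral_lborel_affine: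
      "integral\<^sup>L lborel (\<lambda>x. f (t + c *\<^sub>R x)) = (1 / \<bar>c\<bar> ^ DIM('a)) *\<^sub>R integral\<^sup>L lborel f" (is ?Q)
proof -
  have *: "integrable lborel f \<longleftrightarrow> integrable (density (distr lborel borel (\<lambda>x. t + c *\<^sub>R x)) (\<lambda>_. ennreal (\<bar>c\<bar> ^ DIM('a)))) f"
    using lborel_affine[OF \<open>c \<noteq> 0\<close>, of t] by simp
  show ?P
    unfolding * using \<open>c \<noteq> 0\<close>
      integrable_scaleR_right[of "1 / \<bar>c\<bar> ^ DIM('a)" lborel "\<lambda>x. \<bar>c\<bar> ^ DIM('a) *\<^sub>R f (t + c *\<^sub>R x)"]
    by (subst integrable_density) (auto simp: integrable_distr_eq)
  have "integral\<^sup>L lborel f = integral\<^sup>L (density (distr lborel borel (\<lambda>x. t + c *\<^sub>R x)) (\<lambda>_. ennreal (\<bar>c\<bar> ^ DIM('a)))) f"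
    using lborel_affine[OF \<open>c \<noteq> 0\<close>, of t] by simp
  also have "\<dots> = \<bar>c\<bar> ^ DIM('a) *\<^sub>R integral\<^sup>L lborel (\<lambda>x. f (t + c *\<^sub>R x))"
    by (subst integral_density) (auto simp: integral_distr)
  finally show ?Q using \<open>c \<noteq> 0\<close> by simp
qed

lemma
  fixes f :: "'a::euclidean_space \<Rightarrow> 'b::{banach, second_countable_topology}"
  assumes f: "f \<in> borel_measurable borel"
  shows integrable_lborel_translate: "integrable lborel (\<lambda>x. f (x + t)) \<longleftrightarrow> integrable lborel f"
    and integral_lborel_translate: "integral\<^sup>L lborel (\<lambda>x. f (x + t)) = integral\<^sup>L lborel f"
    and integrable_lborel_reflect: "integrable lborel (\<lambda>x. f (t - x)) \<longleftrightarrow> integrable lborel f"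
    and integral_lborel_reflect: "integral\<^sup>L lborel (\<lambda>x. f (t - x)) = integral\<^sup>L lborel f"
  using integrable_lborel_affine[OF f, of 1 t] integral_lborel_affine[OF f, of 1 t]
    integrable_lborel_affine[OF f, of "-1" t] integral_lborel_affine[OF f, of "-1" t]
  by (simp_all add: add.commute)

abbreviation sphere_area :: "'a::euclidean_space itself \<Rightarrow> real" where
  "sphere_area _ \<equiv> real DIM('a) * unit_ball_vol (real DIM('a))"

text \<open>Polar coordinates for radial functions follow from the volume of balls alone: on each
  half line {..r} both measures give \<open>unit_ball_vol\<close> times r^n, and the half lines form
  an intersection-stable generator exhausting the line.\<close>

lemma distr_norm_lborel:
  "distr (lborel :: 'a::euclidean_space measure) borel norm =
    density lborel (\<lambda>r. ennreal (sphere_area TYPE('a) * r ^ (DIM('a) - 1)) * indicator {0..} r)"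
  (is "?M = ?N")
proof (rule measure_eqI_generator_eq[where E = "range atMost" and \<Omega> = UNIV and A = "\<lambda>i. {.. real i}"])
  show "Int_stable (range (atMost :: real \<Rightarrow> real set))"
    by (auto simp: Int_stable_def intro!: exI[of _ "min _ _"])
  show "sets ?M = sigma_sets UNIV (range atMost)" "sets ?N = sigma_sets UNIV (range atMost)"
    by (simp_all add: borel_eq_atMost)
  have E: "emeasure ?M {..r} = (if r < 0 then 0 else ennreal (unit_ball_vol (real DIM('a)) * r ^ DIM('a)))" for r
  proof -
    have "norm -` {..r} \<inter> space lborel = (cball 0 r :: 'a set)" by auto
    then show ?thesis
      by (simp add: emeasure_distr emeasure_cball)
  qed
  show "emeasure ?M X = emeasure ?N X" if "X \<in> range atMost" for X
  proof -
    from that obtain r where X: "X = {..r}" by (rule rangeE)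
    have "emeasure ?N {..r} = (\<integral>\<^sup>+s\<in>{0..r}. ennreal (sphere_area TYPE('a) * s ^ (DIM('a) - 1)) \<partial>lborel)"
      by (subst emeasure_density) (auto intro!: nn_integral_cong simp: indicator_def)
    also have "\<dots> = (if r < 0 then 0 else ennreal (unit_ball_vol (real DIM('a)) * r ^ DIM('a)))"
    proof (cases "r < 0")
      case False
      have "((\<lambda>s. unit_ball_vol (real DIM('a)) * s ^ DIM('a)) has_real_derivative
          sphere_area TYPE('a) * x ^ (DIM('a) - 1)) (at x)" for x
        by (auto intro!: derivative_eq_intros simp: mult_ac)
      from nn_integral_FTC_Icc[OF _ this, of 0 r]
      show ?thesis using False by (simp add: zero_power)
    qed simp
    finally show ?thesis unfolding X E by simp
  qed
  show "(\<Union>i. {..real i}) = UNIV"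
    using real_arch_simple by auto
  show "emeasure ?M {..real i} \<noteq> \<infinity>" for i
    by (simp add: E)
qed auto

lemma nn_integral_radial:
  assumes [measurable]: "F \<in> borel_measurable borel"
  shows "(\<integral>\<^sup>+ (x::'a::euclidean_space). F (norm x) \<partial>lborel) =
    (\<integral>\<^sup>+ r\<in>{0..}. ennreal (sphere_area TYPE('a) * r ^ (DIM('a) - 1)) * F r \<partial>lborel)"
proof -
  have "(\<integral>\<^sup>+ (x::'a). F (norm x) \<partial>lborel) = (\<integral>\<^sup>+ r. F r \<partial>(distr (lborel :: 'a measure) borel norm))"
    by (subst nn_integral_distr) auto
  also have "\<dots> = (\<integral>\<^sup>+ r\<in>{0..}. ennreal (sphere_area TYPE('a) * r ^ (DIM('a) - 1)) * F r \<partial>lborel)"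
    unfolding distr_norm_lborel by (subst nn_integral_density) (auto intro!: nn_integral_cong simp: indicator_def)
  finally show ?thesis .
qed

lemma has_bochner_integral_radial:
  assumes [measurable]: "F \<in> borel_measurable borel" and F: "\<And>r. 0 \<le> F r"
    and int: "((\<lambda>r. F r * r ^ (DIM('a) - 1)) has_integral I) {0..}"
  shows "has_bochner_integral lborel (\<lambda>x::'a::euclidean_space. F (norm x)) (sphere_area TYPE('a) * I)"
proof -
  have "((\<lambda>r. sphere_area TYPE('a) * (F r * r ^ (DIM('a) - 1))) has_integral (sphere_area TYPE('a) * I)) {0..}"
    using int by (rule has_integral_mult_right)
  moreover have nn: "0 \<le> sphere_area TYPE('a) * (F r * r ^ (DIM('a) - 1))" if "r \<in> {0..}" for r
    using that F by (intro mult_nonneg_nonneg) auto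
  ultimately have "(\<integral>\<^sup>+ r. indicator {0..} r * (sphere_area TYPE('a) * (F r * r ^ (DIM('a) - 1))) \<partial>lborel) = ennreal (sphere_area TYPE('a) * I)"
    by (intro nn_integral_has_integral_lebesgue) auto
  moreover have "(\<integral>\<^sup>+ (x::'a). ennreal (F (norm x)) \<partial>lborel) =
    (\<integral>\<^sup>+ r. indicator {0..} r * (sphere_area TYPE('a) * (F r * r ^ (DIM('a) - 1))) \<partial>lborel)"
    using F by (subst nn_integral_radial) (auto intro!: nn_integral_cong simp: indicator_def ennreal_mult' mult_ac)
  moreover have "0 \<le> sphere_area TYPE('a) * I"
    using has_integral_nonneg[OF \<open>(_ has_integral (sphere_area TYPE('a) * I)) {0..}\<close>] nn by blast
  ultimately show ?thesis
    using F by (intro has_bochner_integral_nn_integral) auto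
qed

text \<open>At r = 0 both sides vanish because \<open>0 powr e = 0\<close> for every exponent,
  negative ones included.\<close>

lemma powr_times_dim:
  assumes "0 \<le> r"
  shows "r powr p * r ^ (DIM('a::euclidean_space) - 1) = r powr (p + real DIM('a) - 1)"
proof (cases "r = 0")
  case False
  then show ?thesis
    using assms DIM_positive[where 'a='a] by (simp add: powr_realpow[symmetric] powr_add[symmetric] of_nat_diff algebra_simps)
qed simp

lemma has_bochner_integral_powr_cball:
  assumes "p > - real DIM('a)" "0 \<le> \<rho>"
  shows "has_bochner_integral lborel (\<lambda>x::'a::euclidean_space. indicator (cball 0 \<rho>) x * norm x powr p)
    (sphere_area TYPE('a) * (\<rho> powr (real DIM('a) + p) / (real DIM('a) + p)))"
proof -
  have "((\<lambda>r. r powr (p + real DIM('a) - 1)) has_integral (\<rho> powr (real DIM('a) + p) / (real DIM('a) + p))) {0..\<rho>}"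
    using has_integral_powr_from_0[of "p + real DIM('a) - 1" \<rho>] assms by (simp add: add.commute)
  then have "((\<lambda>r. if r \<in> {0..\<rho>} then r powr (p + real DIM('a) - 1) else 0)
      has_integral (\<rho> powr (real DIM('a) + p) / (real DIM('a) + p))) {0..}"
    by (subst has_integral_restrict) auto
  then have *: "((\<lambda>r. (indicator {..\<rho>} r * r powr p) * r ^ (DIM('a) - 1))
      has_integral (\<rho> powr (real DIM('a) + p) / (real DIM('a) + p))) {0..}"
    by (rule has_integral_eq[rotated]) (auto simp: indicator_def powr_times_dim[simplified])
  have **: "(\<lambda>x::'a. indicator {..\<rho>} (norm x) * norm x powr p) = (\<lambda>x. indicator (cball 0 \<rho>) x * norm x powr p)"
    by (auto simp: indicator_def)
  show ?thesis
    by (rule has_bochner_integral_radial[OF _ _ *, unfolded **]) auto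
qed

lemma has_bochner_integral_powr_outside:
  assumes "p < - real DIM('a)" "0 < \<rho>"
  shows "has_bochner_integral lborel (\<lambda>x::'a::euclidean_space. indicator {x. \<rho> \<le> norm x} x * norm x powr p)
    (sphere_area TYPE('a) * (\<rho> powr (real DIM('a) + p) / - (real DIM('a) + p)))"
proof -
  have "((\<lambda>r. r powr (p + real DIM('a) - 1)) has_integral (\<rho> powr (real DIM('a) + p) / - (real DIM('a) + p))) {\<rho>..}"
    using has_integral_powr_to_inf[of "p + real DIM('a) - 1" \<rho>] assms by (simp add: add.commute minus_divide_right)
  then have "((\<lambda>r. if r \<in> {\<rho>..} then r powr (p + real DIM('a) - 1) else 0)
      has_integral (\<rho> powr (real DIM('a) + p) / - (real DIM('a) + p))) {0..}"
    using assms by (subst has_integral_restrict) auto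
  then have *: "((\<lambda>r. (indicator {\<rho>..} r * r powr p) * r ^ (DIM('a) - 1))
      has_integral (\<rho> powr (real DIM('a) + p) / - (real DIM('a) + p))) {0..}"
    by (rule has_integral_eq[rotated]) (auto simp: indicator_def powr_times_dim[simplified])
  have **: "(\<lambda>x::'a. indicator {\<rho>..} (norm x) * norm x powr p) = (\<lambda>x. indicator {x. \<rho> \<le> norm x} x * norm x powr p)"
    by (auto simp: indicator_def)
  show ?thesis
    by (rule has_bochner_integral_radial[OF _ _ *, unfolded **]) auto
qed

lemma has_bochner_integral_powr_log:
  assumes "1 \<le> \<rho>"
  shows "has_bochner_integral lborel (\<lambda>x::'a::euclidean_space. indicator {x. 1 \<le> norm x \<and> norm x \<le> \<rho>} x * norm x powr - real DIM('a))
    (sphere_area TYPE('a) * ln \<rho>)"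
proof -
  have "((\<lambda>r. inverse r) has_integral (ln \<rho> - ln 1)) {1..\<rho>}"
    using assms by (intro fundamental_theorem_of_calculus)
      (auto intro!: derivative_eq_intros simp: has_real_derivative_iff_has_vector_derivative[symmetric] divide_simps)
  then have "((\<lambda>r. if r \<in> {1..\<rho>} then inverse r else 0) has_integral (ln \<rho>)) {0..}"
    by (subst has_integral_restrict) auto
  moreover have "inverse r = r powr - real DIM('a) * r ^ (DIM('a) - 1)" if "1 \<le> r" for r
    using that by (subst powr_times_dim) (simp_all add: powr_minus)
  ultimately have *: "((\<lambda>r. (indicator {1..\<rho>} r * r powr - real DIM('a)) * r ^ (DIM('a) - 1)) has_integral (ln \<rho>)) {0..}"
    by (elim has_integral_eq[rotated]) (simp add: indicator_def)
  have **: "(\<lambda>x::'a. indicator {1..\<rho>} (norm x) * norm x powr - real DIM('a)) =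
     (\<lambda>x. indicator {x. 1 \<le> norm x \<and> norm x \<le> \<rho>} x * norm x powr - real DIM('a))"
    by (auto simp: indicator_def)
  show ?thesis
    by (rule has_bochner_integral_radial[OF _ _ *, unfolded **]) auto
qed

text \<open>\<Theta>_m(r) = r^m (1 + r^2)^(-m/2) / m has derivative r^(m-1) (1 + r^2)^(-m/2-1).
  Since 1 = (1 + r^2) - r^2, the radial integrand r^(n-1) (1 + r^2)^(-(n+4)/2) is the derivative of
  \<Theta>_n - \<Theta>_(n+2), which runs from 0 to 1/n - 1/(n+2) = 2/(n(n+2)).\<close>

lemma has_bochner_integral_bubble:
  "has_bochner_integral lborel (\<lambda>x::'a::euclidean_space. (1 + (norm x)\<^sup>2) powr - ((real DIM('a) + 4) / 2))
    (2 * unit_ball_vol (real DIM('a)) / (real DIM('a) + 2))"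
proof -
  define n where "n = DIM('a)"
  have n: "n \<ge> 1" using DIM_positive[where 'a='a] by (simp add: n_def)
  define \<Theta> where "\<Theta> m r = r ^ m * (1 + r\<^sup>2) powr - (real m / 2) / real m" for m r
  have D: "(\<Theta> m has_real_derivative r ^ (m - 1) * (1 + r\<^sup>2) powr - (real m / 2 + 1)) (at r)" if "m \<ge> 1" for m r
  proof -
    have pos: "1 + r\<^sup>2 > 0" by (simp add: add_pos_nonneg)
    have e: "(1 + r\<^sup>2) powr - (real m / 2) = (1 + r\<^sup>2) * (1 + r\<^sup>2) powr - (real m / 2 + 1)"
      using pos powr_add[of "1 + r\<^sup>2" 1 "- (real m / 2 + 1)"] by simp
    have rm: "r ^ m = r * r ^ (m - 1)" using that by (simp add: power_eq_if)
    have "(\<Theta> m has_real_derivative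
       (real m * r ^ (m - 1) * (1 + r\<^sup>2) powr - (real m / 2) + r ^ m * (- (real m / 2) * (1 + r\<^sup>2) powr (- (real m / 2) - 1) * (2 * r))) / real m) (at r)"
      unfolding \<Theta>_def using pos that by (auto intro!: derivative_eq_intros)
    also have "- (real m / 2) - 1 = - (real m / 2 + 1)" by simp
    also have "(real m * r ^ (m - 1) * (1 + r\<^sup>2) powr - (real m / 2) + r ^ m * (- (real m / 2) * (1 + r\<^sup>2) powr - (real m / 2 + 1) * (2 * r))) / real m
      = r ^ (m - 1) * (1 + r\<^sup>2) powr - (real m / 2 + 1)"
      unfolding e rm using that by (simp add: field_simps power2_eq_square)
    finally show ?thesis .
  qed
  have D2: "((\<lambda>r. \<Theta> n r - \<Theta> (n + 2) r) has_real_derivative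
      (1 + r\<^sup>2) powr - ((real n + 4) / 2) * r ^ (n - 1)) (at r)" for r
  proof -
    have pos: "1 + r\<^sup>2 > 0" by (simp add: add_pos_nonneg)
    have e: "(1 + r\<^sup>2) powr - (real n / 2 + 1) = (1 + r\<^sup>2) * (1 + r\<^sup>2) powr - ((real n + 4) / 2)"
    proof -
      have "- (real n / 2 + 1) = 1 + - ((real n + 4) / 2)" by (simp add: field_simps)
      then show ?thesis using pos powr_add[of "1 + r\<^sup>2" 1 "- ((real n + 4) / 2)"] by simp
    qed
    have e2: "- (real (n + 2) / 2 + 1) = - ((real n + 4) / 2)" by (simp add: field_simps)
    have rn: "r ^ (n + 2 - 1) = r\<^sup>2 * r ^ (n - 1)"
      using n by (simp add: power_add[symmetric])
    have "((\<lambda>r. \<Theta> n r - \<Theta> (n + 2) r) has_real_derivative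
       r ^ (n - 1) * (1 + r\<^sup>2) powr - (real n / 2 + 1) - r ^ (n + 2 - 1) * (1 + r\<^sup>2) powr - (real (n + 2) / 2 + 1)) (at r)"
      using n by (intro DERIV_diff D) auto
    then show ?thesis unfolding e e2 rn by (simp add: algebra_simps)
  qed
  have lim: "(\<Theta> m \<longlongrightarrow> 1 / real m) at_top" if "m \<ge> 1" for m
  proof -
    have "((\<lambda>r::real. (1 + inverse r ^ 2) powr - (real m / 2) / real m) \<longlongrightarrow> (1 + 0 ^ 2) powr - (real m / 2) / real m) at_top"
      using that by (intro tendsto_intros tendsto_inverse_0_at_top filterlim_ident) auto
    moreover have "\<forall>\<^sub>F r in at_top. (1 + inverse r ^ 2) powr - (real m / 2) / real m = \<Theta> m r"
      using eventually_gt_at_top[of "0::real"]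
    proof eventually_elim
      case (elim r)
      have "1 + r\<^sup>2 = r\<^sup>2 * (1 + inverse r ^ 2)" using elim by (simp add: field_simps)
      then have "(1 + r\<^sup>2) powr - (real m / 2) = (r\<^sup>2) powr - (real m / 2) * (1 + inverse r ^ 2) powr - (real m / 2)"
        using elim by (simp add: powr_mult)
      also have "(r\<^sup>2) powr - (real m / 2) = r powr - real m"
        using elim by (simp add: powr_powr flip: powr_numeral)
      also have "\<dots> = inverse (r ^ m)" using elim by (simp add: powr_minus powr_realpow)
      finally show ?case using elim by (simp add: \<Theta>_def)
    qed
    ultimately show ?thesis by (simp add: tendsto_cong)
  qed
  have lim2: "((\<lambda>r. \<Theta> n r - \<Theta> (n + 2) r) \<longlongrightarrow> 1 / real n - 1 / real (n + 2)) at_top"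
    using n by (intro tendsto_diff lim) auto
  have "(\<integral>\<^sup>+ r\<in>{0..}. ennreal ((1 + r\<^sup>2) powr - ((real n + 4) / 2) * r ^ (n - 1)) \<partial>lborel)
     = ennreal (1 / real n - 1 / real (n + 2) - (\<Theta> n 0 - \<Theta> (n + 2) 0))"
    by (rule nn_integral_FTC_atLeast[OF _ D2 _ lim2]) auto
  also have "\<Theta> n 0 - \<Theta> (n + 2) 0 = 0" using n by (simp add: \<Theta>_def zero_power)
  finally have I: "(\<integral>\<^sup>+ r\<in>{0..}. ennreal ((1 + r\<^sup>2) powr - ((real n + 4) / 2) * r ^ (n - 1)) \<partial>lborel)
     = ennreal (1 / real n - 1 / real (n + 2))" by simp
  have "(\<integral>\<^sup>+ (x::'a). ennreal ((1 + (norm x)\<^sup>2) powr - ((real DIM('a) + 4) / 2)) \<partial>lborel) =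
     (\<integral>\<^sup>+ r\<in>{0..}. ennreal (sphere_area TYPE('a) * r ^ (n - 1)) * ennreal ((1 + r\<^sup>2) powr - ((real DIM('a) + 4) / 2)) \<partial>lborel)"
    unfolding n_def by (rule nn_integral_radial) auto
  also have "\<dots> = (\<integral>\<^sup>+ r. ennreal (sphere_area TYPE('a)) * (ennreal ((1 + r\<^sup>2) powr - ((real n + 4) / 2) * r ^ (n - 1)) * indicator {0..} r) \<partial>lborel)"
    by (intro nn_integral_cong) (auto simp: n_def indicator_def ennreal_mult' mult_ac)
  also have "\<dots> = ennreal (sphere_area TYPE('a)) * ennreal (1 / real n - 1 / real (n + 2))"
    by (subst nn_integral_cmult) (auto simp: I[simplified])
  also have "\<dots> = ennreal (sphere_area TYPE('a) * (1 / real n - 1 / real (n + 2)))"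
    by (subst ennreal_mult') (use n in \<open>auto simp: field_simps\<close>)
  also have "sphere_area TYPE('a) * (1 / real n - 1 / real (n + 2)) = 2 * unit_ball_vol (real DIM('a)) / (real DIM('a) + 2)"
  proof -
    have "1 / real n - 1 / real (n + 2) = 2 / (real n * (real n + 2))"
      using n by (simp add: field_simps)
    then show ?thesis using n unfolding n_def[symmetric] by simp
  qed
  finally show ?thesis by (intro has_bochner_integral_nn_integral) auto
qed

section \<open>Elementary properties of the weight \<open>bracket\<close>\<close>

lemma bracket_pos: "0 < bracket x" and bracket_ge_1: "1 \<le> bracket x" and norm_le_bracket: "norm x \<le> bracket x"
  by (auto simp: bracket_def intro!: real_le_rsqrt add_pos_nonneg)

lemma bracket_le_norm:
  assumes "1 \<le> norm x"
  shows "bracket x \<le> 2 * norm x"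
proof -
  have "1 \<le> (norm x)\<^sup>2" using assms by (simp add: one_le_power)
  then show ?thesis
    unfolding bracket_def by (intro real_le_lsqrt) (auto simp: power_mult_distrib)
qed

lemma borel_measurable_bracket [measurable]: "bracket \<in> borel_measurable borel"
  unfolding bracket_def by measurable

lemma integrable_bracket_powr:
  assumes "b < - real CARD('n)"
  shows "integrable lborel (\<lambda>x::real^'n::finite. bracket x powr b)"
proof (rule Bochner_Integration.integrable_bound)
  have 1: "integrable lborel (\<lambda>x::real^'n. indicator {x. 1 \<le> norm x} x * norm x powr b)"
    using has_bochner_integral_powr_outside[where 'a="real^'n", of b 1] assms by (auto simp: has_bochner_integral_iff)
  have 2: "integrable lborel (\<lambda>x::real^'n. indicator (cball 0 1) x :: real)"
    using emeasure_lborel_cball_finite[of "0::real^'n" 1] by (intro integrable_real_indicator) auto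
  show "integrable lborel (\<lambda>x::real^'n. indicator {x. 1 \<le> norm x} x * norm x powr b + indicator (cball 0 1) x)"
    using 1 2 by simp
  have le: "bracket x powr b \<le> indicator {x. 1 \<le> norm x} x * norm x powr b + indicator (cball 0 1) x" for x :: "real^'n"
  proof (cases "1 \<le> norm x")
    case True
    then have "bracket x powr b \<le> norm x powr b"
      using assms by (intro powr_mono2') (auto simp: norm_le_bracket)
    then show ?thesis using True by (auto simp: indicator_def)
  next
    case False
    then show ?thesis using assms powr_mono2'[of b 1 "bracket x"] bracket_ge_1[of x] by (simp add: indicator_def)
  qed
  show "AE x::real^'n in lborel. norm (bracket x powr b) \<le> norm (indicator {x. 1 \<le> norm x} x * norm x powr b + indicator (cball 0 1) x)"
  proof (rule AE_I2)
    fix x :: "real^'n"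
    show "norm (bracket x powr b) \<le> norm (indicator {x. 1 \<le> norm x} x * norm x powr b + indicator (cball 0 1) x)"
      using le[of x] powr_ge_zero[of "bracket x" b] unfolding real_norm_def by linarith
  qed
qed measurable

section \<open>Approximate identities\<close>

definition L1_cont :: "('a::euclidean_space \<Rightarrow> real) \<Rightarrow> bool" where
  "L1_cont V \<longleftrightarrow> (\<forall>e>0. \<exists>d>0. \<forall>w. norm w < d \<longrightarrow> (LBINT x. \<bar>V (x + w) - V x\<bar>) \<le> e)"

text \<open>Regularity of Lebesgue measure gives K \<subseteq> A \<subseteq> U with K compact, U
  open and small gaps. A shift shorter than the distance from K to the complement of U does not
  carry K out of U, so the two indicators differ only on A - K, U - A and the translates of these:
  four sets of measure at most e/4.\<close>

lemma L1_cont_indicator: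
  fixes A :: "'a::euclidean_space set"
  assumes A[measurable]: "A \<in> sets borel" and fin: "emeasure lborel A < \<infinity>"
  shows "L1_cont (indicator A)"
  unfolding L1_cont_def
proof (intro allI impI)
  fix e :: real assume "0 < e"
  define e' where "e' = e / 4"
  have e': "0 < e'" using \<open>0 < e\<close> by (simp add: e'_def)
  obtain K0 where K0: "closed K0" "K0 \<subseteq> A" "A - K0 \<in> lmeasurable" "emeasure lebesgue (A - K0) < ennreal e'"
    using sets_lebesgue_inner_closed[of A e'] A e' by (metis sets_completionI_sets sets_lborel)
  have K0A: "emeasure lborel (A - K0) < ennreal e'"
    using K0 A by (simp add: borel_closed)
  \<comment> \<open>Inner regularity supplies only a closed set; cutting it with large balls and
    continuity from above make it compact at no cost.\<close>
  define Kn where "Kn i = K0 \<inter> cball 0 (real i)" for i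
  have "(\<lambda>i. emeasure lborel (A - Kn i)) \<longlonglongrightarrow> emeasure lborel (\<Inter>i. A - Kn i)"
  proof (rule Lim_emeasure_decseq)
    show "range (\<lambda>i. A - Kn i) \<subseteq> sets lborel" using K0 by (auto simp: Kn_def borel_closed)
    show "decseq (\<lambda>i. A - Kn i)" by (auto simp: decseq_def Kn_def)
    show "emeasure lborel (A - Kn i) \<noteq> \<infinity>" for i
      using fin emeasure_mono[of "A - Kn i" A lborel] A by (auto simp: less_top[symmetric] top_unique)
  qed
  moreover have "(\<Inter>i. A - Kn i) = A - K0"
    using real_arch_simple by (auto simp: Kn_def)
  ultimately have "eventually (\<lambda>i. emeasure lborel (A - Kn i) < ennreal e') sequentially"
    using K0A order_tendstoD(2) by fastforce
  then obtain i where i: "emeasure lborel (A - Kn i) < ennreal e'"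
    by (auto simp: eventually_sequentially)
  define K where "K = Kn i"
  have K: "compact K" "K \<subseteq> A" "K \<in> sets borel"
    using K0 by (auto simp: K_def Kn_def closed_Int_compact borel_closed)
  obtain U where U: "open U" "A \<subseteq> U" "emeasure lborel (U - A) < ennreal e'"
    using outer_regular_lborel[of A e'] A e' by blast
  have U_b[measurable]: "U \<in> sets borel" using U by auto
  \<comment> \<open>\<open>setdist\<close> is 0 when one of the sets is empty, so K = {} and U =
    UNIV are treated apart, with any d.\<close>
  obtain d where d: "d > 0" "\<And>x y. x \<in> K \<Longrightarrow> dist x y < d \<Longrightarrow> y \<in> U"
  proof (cases "K = {} \<or> U = UNIV")
    case True
    then show ?thesis using that[of 1] by auto
  next
    case False
    have "K \<inter> (- U) = {}" using K U by auto
    then have "setdist K (- U) > 0"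
      using setdist_gt_0_compact_closed[of K "- U"] K U False by auto
    then show ?thesis
      using that[of "setdist K (- U)"] setdist_le_dist[of _ K _ "- U"] by (metis ComplI not_le)
  qed
  show "\<exists>d>0. \<forall>w. norm w < d \<longrightarrow> (LBINT x. \<bar>indicat_real A (x + w) - indicat_real A x\<bar>) \<le> e"
  proof (intro exI[of _ d] conjI allI impI d(1))
    fix w :: 'a assume w: "norm w < d"
    have [measurable]: "K \<in> sets borel" by (rule K(3))
    have le: "\<bar>indicat_real A (x + w) - indicat_real A x\<bar> \<le>
        (indicat_real (A - K) (x + w) + indicat_real (U - A) x) + (indicat_real (A - K) x + indicat_real (U - A) (x + w))" for x
    proof -
      have 1: "x \<in> U" if "x + w \<in> K" using d(2)[OF that, of x] w by (simp add: dist_norm)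
      have 2: "x + w \<in> U" if "x \<in> K" using d(2)[OF that, of "x + w"] w by (simp add: dist_norm)
      show ?thesis using 1 2 by (auto simp: indicator_def)
    qed
    have iAK: "integrable lborel (indicat_real (A - K))" and mAK: "integral\<^sup>L lborel (indicat_real (A - K)) \<le> e'"
    proof -
      have "emeasure lborel (A - K) < ennreal e'" using i by (simp add: K_def)
      then show "integrable lborel (indicat_real (A - K))"
        by (intro integrable_real_indicator) (auto elim: order_less_trans)
      show "integral\<^sup>L lborel (indicat_real (A - K)) \<le> e'"
        using \<open>emeasure lborel (A - K) < ennreal e'\<close> e' by (simp add: measure_def enn2real_leI)
    qed
    have iUA: "integrable lborel (indicat_real (U - A))" and mUA: "integral\<^sup>L lborel (indicat_real (U - A)) \<le> e'"
    proof -
      show "integrable lborel (indicat_real (U - A))"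
        using U(3) by (intro integrable_real_indicator) (auto elim: order_less_trans)
      show "integral\<^sup>L lborel (indicat_real (U - A)) \<le> e'"
        using U(3) e' by (simp add: measure_def enn2real_leI)
    qed
    have tr: "integrable lborel (\<lambda>x. indicat_real (A - K) (x + w))" "integrable lborel (\<lambda>x. indicat_real (U - A) (x + w))"
      using iAK iUA by (subst integrable_lborel_translate; measurable)+
    have "(LBINT x. \<bar>indicat_real A (x + w) - indicat_real A x\<bar>) \<le>
      (LBINT x. (indicat_real (A - K) (x + w) + indicat_real (U - A) x) + (indicat_real (A - K) x + indicat_real (U - A) (x + w)))"
    proof (rule integral_mono)
      show int: "integrable lborel (\<lambda>x. (indicat_real (A - K) (x + w) + indicat_real (U - A) x) + (indicat_real (A - K) x + indicat_real (U - A) (x + w)))"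
        using iAK iUA tr by (intro Bochner_Integration.integrable_add)
      show "integrable lborel (\<lambda>x. \<bar>indicat_real A (x + w) - indicat_real A x\<bar>)"
        by (rule Bochner_Integration.integrable_bound[OF int]) (auto intro!: AE_I2 order_trans[OF le])
    qed (rule le)
    also have "\<dots> = 2 * integral\<^sup>L lborel (indicat_real (A - K)) + 2 * integral\<^sup>L lborel (indicat_real (U - A))"
      using iAK iUA tr integral_lborel_translate[of "indicat_real (A - K)" w] integral_lborel_translate[of "indicat_real (U - A)" w]
      by (simp add: Bochner_Integration.integral_add)
    also have "\<dots> \<le> e" using mAK mUA by (simp add: e'_def)
    finally show "(LBINT x. \<bar>indicat_real A (x + w) - indicat_real A x\<bar>) \<le> e" .
  qed
qed

lemma integrable_L1_diff:
  fixes V :: "'a::euclidean_space \<Rightarrow> real"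
  assumes "integrable lborel V"
  shows "integrable lborel (\<lambda>x. \<bar>V (x + w) - V x\<bar>)"
proof -
  have "integrable lborel (\<lambda>x. V (x + w))"
    using assms by (subst integrable_lborel_translate) auto
  then show ?thesis using assms by auto
qed

lemma L1_cont_integrable:
  fixes V :: "'a::euclidean_space \<Rightarrow> real"
  assumes "integrable lborel V"
  shows "L1_cont V"
  using assms
proof (induction rule: integrable_induct)
  case (base A c)
  show ?case unfolding L1_cont_def
  proof (intro allI impI)
    fix e :: real assume "0 < e"
    then have "0 < e / (\<bar>c\<bar> + 1)" by simp
    then obtain d where d: "d > 0" "\<And>w. norm w < d \<Longrightarrow> (LBINT x. \<bar>indicat_real A (x + w) - indicat_real A x\<bar>) \<le> e / (\<bar>c\<bar> + 1)"
      using L1_cont_indicator[of A] base unfolding L1_cont_def by (metis sets_lborel)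
    have "(LBINT x. \<bar>indicat_real A (x + w) *\<^sub>R c - indicat_real A x *\<^sub>R c\<bar>) \<le> e" if "norm w < d" for w
    proof -
      have "(LBINT x. \<bar>indicat_real A (x + w) *\<^sub>R c - indicat_real A x *\<^sub>R c\<bar>) = (LBINT x. \<bar>indicat_real A (x + w) - indicat_real A x\<bar> * \<bar>c\<bar>)"
        by (simp add: abs_mult[symmetric] algebra_simps)
      also have "\<dots> = (LBINT x. \<bar>indicat_real A (x + w) - indicat_real A x\<bar>) * \<bar>c\<bar>"
        by simp
      also have "\<dots> \<le> (e / (\<bar>c\<bar> + 1)) * (\<bar>c\<bar> + 1)"
        using d(2)[OF that] \<open>0 < e\<close> by (intro mult_mono) auto
      finally show ?thesis by simp
    qed
    with d(1) show "\<exists>d>0. \<forall>w. norm w < d \<longrightarrow> (LBINT x. \<bar>indicat_real A (x + w) *\<^sub>R c - indicat_real A x *\<^sub>R c\<bar>) \<le> e" by blast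
  qed
next
  case (add f g)
  show ?case unfolding L1_cont_def
  proof (intro allI impI)
    fix e :: real assume "0 < e"
    then have e2: "0 < e / 2" by simp
    obtain d1 where d1: "d1 > 0" "\<And>w. norm w < d1 \<Longrightarrow> (LBINT x. \<bar>f (x + w) - f x\<bar>) \<le> e/2"
      using add(3)[unfolded L1_cont_def, rule_format, OF e2] by blast
    obtain d2 where d2: "d2 > 0" "\<And>w. norm w < d2 \<Longrightarrow> (LBINT x. \<bar>g (x + w) - g x\<bar>) \<le> e/2"
      using add(4)[unfolded L1_cont_def, rule_format, OF e2] by blast
    note d = d1 d2
    have "(LBINT x. \<bar>f (x + w) + g (x + w) - (f x + g x)\<bar>) \<le> e" if "norm w < min d1 d2" for w
    proof -
      have "(LBINT x. \<bar>f (x + w) + g (x + w) - (f x + g x)\<bar>) \<le> (LBINT x. \<bar>f (x + w) - f x\<bar> + \<bar>g (x + w) - g x\<bar>)"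
      proof (rule integral_mono)
        show "integrable lborel (\<lambda>x. \<bar>f (x + w) + g (x + w) - (f x + g x)\<bar>)"
          using integrable_L1_diff[of "\<lambda>x. f x + g x" w] add(1,2) by simp
        show "integrable lborel (\<lambda>x. \<bar>f (x + w) - f x\<bar> + \<bar>g (x + w) - g x\<bar>)"
          using add(1,2) by (intro Bochner_Integration.integrable_add integrable_L1_diff)
      qed linarith
      also have "\<dots> \<le> e"
        using d(2)[of w] d(4)[of w] that add(1,2) integrable_L1_diff by (subst Bochner_Integration.integral_add) auto
      finally show ?thesis .
    qed
    then show "\<exists>d>0. \<forall>w. norm w < d \<longrightarrow> (LBINT x. \<bar>f (x + w) + g (x + w) - (f x + g x)\<bar>) \<le> e"
      using d by (intro exI[of _ "min d1 d2"]) auto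
  qed
next
  case (lim f s)
  show ?case unfolding L1_cont_def
  proof (intro allI impI)
    fix e :: real assume "0 < e"
    have "(\<lambda>i. LBINT x. \<bar>s i x - f x\<bar>) \<longlonglongrightarrow> (LINT x|(lborel :: 'a measure). (0::real))"
    \<comment> \<open>The approximants satisfy |s i x| \<le> 2 |f x|, which gives the factor 3 for
      the difference.\<close>
    proof (rule integral_dominated_convergence[where w = "\<lambda>x. 3 * norm (f x)"])
      show "AE x in lborel. (\<lambda>i. \<bar>s i x - f x\<bar>) \<longlonglongrightarrow> 0"
        using lim by (intro AE_I2 tendsto_rabs_zero) (auto simp: LIM_zero_iff)
      show "AE x in lborel. norm \<bar>s i x - f x\<bar> \<le> 3 * norm (f x)" for i
      proof (rule AE_I2)
        fix x assume "x \<in> space (lborel :: 'a measure)"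
        from lim(3)[OF this, of i] show "norm \<bar>s i x - f x\<bar> \<le> 3 * norm (f x)" by simp
      qed
    qed (use lim in auto)
    then have "eventually (\<lambda>i. (LBINT x. \<bar>s i x - f x\<bar>) < e/3) sequentially"
      using \<open>0 < e\<close> by (intro order_tendstoD) auto
    then obtain i where i: "(LBINT x. \<bar>s i x - f x\<bar>) < e/3" by (auto simp: eventually_sequentially)
    obtain d where d: "d > 0" "\<And>w. norm w < d \<Longrightarrow> (LBINT x. \<bar>s i (x + w) - s i x\<bar>) \<le> e/3"
      using lim(5)[of i, unfolded L1_cont_def, rule_format, of "e / 3"] \<open>0 < e\<close> by auto
    have "(LBINT x. \<bar>f (x + w) - f x\<bar>) \<le> e" if "norm w < d" for w
    proof -
      have a: "integrable lborel (\<lambda>x. \<bar>s i x - f x\<bar>)" using lim by auto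
      have b: "integrable lborel (\<lambda>x. \<bar>s i (x + w) - f (x + w)\<bar>)"
        using a integrable_lborel_translate[of "\<lambda>x. \<bar>s i x - f x\<bar>" w] by auto
      have c: "integrable lborel (\<lambda>x. \<bar>s i (x + w) - s i x\<bar>)" using lim by (intro integrable_L1_diff)
      have "(LBINT x. \<bar>f (x + w) - f x\<bar>) \<le> (LBINT x. \<bar>s i (x + w) - f (x + w)\<bar> + (\<bar>s i (x + w) - s i x\<bar> + \<bar>s i x - f x\<bar>))"
        using a b c lim by (intro integral_mono Bochner_Integration.integrable_add integrable_L1_diff) auto
      also have "\<dots> = (LBINT x. \<bar>s i (x + w) - f (x + w)\<bar>) + ((LBINT x. \<bar>s i (x + w) - s i x\<bar>) + (LBINT x. \<bar>s i x - f x\<bar>))"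
        using a b c by (simp add: Bochner_Integration.integral_add)
      also have "(LBINT x. \<bar>s i (x + w) - f (x + w)\<bar>) = (LBINT x. \<bar>s i x - f x\<bar>)"
        using a by (intro integral_lborel_translate[of "\<lambda>x. \<bar>s i x - f x\<bar>" w]) auto
      finally show ?thesis using i d(2)[OF that] by simp
    qed
    with d(1) show "\<exists>d>0. \<forall>w. norm w < d \<longrightarrow> (LBINT x. \<bar>f (x + w) - f x\<bar>) \<le> e" by blast
  qed
qed

text \<open>The weak form of \<open>k\<^sub>\<epsilon> * U \<rightarrow> U\<close>, already rescaled so that the kernel does not vary.\<close>

lemma approximate_identity:
  fixes U V k :: "'a::euclidean_space \<Rightarrow> real"
  assumes [measurable]: "U \<in> borel_measurable borel" and B: "\<And>x. \<bar>U x\<bar> \<le> B"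
    and V: "integrable lborel V" and k: "integrable lborel k" and r: "r \<longlonglongrightarrow> 0"
  shows "(\<lambda>m. LBINT w. k w * (LBINT z. U (z + r m *\<^sub>R w) * V z)) \<longlonglongrightarrow>
    (LBINT w. k w) * (LBINT z. U z * V z)"
proof -
  have [measurable]: "V \<in> borel_measurable borel" using V by auto
  have [measurable]: "k \<in> borel_measurable borel" using k by auto
  have B0: "0 \<le> B" using B[of 0] by linarith
  define T where "T w = (LBINT z. U (z + w) * V z)" for w
  have int: "integrable lborel (\<lambda>z. U (z + w) * V z)" for w
    by (rule Bochner_Integration.integrable_bound[of _ "\<lambda>z. B * V z"])
      (use V B B0 in \<open>auto intro!: AE_I2 mult_right_mono simp: abs_mult\<close>)
  have Tb: "\<bar>T w\<bar> \<le> B * (LBINT z. \<bar>V z\<bar>)" for w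
  proof -
    have "\<bar>T w\<bar> \<le> (LBINT z. \<bar>U (z + w) * V z\<bar>)" unfolding T_def by (rule integral_abs_bound)
    also have "\<dots> \<le> (LBINT z. B * \<bar>V z\<bar>)"
      using integrable_abs[OF int[of w]] V B
      by (intro integral_mono) (auto intro!: mult_right_mono simp: abs_mult)
    finally show ?thesis by simp
  qed
  have Tm[measurable]: "T \<in> borel_measurable borel"
    unfolding T_def by measurable
  have Tcont: "\<exists>d>0. \<forall>w. norm w < d \<longrightarrow> \<bar>T w - T 0\<bar> \<le> e" if "0 < e" for e
  proof -
    have "0 < e / (B + 1)" using that B0 by simp
    then obtain d where d: "d > 0" "\<And>w. norm w < d \<Longrightarrow> (LBINT x. \<bar>V (x + w) - V x\<bar>) \<le> e / (B + 1)"
      using L1_cont_integrable[OF V] unfolding L1_cont_def by blast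
    have "\<bar>T w - T 0\<bar> \<le> e" if w: "norm w < d" for w
    proof -
      \<comment> \<open>The shift is moved from U, which is merely bounded and measurable, to V,
        whose translates vary continuously in L^1.\<close>
      have i1: "integrable lborel (\<lambda>z. U z * V (z + - w))"
        using int[of w] integrable_lborel_translate[of "\<lambda>z. U (z + w) * V z" "- w"] by auto
      have "T w = (LBINT z. U z * V (z + - w))"
        unfolding T_def using integral_lborel_translate[of "\<lambda>z. U (z + w) * V z" "- w"] by auto
      then have "T w - T 0 = (LBINT z. U z * (V (z + - w) - V z))"
        using i1 int[of 0] by (simp add: T_def right_diff_distrib Bochner_Integration.integral_diff)
      also have "\<bar>\<dots>\<bar> \<le> (LBINT z. \<bar>U z * (V (z + - w) - V z)\<bar>)" by (rule integral_abs_bound)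
      also have "\<dots> \<le> (LBINT z. B * \<bar>V (z + - w) - V z\<bar>)"
      proof (rule integral_mono)
        show "integrable lborel (\<lambda>z. \<bar>U z * (V (z + - w) - V z)\<bar>)"
          unfolding right_diff_distrib using i1 int[of 0] by simp
        show "integrable lborel (\<lambda>z. B * \<bar>V (z + - w) - V z\<bar>)"
          using integrable_L1_diff[OF V, of "-w"] by simp
        show "\<bar>U z * (V (z + - w) - V z)\<bar> \<le> B * \<bar>V (z + - w) - V z\<bar>" for z
          using B[of z] by (auto simp: abs_mult intro: mult_right_mono)
      qed
      also have "\<dots> = B * (LBINT z. \<bar>V (z + - w) - V z\<bar>)" by simp
      also have "\<dots> \<le> (B + 1) * (e / (B + 1))"
        using d(2)[of "- w"] w B0 by (intro mult_mono) auto
      finally show ?thesis using B0 by simp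
    qed
    with d(1) show ?thesis by blast
  qed
  have "T \<midarrow>0\<rightarrow> T 0"
    unfolding LIM_def
  proof (intro allI impI)
    fix e :: real assume "0 < e"
    then obtain d where "d > 0" "\<forall>w. norm w < d \<longrightarrow> \<bar>T w - T 0\<bar> \<le> e/2" using Tcont[of "e/2"] by auto
    then show "\<exists>s>0. \<forall>x. x \<noteq> 0 \<and> dist x 0 < s \<longrightarrow> dist (T x) (T 0) < e"
      using \<open>0 < e\<close> by (intro exI[of _ d]) (fastforce simp: dist_norm)
  qed
  then have contT: "isCont T 0" by (simp add: isCont_def)
  have "(\<lambda>m. LBINT w. k w * T (r m *\<^sub>R w)) \<longlonglongrightarrow> (LBINT w. k w * T 0)"
  proof (rule integral_dominated_convergence[where w = "\<lambda>w. \<bar>k w\<bar> * (B * (LBINT z. \<bar>V z\<bar>))"])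
    show "AE x in lborel. (\<lambda>i. k x * T (r i *\<^sub>R x)) \<longlonglongrightarrow> k x * T 0"
    proof (intro AE_I2 tendsto_mult tendsto_const)
      fix x :: 'a
      have "(\<lambda>i. r i *\<^sub>R x) \<longlonglongrightarrow> 0" using tendsto_scaleR[OF r tendsto_const[of x]] by simp
      then show "(\<lambda>i. T (r i *\<^sub>R x)) \<longlonglongrightarrow> T 0" using isCont_tendsto_compose[OF contT] by blast
    qed
    show "AE x in lborel. norm (k x * T (r i *\<^sub>R x)) \<le> \<bar>k x\<bar> * (B * (LBINT z. \<bar>V z\<bar>))" for i
      using Tb by (intro AE_I2) (auto simp: abs_mult intro!: mult_left_mono)
  qed (use k in auto)
  then show ?thesis by (simp add: T_def)
qed

lemma integrable_pair_prod:
  fixes f :: "'a::euclidean_space \<Rightarrow> real" and g :: "'b::euclidean_space \<Rightarrow> real"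
  assumes f: "integrable lborel f" and g: "integrable lborel g"
  shows "integrable (lborel \<Otimes>\<^sub>M lborel) (\<lambda>(x, y). f x * g y)"
proof (rule lborel_pair.Fubini_integrable)
  have [measurable]: "f \<in> borel_measurable borel" "g \<in> borel_measurable borel" using f g by auto
  show "(\<lambda>(x, y). f x * g y) \<in> borel_measurable (lborel \<Otimes>\<^sub>M lborel)" by measurable
  show "integrable lborel (\<lambda>x. LBINT y. norm (case (x, y) of (x, y) \<Rightarrow> f x * g y))"
    using f by (simp add: abs_mult)
  show "AE x in lborel. integrable lborel (\<lambda>y. case (x, y) of (x, y) \<Rightarrow> f x * g y)"
    using g by simp
qed

text \<open>The substitution y = z + r w replaces the concentrating kernel by the fixed k and an
  average of U(z + r w); Fubini then takes the w-integral outside.\<close>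

lemma approximate_identity_kernel:
  fixes U V k :: "'a::euclidean_space \<Rightarrow> real"
  assumes Um[measurable]: "U \<in> borel_measurable borel" and B: "\<And>x. \<bar>U x\<bar> \<le> B"
    and V: "integrable lborel V" and k: "integrable lborel k" and r: "r \<longlonglongrightarrow> 0" and r0: "\<And>m. r m > 0"
  shows "(\<lambda>m. LBINT z. V z * (1 / r m ^ DIM('a) * (LBINT y. k ((1 / r m) *\<^sub>R (y - z)) * U y))) \<longlonglongrightarrow>
    (LBINT w. k w) * (LBINT z. U z * V z)"
proof -
  have [measurable]: "V \<in> borel_measurable borel" "k \<in> borel_measurable borel" using V k by auto
  have eq: "1 / r m ^ DIM('a) * (LBINT y. k ((1 / r m) *\<^sub>R (y - z)) * U y) = (LBINT w. k w * U (z + r m *\<^sub>R w))" for z m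
    using integral_lborel_affine[of "\<lambda>y. k ((1 / r m) *\<^sub>R (y - z)) * U y" "r m" z] r0[of m] by simp
  have sw: "(LBINT z. V z * (LBINT w. k w * U (z + r m *\<^sub>R w))) = (LBINT w. k w * (LBINT z. U (z + r m *\<^sub>R w) * V z))" for m
  proof -
    have "integrable (lborel \<Otimes>\<^sub>M lborel) (\<lambda>(w, z). k w * (U (z + r m *\<^sub>R w) * V z))"
    proof (rule Bochner_Integration.integrable_bound)
      show "integrable (lborel \<Otimes>\<^sub>M lborel) (\<lambda>(w, z). k w * (B * V z))"
        using k V by (intro integrable_pair_prod) auto
      show "AE x in lborel \<Otimes>\<^sub>M lborel. norm (case x of (w, z) \<Rightarrow> k w * (U (z + r m *\<^sub>R w) * V z)) \<le> norm (case x of (w, z) \<Rightarrow> k w * (B * V z))"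
        using order_trans[OF B abs_ge_self[of B]]
        by (intro AE_I2) (auto simp: abs_mult intro!: mult_left_mono mult_right_mono)
    qed measurable
    from lborel_pair.Fubini_integral[OF this]
    have "(LBINT z. LBINT w. k w * (U (z + r m *\<^sub>R w) * V z)) = (LBINT w. k w * (LBINT z. U (z + r m *\<^sub>R w) * V z))"
      by simp
    moreover have "V z * (LBINT w. k w * U (z + r m *\<^sub>R w)) = (LBINT w. k w * (U (z + r m *\<^sub>R w) * V z))" for z
      by (subst integral_mult_right_zero[symmetric]) (simp add: mult_ac)
    ultimately show ?thesis by simp
  qed
  show ?thesis
    unfolding eq sw by (rule approximate_identity[OF Um B V k r])
qed

section \<open>The weak formulation with explicit divergence-free fields\<close>

text \<open>Differentiability is known abstractly from \<open>smooth_alg\<close>, so a partial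
  derivative may be computed in one variable along the coordinate axis. All explicit derivative
  formulas below are obtained in this way.\<close>

lemma partial_deriv_line:
  fixes g :: "real^'n::finite \<Rightarrow> real"
  assumes "g differentiable (at x)"
    and "((\<lambda>t. g (x + t *\<^sub>R axis k 1)) has_real_derivative d) (at 0)"
  shows "partial_deriv k g x = d"
proof -
  have "((\<lambda>t. x + t *\<^sub>R axis k 1) has_derivative (\<lambda>t. t *\<^sub>R axis k 1)) (at 0)"
    by (auto intro!: derivative_eq_intros)
  moreover have "(g has_derivative frechet_derivative g (at x)) (at (x + 0 *\<^sub>R axis k 1))"
    using assms(1) frechet_derivative_works by auto
  ultimately have "((\<lambda>t. g (x + t *\<^sub>R axis k 1)) has_derivative (\<lambda>t. frechet_derivative g (at x) (t *\<^sub>R axis k 1))) (at 0)"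
    using diff_chain_at[of "\<lambda>t. x + t *\<^sub>R axis k 1" _ 0 g] by (simp add: o_def)
  moreover have "((\<lambda>t. g (x + t *\<^sub>R axis k 1)) has_derivative (\<lambda>t. d * t)) (at 0)"
    using assms(2) by (simp add: has_field_derivative_def)
  ultimately have "(\<lambda>t. frechet_derivative g (at x) (t *\<^sub>R axis k 1)) = (\<lambda>t. d * t)"
    by (rule has_derivative_unique)
  from fun_cong[OF this, of 1] show ?thesis by (simp add: partial_deriv_def)
qed

section \<open>Divergence-free fields generated by a radial potential\<close>

definition kd :: "'n \<Rightarrow> 'n \<Rightarrow> real" where "kd i j = (if i = j then 1 else 0)"

lemma sum_kd [simp]:
  "(\<Sum>k\<in>(UNIV::'n::finite set). kd i k * g k) = g i" "(\<Sum>k\<in>UNIV. g k * kd i k) = g i"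
  "(\<Sum>k\<in>UNIV. kd k i * g k) = g i" "(\<Sum>k\<in>UNIV. g k * kd k i) = g i"
  by (simp_all add: kd_def mult_delta_left mult_delta_right)

lemma kd_self [simp]: "kd i i = 1" by (simp add: kd_def)
lemma kd_commute: "kd i j = kd j i" by (simp add: kd_def)

text \<open>For \<open>\<psi> = h(|z|\<^sup>2)\<close> with \<open>h' = h1\<close>, \<open>h'' = h2\<close>, ..., the field
  \<open>\<phi>\<^sub>j = (\<partial>\<^sub>i\<partial>\<^sub>j - \<delta>\<^sub>i\<^sub>j\<Delta>)\<psi>\<close> is divergence free. \<open>curl_field\<close> is \<open>\<phi>\<^sub>j\<close>, \<open>curl_field_deriv\<close> is
  \<open>\<partial>\<^sub>k\<phi>\<^sub>j\<close>, \<open>bilap\<close> is \<open>\<Delta>\<^sup>2\<psi>\<close>, and \<open>grad_lap\<close> is \<open>\<partial>\<^sub>i\<Delta>\<psi>\<close>.\<close>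

definition curl_field :: "(real \<Rightarrow> real) \<Rightarrow> (real \<Rightarrow> real) \<Rightarrow> 'n::finite \<Rightarrow> 'n \<Rightarrow> real^'n \<Rightarrow> real" where
  "curl_field h1 h2 i j z = 4 * z $ i * z $ j * h2 (z \<bullet> z)
     - kd i j * ((2 * real CARD('n) - 2) * h1 (z \<bullet> z) + 4 * (z \<bullet> z) * h2 (z \<bullet> z))"

definition curl_field_deriv :: "(real \<Rightarrow> real) \<Rightarrow> (real \<Rightarrow> real) \<Rightarrow> 'n::finite \<Rightarrow> 'n \<Rightarrow> 'n \<Rightarrow> real^'n \<Rightarrow> real" where
  "curl_field_deriv h2 h3 i j k z =
     4 * (kd i k * z $ j + kd j k * z $ i) * h2 (z \<bullet> z) + 8 * z $ i * z $ j * z $ k * h3 (z \<bullet> z)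
     - kd i j * z $ k * ((4 * real CARD('n) + 4) * h2 (z \<bullet> z) + 8 * (z \<bullet> z) * h3 (z \<bullet> z))"

definition bilap :: "(real \<Rightarrow> real) \<Rightarrow> (real \<Rightarrow> real) \<Rightarrow> (real \<Rightarrow> real) \<Rightarrow> real^'n::finite \<Rightarrow> real" where
  "bilap h2 h3 h4 z = 4 * real CARD('n) * (real CARD('n) + 2) * h2 (z \<bullet> z)
     + 16 * (real CARD('n) + 2) * (z \<bullet> z) * h3 (z \<bullet> z) + 16 * (z \<bullet> z)\<^sup>2 * h4 (z \<bullet> z)"

definition grad_lap :: "(real \<Rightarrow> real) \<Rightarrow> (real \<Rightarrow> real) \<Rightarrow> 'n::finite \<Rightarrow> real^'n \<Rightarrow> real" where
  "grad_lap h2 h3 i z = z $ i * ((4 * real CARD('n) + 8) * h2 (z \<bullet> z) + 8 * (z \<bullet> z) * h3 (z \<bullet> z))"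

lemma line_nth: "(z + t *\<^sub>R axis k 1) $ i = z $ i + t * kd i k"
  by (simp add: axis_def kd_def)

lemma line_norm:
  fixes z :: "real^'n::finite"
  shows "(z + t *\<^sub>R axis k 1) \<bullet> (z + t *\<^sub>R axis k 1) = z \<bullet> z + 2 * t * z $ k + t\<^sup>2"
  by (simp add: inner_add_left inner_add_right inner_axis inner_axis' power2_eq_square algebra_simps)

lemma DERIV_line_norm:
  assumes "(H has_real_derivative H') (at (s::real))"
  shows "((\<lambda>t. H (s + 2 * t * a + t\<^sup>2)) has_real_derivative (H' * (2 * a))) (at 0)"
proof -
  have "((\<lambda>t. s + 2 * t * a + t\<^sup>2) has_real_derivative 2 * a) (at 0)"
    by (auto intro!: derivative_eq_intros)
  moreover have "(H has_real_derivative H') (at (s + 2 * 0 * a + 0\<^sup>2))" using assms by simp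
  ultimately show ?thesis using DERIV_chain2 by fast
qed

lemma curl_field_line:
  fixes z :: "real^'n::finite"
  assumes "(h1 has_real_derivative h2 (z \<bullet> z)) (at (z \<bullet> z))" "(h2 has_real_derivative h3 (z \<bullet> z)) (at (z \<bullet> z))"
  shows "((\<lambda>t. curl_field h1 h2 i j (z + t *\<^sub>R axis k 1)) has_real_derivative curl_field_deriv h2 h3 i j k z) (at 0)"
  unfolding curl_field_def line_nth line_norm
  by (rule derivative_eq_intros DERIV_line_norm[OF assms(1)] DERIV_line_norm[OF assms(2)] refl | simp)+
    (simp add: curl_field_deriv_def algebra_simps)

lemma grad_lap_line:
  fixes z :: "real^'n::finite"
  assumes "(h2 has_real_derivative h3 (z \<bullet> z)) (at (z \<bullet> z))" "(h3 has_real_derivative h4 (z \<bullet> z)) (at (z \<bullet> z))"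
  shows "((\<lambda>t. grad_lap h2 h3 i (z + t *\<^sub>R axis k 1)) has_real_derivative
     kd i k * ((4 * real CARD('n) + 8) * h2 (z \<bullet> z) + 8 * (z \<bullet> z) * h3 (z \<bullet> z))
     + z $ i * z $ k * ((8 * real CARD('n) + 32) * h3 (z \<bullet> z) + 16 * (z \<bullet> z) * h4 (z \<bullet> z))) (at 0)"
  unfolding grad_lap_def line_nth line_norm
  by (rule derivative_eq_intros DERIV_line_norm[OF assms(1)] DERIV_line_norm[OF assms(2)] refl | simp)+
    (simp add: algebra_simps)

lemma curl_field_deriv_line:
  fixes z :: "real^'n::finite"
  assumes "(h2 has_real_derivative h3 (z \<bullet> z)) (at (z \<bullet> z))" "(h3 has_real_derivative h4 (z \<bullet> z)) (at (z \<bullet> z))"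
  shows "((\<lambda>t. curl_field_deriv h2 h3 i j k (z + t *\<^sub>R axis k 1)) has_real_derivative
     8 * kd i k * kd j k * h2 (z \<bullet> z)
     + 8 * (kd i k * z $ j + kd j k * z $ i) * z $ k * h3 (z \<bullet> z)
     + 8 * (kd i k * z $ j * z $ k + kd j k * z $ i * z $ k + z $ i * z $ j) * h3 (z \<bullet> z)
     + 16 * z $ i * z $ j * z $ k * z $ k * h4 (z \<bullet> z)
     - kd i j * ((4 * real CARD('n) + 4) * h2 (z \<bullet> z) + 8 * (z \<bullet> z) * h3 (z \<bullet> z))
     - kd i j * (z $ k * z $ k) * ((8 * real CARD('n) + 24) * h3 (z \<bullet> z) + 16 * (z \<bullet> z) * h4 (z \<bullet> z))) (at 0)"
  unfolding curl_field_deriv_def line_nth line_norm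
  by (rule derivative_eq_intros DERIV_line_norm[OF assms(1)] DERIV_line_norm[OF assms(2)] refl | simp)+
    (simp add: algebra_simps)

lemma inner_eq_sum_sq: "(\<Sum>k\<in>UNIV. z $ k * z $ k) = z \<bullet> (z :: real^'n::finite)"
  by (simp add: inner_vec_def)

text \<open>In coordinates this is \<partial>_i \<Delta>\<psi> - \<partial>_i \<Delta>\<psi>: the
  first two terms of \<open>curl_field_deriv\<close> contribute z_i ((4n + 4) h2 + 8 |z|^2 h3), and
  the Kronecker term takes exactly this away.\<close>

lemma curl_field_div_free:
  "(\<Sum>j\<in>UNIV. curl_field_deriv h2 h3 i j j z) = 0"
proof -
  have "(\<Sum>j\<in>UNIV. curl_field_deriv h2 h3 i j j z) = 
     (\<Sum>j\<in>UNIV. kd i j * z $ j * (4 * h2 (z \<bullet> z)) + 4 * z $ i * h2 (z \<bullet> z) + (z $ j * z $ j) * (8 * z $ i * h3 (z \<bullet> z))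
     - kd i j * z $ j * ((4 * real CARD('a) + 4) * h2 (z \<bullet> z) + 8 * (z \<bullet> z) * h3 (z \<bullet> z)))"
    by (intro sum.cong) (simp_all add: curl_field_deriv_def algebra_simps)
  also have "\<dots> = 0"
    by (simp add: sum.distrib sum_subtractf sum_distrib_right[symmetric] inner_eq_sum_sq) (simp add: algebra_simps)
  finally show ?thesis .
qed

text \<open>The left side is the sum over k of the second derivatives found in
  \<open>curl_field_deriv_line\<close>. The right side is \<partial>_j of \<open>grad_lap\<close>
  minus the Kronecker delta times \<open>bilap\<close>, that is \<Delta>\<phi>_j = \<partial>_j
  \<partial>_i \<Delta>\<psi> - \<delta>_ij \<Delta>^2 \<psi>. The h's are plain numbers here, so
  that the identity is pure algebra.\<close>

lemma curl_field_laplacian: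
  fixes z :: "real^'n::finite"
  shows "(\<Sum>k\<in>UNIV. 8 * kd i k * kd j k * h2
     + 8 * (kd i k * z $ j + kd j k * z $ i) * z $ k * h3
     + 8 * (kd i k * z $ j * z $ k + kd j k * z $ i * z $ k + z $ i * z $ j) * h3
     + 16 * z $ i * z $ j * z $ k * z $ k * h4
     - kd i j * ((4 * real CARD('n) + 4) * h2 + 8 * (z \<bullet> z) * h3)
     - kd i j * (z $ k * z $ k) * ((8 * real CARD('n) + 24) * h3 + 16 * (z \<bullet> z) * h4))
   = kd i j * ((4 * real CARD('n) + 8) * h2 + 8 * (z \<bullet> z) * h3)
     + z $ i * z $ j * ((8 * real CARD('n) + 32) * h3 + 16 * (z \<bullet> z) * h4)
     - kd i j * (4 * real CARD('n) * (real CARD('n) + 2) * h2 + 16 * (real CARD('n) + 2) * (z \<bullet> z) * h3 + 16 * (z \<bullet> z)\<^sup>2 * h4)"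
    (is "(\<Sum>k\<in>UNIV. ?S k) = ?R")
proof -
  have "(\<Sum>k\<in>UNIV. ?S k) = (\<Sum>k\<in>UNIV. kd i k * (8 * kd j k * h2 + 16 * z $ j * z $ k * h3)
     + kd j k * (16 * z $ i * z $ k * h3) + (8 * z $ i * z $ j * h3 - kd i j * ((4 * real CARD('n) + 4) * h2 + 8 * (z \<bullet> z) * h3))
     + (z $ k * z $ k) * (16 * z $ i * z $ j * h4 - kd i j * ((8 * real CARD('n) + 24) * h3 + 16 * (z \<bullet> z) * h4)))"
    by (intro sum.cong) (simp_all add: algebra_simps)
  also have "\<dots> = ?R"
    by (simp add: sum.distrib sum_distrib_right[symmetric] inner_eq_sum_sq kd_commute[of j i])
      (simp add: algebra_simps power2_eq_square)
  finally show ?thesis .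
qed


section \<open>Locally integrable functions and concrete test functions\<close>

definition loc_integrable :: "('a::euclidean_space \<Rightarrow> real) \<Rightarrow> bool" where
  "loc_integrable h \<longleftrightarrow> (\<forall>r. integrable lborel (\<lambda>x. indicator (cball 0 r) x * h x))"

lemma loc_integrable_mult:
  fixes g h :: "'a::euclidean_space \<Rightarrow> real"
  assumes h: "loc_integrable h" and g: "continuous_on UNIV g" "\<And>x. norm x > r \<Longrightarrow> g x = 0"
  shows "integrable lborel (\<lambda>x. g x * h x)"
proof -
  have "compact (g ` cball 0 r)"
    by (intro compact_continuous_image continuous_on_subset[OF g(1)]) auto
  then obtain B where B: "\<And>x. x \<in> cball 0 r \<Longrightarrow> \<bar>g x\<bar> \<le> B"
    using compact_imp_bounded bounded_iff by (metis image_eqI real_norm_def)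
  have hi: "integrable lborel (\<lambda>x. indicator (cball 0 r) x * h x)" using h by (simp add: loc_integrable_def)
  have eq: "(\<lambda>x. g x * h x) = (\<lambda>x. g x * (indicator (cball 0 r) x * h x))"
    using g(2) by (auto simp: indicator_def fun_eq_iff not_le)
  have gm: "g \<in> borel_measurable borel" using g(1) by (rule borel_measurable_continuous_onI)
  show ?thesis
    unfolding eq
  proof (rule Bochner_Integration.integrable_bound[of _ "\<lambda>x. \<bar>B\<bar> * (indicator (cball 0 r) x * h x)"])
    show "(\<lambda>x. g x * (indicator (cball 0 r) x * h x)) \<in> borel_measurable lborel"
      using gm hi by measurable
    show "AE x in lborel. norm (g x * (indicator (cball 0 r) x * h x)) \<le> norm (\<bar>B\<bar> * (indicator (cball 0 r) x * h x))"
    proof (rule AE_I2)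
      fix x :: 'a
      show "norm (g x * (indicator (cball 0 r) x * h x)) \<le> norm (\<bar>B\<bar> * (indicator (cball 0 r) x * h x))"
        using order_trans[OF B[of x] abs_ge_self] by (cases "x \<in> cball 0 r") (auto simp: abs_mult intro!: mult_right_mono)
    qed
  qed (use hi in auto)
qed

text \<open>A quantitative form of \<open>test_function\<close>: membership in
  \<open>smooth_alg\<close> gives continuity and differentiability at once, and the explicit radius
  gives dominating functions.\<close>

definition test_fn :: "real \<Rightarrow> (real^'n::finite \<Rightarrow> real) \<Rightarrow> bool" where
  "test_fn r g \<longleftrightarrow> smooth_alg g \<and> (\<forall>x. norm x > r \<longrightarrow> g x = 0)"

lemma test_fn_test_function: "test_fn r g \<Longrightarrow> test_function g"
  unfolding test_fn_def using test_function_scalar[of g r 0] by auto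

lemma test_fn_continuous: "test_fn r g \<Longrightarrow> continuous_on UNIV g"
  by (simp add: test_fn_def smooth_alg_continuous)

lemma test_fn_partial:
  assumes "test_fn r g"
  shows "test_fn r (partial_deriv k g)"
proof -
  have "partial_deriv k g x = 0" if x: "norm x > r" for x
  proof -
    have "(g has_derivative (\<lambda>_. 0)) (at x)"
    proof (rule has_derivative_transform_within_open[of "\<lambda>_. 0" _ _ _ "- cball 0 r"])
      show "open (- cball 0 r :: (real^'a) set)" by auto
    qed (use x assms in \<open>auto simp: test_fn_def\<close>)
    then have "frechet_derivative g (at x) = (\<lambda>_. 0)" by (rule frechet_derivative_at[symmetric])
    then show ?thesis by (simp add: partial_deriv_def)
  qed
  then show ?thesis using assms by (auto simp: test_fn_def smooth_alg_partial)
qed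

lemma test_fn_integrable:
  assumes "test_fn r g"
  shows "integrable lborel g"
proof -
  have "loc_integrable (\<lambda>_::real^'a. 1)"
    unfolding loc_integrable_def using emeasure_lborel_cball_finite[of "0::real^'a"] by (auto intro!: integrable_real_indicator)
  from loc_integrable_mult[OF this test_fn_continuous[OF assms], of r] assms show ?thesis
    by (simp add: test_fn_def)
qed

primrec bump_poly :: "nat \<Rightarrow> real poly" where
  "bump_poly 0 = 1"
| "bump_poly (Suc k) = [:0, 0, 1:] * (bump_poly k - pderiv (bump_poly k))"

text \<open>The k-th s-derivative of exp(-1/(1 - s/e^2)), extended by 0 for s \<ge> e^2. With s = |y
  - x0|^2 it is supported in the ball of radius e. It serves as a mollifier for small e and as a
  cutoff for large e, and is not normalised in either role.\<close>

definition scaled_bump :: "real \<Rightarrow> nat \<Rightarrow> real \<Rightarrow> real" where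
  "scaled_bump e k s = (- 1 / e\<^sup>2) ^ k * bump (bump_poly k) (1 - s / e\<^sup>2)"

lemma DERIV_scaled_bump: "(scaled_bump e k has_real_derivative scaled_bump e (Suc k) s) (at s)"
proof -
  have "((\<lambda>s. bump (bump_poly k) (1 - s / e\<^sup>2)) has_real_derivative bump (bump_poly (Suc k)) (1 - s / e\<^sup>2) * (- 1 / e\<^sup>2)) (at s)"
  proof (rule DERIV_chain2[of "bump (bump_poly k)"])
    show "((\<lambda>s. 1 - s / e\<^sup>2) has_real_derivative - 1 / e\<^sup>2) (at s)"
      by (rule DERIV_cong[OF DERIV_diff[OF DERIV_const DERIV_cdivide[OF DERIV_ident]]]) simp
  qed (simp only: bump_poly.simps DERIV_bump)
  from DERIV_cmult[OF this, of "(- 1 / e\<^sup>2) ^ k"] show ?thesis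
    by (simp add: scaled_bump_def[abs_def] mult_ac)
qed

lemma scaled_bump_measurable [measurable]: "scaled_bump e m \<in> borel_measurable borel"
  using DERIV_scaled_bump by (intro borel_measurable_continuous_onI) (meson DERIV_isCont continuous_at_imp_continuous_on)

lemma scaled_bump_eq_0: "0 < e \<Longrightarrow> e\<^sup>2 \<le> s \<Longrightarrow> scaled_bump e k s = 0"
  by (simp add: scaled_bump_def bump_def)

lemma smooth_alg_scaled_bump: "smooth_alg (\<lambda>y. scaled_bump e k ((y - x0) \<bullet> (y - x0)))"
  using sa_radial[of 1 "\<lambda>m. scaled_bump e (k + m)" x0] DERIV_scaled_bump by simp

lemma partial_scaled_bump:
  "partial_deriv k (\<lambda>y. scaled_bump e m ((y - x0) \<bullet> (y - x0))) y = 2 * scaled_bump e (Suc m) ((y - x0) \<bullet> (y - x0)) * (y - x0) $ k"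
  by (subst partial_deriv_gderiv[OF GDERIV_radial[OF DERIV_scaled_bump]]) simp

lemma inner_diff_commute: "(x - y) \<bullet> (x - y) = (y - x) \<bullet> (y - (x::'a::real_inner))"
  by (simp add: inner_commute algebra_simps)

lemma inner_self_ge: "0 \<le> e \<Longrightarrow> norm z \<ge> e \<Longrightarrow> e\<^sup>2 \<le> z \<bullet> (z::'a::real_inner)"
  by (simp add: dot_square_norm power_mono)

lemma partial_deriv_mult:
  fixes f g :: "real^'n::finite \<Rightarrow> real"
  assumes "smooth_alg f" "smooth_alg g"
  shows "partial_deriv k (\<lambda>y. f y * g y) y = partial_deriv k f y * g y + f y * partial_deriv k g y"
proof -
  obtain F G where FG: "\<forall>x. GDERIV f x :> F x" "\<forall>x. GDERIV g x :> G x"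
    using assms smooth_alg_gderiv by metis
  have "partial_deriv k (\<lambda>y. f y * g y) y = (f y *\<^sub>R G y + g y *\<^sub>R F y) $ k"
    using FG by (intro partial_deriv_gderiv GDERIV_mult) auto
  moreover have "partial_deriv k f y = F y $ k" "partial_deriv k g y = G y $ k"
    using FG by (auto intro: partial_deriv_gderiv)
  ultimately show ?thesis by simp
qed

lemma sa_diff: "smooth_alg f \<Longrightarrow> smooth_alg g \<Longrightarrow> smooth_alg (\<lambda>y. f y - g y)"
  using sa_add[of f "\<lambda>y. - 1 * g y"] sa_mult[OF sa_const[of "- 1"], of g] by simp

lemma sa_coord_diff: "smooth_alg (\<lambda>y. (y - x0) $ i)"
  using sa_diff[OF sa_coord sa_const] by simp

lemma sa_norm_sq: "smooth_alg (\<lambda>y. (y - x0) \<bullet> (y - x0))"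
proof -
  define H :: "nat \<Rightarrow> real \<Rightarrow> real" where "H k s = (if k = 0 then s else if k = 1 then 1 else 0)" for k s
  have "(H k has_real_derivative H (Suc k) s) (at s)" for k s
    by (cases "k = 0"; cases "k = 1") (auto simp: H_def[abs_def])
  then show ?thesis using sa_radial[of 1 H x0] by (simp add: H_def)
qed

lemmas smooth_alg_intros = sa_const sa_coord_diff sa_norm_sq sa_add sa_diff sa_mult

text \<open>The problem for Borel representatives whose velocity bound holds at every point, so that
  measurability, Fubini and dominated convergence take place on \<open>lborel\<close>. The weak
  derivative is stated componentwise, and both weak identities only for
  \<open>test_fn\<close>.\<close>

locale weak_ns =
  fixes u f :: "real^'n::finite \<Rightarrow> real^'n" and D :: "'n \<Rightarrow> real^'n \<Rightarrow> real^'n" and B :: real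
  assumes u_meas [measurable]: "u \<in> borel_measurable borel"
    and D_meas [measurable]: "\<And>k. D k \<in> borel_measurable borel"
    and u_bound: "\<And>x. norm (u x) \<le> B"
    and f_int: "integrable lborel f"
    and D_loc: "\<And>k j. loc_integrable (\<lambda>x. D k x $ j)"
    and weak_D: "\<And>r \<phi> k j. test_fn r \<phi> \<Longrightarrow>
      (LBINT x. partial_deriv k \<phi> x * u x $ j) = - (LBINT x. \<phi> x * D k x $ j)"
    and div_free: "AE x in lborel. (\<Sum>k\<in>UNIV. D k x $ k) = 0"
    and weak: "\<And>r \<phi>. (\<And>j. test_fn r (\<lambda>x. \<phi> x $ j)) \<Longrightarrow>
      (\<forall>x. (\<Sum>k\<in>UNIV. partial_deriv k \<phi> x $ k) = 0) \<Longrightarrow>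
      (LBINT x. (\<Sum>k\<in>UNIV. D k x \<bullet> partial_deriv k \<phi> x))
       + (LBINT x. (\<Sum>k\<in>UNIV. u x $ k *\<^sub>R D k x) \<bullet> \<phi> x)
       = (LBINT x. f x \<bullet> \<phi> x)"
begin

lemma u_comp_bound: "\<bar>u x $ j\<bar> \<le> B"
  using component_le_norm_cart[of "u x" j] u_bound[of x] by linarith

lemma B_nonneg: "0 \<le> B" using u_bound[of 0] norm_ge_zero order_trans by blast

lemma u_comp_meas [measurable]: "(\<lambda>x. u x $ j) \<in> borel_measurable borel"
  by (rule measurable_compose[OF u_meas borel_measurable_nth])

lemma integrable_mult_bounded:
  assumes "integrable lborel g" "h \<in> borel_measurable borel" "\<And>x. \<bar>h x\<bar> \<le> C"
  shows "integrable lborel (\<lambda>x::real^'n. g x * h x :: real)" "integrable lborel (\<lambda>x. h x * g x)"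
proof -
  have *: "\<bar>h x\<bar> \<le> \<bar>C\<bar>" for x using assms(3)[of x] by linarith
  show "integrable lborel (\<lambda>x. g x * h x)"
    by (rule Bochner_Integration.integrable_bound[of _ "\<lambda>x. \<bar>C\<bar> * g x"])
      (use assms * in \<open>auto simp: abs_mult mult.commute[of "\<bar>C\<bar>"] intro!: mult_left_mono AE_I2\<close>)
  then show "integrable lborel (\<lambda>x. h x * g x)" by (simp add: mult.commute)
qed

lemma int_test_D: "test_fn r \<phi> \<Longrightarrow> integrable lborel (\<lambda>x. \<phi> x * D k x $ j)"
  using loc_integrable_mult[OF D_loc test_fn_continuous, of r \<phi>] unfolding test_fn_def by blast

lemma int_test_u: "test_fn r \<phi> \<Longrightarrow> integrable lborel (\<lambda>x. \<phi> x * u x $ j)"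
  by (rule integrable_mult_bounded(1)[where C = B, OF test_fn_integrable]) (auto simp: u_comp_bound)

lemma weak_div:
  assumes "test_fn r \<eta>"
  shows "(\<Sum>j\<in>UNIV. LBINT x. partial_deriv j \<eta> x * u x $ j) = 0"
proof -
  have "(\<Sum>j\<in>UNIV. LBINT x. partial_deriv j \<eta> x * u x $ j) = - (\<Sum>j\<in>UNIV. LBINT x. \<eta> x * D j x $ j)"
    by (simp add: weak_D[OF assms] sum_negf)
  also have "(\<Sum>j\<in>UNIV. LBINT x. \<eta> x * D j x $ j) = (LBINT x. (\<Sum>j\<in>UNIV. \<eta> x * D j x $ j))"
    by (rule Bochner_Integration.integral_sum[symmetric]) (rule int_test_D[OF assms])
  also have "\<dots> = (\<integral>x. 0 \<partial>(lborel :: (real^'n) measure))"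
  proof (rule integral_cong_AE)
    show "AE x in lborel. (\<Sum>j\<in>UNIV. \<eta> x * D j x $ j) = 0"
      using div_free by eventually_elim (simp add: sum_distrib_left[symmetric])
    show "(\<lambda>x. \<Sum>j\<in>UNIV. \<eta> x * D j x $ j) \<in> borel_measurable lborel"
      using int_test_D[OF assms] by (intro borel_measurable_sum) (auto simp: borel_measurable_integrable)
  qed auto
  finally show ?thesis by simp
qed

text \<open>The Leibniz rule for \<open>\<Sum>\<^sub>k u\<^sub>k \<partial>\<^sub>k(u\<^sub>j \<phi>)\<close>: \<open>weak_div\<close> applies only to test functions, so
  \<open>u\<^sub>j \<phi>\<close> is mollified, and Fubini moves the derivative of the mollifier onto \<open>u\<^sub>j \<phi>\<close>.\<close>

lemma weak_product:
  assumes \<phi>: "test_fn r \<phi>"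
  shows "(\<Sum>k\<in>UNIV. LBINT z. u z $ k * (u z $ j * partial_deriv k \<phi> z + \<phi> z * D k z $ j)) = 0"
proof -
  \<comment> \<open>V k is the weak derivative \<partial>_k (u_j \<phi>), written out by the product
    rule.\<close>
  define V where "V k z = u z $ j * partial_deriv k \<phi> z + \<phi> z * D k z $ j" for k z
  have V_int: "integrable lborel (V k)" for k
    unfolding V_def using int_test_D[OF \<phi>] int_test_u[OF test_fn_partial[OF \<phi>]]
    by (intro Bochner_Integration.integrable_add) (simp_all add: mult.commute)
  have [measurable]: "V k \<in> borel_measurable borel" for k
    using V_int[of k] by auto
  have V0: "V k z = 0" if "norm z > r" for k z
    using that \<phi> test_fn_partial[OF \<phi>, of k] by (simp add: V_def test_fn_def)
  have [measurable]: "\<phi> \<in> borel_measurable borel"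
    using test_fn_continuous[OF \<phi>] by (rule borel_measurable_continuous_onI)
  \<comment> \<open>The pairing of V k with the mollified u_k. For each e > 0 the sum over k
    vanishes exactly; the claim is the limit e \<rightarrow> 0 after rescaling by e^(-n).\<close>
  define I where "I e k = (LBINT z. V k z * (LBINT y. scaled_bump e 0 ((y - z) \<bullet> (y - z)) * u y $ k))" for e k
  have I0: "(\<Sum>k\<in>UNIV. I e k) = 0" if e: "0 < e" for e
  proof -
    define \<rho> where "\<rho> w = scaled_bump e 0 (w \<bullet> w)" for w :: "real^'n"
    define R where "R k w = 2 * scaled_bump e 1 (w \<bullet> w) * w $ k" for k and w :: "real^'n"
    have \<rho>m [measurable]: "\<rho> \<in> borel_measurable borel" unfolding \<rho>_def by measurable
    have Rm [measurable]: "R k \<in> borel_measurable borel" for k unfolding R_def by measurable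
    have \<rho>_test: "test_fn (norm z + e) (\<lambda>y. \<rho> (y - z))" for z
    proof -
      have "\<rho> (y - z) = 0" if "norm y > norm z + e" for y
        unfolding \<rho>_def using that norm_triangle_ineq2[of y z] e by (intro scaled_bump_eq_0 inner_self_ge) auto
      then show ?thesis unfolding test_fn_def \<rho>_def using smooth_alg_scaled_bump by blast
    qed
    have \<rho>_partial: "partial_deriv k (\<lambda>y. \<rho> (y - z)) y = R k (y - z)" for k y z
      unfolding \<rho>_def R_def by (simp add: partial_scaled_bump)
    have R_odd: "R k (z - y) = - R k (y - z)" for k y z
      unfolding R_def by (simp add: inner_diff_commute[of z y] algebra_simps)
    have \<rho>_even: "\<rho> (z - y) = \<rho> (y - z)" for y z
      unfolding \<rho>_def by (simp add: inner_diff_commute[of z y])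
    have \<rho>_test0: "test_fn e \<rho>" using \<rho>_test[of 0] by simp
    have R_test: "test_fn e (R k)" for k
    proof -
      have "partial_deriv k \<rho> = R k" using \<rho>_partial[of k 0] by (simp add: fun_eq_iff)
      then show ?thesis using test_fn_partial[OF \<rho>_test0, of k] by simp
    qed
    have bdd: "\<exists>C. \<forall>w. \<bar>g w\<bar> \<le> C" if "test_fn e g" for g :: "real^'n \<Rightarrow> real"
    proof -
      have "compact (g ` cball 0 e)"
        by (intro compact_continuous_image continuous_on_subset[OF test_fn_continuous[OF that]]) auto
      then obtain C where C: "\<forall>w\<in>cball 0 e. \<bar>g w\<bar> \<le> C"
        using compact_imp_bounded bounded_iff by (metis image_eqI real_norm_def)
      have "\<bar>g w\<bar> \<le> max C 0" for w
        using C that by (cases "norm w \<le> e") (auto simp: test_fn_def le_max_iff_disj)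
      then show ?thesis by blast
    qed
    \<comment> \<open>The supports of G and H confine y to the ball of radius r + e. On it u is
      bounded, which gives a product as dominating function.\<close>
    have fub: "(LBINT z. LBINT y. G z * (H (y - z) * u y $ k)) = (LBINT y. LBINT z. G z * (H (y - z) * u y $ k))"
      if G: "integrable lborel G" "\<And>z. norm z > r \<Longrightarrow> G z = 0" and H: "test_fn e H" for G H and k
    proof -
      have [measurable]: "G \<in> borel_measurable borel" "H \<in> borel_measurable borel"
        using G test_fn_integrable[OF H] by auto
      obtain C where C: "\<And>w. \<bar>H w\<bar> \<le> C" using bdd[OF H] by blast
      have C0: "0 \<le> C" using C[of 0] by linarith
      have "integrable (lborel \<Otimes>\<^sub>M lborel) (\<lambda>(y, z). G z * (H (y - z) * u y $ k))"
      proof (rule Bochner_Integration.integrable_bound)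
        show "integrable (lborel \<Otimes>\<^sub>M lborel) (\<lambda>(y::real^'n, z). indicator (cball 0 (r + e)) y * (C * B * G z))"
          using emeasure_lborel_cball_finite[of "0::real^'n" "r + e"] G
          by (intro integrable_pair_prod) (auto intro!: integrable_real_indicator)
        show "AE x in lborel \<Otimes>\<^sub>M lborel. norm (case x of (y, z) \<Rightarrow> G z * (H (y - z) * u y $ k))
            \<le> norm (case x of (y, z) \<Rightarrow> indicator (cball 0 (r + e)) y * (C * B * G z))"
        proof (rule AE_I2)
          fix x :: "(real^'n) \<times> (real^'n)"
          obtain y z where x: "x = (y, z)" by force
          have "\<bar>G z * (H (y - z) * u y $ k)\<bar> \<le> \<bar>indicator (cball 0 (r + e)) y * (C * B * G z)\<bar>"
          proof (cases "norm z \<le> r \<and> norm (y - z) \<le> e")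
            case True
            then have "y \<in> cball 0 (r + e)" using norm_triangle_sub[of y z] by auto
            moreover have "\<bar>H (y - z)\<bar> * \<bar>u y $ k\<bar> \<le> C * B" by (intro mult_mono C u_comp_bound C0) auto
            ultimately show ?thesis using C0 B_nonneg
              by (simp add: abs_mult mult.commute[of "\<bar>G z\<bar>"] mult_right_mono)
          next
            case False
            then have "G z * H (y - z) = 0" using G(2) H by (auto simp: test_fn_def not_le)
            then show ?thesis by (auto simp: mult.assoc[symmetric])
          qed
          then show "norm (case x of (y, z) \<Rightarrow> G z * (H (y - z) * u y $ k)) \<le> norm (case x of (y, z) \<Rightarrow> indicator (cball 0 (r + e)) y * (C * B * G z))"
            by (simp add: x)
        qed
      qed measurable
      from lborel_pair.Fubini_integral[OF this] show ?thesis by simp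
    qed
    \<comment> \<open>\<open>weak_D\<close> is applied to the test function \<phi> \<rho>(. - y).
      The sign from integrating by parts is compensated by R being odd, as the gradient of the even
      function \<rho>.\<close>
    have mol: "(LBINT z. V k z * \<rho> (y - z)) = (LBINT z. \<phi> z * u z $ j * R k (y - z))" for k y
    proof -
      have t: "test_fn r (\<lambda>z. \<phi> z * \<rho> (z - y))"
        using \<phi> \<rho>_test[of y] unfolding test_fn_def by (auto intro: sa_mult)
      have p: "partial_deriv k (\<lambda>z. \<phi> z * \<rho> (z - y)) z = partial_deriv k \<phi> z * \<rho> (z - y) + \<phi> z * R k (z - y)" for z
        using \<phi> \<rho>_test[of y] by (subst partial_deriv_mult) (auto simp: test_fn_def \<rho>_partial)
      have t1: "test_fn r (\<lambda>z. partial_deriv k \<phi> z * \<rho> (z - y))"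
        using test_fn_partial[OF \<phi>] \<rho>_test[of y] unfolding test_fn_def by (auto intro: sa_mult)
      have t2: "test_fn r (\<lambda>z. \<phi> z * R k (z - y))"
        using \<phi> test_fn_partial[OF \<rho>_test[of y], of k] unfolding test_fn_def \<rho>_partial by (auto intro: sa_mult)
      have "(LBINT z. (partial_deriv k \<phi> z * \<rho> (z - y)) * u z $ j) + (LBINT z. (\<phi> z * R k (z - y)) * u z $ j)
        = (LBINT z. partial_deriv k (\<lambda>z. \<phi> z * \<rho> (z - y)) z * u z $ j)"
        using int_test_u[OF t1, of j] int_test_u[OF t2, of j]
        by (subst Bochner_Integration.integral_add[symmetric]) (simp_all add: p distrib_right)
      also have "\<dots> = - (LBINT z. (\<phi> z * \<rho> (z - y)) * D k z $ j)" by (rule weak_D[OF t])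
      finally have "(LBINT z. (partial_deriv k \<phi> z * \<rho> (z - y)) * u z $ j) + (LBINT z. (\<phi> z * \<rho> (z - y)) * D k z $ j)
         = - (LBINT z. (\<phi> z * R k (z - y)) * u z $ j)" by linarith
      also have "(LBINT z. (partial_deriv k \<phi> z * \<rho> (z - y)) * u z $ j) + (LBINT z. (\<phi> z * \<rho> (z - y)) * D k z $ j)
        = (LBINT z. V k z * \<rho> (y - z))"
        using int_test_u[OF t1, of j] int_test_D[OF t, of k j]
        by (subst Bochner_Integration.integral_add[symmetric]) (simp_all add: V_def \<rho>_even algebra_simps)
      also have "- (LBINT z. (\<phi> z * R k (z - y)) * u z $ j) = (LBINT z. \<phi> z * u z $ j * R k (y - z))"
        by (simp add: R_odd[of k _ y] mult.assoc mult.commute[of "R k _"])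
      finally show ?thesis .
    qed
    have Ik: "I e k = (LBINT z. \<phi> z * u z $ j * (LBINT y. R k (y - z) * u y $ k))" for k
    proof -
      have "I e k = (LBINT z. LBINT y. V k z * (\<rho> (y - z) * u y $ k))"
        unfolding I_def \<rho>_def by simp
      also have "\<dots> = (LBINT y. LBINT z. V k z * (\<rho> (y - z) * u y $ k))"
        by (rule fub[OF V_int V0 \<rho>_test0])
      also have "\<dots> = (LBINT y. (LBINT z. V k z * \<rho> (y - z)) * u y $ k)"
        by (simp add: mult.assoc[symmetric])
      also have "\<dots> = (LBINT y. (LBINT z. \<phi> z * u z $ j * R k (y - z)) * u y $ k)"
        by (simp add: mol)
      also have "\<dots> = (LBINT y. LBINT z. \<phi> z * u z $ j * (R k (y - z) * u y $ k))"
        by (simp add: mult.assoc[symmetric])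
      also have "\<dots> = (LBINT z. LBINT y. \<phi> z * u z $ j * (R k (y - z) * u y $ k))"
        using \<phi> by (intro fub[symmetric] int_test_u[OF \<phi>] R_test) (auto simp: test_fn_def)
      finally show ?thesis by simp
    qed
    \<comment> \<open>The sum of W k z over k is the weak divergence of u tested with \<rho>(. - z),
      hence 0 for every z. The factor \<phi> u_j is now outside the derivative, which is what the
      mollification was for.\<close>
    define W where "W k z = (LBINT y. R k (y - z) * u y $ k)" for k z
    have W0: "(\<Sum>k\<in>UNIV. W k z) = 0" for z
      using weak_div[OF \<rho>_test[of z]] by (simp add: W_def \<rho>_partial)
    have Wm [measurable]: "W k \<in> borel_measurable borel" for k
      unfolding W_def by measurable
    have Wb: "\<exists>C. \<forall>z. \<bar>W k z\<bar> \<le> C" for k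
    proof -
      have "\<bar>W k z\<bar> \<le> (LBINT y. \<bar>R k y\<bar>) * B" for z
      proof -
        have i: "integrable lborel (\<lambda>y. R k (y - z))"
        proof -
          have "partial_deriv k (\<lambda>y. \<rho> (y - z)) = (\<lambda>y. R k (y - z))" by (simp add: \<rho>_partial fun_eq_iff)
          then show ?thesis using test_fn_integrable[OF test_fn_partial[OF \<rho>_test[of z], of k]] by simp
        qed
        have "\<bar>W k z\<bar> \<le> (LBINT y. \<bar>R k (y - z) * u y $ k\<bar>)" unfolding W_def by (rule integral_abs_bound)
        also have "\<dots> \<le> (LBINT y. \<bar>R k (y - z)\<bar> * B)"
          using i u_comp_bound integrable_abs[OF integrable_mult_bounded(1)[OF i u_comp_meas u_comp_bound, of k]]
          by (intro integral_mono) (auto simp: abs_mult intro!: mult_left_mono)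
        also have "\<dots> = (LBINT y. \<bar>R k y\<bar>) * B"
          using integral_lborel_translate[of "\<lambda>y. \<bar>R k y\<bar>" "- z"] by simp
        finally show ?thesis .
      qed
      then show ?thesis by blast
    qed
    have "(\<Sum>k\<in>UNIV. I e k) = (\<Sum>k\<in>UNIV. LBINT z. \<phi> z * u z $ j * W k z)"
      by (simp add: Ik W_def)
    also have "\<dots> = (LBINT z. (\<Sum>k\<in>UNIV. \<phi> z * u z $ j * W k z))"
    proof (rule Bochner_Integration.integral_sum[symmetric])
      fix k
      obtain C where "\<And>z. \<bar>W k z\<bar> \<le> C" using Wb[of k] by blast
      then show "integrable lborel (\<lambda>z. \<phi> z * u z $ j * W k z)"
        using integrable_mult_bounded(1)[OF int_test_u[OF \<phi>, of j] Wm[of k]] by blast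
    qed
    also have "\<dots> = 0" using W0 by (simp add: sum_distrib_left[symmetric])
    finally show ?thesis .
  qed
  define \<kappa> where "\<kappa> w = scaled_bump 1 0 (w \<bullet> w)" for w :: "real^'n"
  have \<kappa>_int: "integrable lborel \<kappa>"
  proof (rule test_fn_integrable[of 1])
    have "\<kappa> x = 0" if "norm x > 1" for x
      unfolding \<kappa>_def using inner_self_ge[of 1 x] that by (intro scaled_bump_eq_0) auto
    then show "test_fn 1 \<kappa>"
      unfolding test_fn_def \<kappa>_def using smooth_alg_scaled_bump[of 1 0 0] by auto
  qed
  define rr where "rr m = 1 / real (Suc m)" for m
  have rr: "rr m > 0" for m by (simp add: rr_def)
  have rr0: "rr \<longlonglongrightarrow> 0" unfolding rr_def using LIMSEQ_Suc[OF lim_1_over_n] by simp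
  have sc: "\<kappa> ((1 / rr m) *\<^sub>R w) = scaled_bump (rr m) 0 (w \<bullet> w)" for m w
    using rr[of m] by (simp add: \<kappa>_def scaled_bump_def power2_eq_square)
  have "(\<lambda>m. 1 / rr m ^ CARD('n) * I (rr m) k) \<longlonglongrightarrow> integral\<^sup>L lborel \<kappa> * (LBINT z. u z $ k * V k z)" for k
  proof -
    have "(\<lambda>m. LBINT z. V k z * (1 / rr m ^ DIM(real^'n) * (LBINT y. \<kappa> ((1 / rr m) *\<^sub>R (y - z)) * u y $ k))) \<longlonglongrightarrow>
      integral\<^sup>L lborel \<kappa> * (LBINT z. u z $ k * V k z)"
      by (rule approximate_identity_kernel[OF _ u_comp_bound V_int \<kappa>_int rr0 rr]) measurable
    moreover have "(LBINT z. V k z * (1 / rr m ^ DIM(real^'n) * (LBINT y. \<kappa> ((1 / rr m) *\<^sub>R (y - z)) * u y $ k))) = 1 / rr m ^ CARD('n) * I (rr m) k" for m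
      unfolding I_def sc by (subst integral_mult_right_zero[symmetric]) (simp add: mult_ac)
    ultimately show ?thesis by (simp only:)
  qed
  then have "(\<lambda>m. \<Sum>k\<in>UNIV. 1 / rr m ^ CARD('n) * I (rr m) k) \<longlonglongrightarrow> (\<Sum>k\<in>UNIV. integral\<^sup>L lborel \<kappa> * (LBINT z. u z $ k * V k z))"
    by (intro tendsto_sum) auto
  moreover have "(\<Sum>k\<in>UNIV. 1 / rr m ^ CARD('n) * I (rr m) k) = 0" for m
    using I0[OF rr[of m]] by (simp only: sum_distrib_left[symmetric] mult_zero_right)
  ultimately have "(\<Sum>k\<in>UNIV. integral\<^sup>L lborel \<kappa> * (LBINT z. u z $ k * V k z)) = 0"
    by (simp add: LIMSEQ_const_iff)
  \<comment> \<open>The mollifier is not normalised; the limit identity carries its mass as a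
    factor, which must be nonzero to be divided out.\<close>
  moreover have "integral\<^sup>L lborel \<kappa> > 0"
  proof -
    have nn: "0 \<le> \<kappa> w" for w by (simp add: \<kappa>_def scaled_bump_def bump_def)
    have "integral\<^sup>L lborel \<kappa> \<noteq> 0"
    proof
      assume "integral\<^sup>L lborel \<kappa> = 0"
      then have "AE w in lborel. \<kappa> w = 0"
        using integral_nonneg_eq_0_iff_AE[OF \<kappa>_int] nn by simp
      moreover have "\<kappa> w \<noteq> 0" if "w \<in> ball 0 1" for w
      proof -
        have "w \<bullet> w < 1" using that by (simp add: dot_square_norm power_less_one_iff abs_square_less_1)
        then show ?thesis by (simp add: \<kappa>_def scaled_bump_def bump_def)
      qed
      ultimately have "AE w in lborel. w \<notin> ball (0::real^'n) 1"
        by (auto elim: eventually_mono)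
      then have "emeasure lborel (ball (0::real^'n) 1) = 0"
        by (subst (asm) AE_iff_measurable[of "ball 0 1"]) auto
      then show False
        using emeasure_lborel_ball_finite content_ball_pos[of 1 "0::real^'n"] by (simp add: measure_def)
    qed
    moreover have "integral\<^sup>L lborel \<kappa> \<ge> 0" using nn by (intro integral_nonneg_AE) auto
    ultimately show ?thesis by linarith
  qed
  ultimately show ?thesis by (simp add: V_def sum_distrib_left[symmetric])
qed

text \<open>In the viscous term a second integration by parts produces the Laplacian of the test
  field, \<partial>_j \<eta> - \<delta>_ij \<Delta>^2 \<psi>. The gradient \<partial>_j \<eta>
  disappears because u is weakly divergence free, and only the component u_i against the bilaplacian
  survives. In the convective term \<open>weak_product\<close> moves the derivative from u to the
  field.\<close>

lemma weak_radial:
  fixes h1 h2 h3 h4 :: "real \<Rightarrow> real"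
  assumes c: "0 < c"
    and d1: "\<And>s. s > - c \<Longrightarrow> (h1 has_real_derivative h2 s) (at s)"
    and d2: "\<And>s. s > - c \<Longrightarrow> (h2 has_real_derivative h3 s) (at s)"
    and d3: "\<And>s. s > - c \<Longrightarrow> (h3 has_real_derivative h4 s) (at s)"
    and sm1: "smooth_alg (\<lambda>y. h1 ((y - x0) \<bullet> (y - x0)))"
    and sm2: "smooth_alg (\<lambda>y. h2 ((y - x0) \<bullet> (y - x0)))"
    and sm3: "smooth_alg (\<lambda>y. h3 ((y - x0) \<bullet> (y - x0)))"
    and r: "0 \<le> r" and supp: "\<And>s. r\<^sup>2 \<le> s \<Longrightarrow> h1 s = 0 \<and> h2 s = 0 \<and> h3 s = 0"
  shows "(LBINT y. bilap h2 h3 h4 (y - x0) * u y $ i) =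
    (\<Sum>j\<in>UNIV. \<Sum>k\<in>UNIV. LBINT y. curl_field_deriv h2 h3 i j k (y - x0) * (u y $ k * u y $ j))
    + (\<Sum>j\<in>UNIV. LBINT y. curl_field h1 h2 i j (y - x0) * f y $ j)"
proof -
  define r' where "r' = norm x0 + r"
  have pos: "z \<bullet> z > - c" for z :: "real^'n" using c by (smt (verit) inner_ge_zero)
  note d = d1[OF pos] d2[OF pos] d3[OF pos]
  have far: "r\<^sup>2 \<le> (y - x0) \<bullet> (y - x0)" if "norm y > r'" for y
    using that norm_triangle_ineq2[of y x0] r by (intro inner_self_ge) (auto simp: r'_def)
  define \<phi> where "\<phi> j y = curl_field h1 h2 i j (y - x0)" for j y
  define d\<phi> where "d\<phi> j k y = curl_field_deriv h2 h3 i j k (y - x0)" for j k y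
  define \<eta> where "\<eta> y = grad_lap h2 h3 i (y - x0)" for y
  have t\<phi>: "test_fn r' (\<phi> j)" for j
  proof -
    have "smooth_alg (\<phi> j)" unfolding \<phi>_def curl_field_def by (intro smooth_alg_intros sm1 sm2)
    moreover have "\<phi> j y = 0" if "norm y > r'" for y
      using supp[OF far[OF that]] by (simp add: \<phi>_def curl_field_def)
    ultimately show ?thesis by (simp add: test_fn_def)
  qed
  have t\<eta>: "test_fn r' \<eta>"
  proof -
    have "smooth_alg \<eta>" unfolding \<eta>_def grad_lap_def by (intro smooth_alg_intros sm2 sm3)
    moreover have "\<eta> y = 0" if "norm y > r'" for y
      using supp[OF far[OF that]] by (simp add: \<eta>_def grad_lap_def)
    ultimately show ?thesis by (simp add: test_fn_def)
  qed
  have diff: "g differentiable (at y)" if "test_fn r' g" for g :: "real^'n \<Rightarrow> real" and y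
    using that by (simp add: test_fn_def smooth_alg_differentiable)
  have sh: "y + t *\<^sub>R axis k 1 - x0 = (y - x0) + t *\<^sub>R axis k 1" for y t and k :: 'n
    by simp
  have p\<phi>: "partial_deriv k (\<phi> j) = d\<phi> j k" for j k
  proof
    fix y
    show "partial_deriv k (\<phi> j) y = d\<phi> j k y"
      by (rule partial_deriv_line[OF diff[OF t\<phi>]]) (unfold \<phi>_def d\<phi>_def sh, intro curl_field_line d)
  qed
  have td\<phi>: "test_fn r' (d\<phi> j k)" for j k
    using test_fn_partial[OF t\<phi>[of j], of k] by (simp add: p\<phi>)
  have lap: "(\<Sum>k\<in>UNIV. partial_deriv k (d\<phi> j k) y) = partial_deriv j \<eta> y - kd i j * bilap h2 h3 h4 (y - x0)" for j y
  proof -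
    have "(\<Sum>k\<in>UNIV. partial_deriv k (d\<phi> j k) y) =
       kd i j * ((4 * real CARD('n) + 8) * h2 ((y - x0) \<bullet> (y - x0)) + 8 * ((y - x0) \<bullet> (y - x0)) * h3 ((y - x0) \<bullet> (y - x0)))
     + (y - x0) $ i * (y - x0) $ j * ((8 * real CARD('n) + 32) * h3 ((y - x0) \<bullet> (y - x0)) + 16 * ((y - x0) \<bullet> (y - x0)) * h4 ((y - x0) \<bullet> (y - x0)))
     - kd i j * bilap h2 h3 h4 (y - x0)"
      unfolding bilap_def
      by (subst curl_field_laplacian[symmetric], intro sum.cong refl partial_deriv_line diff[OF td\<phi>])
        (unfold d\<phi>_def sh, intro curl_field_deriv_line d)
    moreover have "partial_deriv j \<eta> y = kd i j * ((4 * real CARD('n) + 8) * h2 ((y - x0) \<bullet> (y - x0)) + 8 * ((y - x0) \<bullet> (y - x0)) * h3 ((y - x0) \<bullet> (y - x0)))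
     + (y - x0) $ i * (y - x0) $ j * ((8 * real CARD('n) + 32) * h3 ((y - x0) \<bullet> (y - x0)) + 16 * ((y - x0) \<bullet> (y - x0)) * h4 ((y - x0) \<bullet> (y - x0)))"
      by (rule partial_deriv_line[OF diff[OF t\<eta>]]) (unfold \<eta>_def sh, intro grad_lap_line d)
    ultimately show ?thesis by simp
  qed
  define \<Phi> where "\<Phi> y = (\<chi> j. \<phi> j y)" for y
  have \<Phi>_comp: "partial_deriv k \<Phi> y $ j = d\<phi> j k y" for k y j
  proof -
    have "\<Phi> differentiable (at y)"
      by (rule differentiable_vec) (simp add: \<Phi>_def diff[OF t\<phi>])
    then show ?thesis
      by (subst partial_deriv_component) (simp_all add: \<Phi>_def p\<phi>)
  qed
  have W: "(LBINT y. (\<Sum>k\<in>UNIV. D k y \<bullet> partial_deriv k \<Phi> y))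
     + (LBINT y. (\<Sum>k\<in>UNIV. u y $ k *\<^sub>R D k y) \<bullet> \<Phi> y) = (LBINT y. f y \<bullet> \<Phi> y)"
  proof (rule weak)
    show "test_fn r' (\<lambda>x. \<Phi> x $ j)" for j using t\<phi>[of j] by (simp add: \<Phi>_def)
    show "\<forall>x. (\<Sum>k\<in>UNIV. partial_deriv k \<Phi> x $ k) = 0"
      unfolding \<Phi>_comp d\<phi>_def using curl_field_div_free by blast
  qed
  have "(LBINT y. (\<Sum>k\<in>UNIV. D k y \<bullet> partial_deriv k \<Phi> y)) = (LBINT y. (\<Sum>j\<in>UNIV. \<Sum>k\<in>UNIV. d\<phi> j k y * D k y $ j))"
    unfolding inner_vec_def by (subst sum.swap) (simp add: \<Phi>_comp mult.commute)
  also have "\<dots> = (\<Sum>j\<in>UNIV. \<Sum>k\<in>UNIV. LBINT y. d\<phi> j k y * D k y $ j)"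
    by (simp add: Bochner_Integration.integral_sum int_test_D[OF td\<phi>])
  also have "\<dots> = (\<Sum>j\<in>UNIV. \<Sum>k\<in>UNIV. - (LBINT y. partial_deriv k (d\<phi> j k) y * u y $ j))"
    by (simp add: weak_D[OF td\<phi>])
  also have "\<dots> = (\<Sum>j\<in>UNIV. - (LBINT y. (\<Sum>k\<in>UNIV. partial_deriv k (d\<phi> j k) y) * u y $ j))"
    by (simp add: sum_negf sum_distrib_right Bochner_Integration.integral_sum int_test_u[OF test_fn_partial[OF td\<phi>]])
  \<comment> \<open>The Laplacian is split into its Kronecker part, which keeps j = i, and the
    gradient part, whose sum over j is the weak divergence tested with \<eta>.\<close>
  also have "\<dots> = (\<Sum>j\<in>UNIV. kd i j * (LBINT y. bilap h2 h3 h4 (y - x0) * u y $ j) - (LBINT y. partial_deriv j \<eta> y * u y $ j))"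
  proof (rule sum.cong[OF refl])
    fix j
    have "integrable lborel (\<lambda>y. (\<Sum>k\<in>UNIV. partial_deriv k (d\<phi> j k) y) * u y $ j)"
      unfolding sum_distrib_right by (intro Bochner_Integration.integrable_sum int_test_u[OF test_fn_partial[OF td\<phi>]])
    then have "(LBINT y. partial_deriv j \<eta> y * u y $ j) - (LBINT y. (\<Sum>k\<in>UNIV. partial_deriv k (d\<phi> j k) y) * u y $ j)
      = (LBINT y. kd i j * (bilap h2 h3 h4 (y - x0) * u y $ j))"
      by (subst Bochner_Integration.integral_diff[symmetric])
        (auto simp: int_test_u[OF test_fn_partial[OF t\<eta>]] lap algebra_simps)
    then show "- (LBINT y. (\<Sum>k\<in>UNIV. partial_deriv k (d\<phi> j k) y) * u y $ j) =
      kd i j * (LBINT y. bilap h2 h3 h4 (y - x0) * u y $ j) - (LBINT y. partial_deriv j \<eta> y * u y $ j)"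
      by simp
  qed
  also have "\<dots> = (LBINT y. bilap h2 h3 h4 (y - x0) * u y $ i)"
    using weak_div[OF t\<eta>] by (simp add: sum_subtractf)
  finally have E1: "(LBINT y. (\<Sum>k\<in>UNIV. D k y \<bullet> partial_deriv k \<Phi> y)) = (LBINT y. bilap h2 h3 h4 (y - x0) * u y $ i)" .
  have iD: "integrable lborel (\<lambda>y. u y $ k * (\<phi> j y * D k y $ j))" for j k
    by (rule integrable_mult_bounded(2)[OF int_test_D[OF t\<phi>] u_comp_meas u_comp_bound])
  have iu: "integrable lborel (\<lambda>y. u y $ k * (u y $ j * d\<phi> j k y))" for j k
    using integrable_mult_bounded(2)[OF int_test_u[OF td\<phi>] u_comp_meas u_comp_bound] by (simp add: mult.commute)
  have "(LBINT y. (\<Sum>k\<in>UNIV. u y $ k *\<^sub>R D k y) \<bullet> \<Phi> y) = (LBINT y. (\<Sum>j\<in>UNIV. \<Sum>k\<in>UNIV. u y $ k * (\<phi> j y * D k y $ j)))"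
    by (rule Bochner_Integration.integral_cong) (simp_all add: inner_vec_def \<Phi>_def sum_distrib_left sum_distrib_right mult_ac)
  also have "\<dots> = (\<Sum>j\<in>UNIV. \<Sum>k\<in>UNIV. LBINT y. u y $ k * (\<phi> j y * D k y $ j))"
    by (simp add: Bochner_Integration.integral_sum iD)
  also have "\<dots> = (\<Sum>j\<in>UNIV. - (\<Sum>k\<in>UNIV. LBINT y. u y $ k * (u y $ j * d\<phi> j k y)))"
  proof (rule sum.cong[OF refl])
    fix j
    have "(\<Sum>k\<in>UNIV. LBINT y. u y $ k * (u y $ j * d\<phi> j k y)) + (\<Sum>k\<in>UNIV. LBINT y. u y $ k * (\<phi> j y * D k y $ j)) = 0"
      using weak_product[OF t\<phi>[of j], of j]
      by (simp only: p\<phi> distrib_left Bochner_Integration.integral_add[OF iu iD] sum.distrib)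
    then show "(\<Sum>k\<in>UNIV. LBINT y. u y $ k * (\<phi> j y * D k y $ j)) = - (\<Sum>k\<in>UNIV. LBINT y. u y $ k * (u y $ j * d\<phi> j k y))"
      by linarith
  qed
  finally have E2: "(LBINT y. (\<Sum>k\<in>UNIV. u y $ k *\<^sub>R D k y) \<bullet> \<Phi> y) = - (\<Sum>j\<in>UNIV. \<Sum>k\<in>UNIV. LBINT y. d\<phi> j k y * (u y $ k * u y $ j))"
    by (simp add: sum_negf mult_ac)
  have i\<phi>f: "integrable lborel (\<lambda>y. \<phi> j y * f y $ j)" for j
  proof -
    have "integrable lborel (\<lambda>y. f y $ j)"
      by (rule Bochner_Integration.integrable_bound[OF f_int])
        (use f_int in \<open>auto intro!: AE_I2 component_le_norm_cart measurable_compose[OF _ borel_measurable_nth]\<close>)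
    then have "loc_integrable (\<lambda>y. f y $ j)"
      unfolding loc_integrable_def by (simp add: integrable_real_mult_indicator mult.commute[of "indicator _ _"])
    then show ?thesis
      using loc_integrable_mult[OF _ test_fn_continuous[OF t\<phi>], of _ r'] t\<phi> by (auto simp: test_fn_def)
  qed
  have E3: "(LBINT y. f y \<bullet> \<Phi> y) = (\<Sum>j\<in>UNIV. LBINT y. \<phi> j y * f y $ j)"
    by (subst Bochner_Integration.integral_sum[symmetric]) (simp_all add: i\<phi>f inner_vec_def \<Phi>_def mult.commute)
  show ?thesis using W E1 E2 E3 by (simp add: \<phi>_def d\<phi>_def)
qed

end

section \<open>The integral representation\<close>

lemma curl_field_bound:
  fixes z :: "real^'n::finite"
  assumes "\<bar>h1 (z \<bullet> z)\<bar> \<le> a" "(z \<bullet> z) * \<bar>h2 (z \<bullet> z)\<bar> \<le> a"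
  shows "\<bar>curl_field h1 h2 i j z\<bar> \<le> (2 * real CARD('n) + 6) * a"
proof -
  have zz: "\<bar>z $ i * z $ j\<bar> \<le> z \<bullet> z"
    using mult_mono[OF component_le_norm_cart[of z i] component_le_norm_cart[of z j]]
    by (simp add: abs_mult power2_norm_eq_inner[symmetric] power2_eq_square)
  have "\<bar>z $ i * z $ j\<bar> * \<bar>h2 (z \<bullet> z)\<bar> \<le> a"
    using mult_right_mono[OF zz, of "\<bar>h2 (z \<bullet> z)\<bar>"] assms(2) by simp
  then have 1: "\<bar>4 * z $ i * z $ j * h2 (z \<bullet> z)\<bar> \<le> 4 * a" by (simp add: abs_mult)
  have c: "real CARD('n) \<ge> 1" by (simp add: Suc_leI)
  have 2: "\<bar>(2 * real CARD('n) - 2) * h1 (z \<bullet> z)\<bar> \<le> (2 * real CARD('n) - 2) * a"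
    using c assms(1) by (simp add: abs_mult mult_left_mono)
  have 3: "\<bar>4 * (z \<bullet> z) * h2 (z \<bullet> z)\<bar> \<le> 4 * a" using assms(2) by (simp add: abs_mult)
  have a: "0 \<le> a" using assms(1) by linarith
  have "\<bar>kd i j * ((2 * real CARD('n) - 2) * h1 (z \<bullet> z) + 4 * (z \<bullet> z) * h2 (z \<bullet> z))\<bar> \<le> (2 * real CARD('n) + 2) * a"
    using 2 3 a c by (auto simp: kd_def algebra_simps)
  then show ?thesis using 1 unfolding curl_field_def by (simp add: algebra_simps)
qed

lemma curl_field_deriv_bound:
  fixes z :: "real^'n::finite"
  assumes "norm z * \<bar>h2 (z \<bullet> z)\<bar> \<le> a" "norm z * ((z \<bullet> z) * \<bar>h3 (z \<bullet> z)\<bar>) \<le> a"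
  shows "\<bar>curl_field_deriv h2 h3 i j k z\<bar> \<le> (4 * real CARD('n) + 28) * a"
proof -
  have zz: "\<bar>z $ i * z $ j\<bar> \<le> z \<bullet> z" 
    using mult_mono[OF component_le_norm_cart[of z i] component_le_norm_cart[of z j]]
    by (simp add: abs_mult power2_norm_eq_inner[symmetric] power2_eq_square)
  have a: "0 \<le> a" using assms(1) by (meson abs_ge_zero mult_nonneg_nonneg norm_ge_zero order_trans)
  have z2: "\<bar>z $ l\<bar> * \<bar>h2 (z \<bullet> z)\<bar> \<le> a" for l
    using mult_right_mono[OF component_le_norm_cart[of z l], of "\<bar>h2 (z \<bullet> z)\<bar>"] assms(1) by simp
  have z3: "\<bar>z $ l\<bar> * ((z \<bullet> z) * \<bar>h3 (z \<bullet> z)\<bar>) \<le> a" for l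
    using mult_right_mono[OF component_le_norm_cart[of z l], of "(z \<bullet> z) * \<bar>h3 (z \<bullet> z)\<bar>"] assms(2) by simp
  have 1: "\<bar>4 * (kd i k * z $ j + kd j k * z $ i) * h2 (z \<bullet> z)\<bar> \<le> 8 * a"
  proof -
    have "\<bar>kd i k * z $ j * h2 (z \<bullet> z)\<bar> \<le> a" "\<bar>kd j k * z $ i * h2 (z \<bullet> z)\<bar> \<le> a"
      using z2 a by (auto simp: kd_def abs_mult)
    then show ?thesis by (simp add: algebra_simps)
  qed
  have "\<bar>z $ i * z $ j\<bar> * (\<bar>z $ k\<bar> * \<bar>h3 (z \<bullet> z)\<bar>) \<le> (z \<bullet> z) * (\<bar>z $ k\<bar> * \<bar>h3 (z \<bullet> z)\<bar>)"
    by (rule mult_right_mono[OF zz]) simp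
  also have "\<dots> \<le> a" using z3[of k] by (simp add: mult_ac)
  finally have 2: "\<bar>8 * z $ i * z $ j * z $ k * h3 (z \<bullet> z)\<bar> \<le> 8 * a" by (simp add: abs_mult mult.assoc)
  have 3: "\<bar>kd i j * z $ k * ((4 * real CARD('n) + 4) * h2 (z \<bullet> z) + 8 * (z \<bullet> z) * h3 (z \<bullet> z))\<bar> \<le> (4 * real CARD('n) + 12) * a"
  proof -
    have "\<bar>z $ k * ((4 * real CARD('n) + 4) * h2 (z \<bullet> z) + 8 * (z \<bullet> z) * h3 (z \<bullet> z))\<bar> \<le>
       (4 * real CARD('n) + 4) * (\<bar>z $ k\<bar> * \<bar>h2 (z \<bullet> z)\<bar>) + 8 * (\<bar>z $ k\<bar> * ((z \<bullet> z) * \<bar>h3 (z \<bullet> z)\<bar>))"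
      unfolding distrib_left by (rule order_trans[OF abs_triangle_ineq]) (simp add: abs_mult)
    also have "\<dots> \<le> (4 * real CARD('n) + 4) * a + 8 * a"
      using z2[of k] z3[of k] by (intro add_mono mult_left_mono) auto
    finally show ?thesis using a by (auto simp: kd_def algebra_simps)
  qed
  show ?thesis using 1 2 3 unfolding curl_field_deriv_def by (simp add: algebra_simps)
qed

lemma bilap_bound:
  fixes z :: "real^'n::finite"
  assumes "\<bar>h2 (z \<bullet> z)\<bar> \<le> a" "(z \<bullet> z) * \<bar>h3 (z \<bullet> z)\<bar> \<le> a" "(z \<bullet> z)\<^sup>2 * \<bar>h4 (z \<bullet> z)\<bar> \<le> a"
  shows "\<bar>bilap h2 h3 h4 z\<bar> \<le> (4 * real CARD('n) * (real CARD('n) + 2) + 16 * (real CARD('n) + 2) + 16) * a"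
proof -
  have 1: "\<bar>4 * real CARD('n) * (real CARD('n) + 2) * h2 (z \<bullet> z)\<bar> \<le> 4 * real CARD('n) * (real CARD('n) + 2) * a"
    unfolding abs_mult[of _ "h2 _"] using assms(1) by (intro mult_mono) auto
  have 2: "\<bar>16 * (real CARD('n) + 2) * ((z \<bullet> z) * h3 (z \<bullet> z))\<bar> \<le> 16 * (real CARD('n) + 2) * a"
    unfolding abs_mult[of "_ * _" "_ * h3 _"] using assms(2) by (intro mult_mono) (auto simp: abs_mult)
  have 3: "\<bar>16 * ((z \<bullet> z)\<^sup>2 * h4 (z \<bullet> z))\<bar> \<le> 16 * a" using assms(3) by (simp add: abs_mult)
  show ?thesis using 1 2 3 unfolding bilap_def distrib_right mult.assoc by linarith
qed

text \<open>\<open>power_chain q d m\<close> is the \<open>m\<close>-th derivative of \<open>s \<mapsto> (s + d\<^sup>2)\<^sup>q\<close>.\<close>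

definition power_chain :: "real \<Rightarrow> real \<Rightarrow> nat \<Rightarrow> real \<Rightarrow> real" where
  "power_chain q d m s = (\<Prod>i<m. q - real i) * (s + d\<^sup>2) powr (q - real m)"

lemma DERIV_power_chain:
  assumes "s > - (d\<^sup>2)"
  shows "(power_chain q d m has_real_derivative power_chain q d (Suc m) s) (at s)"
proof -
  have "((\<lambda>s. (s + d\<^sup>2) powr (q - real m)) has_real_derivative (q - real m) * (s + d\<^sup>2) powr (q - real m - 1)) (at s)"
    using assms by (auto intro!: derivative_eq_intros)
  from DERIV_cmult[OF this, of "\<Prod>i<m. q - real i"] show ?thesis
    by (simp add: power_chain_def[abs_def] mult_ac algebra_simps)
qed

lemma power_chain_measurable [measurable]: "power_chain q d m \<in> borel_measurable borel"
  unfolding power_chain_def by measurable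

lemma
  fixes h1 h2 h3 h4 :: "real \<Rightarrow> real"
  assumes [measurable]: "h1 \<in> borel_measurable borel" "h2 \<in> borel_measurable borel" "h3 \<in> borel_measurable borel" "h4 \<in> borel_measurable borel"
  shows curl_field_measurable: "curl_field h1 h2 i j \<in> borel_measurable (borel :: (real^'n::finite) measure)"
    and curl_field_deriv_measurable: "curl_field_deriv h2 h3 i j k \<in> borel_measurable (borel :: (real^'n::finite) measure)"
    and bilap_measurable: "bilap h2 h3 h4 \<in> borel_measurable (borel :: (real^'n::finite) measure)"
  unfolding curl_field_def curl_field_deriv_def bilap_def by measurable

text \<open>Uniformity in R is the point: each s-derivative brings a factor 1/R^2, and 1/R^2 \<le>
  2/(1 + s) on the support s < R^2. A derivative falling on the cutoff thus gains as much decay as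
  one falling on a power of s.\<close>

lemma scaled_bump_bound: "\<exists>C. \<forall>R\<ge>1. \<forall>s\<ge>0. \<bar>scaled_bump R m s\<bar> \<le> C / (1 + s) ^ m"
proof -
  obtain B where B: "\<And>t. t \<le> 1 \<Longrightarrow> \<bar>bump (bump_poly m) t\<bar> \<le> B" using bump_bounded by blast
  have B0: "0 \<le> B" using B[of 0] by linarith
  have "\<bar>scaled_bump R m s\<bar> \<le> 2 ^ m * B / (1 + s) ^ m" if R: "R \<ge> 1" and s: "s \<ge> 0" for R s
  proof (cases "R\<^sup>2 \<le> s")
    case True
    then show ?thesis using R s B0 by (subst scaled_bump_eq_0) auto
  next
    case False
    have R2: "1 \<le> R\<^sup>2" using R by (simp add: one_le_power)
    have "\<bar>scaled_bump R m s\<bar> = (1 / R\<^sup>2) ^ m * \<bar>bump (bump_poly m) (1 - s / R\<^sup>2)\<bar>"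
      by (simp add: scaled_bump_def abs_mult power_abs)
    also have "\<dots> \<le> (2 / (1 + s)) ^ m * B"
    proof (intro mult_mono power_mono B)
      have "(1 + s) / R\<^sup>2 \<le> 2" using R2 False s by (subst pos_divide_le_eq) auto
      then show "1 / R\<^sup>2 \<le> 2 / (1 + s)" using s R2 by (simp add: field_simps)
    qed (use s in auto)
    finally show ?thesis by (simp add: power_divide)
  qed
  then show ?thesis by blast
qed

text \<open>As the radius grows the cutoff tends to its central value exp(-1), whereas every
  derivative is damped by powers of 1/R^2.\<close>

lemma scaled_bump_tendsto:
  "(\<lambda>N. scaled_bump (real (Suc N)) m s) \<longlonglongrightarrow> (if m = 0 then exp (- 1) else 0)"
proof -
  have l: "(\<lambda>N. 1 / (real (Suc N))\<^sup>2) \<longlonglongrightarrow> 0"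
    using tendsto_power[OF LIMSEQ_Suc[OF lim_1_over_n], of 2] by (simp add: power_divide)
  have "(\<lambda>N. 1 - s * (1 / (real (Suc N))\<^sup>2)) \<longlonglongrightarrow> 1 - s * 0"
    by (intro tendsto_intros l)
  then have "(\<lambda>N. bump (bump_poly m) (1 - s * (1 / (real (Suc N))\<^sup>2))) \<longlonglongrightarrow> bump (bump_poly m) 1"
    using isCont_tendsto_compose[OF DERIV_isCont[OF DERIV_bump[of _ 1]]] by simp
  then have "(\<lambda>N. (- (1 / (real (Suc N))\<^sup>2)) ^ m * bump (bump_poly m) (1 - s * (1 / (real (Suc N))\<^sup>2))) \<longlonglongrightarrow> (- 0) ^ m * bump (bump_poly m) 1"
    by (intro tendsto_mult tendsto_power tendsto_minus l)
  moreover have "(- 0) ^ m * bump (bump_poly m) 1 = (if m = 0 then exp (- 1) else 0)"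
    by (simp add: bump_def power_0_left)
  ultimately show ?thesis by (simp add: scaled_bump_def)
qed

lemma power_chain_bound:
  assumes "0 < d" "q \<le> 0"
  shows "\<exists>C. \<forall>s\<ge>0. \<bar>power_chain q d m s\<bar> \<le> C * (1 + s) powr (q - real m)"
proof -
  define c where "c = min 1 (d\<^sup>2)"
  have c: "0 < c" using assms by (simp add: c_def)
  have "\<bar>power_chain q d m s\<bar> \<le> (\<bar>\<Prod>i<m. q - real i\<bar> * c powr (q - real m)) * (1 + s) powr (q - real m)" if s: "0 \<le> s" for s
  proof -
    have "c * s \<le> 1 * s" using s by (intro mult_right_mono) (auto simp: c_def)
    then have "c * (1 + s) \<le> s + d\<^sup>2" by (simp add: distrib_left c_def)
    then have "(s + d\<^sup>2) powr (q - real m) \<le> (c * (1 + s)) powr (q - real m)"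
      using c s assms by (intro powr_mono2') auto
    also have "\<dots> = c powr (q - real m) * (1 + s) powr (q - real m)" using c s by (simp add: powr_mult)
    finally show ?thesis unfolding power_chain_def abs_mult mult.assoc by (intro mult_left_mono) auto
  qed
  then show ?thesis by blast
qed

text \<open>|z|^(-p) is at most its restriction to the unit ball, integrable since p < n, plus 1.
  The first part is paired with the sup norm of F and the second with its L^1 norm, uniformly in
  x.\<close>

lemma riesz_bound:
  assumes "0 < p" "p < real CARD('n)"
  obtains C where "0 \<le> C" "\<And>(F :: real^'n::finite \<Rightarrow> real) A x. integrable lborel F \<Longrightarrow> (\<And>y. \<bar>F y\<bar> \<le> A) \<Longrightarrow>
    integrable lborel (\<lambda>y. norm (y - x) powr - p * F y)"
    "\<And>(F :: real^'n::finite \<Rightarrow> real) A x. integrable lborel F \<Longrightarrow> (\<And>y. \<bar>F y\<bar> \<le> A) \<Longrightarrow>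
    (LBINT y. \<bar>norm (y - x) powr - p * F y\<bar>) \<le> C * A + (LBINT y. \<bar>F y\<bar>)"
proof -
  define k where "k z = indicator (cball 0 1) z * norm z powr - p" for z :: "real^'n"
  have k: "integrable lborel k"
    unfolding k_def using has_bochner_integral_powr_cball[of "- p" 1, where 'a = "real^'n"] assms
    by (auto simp: has_bochner_integral_iff)
  then have km: "k \<in> borel_measurable borel" by auto
  have kt: "integrable lborel (\<lambda>y. k (y - x))" "(LBINT y. k (y - x)) = integral\<^sup>L lborel k" for x
    using integrable_lborel_translate[OF km, of "- x"] integral_lborel_translate[OF km, of "- x"] k by auto
  have k0: "0 \<le> k z" for z by (simp add: k_def)
  have le: "norm (y - x) powr - p \<le> k (y - x) + 1" for x y :: "real^'n"
  proof (cases "norm (y - x) \<le> 1")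
    case False
    then have "norm (y - x) powr - p \<le> 1 powr - p" using assms by (intro powr_mono2') auto
    then show ?thesis using k0[of "y - x"] by simp
  qed (simp add: k_def)
  have b: "\<bar>norm (y - x) powr - p * F y\<bar> \<le> A * k (y - x) + \<bar>F y\<bar>" if "\<And>y. \<bar>F y\<bar> \<le> A" for F A and x y :: "real^'n"
  proof -
    have "\<bar>norm (y - x) powr - p * F y\<bar> \<le> (k (y - x) + 1) * \<bar>F y\<bar>"
      unfolding abs_mult using le by (intro mult_right_mono) auto
    also have "\<dots> \<le> A * k (y - x) + \<bar>F y\<bar>"
      using mult_right_mono[OF that[of y] k0[of "y - x"]] by (simp add: algebra_simps)
    finally show ?thesis .
  qed
  have int: "integrable lborel (\<lambda>y. A * k (y - x) + \<bar>F y\<bar>)" if "integrable lborel F" for F A and x :: "real^'n"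
    using kt that by (intro Bochner_Integration.integrable_add) auto
  have i: "integrable lborel (\<lambda>y. norm (y - x) powr - p * F y)" if "integrable lborel F" "\<And>y. \<bar>F y\<bar> \<le> A" for F A and x :: "real^'n"
  proof (rule Bochner_Integration.integrable_bound[OF int[OF that(1), of A x]])
    have "F \<in> borel_measurable borel" using that by auto
    then show "(\<lambda>y. norm (y - x) powr - p * F y) \<in> borel_measurable lborel" by measurable
    show "AE y in lborel. norm (norm (y - x) powr - p * F y) \<le> norm (A * k (y - x) + \<bar>F y\<bar>)"
      unfolding real_norm_def by (intro AE_I2 order_trans[OF b[OF that(2)] abs_ge_self])
  qed
  show ?thesis
  proof (rule that[of "integral\<^sup>L lborel k"])
    show "0 \<le> integral\<^sup>L lborel k" using k0 by (intro integral_nonneg_AE) auto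
    fix F :: "real^'n \<Rightarrow> real" and A x assume F: "integrable lborel F" "\<And>y. \<bar>F y\<bar> \<le> A"
    show "integrable lborel (\<lambda>y. norm (y - x) powr - p * F y)" by (rule i[OF F])
    have "(LBINT y. \<bar>norm (y - x) powr - p * F y\<bar>) \<le> (LBINT y. A * k (y - x) + \<bar>F y\<bar>)"
      using i[OF F] int[OF F(1)] b[OF F(2)] by (intro integral_mono) auto
    also have "\<dots> = integral\<^sup>L lborel k * A + (LBINT y. \<bar>F y\<bar>)"
      using kt[of x] F by (subst Bochner_Integration.integral_add) auto
    finally show "(LBINT y. \<bar>norm (y - x) powr - p * F y\<bar>) \<le> integral\<^sup>L lborel k * A + (LBINT y. \<bar>F y\<bar>)" .
  qed
qed

lemma curl_field_tendsto:
  assumes "(\<lambda>N. h1 N (z \<bullet> z)) \<longlonglongrightarrow> c * g1 (z \<bullet> z)" "(\<lambda>N. h2 N (z \<bullet> z)) \<longlonglongrightarrow> c * g2 (z \<bullet> z)"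
  shows "(\<lambda>N. curl_field (h1 N) (h2 N) i j z) \<longlonglongrightarrow> c * curl_field g1 g2 i j z"
proof -
  have e: "c * curl_field g1 g2 i j z = curl_field (\<lambda>s. c * g1 s) (\<lambda>s. c * g2 s) i j z"
    by (simp add: curl_field_def algebra_simps)
  show ?thesis unfolding e unfolding curl_field_def by (intro tendsto_intros assms)
qed

lemma curl_field_deriv_tendsto:
  assumes "(\<lambda>N. h1 N (z \<bullet> z)) \<longlonglongrightarrow> c * g1 (z \<bullet> z)" "(\<lambda>N. h2 N (z \<bullet> z)) \<longlonglongrightarrow> c * g2 (z \<bullet> z)"
  shows "(\<lambda>N. curl_field_deriv (h1 N) (h2 N) i j k z) \<longlonglongrightarrow> c * curl_field_deriv g1 g2 i j k z"
proof -
  have e: "c * curl_field_deriv g1 g2 i j k z = curl_field_deriv (\<lambda>s. c * g1 s) (\<lambda>s. c * g2 s) i j k z"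
    by (simp add: curl_field_deriv_def algebra_simps)
  show ?thesis unfolding e unfolding curl_field_deriv_def by (intro tendsto_intros assms)
qed

lemma bilap_tendsto:
  assumes "(\<lambda>N. h1 N (z \<bullet> z)) \<longlonglongrightarrow> c * g1 (z \<bullet> z)" "(\<lambda>N. h2 N (z \<bullet> z)) \<longlonglongrightarrow> c * g2 (z \<bullet> z)"
    "(\<lambda>N. h3 N (z \<bullet> z)) \<longlonglongrightarrow> c * g3 (z \<bullet> z)"
  shows "(\<lambda>N. bilap (h1 N) (h2 N) (h3 N) z) \<longlonglongrightarrow> c * bilap g1 g2 g3 z"
proof -
  have e: "c * bilap g1 g2 g3 z = bilap (\<lambda>s. c * g1 s) (\<lambda>s. c * g2 s) (\<lambda>s. c * g3 s) z"
    by (simp add: bilap_def algebra_simps)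
  show ?thesis unfolding e unfolding bilap_def by (intro tendsto_intros assms)
qed

lemma power_chain_le:
  assumes "0 < s" "q \<le> 0"
  shows "\<bar>power_chain q d m s\<bar> \<le> \<bar>\<Prod>i<m. q - real i\<bar> * s powr (q - real m)"
  unfolding power_chain_def abs_mult using assms by (intro mult_left_mono) (auto intro: powr_mono2')

text \<open>Put S = |z|^2 + d^2. Because n = 2 - 2q and n + 2 = -2(q - 2), the three coefficients
  share the factor 16 q (q - 1) (q - 2), and what remains is S^2 - 2 S (S - d^2) + (S - d^2)^2 =
  d^4. The exponent count 4 + 2(q - 3) = -n then turns d^4 S^(q - 3) into a kernel rescaled by
  d^(-n).\<close>

lemma bilap_power_chain:
  fixes z :: "real^'n::finite"
  defines "q \<equiv> (2 - real CARD('n)) / 2"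
  assumes d: "0 < d"
  shows "bilap (power_chain q d 1) (power_chain q d 2) (power_chain q d 3) z =
    16 * q * (q - 1) * (q - 2) * (1 / d ^ CARD('n) * (1 + (norm ((1 / d) *\<^sub>R z))\<^sup>2) powr - ((real CARD('n) + 4) / 2))"
proof -
  define S where "S = z \<bullet> z + d\<^sup>2"
  have S: "0 < S" using d by (simp add: S_def add_nonneg_pos)
  define P where "P = S powr (q - 3)"
  have p: "S powr (q - 1) = S\<^sup>2 * P" "S powr (q - 2) = S * P"
    using S powr_add[of S 2 "q - 3"] powr_add[of S 1 "q - 3"] by (simp_all add: P_def flip: powr_numeral)
  have n: "real CARD('n) = 2 - 2 * q" by (simp add: q_def field_simps)
  have zz: "z \<bullet> z = S - d\<^sup>2" by (simp add: S_def)
  have "bilap (power_chain q d 1) (power_chain q d 2) (power_chain q d 3) z =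
     4 * (2 - 2 * q) * (4 - 2 * q) * (q * (S\<^sup>2 * P)) + 16 * (4 - 2 * q) * (S - d\<^sup>2) * (q * (q - 1) * (S * P)) + 16 * (S - d\<^sup>2)\<^sup>2 * (q * (q - 1) * (q - 2) * P)"
    unfolding bilap_def power_chain_def n using p
    by (simp add: zz numeral_3_eq_3 numeral_2_eq_2 S_def[symmetric] P_def)
  also have "\<dots> = 16 * q * (q - 1) * (q - 2) * (d ^ 4 * P)"
    by algebra
  also have "d ^ 4 * P = 1 / d ^ CARD('n) * (1 + (norm ((1 / d) *\<^sub>R z))\<^sup>2) powr - ((real CARD('n) + 4) / 2)"
  proof -
    have e: "q - 3 = - ((real CARD('n) + 4) / 2)" by (simp add: q_def field_simps)
    have "S = d\<^sup>2 * (1 + (norm ((1 / d) *\<^sub>R z))\<^sup>2)"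
      using d by (simp add: S_def dot_square_norm power_divide distrib_left)
    then have "P = (d\<^sup>2) powr (q - 3) * (1 + (norm ((1 / d) *\<^sub>R z))\<^sup>2) powr (q - 3)"
      unfolding P_def using d by (simp add: powr_mult)
    moreover have "d ^ 4 * (d\<^sup>2) powr (q - 3) = 1 / d ^ CARD('n)"
    proof -
      have "(d\<^sup>2) powr (q - 3) = d powr (2 * (q - 3))" using d by (simp add: powr_powr flip: powr_numeral)
      moreover have "d ^ 4 = d powr 4" using d by simp
      ultimately have "d ^ 4 * (d\<^sup>2) powr (q - 3) = d powr (4 + 2 * (q - 3))"
        by (simp only: powr_add)
      also have "4 + 2 * (q - 3) = - real CARD('n)" by (simp add: q_def field_simps)
      finally show ?thesis using d by (simp add: powr_minus powr_realpow divide_inverse)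
    qed
    ultimately show ?thesis unfolding e by (simp add: mult.assoc[symmetric])
  qed
  finally show ?thesis .
qed

section \<open>Removing the cutoff and the regularisation\<close>

locale weak_ns_decay = weak_ns u f D B for u f :: "real^'n::finite \<Rightarrow> real^'n" and D B +
  fixes A A' q :: real
  defines "q \<equiv> (2 - real CARD('n)) / 2"
  assumes card3: "CARD('n) \<ge> 3"
    and u_decay: "\<And>x. norm (u x) \<le> A * bracket x powr (1 - real CARD('n))"
    and f_bdd: "\<And>x. norm (f x) \<le> A'"
begin

lemma n3: "real CARD('n) \<ge> 3" using card3 by simp

lemma A_nonneg: "0 \<le> A"
proof -
  have "0 \<le> A * bracket (0::real^'n) powr (1 - real CARD('n))" using u_decay[of 0] norm_ge_zero order_trans by blast
  then show ?thesis using bracket_pos[of "0::real^'n"] by (simp add: zero_le_mult_iff)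
qed

lemma uu_bound: "\<bar>u y $ k * u y $ j\<bar> \<le> A\<^sup>2 * bracket y powr (2 - 2 * real CARD('n))"
proof -
  have c: "\<bar>u y $ l\<bar> \<le> A * bracket y powr (1 - real CARD('n))" for l
    using component_le_norm_cart[of "u y" l] u_decay[of y] by linarith
  have "\<bar>u y $ k * u y $ j\<bar> \<le> (A * bracket y powr (1 - real CARD('n))) * (A * bracket y powr (1 - real CARD('n)))"
    unfolding abs_mult by (intro mult_mono c) (auto simp: A_nonneg)
  also have "\<dots> = A\<^sup>2 * bracket y powr ((1 - real CARD('n)) + (1 - real CARD('n)))"
    by (simp only: powr_add power2_eq_square mult_ac)
  finally show ?thesis by (simp add: algebra_simps)
qed

lemma uu_int: "integrable lborel (\<lambda>y. u y $ k * u y $ j)"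
proof (rule Bochner_Integration.integrable_bound)
  show "integrable lborel (\<lambda>y::real^'n. A\<^sup>2 * bracket y powr (2 - 2 * real CARD('n)))"
    using n3 by (intro integrable_mult_right integrable_bracket_powr) auto
  show "AE y in lborel. norm (u y $ k * u y $ j) \<le> norm (A\<^sup>2 * bracket y powr (2 - 2 * real CARD('n)))"
    using uu_bound by (intro AE_I2) (simp only: real_norm_def, metis abs_ge_self order_trans)
qed measurable

lemma f_comp_int: "integrable lborel (\<lambda>y. f y $ j)"
  by (rule Bochner_Integration.integrable_bound[OF f_int])
    (use f_int in \<open>auto intro!: AE_I2 component_le_norm_cart measurable_compose[OF _ borel_measurable_nth]\<close>)

lemma uu_const_bound: "\<bar>u y $ k * u y $ j\<bar> \<le> B * B"
  unfolding abs_mult using B_nonneg by (intro mult_mono u_comp_bound) auto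

lemma f_comp_bound: "\<bar>f y $ j\<bar> \<le> A'"
  using component_le_norm_cart[of "f y" j] f_bdd[of y] by linarith

lemma smooth_alg_power_chain:
  assumes "0 < d"
  shows "smooth_alg (\<lambda>y::real^'n. power_chain q d m ((y - x0) \<bullet> (y - x0)))"
  using sa_radial[of "d\<^sup>2" "\<lambda>k. power_chain q d (m + k)" x0] DERIV_power_chain assms by simp

text \<open>The cutoff is removed by dominated convergence. The decay of \<open>u\<close> is needed here because
  \<open>\<Delta>\<^sup>2\<psi>\<close> is only bounded by \<open>|z|\<^sup>-\<^sup>n\<close> uniformly in the cutoff radius.\<close>

lemma regularized_identity:
  assumes d: "0 < d"
  shows "(LBINT y. bilap (power_chain q d 1) (power_chain q d 2) (power_chain q d 3) (y - x0) * u y $ i) =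
    (\<Sum>j\<in>UNIV. \<Sum>k\<in>UNIV. LBINT y. curl_field_deriv (power_chain q d 1) (power_chain q d 2) i j k (y - x0) * (u y $ k * u y $ j))
    + (\<Sum>j\<in>UNIV. LBINT y. curl_field (power_chain q d 0) (power_chain q d 1) i j (y - x0) * f y $ j)"
proof -
  define G where "G = power_chain q d"
  define X where "X N = scaled_bump (real (Suc N))" for N
  \<comment> \<open>\<open>h1\<close> is the regularised \<psi>' times the cutoff;
    \<open>h2\<close>, \<open>h3\<close>, \<open>h4\<close> are its successive derivatives by the
    Leibniz rule.\<close>
  define h1 where "h1 N s = G 0 s * X N 0 s" for N s
  define h2 where "h2 N s = G 1 s * X N 0 s + G 0 s * X N 1 s" for N s
  define h3 where "h3 N s = G 2 s * X N 0 s + 2 * (G 1 s * X N 1 s) + G 0 s * X N 2 s" for N s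
  define h4 where "h4 N s = G 3 s * X N 0 s + 3 * (G 2 s * X N 1 s) + 3 * (G 1 s * X N 2 s) + G 0 s * X N 3 s" for N s
  note h_def = h1_def h2_def h3_def h4_def
  have dG: "(G m has_real_derivative G (Suc m) s) (at s)" if "s > - (d\<^sup>2)" for m s
    using DERIV_power_chain[OF that] by (simp add: G_def)
  have dX: "(X N m has_real_derivative X N (Suc m) s) (at s)" for N m s
    using DERIV_scaled_bump by (simp add: X_def)
  have [measurable]: "G m \<in> borel_measurable borel" "X N m \<in> borel_measurable borel" for m N
    unfolding G_def X_def by measurable
  have [measurable]: "h1 N \<in> borel_measurable borel" "h2 N \<in> borel_measurable borel" "h3 N \<in> borel_measurable borel"
     "h4 N \<in> borel_measurable borel" for N
    unfolding h_def by measurable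
  have num: "Suc 0 = 1" "Suc 1 = 2" "Suc 2 = 3" by simp_all
  have id: "(LBINT y. bilap (h2 N) (h3 N) (h4 N) (y - x0) * u y $ i) =
    (\<Sum>j\<in>UNIV. \<Sum>k\<in>UNIV. LBINT y. curl_field_deriv (h2 N) (h3 N) i j k (y - x0) * (u y $ k * u y $ j))
    + (\<Sum>j\<in>UNIV. LBINT y. curl_field (h1 N) (h2 N) i j (y - x0) * f y $ j)" for N
  proof (rule weak_radial)
    show "0 < d\<^sup>2" using d by simp
    fix s :: real assume s: "s > - (d\<^sup>2)"
    note D = dG[OF s] dX
    note D0 = D(1)[of 0, unfolded num] D(1)[of 1, unfolded num] D(1)[of 2, unfolded num]
      D(2)[of N 0, unfolded num] D(2)[of N 1, unfolded num] D(2)[of N 2, unfolded num]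
    show "(h1 N has_real_derivative h2 N s) (at s)"
      unfolding h1_def[abs_def] by (rule DERIV_cong, (rule DERIV_mult DERIV_add DERIV_cmult D0)+) (simp add: h2_def)
    show "(h2 N has_real_derivative h3 N s) (at s)"
      unfolding h2_def[abs_def] by (rule DERIV_cong, (rule DERIV_mult DERIV_add DERIV_cmult D0)+) (simp add: h3_def)
    show "(h3 N has_real_derivative h4 N s) (at s)"
      unfolding h3_def[abs_def] by (rule DERIV_cong, (rule DERIV_mult DERIV_add DERIV_cmult D0)+) (simp add: h4_def)
  next
    have sG: "smooth_alg (\<lambda>y::real^'n. G m ((y - x0) \<bullet> (y - x0)))" for m
      unfolding G_def by (rule smooth_alg_power_chain[OF d])
    have sX: "smooth_alg (\<lambda>y::real^'n. X N m ((y - x0) \<bullet> (y - x0)))" for m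
      unfolding X_def by (rule smooth_alg_scaled_bump)
    show "smooth_alg (\<lambda>y::real^'n. h1 N ((y - x0) \<bullet> (y - x0)))" "smooth_alg (\<lambda>y::real^'n. h2 N ((y - x0) \<bullet> (y - x0)))"
      "smooth_alg (\<lambda>y::real^'n. h3 N ((y - x0) \<bullet> (y - x0)))"
      unfolding h_def by (intro smooth_alg_intros sG sX)+
    show "0 \<le> real (Suc N)" by simp
    show "h1 N s = 0 \<and> h2 N s = 0 \<and> h3 N s = 0" if "(real (Suc N))\<^sup>2 \<le> s" for s
      using scaled_bump_eq_0[OF _ that] by (simp add: h_def X_def)
  qed
  have q0: "q < 0" using n3 by (simp add: q_def)
  obtain CG where CG: "\<And>m s. s \<ge> 0 \<Longrightarrow> \<bar>G m s\<bar> \<le> CG m * (1 + s) powr (q - real m)"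
    using power_chain_bound[OF d, of q] q0 unfolding G_def by (metis less_imp_le)
  obtain CX where CX: "\<And>m N s. s \<ge> 0 \<Longrightarrow> \<bar>X N m s\<bar> \<le> CX m / (1 + s) ^ m"
  proof -
    have "\<forall>m. \<exists>C. \<forall>N. \<forall>s\<ge>0. \<bar>X N m s\<bar> \<le> C / (1 + s) ^ m"
      using scaled_bump_bound unfolding X_def by (metis of_nat_Suc le_add_same_cancel2 of_nat_0_le_iff add.commute)
    then show ?thesis using that by metis
  qed
  have CG0: "0 \<le> CG m" for m using CG[of 0 m] by simp
  have CX0: "0 \<le> CX m" for m using order_trans[OF abs_ge_zero CX[of 0 0 m]] by simp
  define K where "K = (\<Sum>a\<le>3. \<Sum>b\<le>3. CG a * CX b)"
  \<comment> \<open>Whether a derivative falls on the power or on the cutoff, it gains a factor 1/(1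
    + s). Hence all Leibniz terms of one order obey one bound, independent of the cutoff
    radius.\<close>
  have GX: "\<bar>G a s * X N b s\<bar> \<le> K * (1 + s) powr (q - real (a + b))" if "a \<le> 3" "b \<le> 3" "0 \<le> s" for a b s N
  proof -
    have "\<bar>G a s * X N b s\<bar> \<le> (CG a * (1 + s) powr (q - real a)) * (CX b / (1 + s) ^ b)"
      unfolding abs_mult using CG0 by (intro mult_mono CG CX that) auto
    also have "\<dots> = (CG a * CX b) * (1 + s) powr (q - real (a + b))"
    proof -
      have "(1 + s) powr (q - real (a + b)) = (1 + s) powr (q - real a) / (1 + s) ^ b"
        using that powr_diff[of "1 + s" "q - real a" "real b"] by (simp add: powr_realpow algebra_simps)
      then show ?thesis by simp
    qed
    also have "\<dots> \<le> K * (1 + s) powr (q - real (a + b))"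
    proof (rule mult_right_mono)
      have "CG a * CX b \<le> (\<Sum>b\<le>3. CG a * CX b)" using that CG0 CX0 by (intro member_le_sum) auto
      also have "\<dots> \<le> K" unfolding K_def using that CG0 CX0 by (intro member_le_sum sum_nonneg) auto
      finally show "CG a * CX b \<le> K" .
    qed auto
    finally show ?thesis .
  qed
  have hb: "\<bar>h1 N s\<bar> \<le> 8 * K * (1 + s) powr q" "\<bar>h2 N s\<bar> \<le> 8 * K * (1 + s) powr (q - 1)"
    "\<bar>h3 N s\<bar> \<le> 8 * K * (1 + s) powr (q - 2)" "\<bar>h4 N s\<bar> \<le> 8 * K * (1 + s) powr (q - 3)" if s: "0 \<le> s" for N s
  proof -
    have g: "\<bar>G a s * X N b s\<bar> \<le> K * (1 + s) powr (q - c)" if "a \<le> 3" "b \<le> 3" "real (a + b) = c" for a b c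
      using GX[OF that(1,2) s] that(3) by blast
    have p: "0 \<le> K * (1 + s) powr e" for e
      using order_trans[OF abs_ge_zero GX[of 0 0 s N]] s by (simp add: zero_le_mult_iff)
    show "\<bar>h1 N s\<bar> \<le> 8 * K * (1 + s) powr q"
      unfolding h_def using g[of 0 0 0] p[of q] by simp
    show "\<bar>h2 N s\<bar> \<le> 8 * K * (1 + s) powr (q - 1)"
      unfolding h_def using g[of 1 0 1] g[of 0 1 1] p[of "q - 1"] by simp
    show "\<bar>h3 N s\<bar> \<le> 8 * K * (1 + s) powr (q - 2)"
      unfolding h_def using g[of 2 0 2] g[of 1 1 2] g[of 0 2 2] p[of "q - 2"] by simp
    show "\<bar>h4 N s\<bar> \<le> 8 * K * (1 + s) powr (q - 3)"
      unfolding h_def using g[of 3 0 3] g[of 2 1 3] g[of 1 2 3] g[of 0 3 3] p[of "q - 3"] by simp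
  qed
  have K0: "0 \<le> K" unfolding K_def by (intro sum_nonneg mult_nonneg_nonneg CG0 CX0)
  have pw: "(1 + s) ^ m * (1 + s) powr (e - real m) = (1 + s) powr e" if "0 \<le> s" for s e :: real and m
    using that by (simp add: powr_realpow[symmetric] powr_add[symmetric])
  have pq: "(1 + s) powr q \<le> 1" if "0 \<le> s" for s :: real
    using powr_mono2'[of q 1 "1 + s"] q0 that by simp
  have cfb: "\<bar>curl_field (h1 N) (h2 N) i j z\<bar> \<le> (2 * real CARD('n) + 6) * (8 * K)" for N j and z :: "real^'n"
  proof (rule curl_field_bound)
    define s where "s = z \<bullet> z"
    have s: "0 \<le> s" by (simp add: s_def)
    show "\<bar>h1 N (z \<bullet> z)\<bar> \<le> 8 * K"
      using hb(1)[OF s, of N] mult_left_mono[OF pq[OF s], of "8 * K"] K0 by (simp add: s_def)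
    have "s * \<bar>h2 N s\<bar> \<le> (1 + s) ^ 1 * (8 * K * (1 + s) powr (q - real 1))"
      using hb(2)[OF s, of N] s by (intro mult_mono) auto
    also have "\<dots> = 8 * K * (1 + s) powr q" by (subst pw[OF s, of 1 q, symmetric]) simp
    also have "\<dots> \<le> 8 * K" using mult_left_mono[OF pq[OF s], of "8 * K"] K0 by simp
    finally show "(z \<bullet> z) * \<bar>h2 N (z \<bullet> z)\<bar> \<le> 8 * K" by (simp add: s_def)
  qed
  have cfdb: "\<bar>curl_field_deriv (h2 N) (h3 N) i j k z\<bar> \<le> (4 * real CARD('n) + 28) * (8 * K)" for N j k and z :: "real^'n"
  proof (rule curl_field_deriv_bound)
    define s where "s = z \<bullet> z"
    have s: "0 \<le> s" by (simp add: s_def)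
    have zs: "norm z \<le> 1 + s"
    proof -
      have "0 \<le> (norm z - 1)\<^sup>2" by simp
      moreover have "s = (norm z)\<^sup>2" by (simp add: s_def power2_norm_eq_inner)
      ultimately have "2 * norm z \<le> 1 + s" unfolding power2_diff by simp
      then show ?thesis using norm_ge_zero[of z] by linarith
    qed
    have "norm z * \<bar>h2 N s\<bar> \<le> (1 + s) ^ 1 * (8 * K * (1 + s) powr (q - real 1))"
      using hb(2)[OF s, of N] zs s by (intro mult_mono) auto
    also have "\<dots> = 8 * K * (1 + s) powr q" by (subst pw[OF s, of 1 q, symmetric]) simp
    also have "\<dots> \<le> 8 * K" using mult_left_mono[OF pq[OF s], of "8 * K"] K0 by simp
    finally show "norm z * \<bar>h2 N (z \<bullet> z)\<bar> \<le> 8 * K" by (simp add: s_def)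
    have "norm z * (s * \<bar>h3 N s\<bar>) \<le> (1 + s) * ((1 + s) * (8 * K * (1 + s) powr (q - real 2)))"
      using hb(3)[OF s, of N] zs s by (intro mult_mono) auto
    also have "\<dots> = 8 * K * (1 + s) powr q" by (subst pw[OF s, of 2 q, symmetric]) (simp add: power2_eq_square)
    also have "\<dots> \<le> 8 * K" using mult_left_mono[OF pq[OF s], of "8 * K"] K0 by simp
    finally show "norm z * ((z \<bullet> z) * \<bar>h3 N (z \<bullet> z)\<bar>) \<le> 8 * K" by (simp add: s_def)
  qed
  define Kb where "Kb = (4 * real CARD('n) * (real CARD('n) + 2) + 16 * (real CARD('n) + 2) + 16) * (8 * K)"
  have Kb0: "0 \<le> Kb" using K0 n3 by (simp add: Kb_def)
  have bb: "\<bar>bilap (h2 N) (h3 N) (h4 N) z\<bar> \<le> Kb * (1 + z \<bullet> z) powr (q - 1)" for N and z :: "real^'n"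
    unfolding Kb_def mult.assoc[of _ "8 * K"]
  proof (rule bilap_bound)
    define s where "s = z \<bullet> z"
    have s: "0 \<le> s" by (simp add: s_def)
    show "\<bar>h2 N (z \<bullet> z)\<bar> \<le> 8 * K * (1 + z \<bullet> z) powr (q - 1)" using hb(2)[of "z \<bullet> z" N] by simp
    have "s * \<bar>h3 N s\<bar> \<le> (1 + s) ^ 1 * (8 * K * (1 + s) powr (q - 1 - real 1))"
      using hb(3)[OF s, of N] s by (intro mult_mono) auto
    also have "\<dots> = 8 * K * (1 + s) powr (q - 1)" by (subst pw[OF s, of 1 "q - 1", symmetric]) simp
    finally show "(z \<bullet> z) * \<bar>h3 N (z \<bullet> z)\<bar> \<le> 8 * K * (1 + z \<bullet> z) powr (q - 1)" by (simp add: s_def)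
    have "s\<^sup>2 * \<bar>h4 N s\<bar> \<le> (1 + s) ^ 2 * (8 * K * (1 + s) powr (q - 1 - real 2))"
      using hb(4)[OF s, of N] s by (intro mult_mono power_mono) auto
    also have "\<dots> = 8 * K * (1 + s) powr (q - 1)" by (subst pw[OF s, of 2 "q - 1", symmetric]) simp
    finally show "(z \<bullet> z)\<^sup>2 * \<bar>h4 N (z \<bullet> z)\<bar> \<le> 8 * K * (1 + z \<bullet> z) powr (q - 1)" by (simp add: s_def)
  qed
  define e1 where "e1 = exp (- 1 :: real)"
  have X0: "(\<lambda>N. X N 0 s) \<longlonglongrightarrow> e1" for s
    using scaled_bump_tendsto[of 0 s] by (simp add: X_def e1_def)
  have X1: "(\<lambda>N. X N m s) \<longlonglongrightarrow> 0" if "m > 0" for m s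
    using scaled_bump_tendsto[of m s] that by (simp add: X_def)
  have lims: "(\<lambda>N. h1 N s) \<longlonglongrightarrow> e1 * G 0 s" "(\<lambda>N. h2 N s) \<longlonglongrightarrow> e1 * G 1 s"
    "(\<lambda>N. h3 N s) \<longlonglongrightarrow> e1 * G 2 s" "(\<lambda>N. h4 N s) \<longlonglongrightarrow> e1 * G 3 s" for s
  proof -
    have "(\<lambda>N. h1 N s) \<longlonglongrightarrow> G 0 s * e1" unfolding h_def by (intro tendsto_intros X0 X1) 
    moreover have "(\<lambda>N. h2 N s) \<longlonglongrightarrow> G 1 s * e1 + G 0 s * 0" unfolding h_def by (intro tendsto_intros X0 X1) auto
    moreover have "(\<lambda>N. h3 N s) \<longlonglongrightarrow> G 2 s * e1 + 2 * (G 1 s * 0) + G 0 s * 0" unfolding h_def by (intro tendsto_intros X0 X1) auto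
    moreover have "(\<lambda>N. h4 N s) \<longlonglongrightarrow> G 3 s * e1 + 3 * (G 2 s * 0) + 3 * (G 1 s * 0) + G 0 s * 0" unfolding h_def by (intro tendsto_intros X0 X1) auto
    ultimately show "(\<lambda>N. h1 N s) \<longlonglongrightarrow> e1 * G 0 s" "(\<lambda>N. h2 N s) \<longlonglongrightarrow> e1 * G 1 s"
      "(\<lambda>N. h3 N s) \<longlonglongrightarrow> e1 * G 2 s" "(\<lambda>N. h4 N s) \<longlonglongrightarrow> e1 * G 3 s" by (simp_all add: mult.commute)
  qed
  note cm = curl_field_measurable curl_field_deriv_measurable bilap_measurable
  have L: "(\<lambda>N. LBINT y. bilap (h2 N) (h3 N) (h4 N) (y - x0) * u y $ i) \<longlonglongrightarrow>
     (LBINT y. e1 * bilap (G 1) (G 2) (G 3) (y - x0) * u y $ i)"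
  proof (rule integral_dominated_convergence)
    have [measurable]: "bilap (h2 N) (h3 N) (h4 N) \<in> borel_measurable (borel :: (real^'n) measure)" for N by (rule cm; measurable)
    have [measurable]: "bilap (G 1) (G 2) (G 3) \<in> borel_measurable (borel :: (real^'n) measure)" by (rule cm; measurable)
    show "(\<lambda>y. bilap (h2 N) (h3 N) (h4 N) (y - x0) * u y $ i) \<in> borel_measurable lborel" for N by measurable
    show "(\<lambda>y. e1 * bilap (G 1) (G 2) (G 3) (y - x0) * u y $ i) \<in> borel_measurable lborel" by measurable
    \<comment> \<open>With z = y - x0 the kernel is bounded by (1 + |z|^2)^(q - 1) = (1 +
      |z|^2)^(-n/2), which just fails to be integrable. Its product with the decay of u is bounded
      by the sum of the two squares, of orders -2n and 2 - 2n, both integrable for n \<ge> 3. The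
      factor 2^n comes from \<open>(bracket z)\<^sup>2\<close> \<le> 2 (1 + |z|^2).\<close>
    define W where "W y = Kb * A * (2 powr real CARD('n) * bracket (y - x0) powr (- 2 * real CARD('n)) + bracket y powr (2 - 2 * real CARD('n)))" for y
    show "integrable lborel W"
    proof -
      have "integrable lborel (\<lambda>y::real^'n. bracket (y - x0) powr (- 2 * real CARD('n)))"
        using integrable_lborel_translate[of "\<lambda>y::real^'n. bracket y powr (- 2 * real CARD('n))" "- x0"] integrable_bracket_powr[of "- 2 * real CARD('n)", where 'n='n] n3
        by simp
      then show ?thesis unfolding W_def using n3 by (intro integrable_mult_right Bochner_Integration.integrable_add integrable_bracket_powr) auto
    qed
    show "AE y in lborel. (\<lambda>N. bilap (h2 N) (h3 N) (h4 N) (y - x0) * u y $ i) \<longlonglongrightarrow> e1 * bilap (G 1) (G 2) (G 3) (y - x0) * u y $ i"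
      by (intro AE_I2 tendsto_mult bilap_tendsto lims tendsto_const)
    show "AE y in lborel. norm (bilap (h2 N) (h3 N) (h4 N) (y - x0) * u y $ i) \<le> W y" for N
    proof (rule AE_I2)
      fix y :: "real^'n"
      define T where "T = 1 + (y - x0) \<bullet> (y - x0)"
      have T: "T \<ge> 1" by (simp add: T_def)
      have "norm (bilap (h2 N) (h3 N) (h4 N) (y - x0) * u y $ i) \<le> (Kb * T powr (q - 1)) * (A * bracket y powr (1 - real CARD('n)))"
        unfolding real_norm_def abs_mult using bb[of N "y - x0"] component_le_norm_cart[of "u y" i] u_decay[of y] Kb0
        by (intro mult_mono) (auto simp: T_def)
      also have "\<dots> = Kb * A * (T powr (q - 1) * bracket y powr (1 - real CARD('n)))" by simp
      also have "T powr (q - 1) * bracket y powr (1 - real CARD('n)) \<le> (T powr (q - 1))\<^sup>2 + (bracket y powr (1 - real CARD('n)))\<^sup>2"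
      proof -
        have "0 \<le> (T powr (q - 1) - bracket y powr (1 - real CARD('n)))\<^sup>2" by simp
        moreover have "0 \<le> T powr (q - 1) * bracket y powr (1 - real CARD('n))" by simp
        ultimately show ?thesis unfolding power2_diff by linarith
      qed
      also have "(bracket y powr (1 - real CARD('n)))\<^sup>2 = bracket y powr (2 - 2 * real CARD('n))"
        by (simp add: power2_eq_square powr_add[symmetric] algebra_simps)
      also have "(T powr (q - 1))\<^sup>2 \<le> 2 powr real CARD('n) * bracket (y - x0) powr (- 2 * real CARD('n))"
      proof -
        have "(bracket (y - x0))\<^sup>2 \<le> 2 * T"
          by (simp add: bracket_def T_def power2_norm_eq_inner)
        then have "(2 * T) powr - real CARD('n) \<le> ((bracket (y - x0))\<^sup>2) powr - real CARD('n)"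
          using bracket_pos[of "y - x0"] n3 by (intro powr_mono2') auto
        also have "\<dots> = bracket (y - x0) powr (- 2 * real CARD('n))"
          using bracket_pos[of "y - x0"] by (simp add: powr_powr flip: powr_numeral)
        finally have "T powr - real CARD('n) \<le> 2 powr real CARD('n) * bracket (y - x0) powr (- 2 * real CARD('n))"
          using T by (simp add: powr_mult powr_minus field_simps)
        moreover have "(T powr (q - 1))\<^sup>2 = T powr - real CARD('n)"
          by (simp add: q_def power2_eq_square powr_add[symmetric] field_simps)
        ultimately show ?thesis by simp
      qed
      finally show "norm (bilap (h2 N) (h3 N) (h4 N) (y - x0) * u y $ i) \<le> W y"
        using Kb0 A_nonneg by (simp add: W_def mult_left_mono)
    qed
  qed
  have R1: "(\<lambda>N. LBINT y. curl_field_deriv (h2 N) (h3 N) i j k (y - x0) * (u y $ k * u y $ j)) \<longlonglongrightarrow>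
     (LBINT y. e1 * curl_field_deriv (G 1) (G 2) i j k (y - x0) * (u y $ k * u y $ j))" for j k
  proof (rule integral_dominated_convergence)
    have [measurable]: "curl_field_deriv (h2 N) (h3 N) i j k \<in> borel_measurable (borel :: (real^'n) measure)" for N by (rule cm; measurable)
    have [measurable]: "curl_field_deriv (G 1) (G 2) i j k \<in> borel_measurable (borel :: (real^'n) measure)" by (rule cm; measurable)
    show "(\<lambda>y. curl_field_deriv (h2 N) (h3 N) i j k (y - x0) * (u y $ k * u y $ j)) \<in> borel_measurable lborel" for N by measurable
    show "(\<lambda>y. e1 * curl_field_deriv (G 1) (G 2) i j k (y - x0) * (u y $ k * u y $ j)) \<in> borel_measurable lborel" by measurable
    show "integrable lborel (\<lambda>y. (4 * real CARD('n) + 28) * (8 * K) * \<bar>u y $ k * u y $ j\<bar>)"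
      using uu_int by (intro integrable_mult_right integrable_abs)
    show "AE y in lborel. (\<lambda>N. curl_field_deriv (h2 N) (h3 N) i j k (y - x0) * (u y $ k * u y $ j)) \<longlonglongrightarrow> e1 * curl_field_deriv (G 1) (G 2) i j k (y - x0) * (u y $ k * u y $ j)"
      by (intro AE_I2 tendsto_mult curl_field_deriv_tendsto lims tendsto_const)
    show "AE y in lborel. norm (curl_field_deriv (h2 N) (h3 N) i j k (y - x0) * (u y $ k * u y $ j)) \<le> (4 * real CARD('n) + 28) * (8 * K) * \<bar>u y $ k * u y $ j\<bar>" for N
      using cfdb by (intro AE_I2) (simp only: real_norm_def abs_mult[of "curl_field_deriv _ _ _ _ _ _"], intro mult_right_mono, auto)
  qed
  have R2: "(\<lambda>N. LBINT y. curl_field (h1 N) (h2 N) i j (y - x0) * f y $ j) \<longlonglongrightarrow>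
     (LBINT y. e1 * curl_field (G 0) (G 1) i j (y - x0) * f y $ j)" for j
  proof (rule integral_dominated_convergence)
    have [measurable]: "(\<lambda>y. f y $ j) \<in> borel_measurable borel" using f_comp_int[of j] by auto
    have [measurable]: "curl_field (h1 N) (h2 N) i j \<in> borel_measurable (borel :: (real^'n) measure)" for N by (rule cm; measurable)
    have [measurable]: "curl_field (G 0) (G 1) i j \<in> borel_measurable (borel :: (real^'n) measure)" by (rule cm; measurable)
    show "(\<lambda>y. curl_field (h1 N) (h2 N) i j (y - x0) * f y $ j) \<in> borel_measurable lborel" for N by measurable
    show "(\<lambda>y. e1 * curl_field (G 0) (G 1) i j (y - x0) * f y $ j) \<in> borel_measurable lborel" by measurable
    show "integrable lborel (\<lambda>y. (2 * real CARD('n) + 6) * (8 * K) * \<bar>f y $ j\<bar>)"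
      using f_comp_int by (intro integrable_mult_right integrable_abs)
    show "AE y in lborel. (\<lambda>N. curl_field (h1 N) (h2 N) i j (y - x0) * f y $ j) \<longlonglongrightarrow> e1 * curl_field (G 0) (G 1) i j (y - x0) * f y $ j"
      by (intro AE_I2 tendsto_mult curl_field_tendsto lims tendsto_const)
    show "AE y in lborel. norm (curl_field (h1 N) (h2 N) i j (y - x0) * f y $ j) \<le> (2 * real CARD('n) + 6) * (8 * K) * \<bar>f y $ j\<bar>" for N
      using cfb by (intro AE_I2) (simp only: real_norm_def abs_mult[of "curl_field _ _ _ _ _"], intro mult_right_mono, auto)
  qed
  \<comment> \<open>All limits carry the factor exp(-1) of the unnormalised cutoff; it is nonzero
    and cancels.\<close>
  have "(LBINT y. e1 * bilap (G 1) (G 2) (G 3) (y - x0) * u y $ i) =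
    (\<Sum>j\<in>UNIV. \<Sum>k\<in>UNIV. LBINT y. e1 * curl_field_deriv (G 1) (G 2) i j k (y - x0) * (u y $ k * u y $ j))
    + (\<Sum>j\<in>UNIV. LBINT y. e1 * curl_field (G 0) (G 1) i j (y - x0) * f y $ j)"
    by (rule LIMSEQ_unique[OF L]) (unfold id, intro tendsto_intros R1 R2)
  then have "e1 * (LBINT y. bilap (G 1) (G 2) (G 3) (y - x0) * u y $ i) = e1 * (
    (\<Sum>j\<in>UNIV. \<Sum>k\<in>UNIV. LBINT y. curl_field_deriv (G 1) (G 2) i j k (y - x0) * (u y $ k * u y $ j))
    + (\<Sum>j\<in>UNIV. LBINT y. curl_field (G 0) (G 1) i j (y - x0) * f y $ j))"
    by (simp add: mult.assoc sum_distrib_left distrib_left)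
  then show ?thesis by (simp add: e1_def G_def)
qed

text \<open>The bounds are uniform in \<open>d \<ge> 0\<close>; \<open>z = 0\<close> has to be excluded since \<open>0 powr p = 0\<close>.\<close>

lemma kernel_bounds:
  obtains C where "0 \<le> C"
    "\<And>d i j z. z \<noteq> 0 \<Longrightarrow> \<bar>curl_field (power_chain q d 0) (power_chain q d 1) i j (z :: real^'n)\<bar> \<le> C * norm z powr - (real CARD('n) - 2)"
    "\<And>d i j k z. z \<noteq> 0 \<Longrightarrow> \<bar>curl_field_deriv (power_chain q d 1) (power_chain q d 2) i j k (z :: real^'n)\<bar> \<le> C * norm z powr - (real CARD('n) - 1)"
proof -
  have q0: "q \<le> 0" using n3 by (simp add: q_def)
  define b where "b = 1 + \<bar>q\<bar> + \<bar>q * (q - 1)\<bar>"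
  have b0: "b \<ge> 1" by (simp add: b_def)
  define C where "C = (4 * real CARD('n) + 28) * b"
  have pc: "\<bar>power_chain q d 0 s\<bar> \<le> b * s powr q" "\<bar>power_chain q d 1 s\<bar> \<le> b * s powr (q - 1)"
    "\<bar>power_chain q d 2 s\<bar> \<le> b * s powr (q - 2)" if "0 < s" for s d
  proof -
    have le: "c * s powr e \<le> b * s powr e" if "c \<le> b" for c e
      using that by (intro mult_right_mono) auto
    show "\<bar>power_chain q d 0 s\<bar> \<le> b * s powr q"
      using power_chain_le[OF that q0, of d 0] le[of 1 q] by (simp add: b_def)
    show "\<bar>power_chain q d 1 s\<bar> \<le> b * s powr (q - 1)"
      using power_chain_le[OF that q0, of d 1] le[of "\<bar>q\<bar>" "q - 1"] by (simp add: b_def)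
    show "\<bar>power_chain q d 2 s\<bar> \<le> b * s powr (q - 2)"
      using power_chain_le[OF that q0, of d 2] le[of "\<bar>q * (q - 1)\<bar>" "q - 2"] by (simp add: b_def numeral_2_eq_2)
  qed
  show ?thesis
  proof (rule that[of C])
    show "0 \<le> C" using b0 by (simp add: C_def)
  next
    fix d i j and z :: "real^'n" assume z: "z \<noteq> 0"
    define s where "s = z \<bullet> z"
    have s: "0 < s" using z by (simp add: s_def)
    have sz: "s powr q = norm z powr - (real CARD('n) - 2)"
    proof -
      have "s = norm z powr 2" using z by (simp add: s_def power2_norm_eq_inner)
      then have "s powr q = norm z powr (2 * q)" by (simp only: powr_powr)
      moreover have "2 * q = - (real CARD('n) - 2)" by (simp add: q_def field_simps)
      ultimately show ?thesis by (simp only:)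
    qed
    have s1: "s * s powr (q - 1) = s powr q" using s powr_add[of s 1 "q - 1"] by simp
    have "\<bar>curl_field (power_chain q d 0) (power_chain q d 1) i j z\<bar> \<le> (2 * real CARD('n) + 6) * (b * s powr q)"
    proof (rule curl_field_bound)
      show "\<bar>power_chain q d 0 (z \<bullet> z)\<bar> \<le> b * s powr q" using pc(1)[OF s, of d] by (simp add: s_def)
      have "s * \<bar>power_chain q d 1 s\<bar> \<le> s * (b * s powr (q - 1))" using pc(2)[OF s, of d] s by (intro mult_left_mono) auto
      then show "z \<bullet> z * \<bar>power_chain q d 1 (z \<bullet> z)\<bar> \<le> b * s powr q" using s1 by (simp add: s_def mult_ac)
    qed
    also have "\<dots> \<le> C * s powr q" unfolding C_def mult.assoc[symmetric]
      using b0 by (intro mult_right_mono) auto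
    finally show "\<bar>curl_field (power_chain q d 0) (power_chain q d 1) i j z\<bar> \<le> C * norm z powr - (real CARD('n) - 2)"
      by (simp only: sz)
  next
    fix d i j k and z :: "real^'n" assume z: "z \<noteq> 0"
    define s where "s = z \<bullet> z"
    have s: "0 < s" using z by (simp add: s_def)
    have s1: "s * s powr (q - 2) = s powr (q - 1)" using s powr_add[of s 1 "q - 2"] by simp
    have sz: "norm z * s powr (q - 1) = norm z powr - (real CARD('n) - 1)"
    proof -
      have "s = norm z powr 2" using z by (simp add: s_def power2_norm_eq_inner)
      then have "norm z * s powr (q - 1) = norm z powr 1 * norm z powr (2 * (q - 1))" using z by (simp only: powr_powr powr_one norm_ge_zero)
      also have "\<dots> = norm z powr (1 + 2 * (q - 1))" by (simp only: powr_add)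
      also have "1 + 2 * (q - 1) = - (real CARD('n) - 1)" by (simp add: q_def field_simps)
      finally show ?thesis .
    qed
    have "\<bar>curl_field_deriv (power_chain q d 1) (power_chain q d 2) i j k z\<bar> \<le> (4 * real CARD('n) + 28) * (b * (norm z * s powr (q - 1)))"
    proof (rule curl_field_deriv_bound)
      show "norm z * \<bar>power_chain q d 1 (z \<bullet> z)\<bar> \<le> b * (norm z * s powr (q - 1))"
        using mult_left_mono[OF pc(2)[OF s, of d] norm_ge_zero[of z]] by (simp add: s_def mult_ac)
      have "s * \<bar>power_chain q d 2 s\<bar> \<le> s * (b * s powr (q - 2))" using pc(3)[OF s, of d] s by (intro mult_left_mono) auto
      also have "\<dots> = b * s powr (q - 1)" using s1 by (simp add: mult_ac)
      finally show "norm z * (z \<bullet> z * \<bar>power_chain q d 2 (z \<bullet> z)\<bar>) \<le> b * (norm z * s powr (q - 1))"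
        using mult_left_mono[OF _ norm_ge_zero[of z], of "s * \<bar>power_chain q d 2 s\<bar>" "b * s powr (q - 1)"] by (simp add: s_def mult_ac)
    qed
    then show "\<bar>curl_field_deriv (power_chain q d 1) (power_chain q d 2) i j k z\<bar> \<le> C * norm z powr - (real CARD('n) - 1)"
      by (simp only: sz C_def mult.assoc)
  qed
qed

lemma power_chain_tendsto:
  assumes "0 < s" "r \<longlonglongrightarrow> 0"
  shows "(\<lambda>N. power_chain p (r N) m s) \<longlonglongrightarrow> power_chain p 0 m s"
proof -
  have "(\<lambda>N. (\<Prod>i<m. p - real i) * (s + (r N)\<^sup>2) powr (p - real m)) \<longlonglongrightarrow> (\<Prod>i<m. p - real i) * (s + 0\<^sup>2) powr (p - real m)"
    using assms by (intro tendsto_intros) auto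
  then show ?thesis by (simp add: power_chain_def)
qed

text \<open>The kernels share the weakly singular majorant |z|^(-p) with p < n, so
  \<open>riesz_bound\<close> provides a dominating function for each x and bounds uniform in x.
  Assumptions at z \<noteq> 0 suffice because y \<noteq> x for almost every y.\<close>

lemma singular_integral_limit:
  fixes k :: "nat \<Rightarrow> real^'n \<Rightarrow> real" and F :: "real^'n \<Rightarrow> real"
  assumes km: "\<And>N. k N \<in> borel_measurable borel" and k0m: "k0 \<in> borel_measurable borel"
    and p: "0 < p" "p < real CARD('n)"
    and kb: "\<And>N z. z \<noteq> 0 \<Longrightarrow> \<bar>k N z\<bar> \<le> C * norm z powr - p"
    and kl: "\<And>z. z \<noteq> 0 \<Longrightarrow> (\<lambda>N. k N z) \<longlonglongrightarrow> k0 z"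
    and F: "integrable lborel F" and Fb: "\<And>y. \<bar>F y\<bar> \<le> a"
  shows "\<And>N. (\<lambda>x. LBINT y. k N (y - x) * F y) \<in> borel_measurable borel"
    and "(\<lambda>x. LBINT y. k0 (y - x) * F y) \<in> borel_measurable borel"
    and "\<exists>c. \<forall>x N. \<bar>LBINT y. k N (y - x) * F y\<bar> \<le> c"
    and "\<exists>c. \<forall>x. \<bar>LBINT y. k0 (y - x) * F y\<bar> \<le> c"
    and "\<And>x. (\<lambda>N. LBINT y. k N (y - x) * F y) \<longlonglongrightarrow> (LBINT y. k0 (y - x) * F y)"
proof -
  note [measurable] = km k0m
  have [measurable]: "F \<in> borel_measurable borel" using F by auto
  show "(\<lambda>x. LBINT y. k N (y - x) * F y) \<in> borel_measurable borel" for N by measurable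
  show "(\<lambda>x. LBINT y. k0 (y - x) * F y) \<in> borel_measurable borel" by measurable
  obtain Cp where Cp: "0 \<le> Cp" "\<And>x. integrable lborel (\<lambda>y. norm (y - x) powr - p * F y)"
    "\<And>x. (LBINT y. \<bar>norm (y - x) powr - p * F y\<bar>) \<le> Cp * a + (LBINT y. \<bar>F y\<bar>)"
  proof -
    obtain Cp where Cp: "0 \<le> Cp"
      "\<And>(F :: real^'n \<Rightarrow> real) A x. integrable lborel F \<Longrightarrow> (\<And>y. \<bar>F y\<bar> \<le> A) \<Longrightarrow> integrable lborel (\<lambda>y. norm (y - x) powr - p * F y)"
      "\<And>(F :: real^'n \<Rightarrow> real) A x. integrable lborel F \<Longrightarrow> (\<And>y. \<bar>F y\<bar> \<le> A) \<Longrightarrow>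
         (LBINT y. \<bar>norm (y - x) powr - p * F y\<bar>) \<le> Cp * A + (LBINT y. \<bar>F y\<bar>)"
      by (rule riesz_bound[OF p]) blast
    show ?thesis by (rule that[OF Cp(1) Cp(2)[OF F Fb] Cp(3)[OF F Fb]])
  qed
  have ne: "AE y in lborel. y \<noteq> x" for x :: "real^'n"
    by (rule AE_lborel_singleton)
  have b: "AE y in lborel. norm (k N (y - x) * F y) \<le> \<bar>C\<bar> * \<bar>norm (y - x) powr - p * F y\<bar>" for N x
    using ne[of x]
  proof eventually_elim
    case (elim y)
    have "\<bar>k N (y - x)\<bar> \<le> \<bar>C\<bar> * norm (y - x) powr - p"
      using kb[of "y - x" N] elim by (auto elim!: order_trans intro!: mult_right_mono)
    then show ?case by (simp add: abs_mult mult_right_mono mult.assoc[symmetric])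
  qed
  have w: "integrable lborel (\<lambda>y. \<bar>C\<bar> * \<bar>norm (y - x) powr - p * F y\<bar>)" for x
    using Cp(2) by (intro integrable_mult_right integrable_abs)
  show lim: "(\<lambda>N. LBINT y. k N (y - x) * F y) \<longlonglongrightarrow> (LBINT y. k0 (y - x) * F y)" for x
  proof (rule integral_dominated_convergence[OF _ _ w _ b])
    show "AE y in lborel. (\<lambda>N. k N (y - x) * F y) \<longlonglongrightarrow> k0 (y - x) * F y"
      using ne[of x] by eventually_elim (intro tendsto_mult kl tendsto_const, simp)
  qed measurable
  have bd: "\<bar>LBINT y. k N (y - x) * F y\<bar> \<le> \<bar>C\<bar> * (Cp * a + (LBINT y. \<bar>F y\<bar>))" for N x
  proof -
    have i: "integrable lborel (\<lambda>y. k N (y - x) * F y)"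
    proof (rule Bochner_Integration.integrable_bound[OF w[of x]])
      show "AE y in lborel. norm (k N (y - x) * F y) \<le> norm (\<bar>C\<bar> * \<bar>norm (y - x) powr - p * F y\<bar>)"
        using b[of N x] by simp
    qed measurable
    have "\<bar>LBINT y. k N (y - x) * F y\<bar> \<le> (LBINT y. \<bar>k N (y - x) * F y\<bar>)" by (rule integral_abs_bound)
    also have "\<dots> \<le> (LBINT y. \<bar>C\<bar> * \<bar>norm (y - x) powr - p * F y\<bar>)"
      using integrable_abs[OF i] w[of x] b[of N x] by (intro integral_mono_AE) auto
    also have "\<dots> \<le> \<bar>C\<bar> * (Cp * a + (LBINT y. \<bar>F y\<bar>))"
      using Cp(3)[of x] by (simp add: mult_left_mono)
    finally show ?thesis .
  qed
  then show "\<exists>c. \<forall>x N. \<bar>LBINT y. k N (y - x) * F y\<bar> \<le> c" by blast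
  have "\<bar>LBINT y. k0 (y - x) * F y\<bar> \<le> \<bar>C\<bar> * (Cp * a + (LBINT y. \<bar>F y\<bar>))" for x
    using LIMSEQ_le_const2[OF tendsto_rabs[OF lim[of x]]] bd by blast
  then show "\<exists>c. \<forall>x. \<bar>LBINT y. k0 (y - x) * F y\<bar> \<le> c" by blast
qed

text \<open>The left side of the regularised identity converges only weakly, so both sides are
  integrated against an arbitrary integrable V. There the approximate identity tends to its mass
  times u_i, while the right side converges boundedly to the singular integrals. The difference g of
  the two limits is orthogonal to every V, hence 0 almost everywhere.\<close>

theorem representation:
  "AE x in lborel. - 4 * real CARD('n) * (real CARD('n) - 2) * unit_ball_vol (real CARD('n)) * u x $ i =
    (\<Sum>j\<in>UNIV. \<Sum>k\<in>UNIV. LBINT y. curl_field_deriv (power_chain q 0 1) (power_chain q 0 2) i j k (y - x) * (u y $ k * u y $ j))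
    + (\<Sum>j\<in>UNIV. LBINT y. curl_field (power_chain q 0 0) (power_chain q 0 1) i j (y - x) * f y $ j)"
proof -
  define r where "r N = 1 / real (Suc N)" for N
  have r: "r N > 0" for N by (simp add: r_def)
  have r0: "r \<longlonglongrightarrow> 0" unfolding r_def using LIMSEQ_Suc[OF lim_1_over_n] by simp
  define c0 where "c0 = 16 * q * (q - 1) * (q - 2)"
  define \<kappa> where "\<kappa> w = (1 + (norm w)\<^sup>2) powr - ((real CARD('n) + 4) / 2)" for w :: "real^'n"
  have \<kappa>: "integrable lborel \<kappa>" "integral\<^sup>L lborel \<kappa> = 2 * unit_ball_vol (real CARD('n)) / (real CARD('n) + 2)"
    using has_bochner_integral_bubble[where 'a = "real^'n"] unfolding has_bochner_integral_iff \<kappa>_def by simp_all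
  define M where "M = - 4 * real CARD('n) * (real CARD('n) - 2) * unit_ball_vol (real CARD('n))"
  \<comment> \<open>For q = (2 - n)/2 the product 16 q (q - 1) (q - 2) equals 2 n (2 - n) (n + 2),
    and the mass 2 \<open>unit_ball_vol\<close> / (n + 2) of \<kappa> cancels the factor n +
    2.\<close>
  have M: "c0 * integral\<^sup>L lborel \<kappa> = M"
  proof -
    have e: "16 * ((2 - x) / 2) * ((2 - x) / 2 - 1) * ((2 - x) / 2 - 2) * (2 * w / (x + 2)) = - 4 * x * (x - 2) * w"
      if "x + 2 \<noteq> 0" for x w :: real
      using that by (simp add: divide_simps) algebra
    show ?thesis unfolding \<kappa>(2) M_def c0_def q_def by (rule e) (use n3 in linarith)
  qed
  define P where "P d j k x = (LBINT y. curl_field_deriv (power_chain q d 1) (power_chain q d 2) i j k (y - x) * (u y $ k * u y $ j))" for d j k x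
  define Q where "Q d j x = (LBINT y. curl_field (power_chain q d 0) (power_chain q d 1) i j (y - x) * f y $ j)" for d j x
  define R where "R d x = (\<Sum>j\<in>UNIV. \<Sum>k\<in>UNIV. P d j k x) + (\<Sum>j\<in>UNIV. Q d j x)" for d x
  obtain C where C: "0 \<le> C"
    "\<And>d i j z. z \<noteq> 0 \<Longrightarrow> \<bar>curl_field (power_chain q d 0) (power_chain q d 1) i j (z :: real^'n)\<bar> \<le> C * norm z powr - (real CARD('n) - 2)"
    "\<And>d i j k z. z \<noteq> 0 \<Longrightarrow> \<bar>curl_field_deriv (power_chain q d 1) (power_chain q d 2) i j k (z :: real^'n)\<bar> \<le> C * norm z powr - (real CARD('n) - 1)"
    using kernel_bounds by blast
  have Pk: "\<And>N. P (r N) j k \<in> borel_measurable borel" "P 0 j k \<in> borel_measurable borel"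
    "\<exists>c. \<forall>x N. \<bar>P (r N) j k x\<bar> \<le> c" "\<exists>c. \<forall>x. \<bar>P 0 j k x\<bar> \<le> c" "\<And>x. (\<lambda>N. P (r N) j k x) \<longlonglongrightarrow> P 0 j k x" for j k
  proof -
    have p: "0 < real CARD('n) - 1" "real CARD('n) - 1 < real CARD('n)" using n3 by auto
    have l: "(\<lambda>N. curl_field_deriv (power_chain q (r N) 1) (power_chain q (r N) 2) i j k z) \<longlonglongrightarrow>
      curl_field_deriv (power_chain q 0 1) (power_chain q 0 2) i j k z" if "z \<noteq> 0" for z :: "real^'n"
    proof -
      have "(\<lambda>N. curl_field_deriv (power_chain q (r N) 1) (power_chain q (r N) 2) i j k z) \<longlonglongrightarrow>
        1 * curl_field_deriv (power_chain q 0 1) (power_chain q 0 2) i j k z"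
        by (rule curl_field_deriv_tendsto) (use that r0 in \<open>auto intro!: power_chain_tendsto\<close>)
      then show ?thesis by simp
    qed
    have m: "curl_field_deriv (power_chain q d 1) (power_chain q d 2) i j k \<in> borel_measurable (borel :: (real^'n) measure)" for d
      by (rule curl_field_deriv_measurable; measurable)
    note S = singular_integral_limit[of "\<lambda>N. curl_field_deriv (power_chain q (r N) 1) (power_chain q (r N) 2) i j k", OF m m p C(3) l uu_int[of k j] uu_const_bound[of _ k j]]
    show "\<And>N. P (r N) j k \<in> borel_measurable borel" "P 0 j k \<in> borel_measurable borel"
      "\<exists>c. \<forall>x N. \<bar>P (r N) j k x\<bar> \<le> c" "\<exists>c. \<forall>x. \<bar>P 0 j k x\<bar> \<le> c" "\<And>x. (\<lambda>N. P (r N) j k x) \<longlonglongrightarrow> P 0 j k x"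
      unfolding P_def by (rule S; assumption?)+
  qed
  have Qk: "\<And>N. Q (r N) j \<in> borel_measurable borel" "Q 0 j \<in> borel_measurable borel"
    "\<exists>c. \<forall>x N. \<bar>Q (r N) j x\<bar> \<le> c" "\<exists>c. \<forall>x. \<bar>Q 0 j x\<bar> \<le> c" "\<And>x. (\<lambda>N. Q (r N) j x) \<longlonglongrightarrow> Q 0 j x" for j
  proof -
    have p: "0 < real CARD('n) - 2" "real CARD('n) - 2 < real CARD('n)" using n3 by auto
    have l: "(\<lambda>N. curl_field (power_chain q (r N) 0) (power_chain q (r N) 1) i j z) \<longlonglongrightarrow>
      curl_field (power_chain q 0 0) (power_chain q 0 1) i j z" if "z \<noteq> 0" for z :: "real^'n"
    proof -
      have "(\<lambda>N. curl_field (power_chain q (r N) 0) (power_chain q (r N) 1) i j z) \<longlonglongrightarrow>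
        1 * curl_field (power_chain q 0 0) (power_chain q 0 1) i j z"
        by (rule curl_field_tendsto) (use that r0 in \<open>auto intro!: power_chain_tendsto\<close>)
      then show ?thesis by simp
    qed
    have m: "curl_field (power_chain q d 0) (power_chain q d 1) i j \<in> borel_measurable (borel :: (real^'n) measure)" for d
      by (rule curl_field_measurable; measurable)
    note S = singular_integral_limit[of "\<lambda>N. curl_field (power_chain q (r N) 0) (power_chain q (r N) 1) i j", OF m m p C(2) l f_comp_int[of j] f_comp_bound[of _ j]]
    show "\<And>N. Q (r N) j \<in> borel_measurable borel" "Q 0 j \<in> borel_measurable borel"
      "\<exists>c. \<forall>x N. \<bar>Q (r N) j x\<bar> \<le> c" "\<exists>c. \<forall>x. \<bar>Q 0 j x\<bar> \<le> c" "\<And>x. (\<lambda>N. Q (r N) j x) \<longlonglongrightarrow> Q 0 j x"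
      unfolding Q_def by (rule S; assumption?)+
  qed
  have Rm [measurable]: "R (r N) \<in> borel_measurable borel" "R 0 \<in> borel_measurable borel" for N
    unfolding R_def using Pk(1,2) Qk(1,2) by measurable
  have Rl: "(\<lambda>N. R (r N) x) \<longlonglongrightarrow> R 0 x" for x
    unfolding R_def by (intro tendsto_intros Pk Qk)
  have "\<exists>c. \<forall>x N. \<bar>R (r N) x\<bar> \<le> c"
  proof -
    obtain cP where cP: "\<And>j k x N. \<bar>P (r N) j k x\<bar> \<le> cP j k" using Pk(3) by metis
    obtain cQ where cQ: "\<And>j x N. \<bar>Q (r N) j x\<bar> \<le> cQ j" using Qk(3) by metis
    have "\<bar>R (r N) x\<bar> \<le> (\<Sum>j\<in>UNIV. \<Sum>k\<in>UNIV. cP j k) + (\<Sum>j\<in>UNIV. cQ j)" for x N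
      unfolding R_def by (rule order_trans[OF abs_triangle_ineq])
        (intro add_mono order_trans[OF sum_abs] sum_mono cP cQ)
    then show ?thesis by blast
  qed
  then obtain cR where cR: "\<And>x N. \<bar>R (r N) x\<bar> \<le> cR" by blast
  have cR0: "\<bar>R 0 x\<bar> \<le> cR" for x
    using LIMSEQ_le_const2[OF tendsto_rabs[OF Rl[of x]]] cR by blast
  have eq: "c0 * (1 / r N ^ CARD('n) * (LBINT y. \<kappa> ((1 / r N) *\<^sub>R (y - x)) * u y $ i)) = R (r N) x" for N x
  proof -
    have "(LBINT y. bilap (power_chain q (r N) 1) (power_chain q (r N) 2) (power_chain q (r N) 3) (y - x) * u y $ i)
      = (LBINT y. (c0 * (1 / r N ^ CARD('n))) * (\<kappa> ((1 / r N) *\<^sub>R (y - x)) * u y $ i))"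
      unfolding bilap_power_chain[where 'n = 'n, OF r, folded q_def] c0_def \<kappa>_def by (simp add: mult.assoc)
    then show ?thesis
      using regularized_identity[OF r[of N], of x i] by (simp add: R_def P_def Q_def mult.assoc)
  qed
  define g where "g x = M * u x $ i - R 0 x" for x
  have gm [measurable]: "g \<in> borel_measurable borel" unfolding g_def by measurable
  have gb: "\<bar>g x\<bar> \<le> \<bar>M\<bar> * B + cR" for x
  proof -
    have "\<bar>M * u x $ i\<bar> \<le> \<bar>M\<bar> * B" unfolding abs_mult by (intro mult_left_mono u_comp_bound) auto
    then show ?thesis using cR0[of x] unfolding g_def by linarith
  qed
  have pair: "(LBINT x. g x * V x) = 0" if V: "integrable lborel V" for V
  proof -
    have L: "(\<lambda>N. c0 * (LBINT x. V x * (1 / r N ^ DIM(real^'n) * (LBINT y. \<kappa> ((1 / r N) *\<^sub>R (y - x)) * u y $ i)))) \<longlonglongrightarrow>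
      c0 * (integral\<^sup>L lborel \<kappa> * (LBINT x. u x $ i * V x))"
      by (intro tendsto_mult[OF tendsto_const] approximate_identity_kernel[OF u_comp_meas u_comp_bound V \<kappa>(1) r0 r])
    have e: "c0 * (LBINT x. V x * (1 / r N ^ DIM(real^'n) * (LBINT y. \<kappa> ((1 / r N) *\<^sub>R (y - x)) * u y $ i))) = (LBINT x. V x * R (r N) x)" for N
      unfolding eq[symmetric] by (subst integral_mult_right_zero[symmetric]) (simp add: mult_ac)
    have "(\<lambda>N. LBINT x. V x * R (r N) x) \<longlonglongrightarrow> (LBINT x. V x * R 0 x)"
    proof (rule integral_dominated_convergence[where w = "\<lambda>x. \<bar>V x\<bar> * cR"])
      have [measurable]: "V \<in> borel_measurable borel" using V by auto
      show "(\<lambda>x. V x * R (r N) x) \<in> borel_measurable lborel" "(\<lambda>x. V x * R 0 x) \<in> borel_measurable lborel" for N by measurable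
      show "integrable lborel (\<lambda>x. \<bar>V x\<bar> * cR)" using V by auto
      show "AE x in lborel. (\<lambda>N. V x * R (r N) x) \<longlonglongrightarrow> V x * R 0 x" by (intro AE_I2 tendsto_mult tendsto_const Rl)
      show "AE x in lborel. norm (V x * R (r N) x) \<le> \<bar>V x\<bar> * cR" for N
        by (intro AE_I2) (auto simp: abs_mult intro!: mult_left_mono cR)
    qed
    then have "(LBINT x. V x * R 0 x) = M * (LBINT x. u x $ i * V x)"
      using LIMSEQ_unique[OF L[unfolded e]] M by (simp add: mult.assoc[symmetric])
    moreover have "integrable lborel (\<lambda>x. V x * R 0 x)" by (rule integrable_mult_bounded(1)[OF V Rm(2) cR0])
    moreover have "integrable lborel (\<lambda>x. u x $ i * V x)" by (rule integrable_mult_bounded(2)[OF V u_comp_meas u_comp_bound])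
    moreover have "(\<lambda>x. g x * V x) = (\<lambda>x. M * (u x $ i * V x) - V x * R 0 x)"
      by (auto simp: g_def algebra_simps)
    ultimately show ?thesis by simp
  qed
  have "AE x in lborel. x \<in> cball 0 (real m) \<longrightarrow> g x = 0" for m
  proof -
    have i0: "integrable lborel (indicat_real (cball (0::real^'n) (real m)))"
      using emeasure_lborel_cball_finite[of "0::real^'n"] by (intro integrable_real_indicator) auto
    \<comment> \<open>The sign of g, cut off to a ball, turns the pairing into the integral of |g|
      over that ball.\<close>
    have V: "integrable lborel (\<lambda>x. indicat_real (cball 0 (real m)) x * sgn (g x))"
      by (rule integrable_mult_bounded(1)[OF i0, of _ 1]) (auto simp: sgn_if)
    have i: "integrable lborel (\<lambda>x. indicat_real (cball 0 (real m)) x * \<bar>g x\<bar>)"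
      by (rule integrable_mult_bounded(1)[OF i0, of _ "\<bar>M\<bar> * B + cR"]) (use gb in auto)
    have "(LBINT x. indicat_real (cball 0 (real m)) x * \<bar>g x\<bar>) = (LBINT x. g x * (indicat_real (cball 0 (real m)) x * sgn (g x)))"
      by (rule Bochner_Integration.integral_cong) (auto simp: sgn_if)
    also have "\<dots> = 0" by (rule pair[OF V])
    finally have "AE x in lborel. indicat_real (cball 0 (real m)) x * \<bar>g x\<bar> = 0"
      by (subst (asm) integral_nonneg_eq_0_iff_AE[OF i]) auto
    then show ?thesis by eventually_elim (auto simp: indicator_def)
  qed
  then have "AE x in lborel. \<forall>m. x \<in> cball 0 (real m) \<longrightarrow> g x = 0" by (subst AE_all_countable) blast
  then have "AE x in lborel. g x = 0"
    by eventually_elim (use real_arch_simple in auto)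
  then show ?thesis
    by eventually_elim (simp add: g_def R_def P_def Q_def M_def)
qed

end

section \<open>Potentials of decaying densities\<close>

text \<open>By \<open>hg_cong\<close> the value at the origin is arbitrary, as it is for partial derivatives of the
  Lorentz tensor.\<close>

inductive homog :: "real \<Rightarrow> (real^'n::finite \<Rightarrow> real) \<Rightarrow> bool" where
  hg_powr: "homog d (\<lambda>x. norm x powr d)"
| hg_coord: "homog d g \<Longrightarrow> homog (d + 1) (\<lambda>x. x $ i * g x)"
| hg_scale: "homog d g \<Longrightarrow> homog d (\<lambda>x. c * g x)"
| hg_add: "homog d g \<Longrightarrow> homog d h \<Longrightarrow> homog d (\<lambda>x. g x + h x)"
| hg_cong: "homog d g \<Longrightarrow> h \<in> borel_measurable borel \<Longrightarrow> \<forall>x. x \<noteq> 0 \<longrightarrow> h x = g x \<Longrightarrow> homog d h"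

lemma homog_measurable: "homog d g \<Longrightarrow> g \<in> borel_measurable borel"
proof (induction rule: homog.induct)
  case (hg_coord d g i)
  then show ?case using borel_measurable_nth[of i] by measurable
qed auto

lemma homog_bound: "homog d g \<Longrightarrow> \<exists>C. 0 \<le> C \<and> (\<forall>x. x \<noteq> 0 \<longrightarrow> \<bar>g x\<bar> \<le> C * norm x powr d)"
proof (induction rule: homog.induct)
  case (hg_powr d)
  then show ?case by (intro exI[of _ 1]) auto
next
  case (hg_coord d g i)
  then obtain C where C: "0 \<le> C" "\<And>x. x \<noteq> 0 \<Longrightarrow> \<bar>g x\<bar> \<le> C * norm x powr d" by blast
  have "\<bar>x $ i * g x\<bar> \<le> C * norm x powr (d + 1)" if "x \<noteq> 0" for x
  proof -
    have "\<bar>x $ i * g x\<bar> \<le> norm x * (C * norm x powr d)"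
      unfolding abs_mult using C that by (intro mult_mono component_le_norm_cart) auto
    also have "\<dots> = C * norm x powr (d + 1)" using that by (simp add: powr_add)
    finally show ?thesis .
  qed
  then show ?case using C by blast
next
  case (hg_scale d g c)
  then obtain C where C: "0 \<le> C" "\<And>x. x \<noteq> 0 \<Longrightarrow> \<bar>g x\<bar> \<le> C * norm x powr d" by blast
  then show ?case
    by (intro exI[of _ "\<bar>c\<bar> * C"]) (auto simp: abs_mult mult.assoc intro!: mult_left_mono)
next
  case (hg_add d g h)
  then obtain C C' where C: "0 \<le> C" "\<And>x. x \<noteq> 0 \<Longrightarrow> \<bar>g x\<bar> \<le> C * norm x powr d"
    "0 \<le> C'" "\<And>x. x \<noteq> 0 \<Longrightarrow> \<bar>h x\<bar> \<le> C' * norm x powr d" by blast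
  have "\<bar>g x + h x\<bar> \<le> (C + C') * norm x powr d" if "x \<noteq> 0" for x
    using C(2)[OF that] C(4)[OF that] by (simp add: distrib_right)
  then show ?case using C by (intro exI[of _ "C + C'"]) auto
qed auto

lemma homog_degree: "homog d g \<Longrightarrow> d = d' \<Longrightarrow> homog d' g" by simp

lemma GDERIV_cong_off_0:
  fixes g h :: "real^'n::finite \<Rightarrow> real"
  assumes "GDERIV g x :> D" "x \<noteq> 0" "\<forall>x. x \<noteq> 0 \<longrightarrow> h x = g x"
  shows "GDERIV h x :> D"
  using assms(1) unfolding gderiv_def
  by (rule has_derivative_transform_within_open[of _ _ _ _ "- {0}"]) (use assms(2,3) in auto)

text \<open>The components of the gradient belong to the class again, one degree lower, so an
  estimate for homogeneous functions can be applied to their gradients in turn.\<close>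

lemma homog_gderiv:
  "homog d g \<Longrightarrow> \<exists>G. (\<forall>x. x \<noteq> 0 \<longrightarrow> GDERIV g x :> G x) \<and> (\<forall>k. homog (d - 1) (\<lambda>x. G x $ k))"
proof (induction rule: homog.induct)
  case (hg_powr d)
  have e: "norm x powr d = (x \<bullet> x) powr (d / 2)" for x :: "real^'n" and d
    by (metis dot_square_norm norm_ge_zero powr_numeral powr_powr times_divide_eq_right nonzero_mult_div_cancel_left zero_neq_numeral)
  have G: "GDERIV (\<lambda>x. norm x powr d) x :> (d * norm x powr (d - 2)) *\<^sub>R x" if "x \<noteq> 0" for x :: "real^'n"
  proof -
    have "((\<lambda>s. s powr (d / 2)) has_real_derivative d / 2 * (x \<bullet> x) powr (d / 2 - 1)) (at (x \<bullet> x))"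
      using that by (auto intro!: derivative_eq_intros)
    moreover have "(x \<bullet> x) powr (d / 2 - 1) = norm x powr (d - 2)"
      unfolding e by (simp add: diff_divide_distrib)
    ultimately have "((\<lambda>s. s powr (d / 2)) has_real_derivative d / 2 * norm x powr (d - 2)) (at ((x - 0) \<bullet> (x - 0)))"
      by simp
    from GDERIV_radial[OF this] show ?thesis unfolding e[of _ d] by simp
  qed
  have "homog (d - 1) (\<lambda>x. ((d * norm x powr (d - 2)) *\<^sub>R x) $ k)" for k
  proof -
    have "homog (d - 1) (\<lambda>x. x $ k * (d * norm x powr (d - 2)))"
      by (rule homog_degree[OF hg_coord[OF hg_scale[OF homog.hg_powr]]]) simp
    then show ?thesis by (simp add: mult.commute)
  qed
  then show ?case using G by (intro exI[of _ "\<lambda>x. (d * norm x powr (d - 2)) *\<^sub>R x"]) auto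
next
  case (hg_coord d g i)
  then obtain G where G: "\<And>x. x \<noteq> 0 \<Longrightarrow> GDERIV g x :> G x" "\<And>k. homog (d - 1) (\<lambda>x. G x $ k)" by blast
  have "homog (d + 1 - 1) (\<lambda>x. (x $ i *\<^sub>R G x + g x *\<^sub>R axis i 1) $ k)" for k
  proof -
    have "homog d (\<lambda>x. x $ i * G x $ k + kd i k * g x)"
      by (intro hg_add homog_degree[OF homog.hg_coord[OF G(2)]] hg_scale hg_coord) simp
    then show ?thesis by (cases "i = k") (auto simp: axis_def kd_def mult.commute)
  qed
  moreover have "GDERIV (\<lambda>x. x $ i * g x) x :> x $ i *\<^sub>R G x + g x *\<^sub>R axis i 1" if "x \<noteq> 0" for x
    by (rule GDERIV_mult[OF GDERIV_coord G(1)[OF that]])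
  ultimately show ?case
    by (intro exI[of _ "\<lambda>x. x $ i *\<^sub>R G x + g x *\<^sub>R axis i 1"]) auto
next
  case (hg_scale d g c)
  then obtain G where G: "\<And>x. x \<noteq> 0 \<Longrightarrow> GDERIV g x :> G x" "\<And>k. homog (d - 1) (\<lambda>x. G x $ k)" by blast
  have "GDERIV (\<lambda>x. c * g x) x :> c *\<^sub>R G x" if "x \<noteq> 0" for x
    using GDERIV_mult[OF GDERIV_const G(1)[OF that], of c] by simp
  moreover have "homog (d - 1) (\<lambda>x. (c *\<^sub>R G x) $ k)" for k
    using homog.hg_scale[OF G(2)] by simp
  ultimately show ?case by (intro exI[of _ "\<lambda>x. c *\<^sub>R G x"]) auto
next
  case (hg_add d g h)
  then obtain G H where G: "\<And>x. x \<noteq> 0 \<Longrightarrow> GDERIV g x :> G x" "\<And>k. homog (d - 1) (\<lambda>x. G x $ k)"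
    "\<And>x. x \<noteq> 0 \<Longrightarrow> GDERIV h x :> H x" "\<And>k. homog (d - 1) (\<lambda>x. H x $ k)" by blast
  have "homog (d - 1) (\<lambda>x. (G x + H x) $ k)" for k
    using homog.hg_add[OF G(2) G(4)] by simp
  then show ?case using G by (intro exI[of _ "\<lambda>x. G x + H x"]) (auto intro: GDERIV_add)
next
  case (hg_cong d g h)
  then show ?case using GDERIV_cong_off_0 by metis
qed

section \<open>Taylor estimates for homogeneous kernels\<close>

lemma powr_ratio:
  fixes w x e :: real
  assumes "0 < x" "x / 2 \<le> w" "w \<le> 2 * x"
  shows "w powr e \<le> 2 powr \<bar>e\<bar> * x powr e"
proof (cases "0 \<le> e")
  case True
  then have "w powr e \<le> (2 * x) powr e" using assms by (intro powr_mono2) auto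
  then show ?thesis using assms True by (simp add: powr_mult)
next
  case False
  then have "w powr e \<le> (x / 2) powr e" using assms by (intro powr_mono2') auto
  also have "\<dots> = 2 powr - e * x powr e" using assms by (simp add: powr_divide powr_minus field_simps)
  finally show ?thesis using False by simp
qed

lemma norm_near:
  fixes x w :: "'a::real_normed_vector"
  assumes "norm (w - x) \<le> norm x / 2"
  shows "norm x / 2 \<le> norm w" "norm w \<le> 2 * norm x"
  using assms norm_triangle_ineq2[of x w] norm_triangle_ineq2[of w x] by (auto simp: norm_minus_commute)

lemma GDERIV_difference_bound:
  fixes g :: "real^'n::finite \<Rightarrow> real"
  assumes S: "convex S" "x \<in> S" "y \<in> S" and G: "\<And>w. w \<in> S \<Longrightarrow> GDERIV g w :> G w"
    and b: "\<And>w. w \<in> S \<Longrightarrow> norm (G w) \<le> b"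
  shows "\<bar>g x - g y\<bar> \<le> b * norm (x - y)"
proof -
  have "norm (g x - g y) \<le> b * norm (x - y)"
  proof (rule differentiable_bound[OF S(1) _ _ S(2,3)])
    show "(g has_derivative (\<lambda>h. h \<bullet> G w)) (at w within S)" if "w \<in> S" for w
      using G[OF that] unfolding gderiv_def by (rule has_derivative_at_withinI)
    show "onorm (\<lambda>h. h \<bullet> G w) \<le> b" if "w \<in> S" for w
    proof (rule onorm_le)
      fix h :: "real^'n"
      have "norm (h \<bullet> G w) \<le> norm h * norm (G w)" by (simp add: Cauchy_Schwarz_ineq2)
      also have "\<dots> \<le> b * norm h" using mult_left_mono[OF b[OF that] norm_ge_zero[of h]] by (simp add: mult.commute)
      finally show "norm (h \<bullet> G w) \<le> b * norm h" .
    qed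
  qed
  then show ?thesis by simp
qed

text \<open>On the ball of radius |x|/2 about x every point w satisfies |x|/2 \<le> |w| \<le> 2|x|.
  The origin is avoided, the gradient is of size |x|^(d - 1) throughout, and the mean value
  inequality applies.\<close>

lemma homog_diff0:
  assumes "homog d g"
  shows "\<exists>C. 0 \<le> C \<and> (\<forall>x y. x \<noteq> 0 \<longrightarrow> norm y \<le> norm x / 2 \<longrightarrow> \<bar>g (x - y) - g x\<bar> \<le> C * norm y * norm x powr (d - 1))"
proof -
  obtain G where G: "\<And>x. x \<noteq> 0 \<Longrightarrow> GDERIV g x :> G x" "\<And>k. homog (d - 1) (\<lambda>x. G x $ k)"
    using homog_gderiv[OF assms] by blast
  obtain C where C: "\<And>k. 0 \<le> C k" "\<And>k x. x \<noteq> 0 \<Longrightarrow> \<bar>G x $ k\<bar> \<le> C k * norm x powr (d - 1)"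
    using homog_bound[OF G(2)] by metis
  define K where "K = (\<Sum>k\<in>UNIV. C k) * 2 powr \<bar>d - 1\<bar>"
  have K0: "0 \<le> K" unfolding K_def by (intro mult_nonneg_nonneg sum_nonneg C) auto
  have "\<bar>g (x - y) - g x\<bar> \<le> K * norm y * norm x powr (d - 1)" if x: "x \<noteq> 0" and y: "norm y \<le> norm x / 2" for x y
  proof -
    have w: "w \<noteq> 0" "norm (G w) \<le> K * norm x powr (d - 1)" if "w \<in> cball x (norm x / 2)" for w
    proof -
      have n: "norm x / 2 \<le> norm w" "norm w \<le> 2 * norm x"
        using norm_near[of w x] that by (auto simp: dist_norm norm_minus_commute)
      then show "w \<noteq> 0" using x by auto
      have "norm (G w) \<le> (\<Sum>k\<in>UNIV. \<bar>G w $ k\<bar>)" by (rule norm_le_l1_cart)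
      also have "\<dots> \<le> (\<Sum>k\<in>UNIV. C k * norm w powr (d - 1))" by (intro sum_mono C \<open>w \<noteq> 0\<close>)
      also have "\<dots> \<le> (\<Sum>k\<in>UNIV. C k * (2 powr \<bar>d - 1\<bar> * norm x powr (d - 1)))"
        using n x by (intro sum_mono mult_left_mono C powr_ratio) auto
      finally show "norm (G w) \<le> K * norm x powr (d - 1)" by (simp add: K_def sum_distrib_right mult.assoc)
    qed
    have "\<bar>g (x - y) - g x\<bar> \<le> K * norm x powr (d - 1) * norm (x - y - x)"
      by (rule GDERIV_difference_bound[of "cball x (norm x / 2)" _ _ _ G]) (use y in \<open>auto simp: dist_norm intro!: G w\<close>)
    then show ?thesis by (simp add: mult_ac)
  qed
  then show ?thesis using K0 by blast
qed

text \<open>The function w \<mapsto> g(w) - w \<bullet> G(x) has gradient G(w) - G(x), and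
  \<open>homog_diff0\<close> applied to the components of G bounds this by |y| |x|^(d - 2). The mean
  value inequality adds the second factor |y|; no Hessian has to be written down.\<close>

lemma homog_diff1:
  assumes "homog d g" and G: "\<And>x. x \<noteq> 0 \<Longrightarrow> GDERIV g x :> G x"
  shows "\<exists>C. 0 \<le> C \<and> (\<forall>x y. x \<noteq> 0 \<longrightarrow> norm y \<le> norm x / 2 \<longrightarrow>
    \<bar>g (x - y) - (g x - y \<bullet> G x)\<bar> \<le> C * (norm y)\<^sup>2 * norm x powr (d - 2))"
proof -
  obtain G' where G': "\<And>x. x \<noteq> 0 \<Longrightarrow> GDERIV g x :> G' x" "\<And>k. homog (d - 1) (\<lambda>x. G' x $ k)"
    using homog_gderiv[OF assms(1)] by blast
  have GG: "G x = G' x" if "x \<noteq> 0" for x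
    using partial_deriv_gderiv[OF G[OF that]] partial_deriv_gderiv[OF G'(1)[OF that]] by (metis vec_eq_iff)
  have dd: "d - 1 - 1 = d - 2" by simp
  obtain C where C: "\<And>k. 0 \<le> C k" "\<And>k x y. x \<noteq> 0 \<Longrightarrow> norm y \<le> norm x / 2 \<Longrightarrow> \<bar>G' (x - y) $ k - G' x $ k\<bar> \<le> C k * norm y * norm x powr (d - 2)"
    using homog_diff0[OF G'(2), unfolded dd] by metis
  define K where "K = (\<Sum>k\<in>UNIV. C k)"
  have K0: "0 \<le> K" unfolding K_def by (intro sum_nonneg C)
  have "\<bar>g (x - y) - (g x - y \<bullet> G x)\<bar> \<le> K * (norm y)\<^sup>2 * norm x powr (d - 2)" if x: "x \<noteq> 0" and y: "norm y \<le> norm x / 2" for x y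
  proof -
    define h where "h w = g w - w \<bullet> G' x" for w
    have near: "norm (w - x) \<le> norm x / 2" "norm (x - w) \<le> norm y" if "w \<in> cball x (norm y)" for w
      using that y by (auto simp: dist_norm norm_minus_commute)
    have ne: "w \<noteq> 0" if "w \<in> cball x (norm y)" for w
      using norm_near[OF near(1)[OF that]] x by auto
    have hd: "GDERIV h w :> G' w - G' x" if "w \<in> cball x (norm y)" for w
    proof -
      have "GDERIV (\<lambda>w. w \<bullet> G' x) w :> G' x"
        unfolding gderiv_def by (auto intro!: derivative_eq_intros)
      then show ?thesis unfolding h_def using GDERIV_diff[OF G'(1)[OF ne[OF that]]] by blast
    qed
    have hb: "norm (G' w - G' x) \<le> K * norm y * norm x powr (d - 2)" if "w \<in> cball x (norm y)" for w
    proof -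
      have "norm (G' w - G' x) \<le> (\<Sum>k\<in>UNIV. \<bar>(G' w - G' x) $ k\<bar>)" by (rule norm_le_l1_cart)
      also have "\<dots> \<le> (\<Sum>k\<in>UNIV. C k * norm y * norm x powr (d - 2))"
      proof (rule sum_mono)
        fix k
        have "\<bar>G' (x - (x - w)) $ k - G' x $ k\<bar> \<le> C k * norm (x - w) * norm x powr (d - 2)"
          using near[OF that] y by (intro C(2)[OF x]) (auto simp: norm_minus_commute)
        also have "\<dots> \<le> C k * norm y * norm x powr (d - 2)"
          using near(2)[OF that] C(1) by (intro mult_right_mono mult_left_mono) auto
        finally show "\<bar>(G' w - G' x) $ k\<bar> \<le> C k * norm y * norm x powr (d - 2)" by simp
      qed
      finally show ?thesis by (simp add: K_def sum_distrib_right)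
    qed
    have "\<bar>h (x - y) - h x\<bar> \<le> K * norm y * norm x powr (d - 2) * norm (x - y - x)"
      by (rule GDERIV_difference_bound[of "cball x (norm y)" _ _ _ "\<lambda>w. G' w - G' x"]) (auto simp: dist_norm intro!: hd hb)
    then show ?thesis by (simp add: h_def GG[OF x] inner_diff_left power2_eq_square mult_ac algebra_simps)
  qed
  then show ?thesis using K0 by blast
qed

text \<open>The linear terms of the expansions at x - y and x + y cancel.\<close>

lemma homog_diff2:
  assumes "homog d g"
  shows "\<exists>C. 0 \<le> C \<and> (\<forall>x y. x \<noteq> 0 \<longrightarrow> norm y \<le> norm x / 2 \<longrightarrow>
    \<bar>g (x - y) + g (x + y) - 2 * g x\<bar> \<le> C * (norm y)\<^sup>2 * norm x powr (d - 2))"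
proof -
  obtain G where G: "\<And>x. x \<noteq> 0 \<Longrightarrow> GDERIV g x :> G x" using homog_gderiv[OF assms] by blast
  obtain C where C: "0 \<le> C" "\<And>x y. x \<noteq> 0 \<Longrightarrow> norm y \<le> norm x / 2 \<Longrightarrow>
    \<bar>g (x - y) - (g x - y \<bullet> G x)\<bar> \<le> C * (norm y)\<^sup>2 * norm x powr (d - 2)"
    using homog_diff1[OF assms G] by blast
  have "\<bar>g (x - y) + g (x + y) - 2 * g x\<bar> \<le> 2 * C * (norm y)\<^sup>2 * norm x powr (d - 2)"
    if "x \<noteq> 0" "norm y \<le> norm x / 2" for x y
    using C(2)[OF that] C(2)[of x "- y"] that by simp
  then show ?thesis using C(1) by (intro exI[of _ "2 * C"]) auto
qed

section \<open>Densities with power decay\<close>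

text \<open>The size A is separate from the exponent b because every estimate is linear in A, which
  will be a multiple of \<epsilon>. The bound is almost everywhere since, in the bootstrap, the
  remainder of u \<otimes> u is controlled by an expansion of u that holds only almost
  everywhere.\<close>

definition decays :: "(real^'n::finite \<Rightarrow> real) \<Rightarrow> real \<Rightarrow> real \<Rightarrow> bool" where
  "decays F A b \<longleftrightarrow> F \<in> borel_measurable borel \<and> (AE y in lborel. \<bar>F y\<bar> \<le> A * bracket y powr - b)"

lemma integral_le_bound:
  fixes h W :: "'a \<Rightarrow> real"
  assumes "h \<in> borel_measurable M" "integrable M W" "AE y in M. \<bar>h y\<bar> \<le> W y"
  shows "integrable M h" "(\<integral>y. h y \<partial>M) \<le> (\<integral>y. W y \<partial>M)"
proof -
  show i: "integrable M h"
    by (rule Bochner_Integration.integrable_bound[OF assms(2,1)]) (use assms(3) in auto)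
  show "(\<integral>y. h y \<partial>M) \<le> (\<integral>y. W y \<partial>M)"
    using assms(3) by (intro integral_mono_AE i assms(2)) auto
qed

text \<open>Lebesgue measure is not the null measure, so the bound holds at some point at
  least.\<close>

lemma decays_nonneg:
  assumes "decays (F :: real^'n::finite \<Rightarrow> real) A b"
  shows "0 \<le> A"
proof -
  have "\<exists>y::real^'n. \<bar>F y\<bar> \<le> A * bracket y powr - b"
  proof (rule ccontr)
    assume "\<nexists>y. \<bar>F y\<bar> \<le> A * bracket y powr - b"
    then have "AE y in (lborel :: (real^'n) measure). False"
      using assms unfolding decays_def by (auto elim: eventually_mono)
    then have "ae_filter (lborel :: (real^'n) measure) = bot" by (simp add: trivial_limit_def)
    then show False by (simp add: ae_filter_eq_bot_iff)
  qed
  then obtain y where "\<bar>F y\<bar> \<le> A * bracket y powr - b" by blast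
  then have "0 \<le> A * bracket y powr - b" by linarith
  then show ?thesis using bracket_pos[of y] by (simp add: zero_le_mult_iff)
qed

lemma decays_mono:
  assumes "decays F A b" "b' \<le> b"
  shows "decays F A b'"
proof -
  have "A * bracket y powr - b \<le> A * bracket y powr - b'" for y
    using decays_nonneg[OF assms(1)] bracket_ge_1[of y] assms(2) by (intro mult_left_mono powr_mono) auto
  then show ?thesis using assms(1) unfolding decays_def by (auto elim!: eventually_mono intro: order_trans)
qed

lemma decays_moment_integrable:
  fixes F :: "real^'n::finite \<Rightarrow> real"
  assumes "decays F A b" "real CARD('n) + real m < b"
  shows "integrable lborel (\<lambda>y. norm y ^ m * F y)"
proof (rule integral_le_bound(1))
  have [measurable]: "F \<in> borel_measurable borel" using assms by (simp add: decays_def)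
  show "(\<lambda>y. norm y ^ m * F y) \<in> borel_measurable lborel" by measurable
  show "integrable lborel (\<lambda>y::real^'n. A * bracket y powr (real m - b))"
    using assms by (intro integrable_mult_right integrable_bracket_powr) auto
  have "AE y in lborel. \<bar>F y\<bar> \<le> A * bracket y powr - b" using assms by (simp add: decays_def)
  then show "AE y in lborel. \<bar>norm y ^ m * F y\<bar> \<le> A * bracket y powr (real m - b)"
  proof eventually_elim
    case (elim y)
    have "\<bar>norm y ^ m * F y\<bar> \<le> bracket y ^ m * (A * bracket y powr - b)"
      unfolding abs_mult using elim norm_le_bracket[of y] bracket_pos[of y] by (intro mult_mono) (auto simp: power_mono)
    also have "\<dots> = A * bracket y powr (real m - b)"
      using bracket_pos[of y] by (simp add: powr_realpow[symmetric] powr_add[symmetric])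
    finally show ?case .
  qed
qed

lemma decays_integrable: "decays (F :: real^'n::finite \<Rightarrow> real) A b \<Longrightarrow> real CARD('n) < b \<Longrightarrow> integrable lborel F"
  using decays_moment_integrable[of F A b 0] by simp

section \<open>Contributions of |y| \<ge> |x|/2 and of |y| < |x|/2\<close>

abbreviation far :: "real^'n::finite \<Rightarrow> real^'n \<Rightarrow> real" where
  "far x y \<equiv> indicator {y. norm x / 2 \<le> norm y} y"

abbreviation near :: "real^'n::finite \<Rightarrow> real^'n \<Rightarrow> real" where
  "near x y \<equiv> indicator {y. norm y < norm x / 2} y"

lemma half_powr: "0 \<le> x \<Longrightarrow> (x / 2 :: real) powr e = 2 powr - e * x powr e"
  by (simp add: powr_divide powr_minus_divide)

text \<open>The order of the quantifiers matters, here and in the estimates that follow: C is fixed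
  before F, A and x, so the final error is uniform over all solutions.\<close>

lemma far_moment:
  assumes "real CARD('n::finite) + real m < b"
  shows "\<exists>C\<ge>0. \<forall>F A (x::real^'n). decays F A b \<longrightarrow> 1 \<le> norm x \<longrightarrow>
    integrable lborel (\<lambda>y. far x y * \<bar>norm y ^ m * F y\<bar>) \<and>
    (LBINT y. far x y * \<bar>norm y ^ m * F y\<bar>) \<le> C * A * norm x powr (real CARD('n) + real m - b)"
proof -
  let ?n = "real CARD('n)"
  define p where "p = real m - b"
  define K where "K = sphere_area TYPE(real^'n) / - (?n + p)"
  have p: "p < - ?n" using assms by (simp add: p_def)
  have K0: "0 \<le> K" using p unfolding K_def by (intro divide_nonneg_nonneg) auto
  have main: "integrable lborel (\<lambda>y. far x y * \<bar>norm y ^ m * F y\<bar>) \<and>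
    (LBINT y. far x y * \<bar>norm y ^ m * F y\<bar>) \<le> (K * 2 powr - (?n + p)) * A * norm x powr (?n + real m - b)"
    if F: "decays F A b" and x: "1 \<le> norm x" for F A and x :: "real^'n"
  proof -
    have [measurable]: "F \<in> borel_measurable borel" using F by (simp add: decays_def)
    have A: "0 \<le> A" by (rule decays_nonneg[OF F])
    have ib: "has_bochner_integral lborel (\<lambda>y::real^'n. far x y * norm y powr p) (K * (norm x / 2) powr (?n + p))"
    proof -
      have "0 < norm x / 2" using x by linarith
      then show ?thesis
        using has_bochner_integral_powr_outside[where 'a = "real^'n", of p "norm x / 2"] p by (simp add: K_def)
    qed
    have m: "(\<lambda>y. far x y * \<bar>norm y ^ m * F y\<bar>) \<in> borel_measurable lborel" by measurable
    have w: "integrable lborel (\<lambda>y. A * (far x y * norm y powr p))"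
      using ib by (intro integrable_mult_right) (auto simp: has_bochner_integral_iff)
    have le: "AE y in lborel. \<bar>far x y * \<bar>norm y ^ m * F y\<bar>\<bar> \<le> A * (far x y * norm y powr p)"
    proof -
      have "AE y in lborel. \<bar>F y\<bar> \<le> A * bracket y powr - b" using F by (simp add: decays_def)
      then show ?thesis
      proof eventually_elim
        case (elim y)
        show ?case
        proof (cases "norm x / 2 \<le> norm y")
          case True
          then have y: "0 < norm y" using x by linarith
          have "\<bar>norm y ^ m * F y\<bar> \<le> norm y ^ m * (A * norm y powr - b)"
          proof -
            have "bracket y powr - b \<le> norm y powr - b"
              using y norm_le_bracket[of y] assms by (intro powr_mono2') auto
            then show ?thesis unfolding abs_mult using elim A
              by (intro mult_mono) (auto elim!: order_trans intro!: mult_left_mono)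
          qed
          also have "\<dots> = A * norm y powr p"
            using y by (simp add: p_def powr_realpow[symmetric] powr_add[symmetric])
          finally show ?thesis using True by (simp add: indicator_def)
        qed (simp add: indicator_def)
      qed
    qed
    have "(LBINT y. far x y * \<bar>norm y ^ m * F y\<bar>) \<le> (LBINT y. A * (far x y * norm y powr p))"
      by (rule integral_le_bound(2)[OF m w le])
    also have "\<dots> = A * (K * (norm x / 2) powr (?n + p))" using ib by (simp add: has_bochner_integral_iff)
    also have "\<dots> = (K * 2 powr - (?n + p)) * A * norm x powr (?n + real m - b)"
    proof -
      have e: "?n + p = ?n + real m - b" by (simp add: p_def)
      show ?thesis unfolding half_powr[OF norm_ge_zero] e by (simp only: mult_ac)
    qed
    finally show ?thesis using integral_le_bound(1)[OF m w le] by blast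
  qed
  have K: "0 \<le> K * 2 powr - (?n + p)" using K0 by simp
  show ?thesis
    by (rule exI[of _ "K * 2 powr - (?n + p)"])
      (intro conjI allI impI K, (rule main[THEN conjunct1]; assumption), (rule main[THEN conjunct2]; assumption))
qed

text \<open>Let \<rho> = |x|/2 and |y| \<ge> \<rho>. Within distance \<rho> of x the density is at
  most A \<rho>^(-b) and the kernel is integrable since d > -n; elsewhere the kernel is at most C
  \<rho>^d and the density has an integrable tail since b > n. Both parts give \<rho>^(n + d - b).
  For |y| < \<rho> the kernel stays away from its singularity, which gives integrability over the
  whole space.\<close>

lemma far_kernel:
  assumes g: "homog d g" and d: "- real CARD('n) < d" "d \<le> 0" and b: "real CARD('n) < b"
  shows "\<exists>C\<ge>0. \<forall>F A (x::real^'n::finite). decays F A b \<longrightarrow> 1 \<le> norm x \<longrightarrow>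
    integrable lborel (\<lambda>y. g (x - y) * F y) \<and>
    (LBINT y. far x y * \<bar>g (x - y) * F y\<bar>) \<le> C * A * norm x powr (real CARD('n) + d - b)"
proof -
  let ?n = "real CARD('n)"
  have gm [measurable]: "g \<in> borel_measurable borel" by (rule homog_measurable[OF g])
  obtain C where C: "0 \<le> C" "\<And>x. x \<noteq> 0 \<Longrightarrow> \<bar>g x\<bar> \<le> C * norm x powr d" using homog_bound[OF g] by blast
  define K1 where "K1 = sphere_area TYPE(real^'n) / (?n + d)"
  define K2 where "K2 = sphere_area TYPE(real^'n) / - (?n - b)"
  have K0: "0 \<le> K1" "0 \<le> K2" using d b unfolding K1_def K2_def by (auto intro!: divide_nonneg_nonneg)
  define K where "K = C * (K1 + K2) * 2 powr - (?n + d - b)"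
  have main: "integrable lborel (\<lambda>y. g (x - y) * F y) \<and>
    (LBINT y. far x y * \<bar>g (x - y) * F y\<bar>) \<le> K * A * norm x powr (?n + d - b)"
    if F: "decays F A b" and x: "1 \<le> norm x" for F A and x :: "real^'n"
  proof -
    define \<rho> where "\<rho> = norm x / 2"
    have \<rho>: "0 < \<rho>" using x unfolding \<rho>_def by linarith
    have Fm [measurable]: "F \<in> borel_measurable borel" using F by (simp add: decays_def)
    have A: "0 \<le> A" by (rule decays_nonneg[OF F])
    define k where "k z = indicator (cball 0 \<rho>) z * norm z powr d" for z :: "real^'n"
    have kb: "has_bochner_integral lborel k (K1 * \<rho> powr (?n + d))"
      using has_bochner_integral_powr_cball[where 'a = "real^'n", of d \<rho>] d \<rho> by (simp add: K1_def k_def[abs_def])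
    have km: "k \<in> borel_measurable borel" using borel_measurable_has_bochner_integral[OF kb] by simp
    from kb have k: "integrable lborel (\<lambda>y. k (x - y))" "(LBINT y. k (x - y)) = K1 * \<rho> powr (?n + d)"
      using integrable_lborel_reflect[OF km, of x] integral_lborel_reflect[OF km, of x] by (auto simp: has_bochner_integral_iff)
    have o: "has_bochner_integral lborel (\<lambda>y::real^'n. far x y * norm y powr - b) (K2 * \<rho> powr (?n - b))"
      using has_bochner_integral_powr_outside[where 'a = "real^'n", of "- b" "\<rho>"] b \<rho> by (simp add: K2_def \<rho>_def)
    define W where "W y = C * A * (\<rho> powr - b * k (x - y) + \<rho> powr d * (far x y * norm y powr - b))" for y
    have W: "integrable lborel W"
      unfolding W_def using k o by (intro integrable_mult_right Bochner_Integration.integrable_add) (auto simp: has_bochner_integral_iff)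
    have Fb: "AE y in lborel. \<bar>F y\<bar> \<le> A * bracket y powr - b" using F by (simp add: decays_def)
    have ne: "AE y in lborel. y \<noteq> x" by (rule AE_lborel_singleton)
    have le: "AE y in lborel. \<bar>far x y * \<bar>g (x - y) * F y\<bar>\<bar> \<le> W y"
      using Fb ne
    proof eventually_elim
      case (elim y)
      have k0: "0 \<le> k (x - y)" by (simp add: k_def)
      show ?case
      proof (cases "\<rho> \<le> norm y")
        case True
        then have y: "0 < norm y" using \<rho> by linarith
        have br: "bracket y powr - b \<le> norm y powr - b" "norm y powr - b \<le> \<rho> powr - b"
          using y norm_le_bracket[of y] b True \<rho> by (auto intro!: powr_mono2')
        have "\<bar>g (x - y) * F y\<bar> \<le> (C * norm (x - y) powr d) * (A * bracket y powr - b)"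
          unfolding abs_mult using elim C by (intro mult_mono) auto
        also have "\<dots> = C * A * (norm (x - y) powr d * bracket y powr - b)" by simp
        also have "norm (x - y) powr d * bracket y powr - b \<le> \<rho> powr - b * k (x - y) + \<rho> powr d * norm y powr - b"
        proof (cases "norm (x - y) \<le> \<rho>")
          case True
          then have "norm (x - y) powr d * bracket y powr - b \<le> k (x - y) * \<rho> powr - b"
            using br by (simp add: k_def indicator_def mult_left_mono)
          then show ?thesis by (simp add: mult.commute add_increasing2)
        next
          case False
          then have "norm (x - y) powr d \<le> \<rho> powr d" using d \<rho> by (intro powr_mono2') auto
          then have "norm (x - y) powr d * bracket y powr - b \<le> \<rho> powr d * norm y powr - b"
            using br by (intro mult_mono) auto
          then show ?thesis using k0 by (simp add: add_increasing)
        qed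
        finally show ?thesis using True C(1) A by (simp add: W_def \<rho>_def indicator_def mult_left_mono)
      next
        case False
        then show ?thesis using k0 C(1) A by (simp add: W_def \<rho>_def indicator_def)
      qed
    qed
    have m: "(\<lambda>y. far x y * \<bar>g (x - y) * F y\<bar>) \<in> borel_measurable lborel" by measurable
    have "(LBINT y. far x y * \<bar>g (x - y) * F y\<bar>) \<le> (LBINT y. W y)"
      by (rule integral_le_bound(2)[OF m W le])
    also have "\<dots> = C * A * (\<rho> powr - b * (K1 * \<rho> powr (?n + d)) + \<rho> powr d * (K2 * \<rho> powr (?n - b)))"
      unfolding W_def using k o by (simp add: has_bochner_integral_iff)
    also have "\<dots> = C * A * ((K1 + K2) * \<rho> powr (?n + d - b))"
    proof -
      have "\<rho> powr - b * \<rho> powr (?n + d) = \<rho> powr (?n + d - b)" "\<rho> powr d * \<rho> powr (?n - b) = \<rho> powr (?n + d - b)"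
        by (simp_all add: powr_add[symmetric] algebra_simps)
      then show ?thesis by (simp add: distrib_right mult.left_commute[of _ K1] mult.left_commute[of _ K2])
    qed
    also have "\<dots> = K * A * norm x powr (?n + d - b)"
      unfolding K_def \<rho>_def half_powr[OF norm_ge_zero] by (simp only: mult_ac)
    finally have 1: "(LBINT y. far x y * \<bar>g (x - y) * F y\<bar>) \<le> K * A * norm x powr (?n + d - b)" .
    have Fi: "integrable lborel F" by (rule decays_integrable[OF F b])
    have 2: "integrable lborel (\<lambda>y. g (x - y) * F y)"
    proof (rule integral_le_bound(1))
      show "integrable lborel (\<lambda>y. W y + C * \<rho> powr d * \<bar>F y\<bar>)"
        using W Fi by (intro Bochner_Integration.integrable_add integrable_mult_right integrable_abs)
      show "AE y in lborel. \<bar>g (x - y) * F y\<bar> \<le> W y + C * \<rho> powr d * \<bar>F y\<bar>"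
        using le
      proof eventually_elim
        case (elim y)
        show ?case
        proof (cases "\<rho> \<le> norm y")
          case True
          then show ?thesis using elim C(1) by (simp add: \<rho>_def indicator_def add_increasing2)
        next
          case False
          then have "norm x - norm y \<ge> \<rho>" by (simp add: \<rho>_def)
          then have "norm (x - y) \<ge> \<rho>" using norm_triangle_ineq2[of x y] by linarith
          then have "norm (x - y) powr d \<le> \<rho> powr d" using d \<rho> by (intro powr_mono2') auto
          moreover have "x - y \<noteq> 0" using \<open>norm (x - y) \<ge> \<rho>\<close> \<rho> by auto
          ultimately have "\<bar>g (x - y)\<bar> \<le> C * \<rho> powr d" using C by (meson mult_left_mono order_trans)
          then have "\<bar>g (x - y) * F y\<bar> \<le> C * \<rho> powr d * \<bar>F y\<bar>" unfolding abs_mult by (rule mult_right_mono) simp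
          moreover have "0 \<le> W y" using C(1) A by (simp add: W_def k_def)
          ultimately show ?thesis by linarith
        qed
      qed
    qed measurable
    show ?thesis using 1 2 by blast
  qed
  have K: "0 \<le> K" unfolding K_def using K0 C(1) by (intro mult_nonneg_nonneg) auto
  show ?thesis
    by (rule exI[of _ K])
      (intro conjI allI impI K, (rule main[THEN conjunct1]; assumption), (rule main[THEN conjunct2]; assumption))
qed

lemma near_moment_conv:
  assumes p: "0 \<le> p" and b: "real CARD('n::finite) + p < b"
  shows "\<exists>C\<ge>0. \<forall>F A (x::real^'n). decays F A b \<longrightarrow>
    integrable lborel (\<lambda>y. near x y * (norm y powr p * \<bar>F y\<bar>)) \<and>
    (LBINT y. near x y * (norm y powr p * \<bar>F y\<bar>)) \<le> C * A"
proof -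
  define C where "C = (LBINT y. bracket (y::real^'n) powr (p - b))"
  have C0: "0 \<le> C" unfolding C_def by (intro integral_nonneg_AE) auto
  have main: "integrable lborel (\<lambda>y. near x y * (norm y powr p * \<bar>F y\<bar>)) \<and>
    (LBINT y. near x y * (norm y powr p * \<bar>F y\<bar>)) \<le> C * A" if F: "decays F A b" for F A and x :: "real^'n"
  proof -
    have [measurable]: "F \<in> borel_measurable borel" using F by (simp add: decays_def)
    have m: "(\<lambda>y. near x y * (norm y powr p * \<bar>F y\<bar>)) \<in> borel_measurable lborel" by measurable
    have w: "integrable lborel (\<lambda>y::real^'n. A * bracket y powr (p - b))"
      using b by (intro integrable_mult_right integrable_bracket_powr) auto
    have le: "AE y in lborel. \<bar>near x y * (norm y powr p * \<bar>F y\<bar>)\<bar> \<le> A * bracket y powr (p - b)"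
    proof -
      have "AE y in lborel. \<bar>F y\<bar> \<le> A * bracket y powr - b" using F by (simp add: decays_def)
      then show ?thesis
      proof eventually_elim
        case (elim y)
        have "\<bar>near x y * (norm y powr p * \<bar>F y\<bar>)\<bar> \<le> 1 * (bracket y powr p * (A * bracket y powr - b))"
          unfolding abs_mult using elim p norm_le_bracket[of y] by (intro mult_mono) (auto simp: indicator_def intro!: powr_mono2)
        also have "\<dots> = A * (bracket y powr p * bracket y powr - b)" by simp
        also have "\<dots> = A * bracket y powr (p - b)" by (simp only: powr_add[symmetric]) simp
        finally show ?case .
      qed
    qed
    show ?thesis using integral_le_bound[OF m w le] by (simp add: C_def mult.commute)
  qed
  show ?thesis
    by (rule exI[of _ C])
      (intro conjI allI impI C0, (rule main[THEN conjunct1]; assumption), (rule main[THEN conjunct2]; assumption))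
qed

text \<open>Below the critical exponent \<open>bracket y\<close> may be replaced by |y|: the
  resulting singularity |y|^(p - b) at the origin is integrable because p - b > -n, and the growth
  comes from the outer radius.\<close>

lemma near_moment_div:
  assumes p: "0 \<le> p" and b: "0 \<le> b" "b < real CARD('n::finite) + p"
  shows "\<exists>C\<ge>0. \<forall>F A (x::real^'n). decays F A b \<longrightarrow>
    integrable lborel (\<lambda>y. near x y * (norm y powr p * \<bar>F y\<bar>)) \<and>
    (LBINT y. near x y * (norm y powr p * \<bar>F y\<bar>)) \<le> C * A * norm x powr (real CARD('n) + p - b)"
proof -
  let ?e = "real CARD('n) + p - b"
  define K where "K = sphere_area TYPE(real^'n) / ?e"
  have K0: "0 \<le> K" unfolding K_def using b by (intro divide_nonneg_nonneg) auto
  have main: "integrable lborel (\<lambda>y. near x y * (norm y powr p * \<bar>F y\<bar>)) \<and>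
    (LBINT y. near x y * (norm y powr p * \<bar>F y\<bar>)) \<le> (K * 2 powr - ?e) * A * norm x powr ?e" if F: "decays F A b" for F A and x :: "real^'n"
  proof -
    have [measurable]: "F \<in> borel_measurable borel" using F by (simp add: decays_def)
    have A: "0 \<le> A" by (rule decays_nonneg[OF F])
    have e: "real CARD('n) + (p - b) = ?e" by simp
    have ib: "has_bochner_integral lborel (\<lambda>y::real^'n. indicator (cball 0 (norm x / 2)) y * norm y powr (p - b)) (K * (norm x / 2) powr ?e)"
      using has_bochner_integral_powr_cball[where 'a = "real^'n", of "p - b" "norm x / 2"] b by (simp add: K_def algebra_simps)
    have m: "(\<lambda>y. near x y * (norm y powr p * \<bar>F y\<bar>)) \<in> borel_measurable lborel" by measurable
    have w: "integrable lborel (\<lambda>y::real^'n. A * (indicator (cball 0 (norm x / 2)) y * norm y powr (p - b)))"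
      using ib by (intro integrable_mult_right) (auto simp: has_bochner_integral_iff)
    have le: "AE y in lborel. \<bar>near x y * (norm y powr p * \<bar>F y\<bar>)\<bar> \<le> A * (indicator (cball 0 (norm x / 2)) y * norm y powr (p - b))"
    proof -
      have "AE y in lborel. \<bar>F y\<bar> \<le> A * bracket y powr - b" using F by (simp add: decays_def)
      moreover have "AE y in lborel. y \<noteq> (0::real^'n)" by (rule AE_lborel_singleton)
      ultimately show ?thesis
      proof eventually_elim
        case (elim y)
        have "bracket y powr - b \<le> norm y powr - b" using elim(2) b norm_le_bracket[of y] by (intro powr_mono2') auto
        then have F': "\<bar>F y\<bar> \<le> A * norm y powr - b" using elim(1) A by (meson mult_left_mono order_trans)
        have "\<bar>near x y * (norm y powr p * \<bar>F y\<bar>)\<bar> \<le> indicator (cball 0 (norm x / 2)) y * (norm y powr p * (A * norm y powr - b))"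
          unfolding abs_mult using F' by (intro mult_mono) (auto simp: indicator_def)
        also have "\<dots> = A * (indicator (cball 0 (norm x / 2)) y * (norm y powr p * norm y powr - b))" by simp
        also have "\<dots> = A * (indicator (cball 0 (norm x / 2)) y * norm y powr (p - b))" by (simp only: powr_add[symmetric]) simp
        finally show ?case .
      qed
    qed
    have "(LBINT y. near x y * (norm y powr p * \<bar>F y\<bar>)) \<le> A * (K * (norm x / 2) powr ?e)"
      using integral_le_bound(2)[OF m w le] ib by (simp add: has_bochner_integral_iff)
    also have "\<dots> = (K * 2 powr - ?e) * A * norm x powr ?e"
      unfolding half_powr[OF norm_ge_zero] by (simp only: mult_ac)
    finally show ?thesis using integral_le_bound(1)[OF m w le] by blast
  qed
  have K: "0 \<le> K * 2 powr - ?e" using K0 by simp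
  show ?thesis
    by (rule exI[of _ "K * 2 powr - ?e"])
      (intro conjI allI impI K, (rule main[THEN conjunct1]; assumption), (rule main[THEN conjunct2]; assumption))
qed

text \<open>The critical exponent, where the integrand behaves like |y|^(-n) on 1 \<le> |y| \<le>
  |x|. This is the origin of the logarithm in \<open>decay\<close>; the unit ball is split off
  because the bound |y|^(-n) is not integrable at the origin.\<close>

lemma near_moment_log:
  assumes p: "0 \<le> p"
  shows "\<exists>C\<ge>0. \<forall>F A (x::real^'n::finite). decays F A (real CARD('n) + p) \<longrightarrow> 1 \<le> norm x \<longrightarrow>
    integrable lborel (\<lambda>y. near x y * (norm y powr p * \<bar>F y\<bar>)) \<and>
    (LBINT y. near x y * (norm y powr p * \<bar>F y\<bar>)) \<le> C * A * (1 + ln (norm x))"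
proof -
  let ?b = "real CARD('n) + p"
  define v where "v = (LBINT y. indicator (cball (0::real^'n) 1) y :: real)"
  define K where "K = max v (sphere_area TYPE(real^'n))"
  have i1: "integrable lborel (indicator (cball (0::real^'n) 1) :: _ \<Rightarrow> real)"
    using emeasure_lborel_cball_finite[of "0::real^'n" 1] by (intro integrable_real_indicator) auto
  have main: "integrable lborel (\<lambda>y. near x y * (norm y powr p * \<bar>F y\<bar>)) \<and>
    (LBINT y. near x y * (norm y powr p * \<bar>F y\<bar>)) \<le> K * A * (1 + ln (norm x))"
    if F: "decays F A ?b" and x: "1 \<le> norm x" for F A and x :: "real^'n"
  proof -
    have [measurable]: "F \<in> borel_measurable borel" using F by (simp add: decays_def)
    have A: "0 \<le> A" by (rule decays_nonneg[OF F])
    have ib: "has_bochner_integral lborel (\<lambda>y::real^'n. indicator {y. 1 \<le> norm y \<and> norm y \<le> norm x} y * norm y powr - real CARD('n)) (sphere_area TYPE(real^'n) * ln (norm x))"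
      using has_bochner_integral_powr_log[where 'a = "real^'n", OF x] by simp
    have m: "(\<lambda>y. near x y * (norm y powr p * \<bar>F y\<bar>)) \<in> borel_measurable lborel" by measurable
    define W where "W y = A * (indicator (cball 0 1) y + indicator {y. 1 \<le> norm y \<and> norm y \<le> norm x} y * norm y powr - real CARD('n))" for y :: "real^'n"
    have w: "integrable lborel W"
      unfolding W_def using i1 ib by (intro integrable_mult_right Bochner_Integration.integrable_add) (auto simp: has_bochner_integral_iff)
    have le: "AE y in lborel. \<bar>near x y * (norm y powr p * \<bar>F y\<bar>)\<bar> \<le> W y"
    proof -
      have "AE y in lborel. \<bar>F y\<bar> \<le> A * bracket y powr - ?b" using F by (simp add: decays_def)
      moreover have "AE y in lborel. y \<noteq> (0::real^'n)" by (rule AE_lborel_singleton)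
      ultimately show ?thesis
      proof eventually_elim
        case (elim y)
        have W0: "0 \<le> W y" using A by (simp add: W_def)
        have F': "norm y powr p * \<bar>F y\<bar> \<le> A * (norm y powr p * bracket y powr - ?b)"
          using mult_left_mono[OF elim(1), of "norm y powr p"] by (simp add: mult_ac)
        consider "norm y \<ge> norm x / 2" | "norm y < norm x / 2" "norm y \<le> 1" | "norm y < norm x / 2" "norm y > 1" by linarith
        then show ?case
        proof cases
          case 1
          then show ?thesis using W0 by (simp add: indicator_def)
        next
          case 2
          have "norm y powr p * bracket y powr - ?b \<le> 1 * 1"
            using 2(2) p bracket_ge_1[of y] powr_mono2'[of "- ?b" 1 "bracket y"] powr_mono2[of p "norm y" 1]
            by (intro mult_mono) auto
          then have "norm y powr p * \<bar>F y\<bar> \<le> A" using F' A mult_left_mono[of _ 1 A] by fastforce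
          moreover have "A * 1 \<le> W y" unfolding W_def using 2 A by (intro mult_left_mono) (auto simp: indicator_def)
          moreover have "near x y = 1" using 2 by (simp add: indicator_def)
          ultimately show ?thesis by simp
        next
          case 3
          have "bracket y powr - ?b \<le> norm y powr - ?b" using 3 p norm_le_bracket[of y] by (intro powr_mono2') auto
          then have "norm y powr p * bracket y powr - ?b \<le> norm y powr p * norm y powr - ?b" by (rule mult_left_mono) simp
          also have "\<dots> = norm y powr - real CARD('n)" by (simp add: powr_add[symmetric])
          finally have "norm y powr p * \<bar>F y\<bar> \<le> A * norm y powr - real CARD('n)" using F' A by (meson mult_left_mono order_trans)
          then show ?thesis using 3 x A by (simp add: W_def indicator_def)
        qed
      qed
    qed
    have "(LBINT y. near x y * (norm y powr p * \<bar>F y\<bar>)) \<le> (LBINT y. W y)"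
      by (rule integral_le_bound(2)[OF m w le])
    also have "\<dots> = A * (v + sphere_area TYPE(real^'n) * ln (norm x))"
      unfolding W_def v_def using i1 ib by (simp add: has_bochner_integral_iff)
    also have "\<dots> \<le> A * (K + K * ln (norm x))"
      using A x unfolding K_def by (intro mult_left_mono add_mono mult_right_mono) auto
    finally show ?thesis using integral_le_bound(1)[OF m w le] by (simp add: algebra_simps)
  qed
  have K: "0 \<le> K" by (simp add: K_def le_max_iff_disj)
  show ?thesis
    by (rule exI[of _ K])
      (intro conjI allI impI K, (rule main[THEN conjunct1]; assumption), (rule main[THEN conjunct2]; assumption))
qed

section \<open>Expansions of potentials at large distance\<close>

text \<open>P is to be the Taylor polynomial of y \<mapsto> g(x - y). It is a good approximation
  only for |y| < |x|/2, so there the difference is kept together, while in the far region the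
  potential and the polynomial are estimated separately.\<close>

lemma split_estimate:
  fixes g P F :: "real^'n::finite \<Rightarrow> real" and x :: "real^'n"
  assumes g: "integrable lborel (\<lambda>y. g (x - y) * F y)" and P: "integrable lborel (\<lambda>y. P y * F y)"
  shows "\<bar>(LBINT y. g (x - y) * F y) - (LBINT y. P y * F y)\<bar> \<le>
    (LBINT y. far x y * \<bar>g (x - y) * F y\<bar>) + (LBINT y. far x y * \<bar>P y * F y\<bar>)
    + \<bar>LBINT y. near x y * ((g (x - y) - P y) * F y)\<bar>"
proof -
  have S: "{y. norm x / 2 \<le> norm y} \<in> sets (lborel :: (real^'n) measure)" "{y. norm y < norm x / 2} \<in> sets (lborel :: (real^'n) measure)"
    by measurable
  have f: "integrable lborel (\<lambda>y. far x y * h y)" if "integrable lborel h" for h :: "real^'n \<Rightarrow> real"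
    using integrable_real_mult_indicator[OF S(1) that] by (simp only: mult.commute)
  have n: "integrable lborel (\<lambda>y. near x y * h y)" if "integrable lborel h" for h :: "real^'n \<Rightarrow> real"
    using integrable_real_mult_indicator[OF S(2) that] by (simp only: mult.commute)
  have d: "integrable lborel (\<lambda>y. (g (x - y) - P y) * F y)"
    using g P by (simp add: left_diff_distrib)
  have "(LBINT y. g (x - y) * F y) - (LBINT y. P y * F y) = (LBINT y. (g (x - y) - P y) * F y)"
    using g P by (simp add: left_diff_distrib)
  also have "\<dots> = (LBINT y. (far x y * (g (x - y) * F y) - far x y * (P y * F y)) + near x y * ((g (x - y) - P y) * F y))"
    by (rule Bochner_Integration.integral_cong) (auto simp: indicator_def algebra_simps)
  also have "\<dots> = (LBINT y. far x y * (g (x - y) * F y)) - (LBINT y. far x y * (P y * F y)) + (LBINT y. near x y * ((g (x - y) - P y) * F y))"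
    by (simp only: Bochner_Integration.integral_add[OF Bochner_Integration.integrable_diff[OF f[OF g] f[OF P]] n[OF d]] Bochner_Integration.integral_diff[OF f[OF g] f[OF P]])
  finally have eq: "(LBINT y. g (x - y) * F y) - (LBINT y. P y * F y) =
    (LBINT y. far x y * (g (x - y) * F y)) - (LBINT y. far x y * (P y * F y)) + (LBINT y. near x y * ((g (x - y) - P y) * F y))" .
  have tri: "\<bar>a - b + c\<bar> \<le> a' + b' + \<bar>c\<bar>" if "\<bar>a\<bar> \<le> a'" "\<bar>b\<bar> \<le> b'" for a b c a' b' :: real
    using that by linarith
  have fb: "\<bar>LBINT y. far x y * h y\<bar> \<le> (LBINT y. far x y * \<bar>h y\<bar>)" for h :: "real^'n \<Rightarrow> real"
    using integral_abs_bound[of lborel "\<lambda>y. far x y * h y"] by (simp add: abs_mult)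
  show ?thesis unfolding eq by (rule tri[OF fb fb])
qed

lemma near_integral_bound:
  fixes h F :: "real^'n::finite \<Rightarrow> real"
  assumes "h \<in> borel_measurable borel" "F \<in> borel_measurable borel"
    and b: "\<And>y. norm y < norm x / 2 \<Longrightarrow> \<bar>h y\<bar> \<le> c * norm y powr p"
    and i: "integrable lborel (\<lambda>y. near x y * (norm y powr p * \<bar>F y\<bar>))"
  shows "\<bar>LBINT y. near x y * (h y * F y)\<bar> \<le> c * (LBINT y. near x y * (norm y powr p * \<bar>F y\<bar>))"
proof -
  note [measurable] = assms(1,2)
  have w: "integrable lborel (\<lambda>y. c * (near x y * (norm y powr p * \<bar>F y\<bar>)))" using i by simp
  have le: "\<bar>near x y * (h y * F y)\<bar> \<le> c * (near x y * (norm y powr p * \<bar>F y\<bar>))" for y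
    using mult_right_mono[OF b, of y "\<bar>F y\<bar>"] by (auto simp: indicator_def abs_mult mult_ac)
  have "\<bar>LBINT y. near x y * (h y * F y)\<bar> \<le> (LBINT y. \<bar>near x y * (h y * F y)\<bar>)" by (rule integral_abs_bound)
  also have "\<dots> \<le> (LBINT y. c * (near x y * (norm y powr p * \<bar>F y\<bar>)))"
    by (rule integral_le_bound(2)[OF _ w]) (use le in auto)
  finally show ?thesis by simp
qed

lemma asymptotic_order0:
  assumes g: "homog d (g :: real^'n::finite \<Rightarrow> real)" and d: "- real CARD('n) < d" "d \<le> 0"
    and \<eta>: "0 < \<eta>" "\<eta> \<le> 1" and b: "real CARD('n) + \<eta> < b"
  shows "\<exists>C\<ge>0. \<forall>F A (x::real^'n). decays F A b \<longrightarrow> 1 \<le> norm x \<longrightarrow>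
    \<bar>(LBINT y. g (x - y) * F y) - g x * (LBINT y. F y)\<bar> \<le> C * A * norm x powr (d - \<eta>)"
proof -
  let ?n = "real CARD('n)"
  have gm [measurable]: "g \<in> borel_measurable borel" by (rule homog_measurable[OF g])
  obtain Cg where Cg: "0 \<le> Cg" "\<And>x. x \<noteq> 0 \<Longrightarrow> \<bar>g x\<bar> \<le> Cg * norm x powr d" using homog_bound[OF g] by blast
  obtain C0 where C0: "0 \<le> C0" "\<And>x y. x \<noteq> 0 \<Longrightarrow> norm y \<le> norm x / 2 \<Longrightarrow> \<bar>g (x - y) - g x\<bar> \<le> C0 * norm y * norm x powr (d - 1)"
    using homog_diff0[OF g] by blast
  have bn: "?n < b" using b \<eta> by simp
  obtain C1 where C1: "0 \<le> C1" "\<And>F A (x::real^'n). decays F A b \<Longrightarrow> 1 \<le> norm x \<Longrightarrow> integrable lborel (\<lambda>y. g (x - y) * F y)"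
    "\<And>F A (x::real^'n). decays F A b \<Longrightarrow> 1 \<le> norm x \<Longrightarrow> (LBINT y. far x y * \<bar>g (x - y) * F y\<bar>) \<le> C1 * A * norm x powr (?n + d - b)"
    using far_kernel[OF g d bn] by blast
  obtain C2 where C2: "0 \<le> C2" "\<And>F A (x::real^'n). decays F A b \<Longrightarrow> 1 \<le> norm x \<Longrightarrow> (LBINT y. far x y * \<bar>F y\<bar>) \<le> C2 * A * norm x powr (?n - b)"
    using far_moment[of 0 b, where 'n = 'n] bn by auto
  obtain C3 where C3: "0 \<le> C3" "\<And>F A (x::real^'n). decays F A b \<Longrightarrow> integrable lborel (\<lambda>y. near x y * (norm y powr \<eta> * \<bar>F y\<bar>))"
    "\<And>F A (x::real^'n). decays F A b \<Longrightarrow> (LBINT y. near x y * (norm y powr \<eta> * \<bar>F y\<bar>)) \<le> C3 * A"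
    using near_moment_conv[of \<eta> b, where 'n = 'n] b \<eta> by (meson less_imp_le)
  have main: "\<bar>(LBINT y. g (x - y) * F y) - g x * (LBINT y. F y)\<bar> \<le> (C1 + Cg * C2 + C0 * C3) * A * norm x powr (d - \<eta>)"
    if F: "decays F A b" and x: "1 \<le> norm x" for F A and x :: "real^'n"
  proof -
    have x0: "x \<noteq> 0" using x by auto
    have A: "0 \<le> A" by (rule decays_nonneg[OF F])
    have Fm: "F \<in> borel_measurable borel" using F by (simp add: decays_def)
    have Fi: "integrable lborel F" by (rule decays_integrable[OF F bn])
    have e: "norm x powr (?n + d - b) \<le> norm x powr (d - \<eta>)" using x b by (intro powr_mono) auto
    have 1: "(LBINT y. far x y * \<bar>g (x - y) * F y\<bar>) \<le> C1 * A * norm x powr (d - \<eta>)"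
      using C1(3)[OF F x] mult_left_mono[OF e, of "C1 * A"] C1(1) A by simp
    have "(LBINT y. far x y * \<bar>g x * F y\<bar>) = \<bar>g x\<bar> * (LBINT y. far x y * \<bar>F y\<bar>)"
      by (simp add: abs_mult mult.left_commute)
    also have "\<dots> \<le> (Cg * norm x powr d) * (C2 * A * norm x powr (?n - b))"
      using Cg C2 F x x0 by (intro mult_mono) auto
    also have "\<dots> = Cg * C2 * A * norm x powr (?n + d - b)"
    proof -
      have "norm x powr (?n + d - b) = norm x powr d * norm x powr (?n - b)" by (simp add: powr_add[symmetric] algebra_simps)
      then show ?thesis by simp
    qed
    also have "\<dots> \<le> Cg * C2 * A * norm x powr (d - \<eta>)"
      using e Cg(1) C2(1) A by (intro mult_left_mono) auto
    finally have 2: "(LBINT y. far x y * \<bar>g x * F y\<bar>) \<le> Cg * C2 * A * norm x powr (d - \<eta>)" .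
    have "\<bar>LBINT y. near x y * ((g (x - y) - g x) * F y)\<bar> \<le> (C0 * norm x powr (d - \<eta>)) * (LBINT y. near x y * (norm y powr \<eta> * \<bar>F y\<bar>))"
    proof (rule near_integral_bound[OF _ Fm _ C3(2)[OF F]])
      show "(\<lambda>y. g (x - y) - g x) \<in> borel_measurable borel" by measurable
      fix y :: "real^'n" assume y: "norm y < norm x / 2"
      have "norm y * norm x powr (d - 1) \<le> norm x powr (d - \<eta>) * norm y powr \<eta>"
      proof (cases "y = 0")
        case False
        have "norm y * norm x powr (d - 1) = norm y powr \<eta> * (norm y powr (1 - \<eta>) * norm x powr (d - 1))"
          using False powr_add[of "norm y" \<eta> "1 - \<eta>"] by simp
        also have "\<dots> \<le> norm y powr \<eta> * (norm x powr (1 - \<eta>) * norm x powr (d - 1))"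
          using y \<eta> norm_ge_zero[of y] by (intro mult_left_mono mult_right_mono powr_mono2) (linarith | simp)+
        also have "norm x powr (1 - \<eta>) * norm x powr (d - 1) = norm x powr (d - \<eta>)"
          by (simp add: powr_add[symmetric])
        finally show ?thesis by (simp add: mult.commute)
      qed simp
      then have "C0 * (norm y * norm x powr (d - 1)) \<le> C0 * (norm x powr (d - \<eta>) * norm y powr \<eta>)"
        by (rule mult_left_mono[OF _ C0(1)])
      then show "\<bar>g (x - y) - g x\<bar> \<le> (C0 * norm x powr (d - \<eta>)) * norm y powr \<eta>"
        using C0(2)[OF x0, of y] y by (simp add: mult.assoc)
    qed
    also have "\<dots> \<le> (C0 * norm x powr (d - \<eta>)) * (C3 * A)"
      using C3(3)[OF F] C0(1) by (intro mult_left_mono) auto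
    finally have 3: "\<bar>LBINT y. near x y * ((g (x - y) - g x) * F y)\<bar> \<le> C0 * C3 * A * norm x powr (d - \<eta>)" by (simp add: mult_ac)
    have i: "integrable lborel (\<lambda>y. g x * F y)" using Fi by simp
    show ?thesis
      using split_estimate[OF C1(2)[OF F x] i] 1 2 3 by (simp add: algebra_simps)
  qed
  have K: "0 \<le> C1 + Cg * C2 + C0 * C3" using C0 C1 C2 C3 Cg by simp
  show ?thesis
    by (rule exI[of _ "C1 + Cg * C2 + C0 * C3"]) (intro conjI allI impI K, rule main)
qed

text \<open>At exponent n + 1 the first moment may diverge logarithmically, so a first-order Taylor
  bound would lose a logarithm. Evenness permits the second difference instead: it costs |y|^2
  |x|^(d - 2), and the second moment over |y| < |x|/2 grows only like |x|.\<close>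

lemma asymptotic_even:
  assumes g: "homog d (g :: real^'n::finite \<Rightarrow> real)" and d: "- real CARD('n) < d" "d \<le> 0"
  shows "\<exists>C\<ge>0. \<forall>F A (x::real^'n). decays F A (real CARD('n) + 1) \<longrightarrow> (\<forall>y. F (- y) = F y) \<longrightarrow> 1 \<le> norm x \<longrightarrow>
    \<bar>(LBINT y. g (x - y) * F y) - g x * (LBINT y. F y)\<bar> \<le> C * A * norm x powr (d - 1)"
proof -
  let ?n = "real CARD('n)"
  define b where "b = ?n + 1"
  have gm [measurable]: "g \<in> borel_measurable borel" by (rule homog_measurable[OF g])
  obtain Cg where Cg: "0 \<le> Cg" "\<And>x. x \<noteq> 0 \<Longrightarrow> \<bar>g x\<bar> \<le> Cg * norm x powr d" using homog_bound[OF g] by blast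
  obtain C0 where C0: "0 \<le> C0" "\<And>x y. x \<noteq> 0 \<Longrightarrow> norm y \<le> norm x / 2 \<Longrightarrow> \<bar>g (x - y) + g (x + y) - 2 * g x\<bar> \<le> C0 * (norm y)\<^sup>2 * norm x powr (d - 2)"
    using homog_diff2[OF g] by blast
  have bn: "?n < b" by (simp add: b_def)
  obtain C1 where C1: "0 \<le> C1" "\<And>F A (x::real^'n). decays F A b \<Longrightarrow> 1 \<le> norm x \<Longrightarrow> integrable lborel (\<lambda>y. g (x - y) * F y)"
    "\<And>F A (x::real^'n). decays F A b \<Longrightarrow> 1 \<le> norm x \<Longrightarrow> (LBINT y. far x y * \<bar>g (x - y) * F y\<bar>) \<le> C1 * A * norm x powr (?n + d - b)"
    using far_kernel[OF g d bn] by blast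
  obtain C2 where C2: "0 \<le> C2" "\<And>F A (x::real^'n). decays F A b \<Longrightarrow> 1 \<le> norm x \<Longrightarrow> (LBINT y. far x y * \<bar>F y\<bar>) \<le> C2 * A * norm x powr (?n - b)"
    using far_moment[of 0 b, where 'n = 'n] bn by auto
  obtain C3 where C3: "0 \<le> C3" "\<And>F A (x::real^'n). decays F A b \<Longrightarrow> integrable lborel (\<lambda>y. near x y * (norm y powr 2 * \<bar>F y\<bar>))"
    "\<And>F A (x::real^'n). decays F A b \<Longrightarrow> (LBINT y. near x y * (norm y powr 2 * \<bar>F y\<bar>)) \<le> C3 * A * norm x powr (?n + 2 - b)"
    using near_moment_div[of 2 b, where 'n = 'n] by (auto simp: b_def)
  have main: "\<bar>(LBINT y. g (x - y) * F y) - g x * (LBINT y. F y)\<bar> \<le> (C1 + Cg * C2 + C0 * C3) * A * norm x powr (d - 1)"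
    if F: "decays F A b" and even: "\<forall>y. F (- y) = F y" and x: "1 \<le> norm x" for F A and x :: "real^'n"
  proof -
    have x0: "x \<noteq> 0" using x by auto
    have A: "0 \<le> A" by (rule decays_nonneg[OF F])
    have Fm [measurable]: "F \<in> borel_measurable borel" using F by (simp add: decays_def)
    have Fi: "integrable lborel F" by (rule decays_integrable[OF F bn])
    have e: "?n + d - b = d - 1" by (simp add: b_def)
    have 1: "(LBINT y. far x y * \<bar>g (x - y) * F y\<bar>) \<le> C1 * A * norm x powr (d - 1)"
      using C1(3)[OF F x] by (simp only: e)
    have "(LBINT y. far x y * \<bar>g x * F y\<bar>) = \<bar>g x\<bar> * (LBINT y. far x y * \<bar>F y\<bar>)"
      by (simp add: abs_mult mult.left_commute)
    also have "\<dots> \<le> (Cg * norm x powr d) * (C2 * A * norm x powr (?n - b))"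
      using Cg C2 F x x0 by (intro mult_mono) auto
    also have "\<dots> = Cg * C2 * A * norm x powr (d - 1)"
    proof -
      have "norm x powr (d - 1) = norm x powr d * norm x powr (?n - b)" by (simp only: b_def powr_add[symmetric]) simp
      then show ?thesis by simp
    qed
    finally have 2: "(LBINT y. far x y * \<bar>g x * F y\<bar>) \<le> Cg * C2 * A * norm x powr (d - 1)" .
    have gF: "integrable lborel (\<lambda>y. (g (x - y) - g x) * F y)" using C1(2)[OF F x] Fi by (simp add: left_diff_distrib)
    have nm: "{y. norm y < norm x / 2} \<in> sets (lborel :: (real^'n) measure)" by measurable
    define h where "h y = near x y * ((g (x - y) - g x) * F y)" for y
    have h: "integrable lborel h" unfolding h_def using integrable_real_mult_indicator[OF nm gF] by (simp add: mult.commute)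
    have hm: "h \<in> borel_measurable borel" using h by auto
    have hr: "integrable lborel (\<lambda>y. h (0 - y))" "(LBINT y. h (0 - y)) = (LBINT y. h y)"
      using integrable_lborel_reflect[OF hm, of 0] integral_lborel_reflect[OF hm, of 0] h by auto
    \<comment> \<open>The near region is invariant under y \<mapsto> -y, so adding the reflected
      integral symmetrises the kernel while the even density stays as it is.\<close>
    have "2 * (LBINT y. h y) = (LBINT y. h y + h (0 - y))"
      using h hr by simp
    also have "\<dots> = (LBINT y. near x y * ((g (x - y) + g (x + y) - 2 * g x) * F y))"
      by (rule Bochner_Integration.integral_cong) (use even in \<open>auto simp: h_def indicator_def algebra_simps\<close>)
    finally have sym: "2 * (LBINT y. h y) = (LBINT y. near x y * ((g (x - y) + g (x + y) - 2 * g x) * F y))" .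
    have "\<bar>LBINT y. near x y * ((g (x - y) + g (x + y) - 2 * g x) * F y)\<bar> \<le> (C0 * norm x powr (d - 2)) * (LBINT y. near x y * (norm y powr 2 * \<bar>F y\<bar>))"
    proof (rule near_integral_bound[OF _ Fm _ C3(2)[OF F]])
      show "(\<lambda>y. g (x - y) + g (x + y) - 2 * g x) \<in> borel_measurable borel" by measurable
      fix y :: "real^'n" assume y: "norm y < norm x / 2"
      show "\<bar>g (x - y) + g (x + y) - 2 * g x\<bar> \<le> (C0 * norm x powr (d - 2)) * norm y powr 2"
        using C0(2)[OF x0, of y] y by (simp add: mult_ac)
    qed
    also have "\<dots> \<le> (C0 * norm x powr (d - 2)) * (C3 * A * norm x powr (?n + 2 - b))"
      using C3(3)[OF F] C0(1) by (intro mult_left_mono) auto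
    also have "\<dots> = C0 * C3 * A * norm x powr (d - 1)"
    proof -
      have "norm x powr (d - 1) = norm x powr (d - 2) * norm x powr (?n + 2 - b)" by (simp only: b_def powr_add[symmetric]) simp
      then show ?thesis by simp
    qed
    finally have "\<bar>2 * (LBINT y. h y)\<bar> \<le> C0 * C3 * A * norm x powr (d - 1)" unfolding sym .
    then have 3: "\<bar>LBINT y. near x y * ((g (x - y) - g x) * F y)\<bar> \<le> C0 * C3 * A * norm x powr (d - 1)"
      unfolding h_def by linarith
    have i: "integrable lborel (\<lambda>y. g x * F y)" using Fi by simp
    show ?thesis
      using split_estimate[OF C1(2)[OF F x] i] 1 2 3 by (simp add: algebra_simps)
  qed
  have K: "0 \<le> C1 + Cg * C2 + C0 * C3" using C0 C1 C2 C3 Cg by simp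
  show ?thesis
    by (rule exI[of _ "C1 + Cg * C2 + C0 * C3"]) (intro conjI allI impI K, rule main[unfolded b_def])
qed

section \<open>The error weight \<open>decay\<close> and the potential of the force\<close>

lemma powr_le_bracket:
  assumes "1 \<le> norm x" "0 \<le> e"
  shows "norm x powr - e \<le> 2 powr e * bracket x powr - e"
proof -
  have "(2 * norm x) powr - e \<le> bracket x powr - e"
    using assms bracket_le_norm[OF assms(1)] bracket_pos[of x] by (intro powr_mono2') auto
  then have "2 powr - e * norm x powr - e \<le> bracket x powr - e" by (simp add: powr_mult)
  then have "2 powr e * (2 powr - e * norm x powr - e) \<le> 2 powr e * bracket x powr - e"
    by (rule mult_left_mono) simp
  moreover have "2 powr e * 2 powr - e = (1::real)" by (simp add: powr_minus)
  ultimately show ?thesis by (simp only: mult.assoc[symmetric] mult_1_left)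
qed

lemma decay_ge: "bracket x powr - min (a - 2) (real CARD('n)) \<le> decay a (x :: real^'n::finite)"
  unfolding decay_def using bracket_ge_1[of x] by (simp add: mult_le_cancel_left1)

lemma decay_nonneg: "0 \<le> decay a x"
  using decay_ge[of x a] powr_ge_zero order_trans by blast

lemma decay_ge_norm:
  assumes x: "1 \<le> norm (x :: real^'n::finite)" and a: "2 < a" and e: "min (a - 2) (real CARD('n)) \<le> e"
  shows "norm x powr - e \<le> 2 powr e * decay a x"
proof -
  have "0 \<le> e" using a e by (auto simp: min_def split: if_splits)
  then have "norm x powr - e \<le> 2 powr e * bracket x powr - e" by (rule powr_le_bracket[OF x])
  also have "\<dots> \<le> 2 powr e * bracket x powr - min (a - 2) (real CARD('n))"
    using e bracket_ge_1[of x] by (intro mult_left_mono powr_mono) auto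
  also have "\<dots> \<le> 2 powr e * decay a x" by (intro mult_left_mono decay_ge) auto
  finally show ?thesis .
qed

text \<open>This is the second-order Taylor remainder of a kernel of degree 2 - n. For a below,
  equal to or above n + 2 it is of order |x|^(2 - a), |x|^(-n) (1 + log |x|) or |x|^(-n), which is
  exactly the case distinction built into \<open>decay\<close>.\<close>

lemma near_second_moment:
  assumes a: "real CARD('n::finite) + 1 < a"
  shows "\<exists>C\<ge>0. \<forall>F A (x::real^'n). decays F A a \<longrightarrow> 1 \<le> norm x \<longrightarrow>
    integrable lborel (\<lambda>y. near x y * (norm y powr 2 * \<bar>F y\<bar>)) \<and>
    norm x powr - real CARD('n) * (LBINT y. near x y * (norm y powr 2 * \<bar>F y\<bar>)) \<le> C * A * decay a x"
proof -
  let ?n = "real CARD('n)"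
  have a2: "2 < a" using a zero_less_card_finite[where 'a = 'n] by linarith
  \<comment> \<open>The common end of the three cases; w is the growth of the near second moment in
    the case at hand.\<close>
  have fin: ?thesis if C: "C \<ge> 0" and K: "K \<ge> 0"
    and N: "\<And>F A (x::real^'n). decays F A a \<Longrightarrow> 1 \<le> norm x \<Longrightarrow> integrable lborel (\<lambda>y. near x y * (norm y powr 2 * \<bar>F y\<bar>)) \<and>
      (LBINT y. near x y * (norm y powr 2 * \<bar>F y\<bar>)) \<le> C * A * w x"
    and D: "\<And>x::real^'n. 1 \<le> norm x \<Longrightarrow> norm x powr - ?n * w x \<le> K * decay a x" for C K and w :: "real^'n \<Rightarrow> real"
  proof -
    have "norm x powr - ?n * (LBINT y. near x y * (norm y powr 2 * \<bar>F y\<bar>)) \<le> (C * K) * A * decay a x"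
      if F: "decays F A a" and x: "1 \<le> norm x" for F A and x :: "real^'n"
    proof -
      have "norm x powr - ?n * (LBINT y. near x y * (norm y powr 2 * \<bar>F y\<bar>)) \<le> norm x powr - ?n * (C * A * w x)"
        using N[OF F x] by (intro mult_left_mono) auto
      also have "\<dots> = C * A * (norm x powr - ?n * w x)" by simp
      also have "\<dots> \<le> C * A * (K * decay a x)" using D[OF x] C decays_nonneg[OF F] by (intro mult_left_mono) auto
      finally show ?thesis by (simp add: mult_ac)
    qed
    then show ?thesis using N C K by (intro exI[of _ "C * K"]) auto
  qed
  consider "a < ?n + 2" | "a = ?n + 2" | "?n + 2 < a" by linarith
  then show ?thesis
  proof cases
    case 1
    obtain C where C: "C \<ge> 0" "\<And>F A (x::real^'n). decays F A a \<Longrightarrow> integrable lborel (\<lambda>y. near x y * (norm y powr 2 * \<bar>F y\<bar>)) \<and>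
      (LBINT y. near x y * (norm y powr 2 * \<bar>F y\<bar>)) \<le> C * A * norm x powr (?n + 2 - a)"
      using near_moment_div[of 2 a, where 'n = 'n] 1 a by auto
    have D: "norm x powr - ?n * norm x powr (?n + 2 - a) \<le> 2 powr (a - 2) * decay a x" if "1 \<le> norm x" for x :: "real^'n"
    proof -
      have "norm x powr - ?n * norm x powr (?n + 2 - a) = norm x powr - (a - 2)" by (simp add: powr_add[symmetric])
      then show ?thesis using decay_ge_norm[OF that, of a "a - 2"] a2 by simp
    qed
    show ?thesis by (rule fin[OF C(1) _ C(2) D]) auto
  next
    case 2
    obtain C where C: "C \<ge> 0" "\<And>F A (x::real^'n). decays F A a \<Longrightarrow> 1 \<le> norm x \<Longrightarrow> integrable lborel (\<lambda>y. near x y * (norm y powr 2 * \<bar>F y\<bar>)) \<and>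
      (LBINT y. near x y * (norm y powr 2 * \<bar>F y\<bar>)) \<le> C * A * (1 + ln (norm x))"
      using near_moment_log[of 2, where 'n = 'n] 2 by auto
    have D: "norm x powr - ?n * (1 + ln (norm x)) \<le> 2 powr ?n * decay a x" if x: "1 \<le> norm x" for x :: "real^'n"
    proof -
      have "norm x powr - ?n * (1 + ln (norm x)) \<le> (2 powr ?n * bracket x powr - ?n) * (1 + ln (bracket x))"
      proof (intro mult_mono add_mono)
        have "0 < norm x" using x by linarith
        then show "ln (norm x) \<le> ln (bracket x)" using norm_le_bracket[of x] bracket_pos[of x] by simp
      qed (use powr_le_bracket[OF x, of ?n] x in auto)
      then show ?thesis using 2 by (simp add: decay_def)
    qed
    show ?thesis by (rule fin[OF C(1) _ C(2) D]) auto
  next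
    case 3
    obtain C where C: "C \<ge> 0" "\<And>F A (x::real^'n). decays F A a \<Longrightarrow> integrable lborel (\<lambda>y. near x y * (norm y powr 2 * \<bar>F y\<bar>)) \<and>
      (LBINT y. near x y * (norm y powr 2 * \<bar>F y\<bar>)) \<le> C * A * 1"
      using near_moment_conv[of 2 a, where 'n = 'n] 3 by auto
    have D: "norm x powr - ?n * 1 \<le> 2 powr ?n * decay a x" if "1 \<le> norm x" for x :: "real^'n"
      using decay_ge_norm[OF that, of a ?n] 3 by simp
    show ?thesis by (rule fin[OF C(1) _ C(2) D]) auto
  qed
qed

text \<open>The assumption a > n + 1 makes the first moments of F finite. All three far
  contributions, from the kernel, from g(x) and from y \<bullet> G(x), come out as |x|^(2 - a), and
  the near contribution is the second-order remainder of \<open>near_second_moment\<close>.\<close>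

lemma asymptotic_order1:
  assumes g: "homog (2 - real CARD('n)) (g :: real^'n::finite \<Rightarrow> real)" and G: "\<And>x. x \<noteq> 0 \<Longrightarrow> GDERIV g x :> G x"
    and n2: "2 \<le> CARD('n)" and a: "real CARD('n) + 1 < a"
  shows "\<exists>C\<ge>0. \<forall>F A (x::real^'n). decays F A a \<longrightarrow> 1 \<le> norm x \<longrightarrow>
    \<bar>(LBINT y. g (x - y) * F y) - (g x * (LBINT y. F y) - (\<Sum>k\<in>UNIV. G x $ k * (LBINT y. y $ k * F y)))\<bar>
      \<le> C * A * decay a x"
proof -
  let ?n = "real CARD('n)"
  define d where "d = 2 - ?n"
  have d: "- ?n < d" "d \<le> 0" using n2 by (auto simp: d_def)
  have gm [measurable]: "g \<in> borel_measurable borel" by (rule homog_measurable[OF g])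
  obtain Cg where Cg: "0 \<le> Cg" "\<And>x. x \<noteq> 0 \<Longrightarrow> \<bar>g x\<bar> \<le> Cg * norm x powr d" using homog_bound[OF g] unfolding d_def by blast
  obtain CG where CG: "0 \<le> CG" "\<And>x. x \<noteq> 0 \<Longrightarrow> norm (G x) \<le> CG * norm x powr (d - 1)"
  proof -
    obtain G' where G': "\<And>x. x \<noteq> 0 \<Longrightarrow> GDERIV g x :> G' x" "\<And>k. homog (d - 1) (\<lambda>x. G' x $ k)"
      using homog_gderiv[OF g] unfolding d_def by blast
    have GG: "G x = G' x" if "x \<noteq> 0" for x
      using partial_deriv_gderiv[OF G[OF that]] partial_deriv_gderiv[OF G'(1)[OF that]] by (metis vec_eq_iff)
    obtain C where C: "\<And>k. 0 \<le> C k" "\<And>k x. x \<noteq> 0 \<Longrightarrow> \<bar>G' x $ k\<bar> \<le> C k * norm x powr (d - 1)"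
      using homog_bound[OF G'(2)] by metis
    have "norm (G x) \<le> (\<Sum>k\<in>UNIV. C k) * norm x powr (d - 1)" if "x \<noteq> 0" for x
      unfolding GG[OF that] sum_distrib_right by (rule order_trans[OF norm_le_l1_cart]) (intro sum_mono C that)
    then show ?thesis using that[of "\<Sum>k\<in>UNIV. C k"] C(1) by (simp add: sum_nonneg)
  qed
  have d2: "2 - ?n - 2 = - ?n" by simp
  obtain C0 where C0: "0 \<le> C0" "\<And>x y. x \<noteq> 0 \<Longrightarrow> norm y \<le> norm x / 2 \<Longrightarrow> \<bar>g (x - y) - (g x - y \<bullet> G x)\<bar> \<le> C0 * (norm y)\<^sup>2 * norm x powr - ?n"
    using homog_diff1[OF g G, unfolded d2] by blast
  have bn: "?n < a" using a by simp
  obtain C1 where C1: "0 \<le> C1" "\<And>F A (x::real^'n). decays F A a \<Longrightarrow> 1 \<le> norm x \<Longrightarrow> integrable lborel (\<lambda>y. g (x - y) * F y)"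
    "\<And>F A (x::real^'n). decays F A a \<Longrightarrow> 1 \<le> norm x \<Longrightarrow> (LBINT y. far x y * \<bar>g (x - y) * F y\<bar>) \<le> C1 * A * norm x powr (?n + d - a)"
    using far_kernel[OF g[folded d_def] d bn] by blast
  obtain C2 where C2: "0 \<le> C2" "\<And>F A (x::real^'n). decays F A a \<Longrightarrow> 1 \<le> norm x \<Longrightarrow> integrable lborel (\<lambda>y. far x y * \<bar>F y\<bar>)"
    "\<And>F A (x::real^'n). decays F A a \<Longrightarrow> 1 \<le> norm x \<Longrightarrow> (LBINT y. far x y * \<bar>F y\<bar>) \<le> C2 * A * norm x powr (?n - a)"
    using far_moment[of 0 a, where 'n = 'n] bn by auto
  obtain C2' where C2': "0 \<le> C2'" "\<And>F A (x::real^'n). decays F A a \<Longrightarrow> 1 \<le> norm x \<Longrightarrow> integrable lborel (\<lambda>y. far x y * \<bar>norm y * F y\<bar>)"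
    "\<And>F A (x::real^'n). decays F A a \<Longrightarrow> 1 \<le> norm x \<Longrightarrow> (LBINT y. far x y * \<bar>norm y * F y\<bar>) \<le> C2' * A * norm x powr (?n + 1 - a)"
    using far_moment[of 1 a, where 'n = 'n] a by auto
  obtain C3 where C3: "0 \<le> C3" "\<And>F A (x::real^'n). decays F A a \<Longrightarrow> 1 \<le> norm x \<Longrightarrow> integrable lborel (\<lambda>y. near x y * (norm y powr 2 * \<bar>F y\<bar>))"
    "\<And>F A (x::real^'n). decays F A a \<Longrightarrow> 1 \<le> norm x \<Longrightarrow> norm x powr - ?n * (LBINT y. near x y * (norm y powr 2 * \<bar>F y\<bar>)) \<le> C3 * A * decay a x"
    using near_second_moment[OF a] by blast
  define K where "K = 2 powr (a - 2)"
  have K0: "0 \<le> K" by (simp add: K_def)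
  have main: "\<bar>(LBINT y. g (x - y) * F y) - (g x * (LBINT y. F y) - (\<Sum>k\<in>UNIV. G x $ k * (LBINT y. y $ k * F y)))\<bar>
      \<le> ((C1 + Cg * C2 + CG * C2') * K + C0 * C3) * A * decay a x"
    if F: "decays F A a" and x: "1 \<le> norm x" for F A and x :: "real^'n"
  proof -
    have x0: "x \<noteq> 0" using x by auto
    have A: "0 \<le> A" by (rule decays_nonneg[OF F])
    have Fm [measurable]: "F \<in> borel_measurable borel" using F by (simp add: decays_def)
    have Fi: "integrable lborel F" by (rule decays_integrable[OF F bn])
    have yF: "integrable lborel (\<lambda>y. y $ k * F y)" for k
    proof (rule Bochner_Integration.integrable_bound)
      show "integrable lborel (\<lambda>y. norm y * F y)" using decays_moment_integrable[OF F, of 1] a by simp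
      have [measurable]: "(\<lambda>y::real^'n. y $ k) \<in> borel_measurable borel" by (rule borel_measurable_nth)
      show "(\<lambda>y. y $ k * F y) \<in> borel_measurable lborel" by measurable
      show "AE y in lborel. norm (y $ k * F y) \<le> norm (norm y * F y)"
        by (intro AE_I2) (simp add: abs_mult mult_right_mono component_le_norm_cart)
    qed
    define P where "P y = g x - y \<bullet> G x" for y
    have PF: "P y * F y = g x * F y - (\<Sum>k\<in>UNIV. G x $ k * (y $ k * F y))" for y
      by (simp add: P_def inner_vec_def left_diff_distrib sum_distrib_left sum_distrib_right mult_ac) (simp add: algebra_simps sum_distrib_left)
    have Pi: "integrable lborel (\<lambda>y. P y * F y)"
      unfolding PF using Fi yF by (intro Bochner_Integration.integrable_diff Bochner_Integration.integrable_sum integrable_mult_right)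
    have PI: "(LBINT y. P y * F y) = g x * (LBINT y. F y) - (\<Sum>k\<in>UNIV. G x $ k * (LBINT y. y $ k * F y))"
      unfolding PF using Fi yF by (simp add: Bochner_Integration.integral_diff Bochner_Integration.integral_sum Bochner_Integration.integrable_sum)
    have Kd: "norm x powr (2 - a) \<le> K * decay a x"
      using decay_ge_norm[OF x, of a "a - 2"] a n2 by (simp add: K_def)
    have e: "?n + d - a = 2 - a" by (simp add: d_def)
    have 1: "(LBINT y. far x y * \<bar>g (x - y) * F y\<bar>) \<le> C1 * A * (K * decay a x)"
      using C1(3)[OF F x] mult_left_mono[OF Kd, of "C1 * A"] C1(1) A unfolding e by simp
    have "(LBINT y. far x y * \<bar>P y * F y\<bar>) \<le> (LBINT y. \<bar>g x\<bar> * (far x y * \<bar>F y\<bar>) + norm (G x) * (far x y * \<bar>norm y * F y\<bar>))"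
    proof (rule integral_le_bound(2))
      have "(\<lambda>y. P y * F y) \<in> borel_measurable borel" using Pi by auto
      then show "(\<lambda>y. far x y * \<bar>P y * F y\<bar>) \<in> borel_measurable lborel" by measurable
      show "integrable lborel (\<lambda>y. \<bar>g x\<bar> * (far x y * \<bar>F y\<bar>) + norm (G x) * (far x y * \<bar>norm y * F y\<bar>))"
        using C2(2)[OF F x] C2'(2)[OF F x] by (intro Bochner_Integration.integrable_add integrable_mult_right)
      have "\<bar>P y\<bar> \<le> \<bar>g x\<bar> + norm (G x) * norm y" for y
        using Cauchy_Schwarz_ineq2[of y "G x"] by (simp add: P_def mult.commute)
      then have "\<bar>P y * F y\<bar> \<le> \<bar>g x\<bar> * \<bar>F y\<bar> + norm (G x) * \<bar>norm y * F y\<bar>" for y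
        using mult_right_mono[of "\<bar>P y\<bar>" "\<bar>g x\<bar> + norm (G x) * norm y" "\<bar>F y\<bar>"] by (simp add: abs_mult distrib_right mult.assoc)
      then show "AE y in lborel. \<bar>far x y * \<bar>P y * F y\<bar>\<bar> \<le> \<bar>g x\<bar> * (far x y * \<bar>F y\<bar>) + norm (G x) * (far x y * \<bar>norm y * F y\<bar>)"
        by (intro AE_I2) (simp add: indicator_def)
    qed
    also have "\<dots> = \<bar>g x\<bar> * (LBINT y. far x y * \<bar>F y\<bar>) + norm (G x) * (LBINT y. far x y * \<bar>norm y * F y\<bar>)"
      using C2(2)[OF F x] C2'(2)[OF F x] by (subst Bochner_Integration.integral_add) (simp_all only: integrable_mult_right integral_mult_right_zero)
    also have "\<dots> \<le> (Cg * norm x powr d) * (C2 * A * norm x powr (?n - a)) + (CG * norm x powr (d - 1)) * (C2' * A * norm x powr (?n + 1 - a))"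
      using Cg(1) CG(1) Cg(2)[OF x0] CG(2)[OF x0] C2(3)[OF F x] C2'(3)[OF F x] by (intro add_mono mult_mono) auto
    also have "\<dots> = (Cg * C2 + CG * C2') * A * norm x powr (2 - a)"
    proof -
      have "norm x powr d * norm x powr (?n - a) = norm x powr (2 - a)" "norm x powr (d - 1) * norm x powr (?n + 1 - a) = norm x powr (2 - a)"
        by (simp_all add: d_def powr_add[symmetric])
      moreover have "(Cg * p) * (C2 * A * p') + (CG * s) * (C2' * A * s') = Cg * C2 * A * (p * p') + CG * C2' * A * (s * s')" for p p' s s' :: real
        by simp
      ultimately show ?thesis by (simp only: distrib_right)
    qed
    also have "\<dots> \<le> (Cg * C2 + CG * C2') * A * (K * decay a x)"
      using Kd Cg(1) CG(1) C2(1) C2'(1) A by (intro mult_left_mono) auto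
    finally have 2: "(LBINT y. far x y * \<bar>P y * F y\<bar>) \<le> (Cg * C2 + CG * C2') * A * (K * decay a x)" .
    have "\<bar>LBINT y. near x y * ((g (x - y) - P y) * F y)\<bar> \<le> (C0 * norm x powr - ?n) * (LBINT y. near x y * (norm y powr 2 * \<bar>F y\<bar>))"
    proof (rule near_integral_bound[OF _ Fm _ C3(2)[OF F x]])
      show "(\<lambda>y. g (x - y) - P y) \<in> borel_measurable borel" unfolding P_def by measurable
      fix y :: "real^'n" assume y: "norm y < norm x / 2"
      show "\<bar>g (x - y) - P y\<bar> \<le> (C0 * norm x powr - ?n) * norm y powr 2"
        using C0(2)[OF x0, of y] y by (simp add: P_def mult_ac)
    qed
    also have "\<dots> \<le> C0 * (C3 * A * decay a x)"
      using mult_left_mono[OF C3(3)[OF F x] C0(1)] by (simp add: mult.assoc)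
    finally have 3: "\<bar>LBINT y. near x y * ((g (x - y) - P y) * F y)\<bar> \<le> C0 * (C3 * A * decay a x)" .
    have "\<bar>(LBINT y. g (x - y) * F y) - (LBINT y. P y * F y)\<bar> \<le>
      C1 * A * (K * decay a x) + (Cg * C2 + CG * C2') * A * (K * decay a x) + C0 * (C3 * A * decay a x)"
      using split_estimate[OF C1(2)[OF F x] Pi] 1 2 3 by linarith
    also have "\<dots> = ((C1 + Cg * C2 + CG * C2') * K + C0 * C3) * A * decay a x" by algebra
    finally show ?thesis unfolding PI .
  qed
  have "0 \<le> (C1 + Cg * C2 + CG * C2') * K + C0 * C3"
    using C0(1) C1(1) C2(1) C2'(1) C3(1) Cg(1) CG(1) K0 by (intro add_nonneg_nonneg mult_nonneg_nonneg)
  then show ?thesis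
    by (intro exI[of _ "(C1 + Cg * C2 + CG * C2') * K + C0 * C3"] conjI allI impI main)
qed

section \<open>The asymptotic expansion\<close>

text \<open>The regularised kernel at d = 0: off the origin, the Stokes fundamental solution without
  its normalising constant.\<close>

definition stokeslet :: "'n::finite \<Rightarrow> 'n \<Rightarrow> real^'n \<Rightarrow> real" where
  "stokeslet i j = curl_field (power_chain ((2 - real CARD('n)) / 2) 0 0) (power_chain ((2 - real CARD('n)) / 2) 0 1) i j"

definition stokeslet_deriv :: "'n::finite \<Rightarrow> 'n \<Rightarrow> 'n \<Rightarrow> real^'n \<Rightarrow> real" where
  "stokeslet_deriv i j k = curl_field_deriv (power_chain ((2 - real CARD('n)) / 2) 0 1) (power_chain ((2 - real CARD('n)) / 2) 0 2) i j k"

text \<open>The mass of the approximate identity produced by the bilaplacian, and therefore the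
  ratio of \<open>stokeslet\<close> to \<open>Lorentz\<close>.\<close>

definition stokes_const :: "'n::finite itself \<Rightarrow> real" where
  "stokes_const _ = - 4 * real CARD('n) * (real CARD('n) - 2) * unit_ball_vol (real CARD('n))"

lemma stokeslet_eq:
  fixes z :: "real^'n::finite"
  assumes "z \<noteq> 0"
  shows "stokeslet i j z = 2 * (2 - real CARD('n)) * (z $ i * (z $ j * norm z powr - real CARD('n))) + (- 2 * kd i j) * norm z powr (2 - real CARD('n))"
proof -
  define q where "q = (2 - real CARD('n)) / 2"
  have s: "z \<bullet> z = norm z powr 2" using assms by (simp add: power2_norm_eq_inner)
  have q0: "(z \<bullet> z) powr q = norm z powr (2 - real CARD('n))"
    unfolding s powr_powr by (rule arg_cong[where f = "\<lambda>e. norm z powr e"]) (simp add: q_def field_simps)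
  have q1: "(z \<bullet> z) powr (q - 1) = norm z powr - real CARD('n)"
    unfolding s powr_powr by (rule arg_cong[where f = "\<lambda>e. norm z powr e"]) (simp add: q_def field_simps)
  have q2: "(z \<bullet> z) * norm z powr - real CARD('n) = norm z powr (2 - real CARD('n))"
    unfolding s by (simp only: powr_add[symmetric]) simp
  have "stokeslet i j z = 4 * z $ i * z $ j * (q * norm z powr - real CARD('n))
     - kd i j * ((2 * real CARD('n) - 2) * norm z powr (2 - real CARD('n)) + 4 * (z \<bullet> z) * (q * norm z powr - real CARD('n)))"
    by (simp add: stokeslet_def curl_field_def power_chain_def q_def[symmetric] q0 q1)
  also have "4 * (z \<bullet> z) * (q * norm z powr - real CARD('n)) = 4 * q * norm z powr (2 - real CARD('n))"
    by (simp add: q2[symmetric])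
  finally have e: "stokeslet i j z = 4 * z $ i * z $ j * (q * norm z powr - real CARD('n))
     - kd i j * ((2 * real CARD('n) - 2) * norm z powr (2 - real CARD('n)) + 4 * q * norm z powr (2 - real CARD('n)))" .
  have poly: "4 * a * b * (r * c) - k * ((2 * m - 2) * d + 4 * r * d) = 2 * (2 - m) * (a * (b * c)) + (- 2 * k) * d"
    if "2 * r = 2 - m" for a b c d k m r :: real
    using that by algebra
  show ?thesis unfolding e by (rule poly) (simp add: q_def)
qed

lemma stokeslet_measurable: "stokeslet i j \<in> borel_measurable borel"
  unfolding stokeslet_def by (rule curl_field_measurable; measurable)

lemma stokeslet_deriv_measurable: "stokeslet_deriv i j k \<in> borel_measurable borel"
  unfolding stokeslet_deriv_def by (rule curl_field_deriv_measurable; measurable)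

lemma homog_stokeslet: "homog (2 - real CARD('n)) (stokeslet i j :: real^'n::finite \<Rightarrow> real)"
proof (rule hg_cong[OF _ stokeslet_measurable])
  have "homog (- real CARD('n) + 1 + 1) (\<lambda>z::real^'n. z $ i * (z $ j * norm z powr - real CARD('n)))"
    by (intro hg_coord hg_powr)
  then have "homog (2 - real CARD('n)) (\<lambda>z::real^'n. z $ i * (z $ j * norm z powr - real CARD('n)))"
    by (rule homog_degree) simp
  then show "homog (2 - real CARD('n)) (\<lambda>z::real^'n. 2 * (2 - real CARD('n)) * (z $ i * (z $ j * norm z powr - real CARD('n))) + (- 2 * kd i j) * norm z powr (2 - real CARD('n)))"
    by (intro hg_add hg_scale hg_powr)
  show "\<forall>z. z \<noteq> 0 \<longrightarrow> stokeslet i j z = 2 * (2 - real CARD('n)) * (z $ i * (z $ j * norm z powr - real CARD('n))) + (- 2 * kd i j) * norm z powr (2 - real CARD('n))"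
    using stokeslet_eq by blast
qed

lemma GDERIV_stokeslet:
  fixes z :: "real^'n::finite"
  assumes z: "z \<noteq> 0"
  shows "GDERIV (stokeslet i j) z :> (\<chi> k. stokeslet_deriv i j k z)"
proof -
  let ?q = "(2 - real CARD('n)) / 2"
  obtain G where G: "GDERIV (stokeslet i j) z :> G"
    using homog_gderiv[OF homog_stokeslet[of i j]] z by blast
  have "G $ k = stokeslet_deriv i j k z" for k
  proof -
    have pos: "z \<bullet> z > - (0\<^sup>2)" using z by simp
    have d: "(power_chain ?q 0 0 has_real_derivative power_chain ?q 0 1 (z \<bullet> z)) (at (z \<bullet> z))"
      "(power_chain ?q 0 1 has_real_derivative power_chain ?q 0 2 (z \<bullet> z)) (at (z \<bullet> z))"
      using DERIV_power_chain[OF pos, of ?q 0] DERIV_power_chain[OF pos, of ?q 1] by (simp_all add: numeral_2_eq_2)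
    have "partial_deriv k (stokeslet i j) z = stokeslet_deriv i j k z"
    proof (rule partial_deriv_line)
      show "stokeslet i j differentiable at z" using G unfolding gderiv_def differentiable_def by blast
      show "((\<lambda>t. stokeslet i j (z + t *\<^sub>R axis k 1)) has_real_derivative stokeslet_deriv i j k z) (at 0)"
        unfolding stokeslet_def stokeslet_deriv_def by (intro curl_field_line d)
    qed
    then show ?thesis using partial_deriv_gderiv[OF G] by simp
  qed
  then have "G = (\<chi> k. stokeslet_deriv i j k z)" by (simp add: vec_eq_iff)
  then show ?thesis using G by simp
qed

text \<open>Homogeneity is inherited from the abstract gradient of \<open>stokeslet\<close>, which
  agrees with the explicit formula off the origin because gradients are unique.\<close>

lemma homog_stokeslet_deriv: "homog (1 - real CARD('n)) (stokeslet_deriv i j k :: real^'n::finite \<Rightarrow> real)"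
proof -
  obtain G where G: "\<And>z. z \<noteq> 0 \<Longrightarrow> GDERIV (stokeslet i j :: real^'n \<Rightarrow> real) z :> G z" "\<And>k. homog (2 - real CARD('n) - 1) (\<lambda>z. G z $ k)"
    using homog_gderiv[OF homog_stokeslet[of i j]] by blast
  have "stokeslet_deriv i j k z = G z $ k" if "z \<noteq> 0" for z
    using partial_deriv_gderiv[OF G(1)[OF that], of k] partial_deriv_gderiv[OF GDERIV_stokeslet[OF that, of i j], of k] by simp
  then have "homog (2 - real CARD('n) - 1) (stokeslet_deriv i j k :: real^'n \<Rightarrow> real)"
    using hg_cong[OF G(2) stokeslet_deriv_measurable] by blast
  then show ?thesis by (rule homog_degree) simp
qed

lemma stokeslet_even: "stokeslet i j (- z) = stokeslet i j z"
  by (simp add: stokeslet_def curl_field_def)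

lemma stokeslet_deriv_odd: "stokeslet_deriv i j k (- z) = - stokeslet_deriv i j k z"
  by (simp add: stokeslet_deriv_def curl_field_deriv_def algebra_simps)

text \<open>This is the linear relation among the diagonal fields that later permits removal of the
  (N, N) term.\<close>

lemma stokeslet_deriv_div_free: "(\<Sum>j\<in>UNIV. stokeslet_deriv i j j z) = 0"
  unfolding stokeslet_deriv_def by (rule curl_field_div_free)

lemma stokes_const_nonzero: "3 \<le> CARD('n::finite) \<Longrightarrow> stokes_const TYPE('n) \<noteq> 0"
  unfolding stokes_const_def by (simp add: less_imp_neq[OF unit_ball_vol_pos, symmetric])

text \<open>With M = \<open>stokes_const\<close> and \<omega> the volume of the unit ball, 2(2 -
  n)/M = 1/(2 n \<omega>) is the coefficient of the tensor part, and -2/M = 1/(2 n (n - 2) \<omega>)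
  that of the Kronecker part.\<close>

lemma Lorentz_eq_stokeslet:
  fixes z :: "real^'n::finite"
  assumes n: "3 \<le> CARD('n)" and z: "z \<noteq> 0"
  shows "Lorentz i j z = stokeslet i j z / stokes_const TYPE('n)"
proof -
  let ?n = "real CARD('n)"
  have n0: "?n > 0" "?n - 2 > 0" using n by auto
  have w: "omega CARD('n) = unit_ball_vol ?n" using n by (intro omega_eq_unit_ball_vol) simp
  have wp: "unit_ball_vol ?n > 0" using unit_ball_vol_pos[of ?n] by simp
  have p: "norm z powr - ?n = 1 / norm z ^ CARD('n)" using z by (simp add: powr_minus_divide powr_realpow)
  have "stokeslet i j z / stokes_const TYPE('n) =
     (2 * (2 - ?n)) / stokes_const TYPE('n) * (z $ i * z $ j / norm z ^ CARD('n)) + (- 2 / stokes_const TYPE('n)) * kd i j * norm z powr (2 - ?n)"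
    unfolding stokeslet_eq[OF z] p add_divide_distrib by simp
  also have "(2 * (2 - ?n)) / stokes_const TYPE('n) = 1 / (2 * ?n * unit_ball_vol ?n)"
    unfolding stokes_const_def using n0 wp by (simp add: divide_simps) (simp add: algebra_simps)?
  also have "- 2 / stokes_const TYPE('n) = 1 / 2 * (1 / (?n * (?n - 2) * unit_ball_vol ?n))"
    unfolding stokes_const_def using n0 wp by (simp add: divide_simps) (simp add: algebra_simps)?
  finally show ?thesis
    unfolding Lorentz_def fund_sol_def w by (simp add: kd_def)
qed

lemma Phi_eq_stokeslet_deriv:
  fixes z :: "real^'n::finite"
  assumes n: "3 \<le> CARD('n)" and z: "z \<noteq> 0"
  shows "Phi j k i z = stokeslet_deriv i j k z / stokes_const TYPE('n)"
proof -
  let ?M = "stokes_const TYPE('n)"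
  have "GDERIV (\<lambda>z. 1 / ?M * stokeslet i j z) z :> (1 / ?M) *\<^sub>R (\<chi> k. stokeslet_deriv i j k z)"
    using GDERIV_mult[OF GDERIV_const GDERIV_stokeslet[OF z, of i j], of "1 / ?M"] by simp
  then have "GDERIV (Lorentz i j) z :> (1 / ?M) *\<^sub>R (\<chi> k. stokeslet_deriv i j k z)"
    by (rule GDERIV_cong_off_0[OF _ z]) (simp add: Lorentz_eq_stokeslet[OF n])
  from partial_deriv_gderiv[OF this, of k] show ?thesis by (simp add: Phi_def)
qed

section \<open>The two-pass bootstrap\<close>

text \<open>The choice of \<eta> makes min (a - 2) n at least n - 1 + 2\<eta>. One of the two \<eta>
  pays for the logarithm, through ln b \<le> b^\<eta> / \<eta>, and the other is the gain of the
  first pass.\<close>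

lemma decay_le_norm:
  fixes x :: "real^'n::finite"
  assumes \<eta>: "0 < \<eta>" "\<eta> \<le> 1/2" "2 * \<eta> \<le> a - real CARD('n) - 1" and x: "1 \<le> norm x"
  shows "decay a x \<le> (1 + 1 / \<eta>) * norm x powr (1 - real CARD('n) - \<eta>)"
proof -
  let ?b = "bracket x"
  have b: "1 \<le> ?b" by (rule bracket_ge_1)
  have b1: "1 \<le> ?b powr \<eta>" using b \<eta> by (simp add: ge_one_powr_ge_zero)
  have ln: "1 + (if a = real CARD('n) + 2 then ln ?b else 0) \<le> (1 + 1 / \<eta>) * ?b powr \<eta>"
  proof -
    have "ln ?b \<le> ?b powr \<eta> / \<eta>" using b \<eta> by (intro ln_powr_bound) auto
    then show ?thesis using b1 \<eta> by (auto simp: distrib_right add_increasing2)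
  qed
  have "decay a x \<le> ?b powr - (real CARD('n) - 1 + 2 * \<eta>) * ((1 + 1 / \<eta>) * ?b powr \<eta>)"
    unfolding decay_def using b \<eta> ln by (intro mult_mono powr_mono) (auto simp: min_def)
  also have "\<dots> = (1 + 1 / \<eta>) * (?b powr - (real CARD('n) - 1 + 2 * \<eta>) * ?b powr \<eta>)" by simp
  also have "?b powr - (real CARD('n) - 1 + 2 * \<eta>) * ?b powr \<eta> = ?b powr (1 - real CARD('n) - \<eta>)"
    by (simp add: powr_add[symmetric])
  also have "(1 + 1 / \<eta>) * ?b powr (1 - real CARD('n) - \<eta>) \<le> (1 + 1 / \<eta>) * norm x powr (1 - real CARD('n) - \<eta>)"
  proof (intro mult_left_mono powr_mono2')
    have "1 \<le> real CARD('n)" by (simp add: Suc_leI)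
    then show "1 - real CARD('n) - \<eta> \<le> 0" using \<eta> by linarith
    show "0 < norm x" using x by linarith
  qed (use \<eta> norm_le_bracket in auto)
  finally show ?thesis .
qed

lemma decays_integral_bound:
  assumes "decays (F :: real^'n::finite \<Rightarrow> real) A b" "real CARD('n) < b"
  shows "\<bar>LBINT y. F y\<bar> \<le> A * (LBINT y. bracket (y::real^'n) powr - b)"
proof -
  have i: "integrable lborel (\<lambda>y::real^'n. A * bracket y powr - b)"
    using assms by (intro integrable_mult_right integrable_bracket_powr) auto
  have "\<bar>LBINT y. F y\<bar> \<le> (LBINT y. \<bar>F y\<bar>)" by (rule integral_abs_bound)
  also have "\<dots> \<le> (LBINT y. A * bracket (y::real^'n) powr - b)"
    by (rule integral_le_bound(2)[OF _ i]) (use assms in \<open>auto simp: decays_def\<close>)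
  finally show ?thesis by simp
qed

text \<open>The coefficient of \<open>\<Phi>\<^sup>j\<^sup>k\<close> before the trace is removed.\<close>

definition full_coeff :: "(real^'n::finite \<Rightarrow> real^'n) \<Rightarrow> (real^'n \<Rightarrow> real^'n) \<Rightarrow> 'n \<Rightarrow> 'n \<Rightarrow> real" where
  "full_coeff f u j k = - ((LBINT y. y $ k * f y $ j) + (LBINT y. u y $ k * u y $ j))"

text \<open>The leading term with all n^2 coefficients. In this form it is visibly odd and bounded
  by a multiple of |x|^(1 - n), which is what the bootstrap uses; the sum without (N, N) is
  recovered at the end.\<close>

definition profile :: "(real^'n::finite \<Rightarrow> real^'n) \<Rightarrow> (real^'n \<Rightarrow> real^'n) \<Rightarrow> 'n \<Rightarrow> real^'n \<Rightarrow> real" where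
  "profile f u i x = (\<Sum>j\<in>UNIV. \<Sum>k\<in>UNIV. stokeslet_deriv i j k x * full_coeff f u j k) / stokes_const TYPE('n)"

definition integral_solution :: "(real^'n::finite \<Rightarrow> real^'n) \<Rightarrow> (real^'n \<Rightarrow> real^'n) \<Rightarrow> bool" where
  "integral_solution f u \<longleftrightarrow> (\<forall>i. AE x in lborel. stokes_const TYPE('n) * u x $ i =
    (\<Sum>j\<in>UNIV. LBINT y. stokeslet i j (x - y) * f y $ j)
    - (\<Sum>j\<in>UNIV. \<Sum>k\<in>UNIV. LBINT y. stokeslet_deriv i j k (x - y) * (u y $ k * u y $ j)))"

text \<open>One step of the bootstrap: an expansion of the quadratic potentials with error \<open>w\<close> yields one of \<open>u\<close>.\<close>

lemma expansion_step:
  fixes f u :: "real^'n::finite \<Rightarrow> real^'n" and x :: "real^'n"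
  assumes rep: "stokes_const TYPE('n) * u x $ i =
      (\<Sum>j\<in>UNIV. LBINT y. stokeslet i j (x - y) * f y $ j)
      - (\<Sum>j\<in>UNIV. \<Sum>k\<in>UNIV. LBINT y. stokeslet_deriv i j k (x - y) * (u y $ k * u y $ j))"
    and n: "3 \<le> CARD('n)"
    and quad: "\<And>j k. \<bar>(LBINT y. stokeslet_deriv i j k (x - y) * (u y $ k * u y $ j)) - stokeslet_deriv i j k x * (LBINT y. u y $ k * u y $ j)\<bar> \<le> K j k * w"
    and force: "\<And>j. \<bar>(LBINT y. stokeslet i j (x - y) * f y $ j) - (stokeslet i j x * (LBINT y. f y $ j) - (\<Sum>k\<in>UNIV. stokeslet_deriv i j k x * (LBINT y. y $ k * f y $ j)))\<bar> \<le> L j * w"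
    and mean: "\<And>j. (LBINT y. f y $ j) = 0"
  shows "\<bar>u x $ i - profile f u i x\<bar> \<le> ((\<Sum>j\<in>UNIV. L j) + (\<Sum>j\<in>UNIV. \<Sum>k\<in>UNIV. K j k)) / \<bar>stokes_const TYPE('n)\<bar> * w"
proof -
  let ?M = "stokes_const TYPE('n)"
  have M: "?M \<noteq> 0" by (rule stokes_const_nonzero[OF n])
  define X where "X j = (LBINT y. stokeslet i j (x - y) * f y $ j)" for j
  define Y where "Y j k = (LBINT y. stokeslet_deriv i j k (x - y) * (u y $ k * u y $ j))" for j k
  define X' where "X' j = (\<Sum>k\<in>UNIV. stokeslet_deriv i j k x * (LBINT y. y $ k * f y $ j))" for j
  define Y' where "Y' j k = stokeslet_deriv i j k x * (LBINT y. u y $ k * u y $ j)" for j k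
  have P: "?M * profile f u i x = - (\<Sum>j\<in>UNIV. X' j) - (\<Sum>j\<in>UNIV. \<Sum>k\<in>UNIV. Y' j k)"
  proof -
    have "stokeslet_deriv i j k x * full_coeff f u j k = - (stokeslet_deriv i j k x * (LBINT y. y $ k * f y $ j)) - Y' j k" for j k
      by (simp add: full_coeff_def Y'_def algebra_simps)
    then show ?thesis using M by (simp add: profile_def X'_def sum_subtractf sum_negf)
  qed
  have "?M * (u x $ i - profile f u i x) = (\<Sum>j\<in>UNIV. X j + X' j) - (\<Sum>j\<in>UNIV. \<Sum>k\<in>UNIV. Y j k - Y' j k)"
    unfolding right_diff_distrib P rep X_def[symmetric] Y_def[symmetric] by (simp add: sum.distrib sum_subtractf)
  also have "\<bar>\<dots>\<bar> \<le> (\<Sum>j\<in>UNIV. L j * w) + (\<Sum>j\<in>UNIV. \<Sum>k\<in>UNIV. K j k * w)"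
  proof -
    have tri: "\<bar>a - b\<bar> \<le> a' + b'" if "\<bar>a\<bar> \<le> a'" "\<bar>b\<bar> \<le> b'" for a b a' b' :: real using that by linarith
    have 1: "\<bar>X j + X' j\<bar> \<le> L j * w" for j using force[of j] by (simp add: X_def X'_def mean)
    have 2: "\<bar>Y j k - Y' j k\<bar> \<le> K j k * w" for j k using quad[of j k] by (simp add: Y_def Y'_def)
    show ?thesis
      by (rule tri) (intro order_trans[OF sum_abs] sum_mono 1 2)+
  qed
  also have "\<dots> = ((\<Sum>j\<in>UNIV. L j) + (\<Sum>j\<in>UNIV. \<Sum>k\<in>UNIV. K j k)) * w"
    by (simp add: sum_distrib_right distrib_right)
  finally have "\<bar>?M\<bar> * \<bar>u x $ i - profile f u i x\<bar> \<le> ((\<Sum>j\<in>UNIV. L j) + (\<Sum>j\<in>UNIV. \<Sum>k\<in>UNIV. K j k)) * w"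
    by (simp only: abs_mult)
  then have "\<bar>u x $ i - profile f u i x\<bar> \<le> (((\<Sum>j\<in>UNIV. L j) + (\<Sum>j\<in>UNIV. \<Sum>k\<in>UNIV. K j k)) * w) / \<bar>?M\<bar>"
    using M by (subst pos_le_divide_eq) (simp_all add: mult.commute)
  then show ?thesis by simp
qed

text \<open>The constants K1 to K5 come from the kernels before any solution is fixed. Bounds on
  moments by multiples of \<epsilon> then make the profile, and both parts of u \<otimes> u, of size
  O(\<epsilon>).\<close>

lemma asymptotic_expansion:
  assumes n: "3 \<le> CARD('n::finite)" and a: "real CARD('n) + 1 < a"
  shows "\<exists>C. \<forall>\<epsilon> (u :: real^'n \<Rightarrow> real^'n) f. 0 < \<epsilon> \<longrightarrow> \<epsilon> \<le> 1 \<longrightarrow>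
    u \<in> borel_measurable borel \<longrightarrow> f \<in> borel_measurable borel \<longrightarrow>
    (\<forall>x. norm (u x) \<le> \<epsilon> * bracket x powr (1 - real CARD('n))) \<longrightarrow>
    (\<forall>x. norm (f x) \<le> \<epsilon> * bracket x powr - a) \<longrightarrow>
    (\<forall>j. (LBINT y. f y $ j) = 0) \<longrightarrow> integral_solution f u \<longrightarrow>
    (\<forall>i. AE x in lborel. 1 \<le> norm x \<longrightarrow> \<bar>u x $ i - profile f u i x\<bar> \<le> C * \<epsilon> * decay a x)"
proof -
  let ?n = "real CARD('n)" and ?M = "stokes_const TYPE('n)"
  have n3: "3 \<le> ?n" using n by simp
  \<comment> \<open>The second entry is half the margin of a above n + 1, as
    \<open>decay_le_norm\<close> requires; the entry 1/2 keeps n + \<eta> below the decay exponent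
    2n - 2 of u \<otimes> u when n = 3.\<close>
  define \<eta> where "\<eta> = min (1/2) ((a - ?n - 1) / 2)"
  have \<eta>: "0 < \<eta>" "\<eta> \<le> 1/2" "\<eta> \<le> 1" "2 * \<eta> \<le> a - ?n - 1" using a by (auto simp: \<eta>_def min_def)
  have d: "- ?n < 1 - ?n" "1 - ?n \<le> 0" using n3 by auto
  have e1: "1 - ?n - 1 = - ?n" by simp
  \<comment> \<open>For the first pass: only the crude decay of u \<otimes> u is known.\<close>
  have "\<forall>i j k. \<exists>C\<ge>0. \<forall>F A (x::real^'n). decays F A (2 * ?n - 2) \<longrightarrow> 1 \<le> norm x \<longrightarrow>
    \<bar>(LBINT y. stokeslet_deriv i j k (x - y) * F y) - stokeslet_deriv i j k x * (LBINT y. F y)\<bar> \<le> C * A * norm x powr (1 - ?n - \<eta>)"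
    by (intro allI asymptotic_order0[OF homog_stokeslet_deriv d \<eta>(1,3)]) (use \<eta>(2) n3 in linarith)
  then obtain K1 where K1': "\<forall>i j k. 0 \<le> K1 i j k \<and> (\<forall>F A (x::real^'n). decays F A (2 * ?n - 2) \<longrightarrow> 1 \<le> norm x \<longrightarrow>
    \<bar>(LBINT y. stokeslet_deriv i j k (x - y) * F y) - stokeslet_deriv i j k x * (LBINT y. F y)\<bar> \<le> K1 i j k * A * norm x powr (1 - ?n - \<eta>))"
    unfolding choice_iff vec_lambda_beta by (elim exE)
  then have K1: "\<And>i j k. 0 \<le> K1 i j k" "\<And>i j k F A (x::real^'n). decays F A (2 * ?n - 2) \<Longrightarrow> 1 \<le> norm x \<Longrightarrow>
    \<bar>(LBINT y. stokeslet_deriv i j k (x - y) * F y) - stokeslet_deriv i j k x * (LBINT y. F y)\<bar> \<le> K1 i j k * A * norm x powr (1 - ?n - \<eta>)"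
    by blast+
  \<comment> \<open>For the second pass, remainder part: its first moment is finite, so a full order
    is gained.\<close>
  have "\<forall>i j k. \<exists>C\<ge>0. \<forall>F A (x::real^'n). decays F A (?n + 1 + \<eta>) \<longrightarrow> 1 \<le> norm x \<longrightarrow>
    \<bar>(LBINT y. stokeslet_deriv i j k (x - y) * F y) - stokeslet_deriv i j k x * (LBINT y. F y)\<bar> \<le> C * A * norm x powr - ?n"
    by (intro allI asymptotic_order0[OF homog_stokeslet_deriv d, of 1, unfolded e1]) (use \<eta>(1) in auto)
  then obtain K2 where K2': "\<forall>i j k. 0 \<le> K2 i j k \<and> (\<forall>F A (x::real^'n). decays F A (?n + 1 + \<eta>) \<longrightarrow> 1 \<le> norm x \<longrightarrow>
    \<bar>(LBINT y. stokeslet_deriv i j k (x - y) * F y) - stokeslet_deriv i j k x * (LBINT y. F y)\<bar> \<le> K2 i j k * A * norm x powr - ?n)"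
    unfolding choice_iff vec_lambda_beta by (elim exE)
  then have K2: "\<And>i j k. 0 \<le> K2 i j k" "\<And>i j k F A (x::real^'n). decays F A (?n + 1 + \<eta>) \<Longrightarrow> 1 \<le> norm x \<Longrightarrow>
    \<bar>(LBINT y. stokeslet_deriv i j k (x - y) * F y) - stokeslet_deriv i j k x * (LBINT y. F y)\<bar> \<le> K2 i j k * A * norm x powr - ?n"
    by blast+
  \<comment> \<open>For the second pass, profile part: at the exponent n + 1, which is 2n - 2 for n
    = 3, evenness replaces the missing first moment.\<close>
  have "\<forall>i j k. \<exists>C\<ge>0. \<forall>F A (x::real^'n). decays F A (?n + 1) \<longrightarrow> (\<forall>y. F (- y) = F y) \<longrightarrow> 1 \<le> norm x \<longrightarrow>
    \<bar>(LBINT y. stokeslet_deriv i j k (x - y) * F y) - stokeslet_deriv i j k x * (LBINT y. F y)\<bar> \<le> C * A * norm x powr - ?n"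
    by (intro allI asymptotic_even[OF homog_stokeslet_deriv d, unfolded e1])
  then obtain K3 where K3': "\<forall>i j k. 0 \<le> K3 i j k \<and> (\<forall>F A (x::real^'n). decays F A (?n + 1) \<longrightarrow> (\<forall>y. F (- y) = F y) \<longrightarrow> 1 \<le> norm x \<longrightarrow>
    \<bar>(LBINT y. stokeslet_deriv i j k (x - y) * F y) - stokeslet_deriv i j k x * (LBINT y. F y)\<bar> \<le> K3 i j k * A * norm x powr - ?n)"
    unfolding choice_iff vec_lambda_beta by (elim exE)
  then have K3: "\<And>i j k. 0 \<le> K3 i j k" "\<And>i j k F A (x::real^'n). decays F A (?n + 1) \<Longrightarrow> \<forall>y. F (- y) = F y \<Longrightarrow> 1 \<le> norm x \<Longrightarrow>
    \<bar>(LBINT y. stokeslet_deriv i j k (x - y) * F y) - stokeslet_deriv i j k x * (LBINT y. F y)\<bar> \<le> K3 i j k * A * norm x powr - ?n"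
    by blast+
  have kint: "integrable lborel (\<lambda>y. stokeslet_deriv i j k (x - y) * F y)" if "decays F A (?n + 1)" "1 \<le> norm x" for i j k F A and x :: "real^'n"
  proof -
    have "?n < ?n + 1" by simp
    from far_kernel[OF homog_stokeslet_deriv d this, of i j k] that show ?thesis by blast
  qed
  have "\<forall>i j. \<exists>C\<ge>0. \<forall>F A (x::real^'n). decays F A a \<longrightarrow> 1 \<le> norm x \<longrightarrow>
    \<bar>(LBINT y. stokeslet i j (x - y) * F y) - (stokeslet i j x * (LBINT y. F y) - (\<Sum>k\<in>UNIV. (\<chi> k. stokeslet_deriv i j k x) $ k * (LBINT y. y $ k * F y)))\<bar>
      \<le> C * A * decay a x"
    by (intro allI asymptotic_order1[OF homog_stokeslet GDERIV_stokeslet _ a]) (use n in auto)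
  then obtain K4 where K4': "\<forall>i j. 0 \<le> K4 i j \<and> (\<forall>F A (x::real^'n). decays F A a \<longrightarrow> 1 \<le> norm x \<longrightarrow>
    \<bar>(LBINT y. stokeslet i j (x - y) * F y) - (stokeslet i j x * (LBINT y. F y) - (\<Sum>k\<in>UNIV. stokeslet_deriv i j k x * (LBINT y. y $ k * F y)))\<bar>
      \<le> K4 i j * A * decay a x)"
    unfolding choice_iff vec_lambda_beta by (elim exE)
  then have K4: "\<And>i j. 0 \<le> K4 i j" "\<And>i j F A (x::real^'n). decays F A a \<Longrightarrow> 1 \<le> norm x \<Longrightarrow>
    \<bar>(LBINT y. stokeslet i j (x - y) * F y) - (stokeslet i j x * (LBINT y. F y) - (\<Sum>k\<in>UNIV. stokeslet_deriv i j k x * (LBINT y. y $ k * F y)))\<bar>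
      \<le> K4 i j * A * decay a x"
    by blast+
  have "\<forall>i j k. \<exists>C. 0 \<le> C \<and> (\<forall>x::real^'n. x \<noteq> 0 \<longrightarrow> \<bar>stokeslet_deriv i j k x\<bar> \<le> C * norm x powr (1 - ?n))"
    by (intro allI homog_bound homog_stokeslet_deriv)
  then obtain K5 where "\<forall>i j k. 0 \<le> K5 i j k \<and> (\<forall>x::real^'n. x \<noteq> 0 \<longrightarrow> \<bar>stokeslet_deriv i j k x\<bar> \<le> K5 i j k * norm x powr (1 - ?n))"
    unfolding choice_iff by (elim exE)
  then have K5: "\<And>i j k. 0 \<le> K5 i j k" "\<And>i j k (x::real^'n). x \<noteq> 0 \<Longrightarrow> \<bar>stokeslet_deriv i j k x\<bar> \<le> K5 i j k * norm x powr (1 - ?n)"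
    by blast+
  define I1 where "I1 = (LBINT y. bracket (y::real^'n) powr - (a - 1))"
  define I2 where "I2 = (LBINT y. bracket (y::real^'n) powr - (2 * ?n - 2))"
  have I0: "0 \<le> I1" "0 \<le> I2" unfolding I1_def I2_def by (auto intro!: integral_nonneg_AE)
  define Kd where "Kd = 1 + 1 / \<eta>"
  have Kd0: "0 \<le> Kd" using \<eta> by (simp add: Kd_def)
  define C1 where "C1 i = ((\<Sum>j\<in>UNIV. K4 i j * Kd) + (\<Sum>j\<in>UNIV. \<Sum>k\<in>UNIV. K1 i j k)) / \<bar>?M\<bar>" for i
  define C1m where "C1m = (\<Sum>i\<in>UNIV. C1 i)"
  have C10: "0 \<le> C1 i" for i unfolding C1_def by (intro divide_nonneg_nonneg add_nonneg_nonneg sum_nonneg mult_nonneg_nonneg K4 K1 Kd0) auto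
  have C1m: "C1 i \<le> C1m" "0 \<le> C1m" for i unfolding C1m_def using C10 by (auto intro!: member_le_sum sum_nonneg)
  define CP where "CP i = (\<Sum>j\<in>UNIV. \<Sum>k\<in>UNIV. K5 i j k * (I1 + I2)) / \<bar>?M\<bar>" for i
  define CPm where "CPm = (\<Sum>i\<in>UNIV. CP i)"
  have CP0: "0 \<le> CP i" for i unfolding CP_def by (intro divide_nonneg_nonneg sum_nonneg mult_nonneg_nonneg K5 add_nonneg_nonneg I0) auto
  have CPm: "CP i \<le> CPm" "0 \<le> CPm" for i unfolding CPm_def using CP0 by (auto intro!: member_le_sum sum_nonneg)
  define A1 where "A1 = CPm * CPm * 2 powr (2 * ?n - 2)"
  \<comment> \<open>The first summand covers |y| < 1, where \<open>bracket y\<close> \<le> 2; the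
    second covers |y| \<ge> 1, combining the sizes of u and of the profile with the first-pass
    error. The power of 2 there converts |y| into \<open>bracket y\<close>.\<close>
  define A2 where "A2 = 2 powr (?n + 2) + (1 + CPm) * C1m * 2 powr (2 * ?n - 2 + \<eta>)"
  define C2 where "C2 i = ((\<Sum>j\<in>UNIV. K4 i j) + (\<Sum>j\<in>UNIV. \<Sum>k\<in>UNIV. (K2 i j k * A2 + K3 i j k * A1) * 2 powr ?n)) / \<bar>?M\<bar>" for i
  define C where "C = (\<Sum>i\<in>UNIV. C2 i)"
  have A0: "0 \<le> A1" "0 \<le> A2" using CPm C1m by (auto simp: A1_def A2_def)
  have C20: "0 \<le> C2 i" for i unfolding C2_def by (intro divide_nonneg_nonneg add_nonneg_nonneg sum_nonneg mult_nonneg_nonneg K4 K2 K3 A0) auto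
  have C2C: "C2 i \<le> C" for i unfolding C_def using C20 by (auto intro!: member_le_sum)
  have main: "AE x in lborel. 1 \<le> norm x \<longrightarrow> \<bar>u x $ i - profile f u i x\<bar> \<le> C * \<epsilon> * decay a x"
    if \<epsilon>: "0 < \<epsilon>" "\<epsilon> \<le> 1" and um [measurable]: "u \<in> borel_measurable borel" and fm [measurable]: "f \<in> borel_measurable borel"
      and u: "\<And>x. norm (u x) \<le> \<epsilon> * bracket x powr (1 - ?n)" and f: "\<And>x. norm (f x) \<le> \<epsilon> * bracket x powr - a"
      and mean: "\<And>j. (LBINT y. f y $ j) = 0" and rep: "integral_solution f u"
    for \<epsilon> i and u f :: "real^'n \<Rightarrow> real^'n"
  proof -
    have ucm [measurable]: "(\<lambda>x. u x $ k) \<in> borel_measurable borel" for k by (rule measurable_compose[OF um borel_measurable_nth])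
    have fcm [measurable]: "(\<lambda>x. f x $ k) \<in> borel_measurable borel" for k by (rule measurable_compose[OF fm borel_measurable_nth])
    have uc: "\<bar>u x $ k\<bar> \<le> \<epsilon> * bracket x powr (1 - ?n)" for x k
      using order_trans[OF component_le_norm_cart u] .
    have fc: "\<bar>f x $ k\<bar> \<le> \<epsilon> * bracket x powr - a" for x k
      using order_trans[OF component_le_norm_cart f] .
    \<comment> \<open>Here \<epsilon> \<le> 1 keeps the quadratic terms of size
      O(\<epsilon>).\<close>
    have \<epsilon>2: "\<epsilon> * \<epsilon> \<le> \<epsilon>" using \<epsilon> by (simp add: mult_le_cancel_left1)
    have uu: "\<bar>u x $ k * u x $ j\<bar> \<le> \<epsilon> * bracket x powr - (2 * ?n - 2)" for x j k
    proof -
      have "\<bar>u x $ k * u x $ j\<bar> \<le> (\<epsilon> * bracket x powr (1 - ?n)) * (\<epsilon> * bracket x powr (1 - ?n))"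
        unfolding abs_mult using \<epsilon> by (intro mult_mono uc) auto
      also have "\<dots> = (\<epsilon> * \<epsilon>) * bracket x powr ((1 - ?n) + (1 - ?n))" by (simp only: powr_add mult_ac)
      also have "\<dots> \<le> \<epsilon> * bracket x powr ((1 - ?n) + (1 - ?n))" by (intro mult_right_mono \<epsilon>2) auto
      finally show ?thesis by (simp add: algebra_simps)
    qed
    have du: "decays (\<lambda>y. u y $ k * u y $ j) \<epsilon> (2 * ?n - 2)" for j k
      unfolding decays_def using uu by auto
    have df: "decays (\<lambda>y. f y $ j) \<epsilon> a" for j unfolding decays_def using fc by auto
    have fc1: "\<bar>full_coeff f u j k\<bar> \<le> (I1 + I2) * \<epsilon>" for j k
    proof -
      have "decays (\<lambda>y. y $ k * f y $ j) \<epsilon> (a - 1)"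
        unfolding decays_def
      proof (intro conjI AE_I2)
        have [measurable]: "(\<lambda>y::real^'n. y $ k) \<in> borel_measurable borel" by (rule borel_measurable_nth)
        show "(\<lambda>y. y $ k * f y $ j) \<in> borel_measurable borel" by measurable
        fix y :: "real^'n"
        have "\<bar>y $ k * f y $ j\<bar> \<le> bracket y * (\<epsilon> * bracket y powr - a)"
          unfolding abs_mult using order_trans[OF component_le_norm_cart norm_le_bracket] bracket_pos[of y] by (intro mult_mono fc) auto
        also have "\<dots> = \<epsilon> * bracket y powr - (a - 1)"
          using bracket_pos[of y] powr_add[of "bracket y" 1 "- a"] by (simp add: add.commute)
        finally show "\<bar>y $ k * f y $ j\<bar> \<le> \<epsilon> * bracket y powr - (a - 1)" .
      qed
      then have "\<bar>LBINT y. y $ k * f y $ j\<bar> \<le> \<epsilon> * I1"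
        unfolding I1_def using a by (intro decays_integral_bound) auto
      moreover have "\<bar>LBINT y. u y $ k * u y $ j\<bar> \<le> \<epsilon> * I2"
        unfolding I2_def using n3 by (intro decays_integral_bound du) auto
      ultimately show ?thesis unfolding full_coeff_def by (simp add: algebra_simps)
    qed
    define P where "P l x = profile f u l x" for l x
    have Pb: "\<bar>P l x\<bar> \<le> CPm * \<epsilon> * norm x powr (1 - ?n)" if "x \<noteq> 0" for l x
    proof -
      have "\<bar>\<Sum>j\<in>UNIV. \<Sum>k\<in>UNIV. stokeslet_deriv l j k x * full_coeff f u j k\<bar> \<le> (\<Sum>j\<in>UNIV. \<Sum>k\<in>UNIV. (K5 l j k * norm x powr (1 - ?n)) * ((I1 + I2) * \<epsilon>))"
      proof (intro order_trans[OF sum_abs] sum_mono)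
        fix j k
        show "\<bar>stokeslet_deriv l j k x * full_coeff f u j k\<bar> \<le> (K5 l j k * norm x powr (1 - ?n)) * ((I1 + I2) * \<epsilon>)"
          unfolding abs_mult using K5 that by (intro mult_mono fc1) auto
      qed
      also have "\<dots> = (\<Sum>j\<in>UNIV. \<Sum>k\<in>UNIV. K5 l j k * (I1 + I2)) * (\<epsilon> * norm x powr (1 - ?n))"
        unfolding sum_distrib_right by (intro sum.cong refl) simp
      finally have "\<bar>P l x\<bar> \<le> CP l * (\<epsilon> * norm x powr (1 - ?n))"
        unfolding P_def profile_def CP_def using divide_right_mono[of _ _ "\<bar>?M\<bar>"] by fastforce
      also have "\<dots> \<le> CPm * (\<epsilon> * norm x powr (1 - ?n))" using CPm \<epsilon> by (intro mult_right_mono) auto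
      finally show ?thesis by (simp only: mult.assoc)
    qed
    have Podd: "P l (- x) = - P l x" for l x
      by (simp add: P_def profile_def stokeslet_deriv_odd sum_negf)
    have Pm [measurable]: "P l \<in> borel_measurable borel" for l
      unfolding P_def profile_def using stokeslet_deriv_measurable by measurable
    have pass1: "AE x in lborel. 1 \<le> norm x \<longrightarrow> \<bar>u x $ l - P l x\<bar> \<le> C1m * \<epsilon> * norm x powr (1 - ?n - \<eta>)" for l
    proof -
      have "AE x in lborel. ?M * u x $ l =
        (\<Sum>j\<in>UNIV. LBINT y. stokeslet l j (x - y) * f y $ j)
        - (\<Sum>j\<in>UNIV. \<Sum>k\<in>UNIV. LBINT y. stokeslet_deriv l j k (x - y) * (u y $ k * u y $ j))"
        using rep unfolding integral_solution_def by blast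
      then show ?thesis
      proof eventually_elim
        case (elim x)
        show ?case
        proof
          assume x: "1 \<le> norm x"
          have "\<bar>u x $ l - profile f u l x\<bar> \<le> C1 l * (\<epsilon> * norm x powr (1 - ?n - \<eta>))"
            unfolding C1_def
          proof (rule expansion_step[OF elim n _ _ mean])
            show "\<bar>(LBINT y. stokeslet_deriv l j k (x - y) * (u y $ k * u y $ j)) - stokeslet_deriv l j k x * (LBINT y. u y $ k * u y $ j)\<bar> \<le> K1 l j k * (\<epsilon> * norm x powr (1 - ?n - \<eta>))" for j k
              using K1(2)[OF du x] by (simp only: mult.assoc)
            show "\<bar>(LBINT y. stokeslet l j (x - y) * f y $ j) - (stokeslet l j x * (LBINT y. f y $ j) - (\<Sum>k\<in>UNIV. stokeslet_deriv l j k x * (LBINT y. y $ k * f y $ j)))\<bar> \<le> K4 l j * Kd * (\<epsilon> * norm x powr (1 - ?n - \<eta>))" for j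
            proof (rule order_trans[OF K4(2)[OF df x]])
              have "K4 l j * \<epsilon> * decay a x \<le> K4 l j * \<epsilon> * (Kd * norm x powr (1 - ?n - \<eta>))"
                using decay_le_norm[OF \<eta>(1,2,4) x] K4(1) \<epsilon> by (intro mult_left_mono) (auto simp: Kd_def)
              then show "K4 l j * \<epsilon> * decay a x \<le> K4 l j * Kd * (\<epsilon> * norm x powr (1 - ?n - \<eta>))" by (simp only: mult_ac)
            qed
          qed
          also have "\<dots> \<le> C1m * (\<epsilon> * norm x powr (1 - ?n - \<eta>))" using C1m \<epsilon> by (intro mult_right_mono) auto
          finally show "\<bar>u x $ l - P l x\<bar> \<le> C1m * \<epsilon> * norm x powr (1 - ?n - \<eta>)" by (simp only: P_def mult.assoc)
        qed
      qed
    qed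
    \<comment> \<open>Truncation at |y| \<ge> 1 is needed because the profile is of degree 1 - n at
      the origin and its square need not be integrable there. The indicator is even, so F1 stays
      even, and for |y| < 1 the remainder F2 is u \<otimes> u itself.\<close>
    define F1 where "F1 j k y = indicator {y. 1 \<le> norm y} y * (P k y * P j y)" for j k and y :: "real^'n"
    define F2 where "F2 j k y = u y $ k * u y $ j - F1 j k y" for j k y
    have F1m [measurable]: "F1 j k \<in> borel_measurable borel" for j k unfolding F1_def by measurable
    have F1even: "\<forall>y. F1 j k (- y) = F1 j k y" for j k by (simp add: F1_def Podd indicator_def)
    have F1d: "decays (F1 j k) (A1 * \<epsilon>) (?n + 1)" for j k
      unfolding decays_def
    proof (intro conjI F1m AE_I2)
      fix y :: "real^'n"
      show "\<bar>F1 j k y\<bar> \<le> A1 * \<epsilon> * bracket y powr - (?n + 1)"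
      proof (cases "1 \<le> norm y")
        case True
        then have y0: "y \<noteq> 0" by auto
        have "\<bar>F1 j k y\<bar> \<le> (CPm * \<epsilon> * norm y powr (1 - ?n)) * (CPm * \<epsilon> * norm y powr (1 - ?n))"
          using True Pb[OF y0] CPm \<epsilon> by (simp add: F1_def abs_mult) (intro mult_mono, auto)
        also have "\<dots> = CPm * CPm * (\<epsilon> * \<epsilon>) * norm y powr ((1 - ?n) + (1 - ?n))"
          by (simp only: powr_add mult_ac)
        also have "(1 - ?n) + (1 - ?n) = - (2 * ?n - 2)" by simp
        also have "CPm * CPm * (\<epsilon> * \<epsilon>) * norm y powr - (2 * ?n - 2) \<le> CPm * CPm * \<epsilon> * (2 powr (2 * ?n - 2) * bracket y powr - (?n + 1))"
        proof (intro mult_mono mult_left_mono \<epsilon>2)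
          have "norm y powr - (2 * ?n - 2) \<le> 2 powr (2 * ?n - 2) * bracket y powr - (2 * ?n - 2)"
            using n3 by (intro powr_le_bracket True) auto
          also have "\<dots> \<le> 2 powr (2 * ?n - 2) * bracket y powr - (?n + 1)"
            using n3 bracket_ge_1[of y] by (intro mult_left_mono powr_mono) auto
          finally show "norm y powr - (2 * ?n - 2) \<le> 2 powr (2 * ?n - 2) * bracket y powr - (?n + 1)" .
        qed (use CPm \<epsilon> in auto)
        finally show ?thesis by (simp only: A1_def mult_ac)
      next
        case False
        then show ?thesis using A0 \<epsilon> by (simp add: F1_def indicator_def)
      qed
    qed
    have F2d: "decays (F2 j k) (A2 * \<epsilon>) (?n + 1 + \<eta>)" for j k
      unfolding decays_def
    proof (intro conjI)
      show "F2 j k \<in> borel_measurable borel" unfolding F2_def by measurable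
      show "AE y in lborel. \<bar>F2 j k y\<bar> \<le> A2 * \<epsilon> * bracket y powr - (?n + 1 + \<eta>)"
        using pass1[of j] pass1[of k]
      proof eventually_elim
        case (elim y)
        show ?case
        proof (cases "1 \<le> norm y")
          case True
          then have y0: "y \<noteq> 0" by auto
          have uy: "\<bar>u y $ k\<bar> \<le> \<epsilon> * norm y powr (1 - ?n)"
          proof -
            have "bracket y powr (1 - ?n) \<le> norm y powr (1 - ?n)"
              using True n3 norm_le_bracket[of y] y0 by (intro powr_mono2') auto
            then show ?thesis using uc[of y k] \<epsilon> by (meson less_imp_le mult_left_mono order_trans)
          qed
          \<comment> \<open>A difference of products with one first-pass error in each term: decay
            2n - 2 + \<eta>, at least n + 1 + \<eta>.\<close>
          have "F2 j k y = u y $ k * (u y $ j - P j y) + P j y * (u y $ k - P k y)"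
            using True by (simp add: F2_def F1_def algebra_simps)
          also have "\<bar>\<dots>\<bar> \<le> \<bar>u y $ k\<bar> * \<bar>u y $ j - P j y\<bar> + \<bar>P j y\<bar> * \<bar>u y $ k - P k y\<bar>"
            by (metis abs_mult abs_triangle_ineq)
          also have "\<dots> \<le> (\<epsilon> * norm y powr (1 - ?n)) * (C1m * \<epsilon> * norm y powr (1 - ?n - \<eta>)) + (CPm * \<epsilon> * norm y powr (1 - ?n)) * (C1m * \<epsilon> * norm y powr (1 - ?n - \<eta>))"
            using elim True uy Pb[OF y0] CPm \<epsilon> by (intro add_mono mult_mono) auto
          also have "\<dots> = (1 + CPm) * C1m * (\<epsilon> * \<epsilon>) * norm y powr ((1 - ?n) + (1 - ?n - \<eta>))"
            unfolding powr_add by algebra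
          also have "(1 - ?n) + (1 - ?n - \<eta>) = - (2 * ?n - 2 + \<eta>)" by simp
          also have "(1 + CPm) * C1m * (\<epsilon> * \<epsilon>) * norm y powr - (2 * ?n - 2 + \<eta>) \<le> (1 + CPm) * C1m * \<epsilon> * (2 powr (2 * ?n - 2 + \<eta>) * bracket y powr - (?n + 1 + \<eta>))"
          proof (intro mult_mono mult_left_mono \<epsilon>2)
            have "norm y powr - (2 * ?n - 2 + \<eta>) \<le> 2 powr (2 * ?n - 2 + \<eta>) * bracket y powr - (2 * ?n - 2 + \<eta>)"
              using n3 \<eta> by (intro powr_le_bracket True) auto
            also have "\<dots> \<le> 2 powr (2 * ?n - 2 + \<eta>) * bracket y powr - (?n + 1 + \<eta>)"
              using n3 bracket_ge_1[of y] by (intro mult_left_mono powr_mono) auto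
            finally show "norm y powr - (2 * ?n - 2 + \<eta>) \<le> 2 powr (2 * ?n - 2 + \<eta>) * bracket y powr - (?n + 1 + \<eta>)" .
          qed (use CPm C1m \<epsilon> in auto)
          also have "\<dots> = ((1 + CPm) * C1m * 2 powr (2 * ?n - 2 + \<eta>)) * \<epsilon> * bracket y powr - (?n + 1 + \<eta>)" by (simp only: mult_ac)
          also have "\<dots> \<le> A2 * \<epsilon> * bracket y powr - (?n + 1 + \<eta>)"
            using \<epsilon> by (intro mult_right_mono) (auto simp: A2_def)
          finally show ?thesis .
        next
          case False
          have "bracket y \<le> 2"
            unfolding bracket_def using False power_mono[of "norm y" 1 2] by (intro real_le_lsqrt) auto
          then have "2 powr - (?n + 2) \<le> bracket y powr - (?n + 2)"
            using n3 bracket_pos[of y] by (intro powr_mono2') auto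
          also have "\<dots> \<le> bracket y powr - (?n + 1 + \<eta>)"
            using \<eta> bracket_ge_1[of y] by (intro powr_mono) auto
          finally have "2 powr (?n + 2) * 2 powr - (?n + 2) \<le> 2 powr (?n + 2) * bracket y powr - (?n + 1 + \<eta>)"
            by (intro mult_left_mono) auto
          moreover have "2 powr (?n + 2) * 2 powr - (?n + 2) = (1::real)" by (simp only: powr_add[symmetric]) simp
          ultimately have one: "1 \<le> 2 powr (?n + 2) * bracket y powr - (?n + 1 + \<eta>)" by linarith
          have "bracket y powr - (2 * ?n - 2) \<le> 1"
            using n3 bracket_ge_1[of y] powr_mono2'[of "- (2 * ?n - 2)" 1 "bracket y"] by simp
          then have "\<epsilon> * bracket y powr - (2 * ?n - 2) \<le> \<epsilon> * 1" using \<epsilon> by (intro mult_left_mono) auto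
          moreover have "F2 j k y = u y $ k * u y $ j" using False by (simp add: F2_def F1_def indicator_def)
          ultimately have "\<bar>F2 j k y\<bar> \<le> \<epsilon> * 1" using uu[of y k j] by linarith
          also have "\<dots> \<le> \<epsilon> * (2 powr (?n + 2) * bracket y powr - (?n + 1 + \<eta>))"
            using one \<epsilon> by (intro mult_left_mono) auto
          also have "\<dots> = 2 powr (?n + 2) * \<epsilon> * bracket y powr - (?n + 1 + \<eta>)" by (simp only: mult_ac)
          also have "\<dots> \<le> A2 * \<epsilon> * bracket y powr - (?n + 1 + \<eta>)"
            using \<epsilon> CPm C1m by (intro mult_right_mono) (auto simp: A2_def)
          finally show ?thesis .
        qed
      qed
    qed
    have F2d': "decays (F2 j k) (A2 * \<epsilon>) (?n + 1)" for j k
      by (rule decays_mono[OF F2d]) (use \<eta> in simp)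
    have "AE x in lborel. ?M * u x $ i =
      (\<Sum>j\<in>UNIV. LBINT y. stokeslet i j (x - y) * f y $ j)
      - (\<Sum>j\<in>UNIV. \<Sum>k\<in>UNIV. LBINT y. stokeslet_deriv i j k (x - y) * (u y $ k * u y $ j))"
      using rep unfolding integral_solution_def by blast
    then show ?thesis
    proof eventually_elim
      case (elim x)
      show ?case
      proof
        assume x: "1 \<le> norm x"
        have nd: "norm x powr - ?n \<le> 2 powr ?n * decay a x"
          using a n3 by (intro decay_ge_norm x) auto
        have "\<bar>u x $ i - profile f u i x\<bar> \<le> C2 i * (\<epsilon> * decay a x)"
          unfolding C2_def
        proof (rule expansion_step[OF elim n _ _ mean])
          fix j k
          have Fi: "integrable lborel (F1 j k)" "integrable lborel (F2 j k)"
            using decays_integrable[OF F1d] decays_integrable[OF F2d'] by auto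
          have s: "u y $ k * u y $ j = F1 j k y + F2 j k y" for y by (simp add: F2_def)
          have "(LBINT y. stokeslet_deriv i j k (x - y) * (u y $ k * u y $ j)) - stokeslet_deriv i j k x * (LBINT y. u y $ k * u y $ j)
            = ((LBINT y. stokeslet_deriv i j k (x - y) * F1 j k y) - stokeslet_deriv i j k x * (LBINT y. F1 j k y))
            + ((LBINT y. stokeslet_deriv i j k (x - y) * F2 j k y) - stokeslet_deriv i j k x * (LBINT y. F2 j k y))"
            unfolding s distrib_left Bochner_Integration.integral_add[OF kint[OF F1d x] kint[OF F2d' x]] Bochner_Integration.integral_add[OF Fi] by simp
          also have "\<bar>\<dots>\<bar> \<le> K3 i j k * (A1 * \<epsilon>) * norm x powr - ?n + K2 i j k * (A2 * \<epsilon>) * norm x powr - ?n"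
            by (rule order_trans[OF abs_triangle_ineq]) (intro add_mono K3(2)[OF F1d F1even x] K2(2)[OF F2d x])
          also have "\<dots> = (K2 i j k * A2 + K3 i j k * A1) * \<epsilon> * norm x powr - ?n" by (simp add: algebra_simps)
          also have "\<dots> \<le> (K2 i j k * A2 + K3 i j k * A1) * \<epsilon> * (2 powr ?n * decay a x)"
            using K2(1) K3(1) A0 \<epsilon> by (intro mult_left_mono nd mult_nonneg_nonneg add_nonneg_nonneg) auto
          also have "\<dots> = (K2 i j k * A2 + K3 i j k * A1) * 2 powr ?n * (\<epsilon> * decay a x)" by (simp only: mult_ac)
          finally show "\<bar>(LBINT y. stokeslet_deriv i j k (x - y) * (u y $ k * u y $ j)) - stokeslet_deriv i j k x * (LBINT y. u y $ k * u y $ j)\<bar>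
            \<le> (K2 i j k * A2 + K3 i j k * A1) * 2 powr ?n * (\<epsilon> * decay a x)" .
        next
          fix j
          show "\<bar>(LBINT y. stokeslet i j (x - y) * f y $ j) - (stokeslet i j x * (LBINT y. f y $ j) - (\<Sum>k\<in>UNIV. stokeslet_deriv i j k x * (LBINT y. y $ k * f y $ j)))\<bar> \<le> K4 i j * (\<epsilon> * decay a x)"
            using K4(2)[OF df x] by (simp only: mult.assoc)
        qed
        also have "\<dots> \<le> C * (\<epsilon> * decay a x)" using C2C \<epsilon> decay_nonneg[of a x] by (intro mult_right_mono) auto
        finally show "\<bar>u x $ i - profile f u i x\<bar> \<le> C * \<epsilon> * decay a x" by (simp only: mult.assoc)
      qed
    qed
  qed
  show ?thesis
    by (rule exI[of _ C]) (intro allI impI, rule main, auto)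
qed

section \<open>From Lebesgue classes to Borel representatives\<close>

text \<open>Only g' is assumed measurable. Measurability of g comes from completeness of Lebesgue
  measure: preimages under g and g' differ by a null set.\<close>

lemma
  fixes g g' :: "'a::euclidean_space \<Rightarrow> 'b::{banach, second_countable_topology}"
  assumes g': "g' \<in> borel_measurable borel" and ae: "AE x in lborel. g x = g' x"
  shows integral_lebesgue_lborel: "integral\<^sup>L lebesgue g = integral\<^sup>L lborel g'"
    and integrable_lebesgue_lborel: "integrable lebesgue g \<longleftrightarrow> integrable lborel g'"
proof -
  have ae': "AE x in lebesgue. g x = g' x" using ae by (rule AE_completion)
  have g'l: "g' \<in> borel_measurable lebesgue" using g' by (simp add: measurable_completion)
  have gl: "g \<in> borel_measurable lebesgue"
  proof (rule measurableI)
    fix S :: "'b set" assume S: "S \<in> sets borel"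
    have "g' -` S \<inter> space lebesgue \<in> sets lebesgue" using g'l S by (rule measurable_sets)
    then show "g -` S \<inter> space lebesgue \<in> sets lebesgue"
      by (rule completion.in_sets_AE[rotated]) (use ae' in auto)
  qed simp
  show "integral\<^sup>L lebesgue g = integral\<^sup>L lborel g'"
    using integral_cong_AE[OF gl g'l ae'] integral_completion[of g' lborel] g' by simp
  show "integrable lebesgue g \<longleftrightarrow> integrable lborel g'"
    using integrable_cong_AE[OF gl g'l ae'] integrable_completion[of g' lborel] g' by simp
qed

lemma borel_measurable_vec_lambda:
  fixes g :: "'n::finite \<Rightarrow> 'a \<Rightarrow> real"
  assumes "\<And>j. g j \<in> borel_measurable M"
  shows "(\<lambda>x. \<chi> j. g j x) \<in> borel_measurable M"
proof -
  have "(\<lambda>x. (\<chi> j. g j x) \<bullet> b) \<in> borel_measurable M" if "b \<in> Basis" for b :: "real^'n"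
    using that assms by (auto simp: Basis_vec_def inner_axis)
  then show ?thesis by (simp add: borel_measurable_euclidean_space[of "\<lambda>x. \<chi> j. g j x"])
qed

lemma borel_version:
  fixes g :: "'a::euclidean_space \<Rightarrow> real^'n::finite"
  assumes "g \<in> borel_measurable lebesgue"
  shows "\<exists>g'. g' \<in> borel_measurable borel \<and> (AE x in lborel. g x = g' x)"
proof -
  have "\<exists>h. h \<in> borel_measurable lborel \<and> (AE x in lborel. g x $ j = h x)" for j
    using completion_ex_borel_measurable_real[OF measurable_compose[OF assms borel_measurable_nth[of j]]] by blast
  then obtain h where h: "\<And>j. h j \<in> borel_measurable lborel" "\<And>j. AE x in lborel. g x $ j = h j x" by metis
  have "AE x in lborel. \<forall>j. g x $ j = h j x" using h(2) by (simp add: AE_all_countable)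
  then have "AE x in lborel. g x = (\<chi> j. h j x)" by eventually_elim (simp add: vec_eq_iff)
  moreover have "(\<lambda>x. \<chi> j. h j x) \<in> borel_measurable lborel" by (rule borel_measurable_vec_lambda) (rule h)
  ultimately show ?thesis by (intro exI[of _ "\<lambda>x. \<chi> j. h j x"]) simp
qed

text \<open>Replacing a Borel version by 0 where the bound fails changes it on a null set only, and
  the bound then holds everywhere.\<close>

lemma bounded_borel_version:
  fixes g :: "'a::euclidean_space \<Rightarrow> real^'n::finite"
  assumes g: "g \<in> borel_measurable lebesgue" and b: "b \<in> borel_measurable borel" "\<And>x. 0 \<le> b x"
    and ae: "AE x in lebesgue. norm (g x) \<le> b x"
  obtains g' where "g' \<in> borel_measurable borel" "AE x in lborel. g x = g' x" "\<And>x. norm (g' x) \<le> b x"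
proof -
  obtain g0 where g0 [measurable]: "g0 \<in> borel_measurable borel" and e: "AE x in lborel. g x = g0 x" using borel_version[OF g] by blast
  note [measurable] = b(1)
  define g' where "g' x = (if norm (g0 x) \<le> b x then g0 x else 0)" for x
  have "g' \<in> borel_measurable borel" unfolding g'_def by measurable
  moreover have "AE x in lborel. g x = g' x"
    using e ae[unfolded AE_completion_iff] by eventually_elim (simp add: g'_def)
  moreover have "norm (g' x) \<le> b x" for x by (simp add: g'_def b)
  ultimately show ?thesis by (rule that)
qed

text \<open>Local integrability gives measurability of truncations only; f is their pointwise
  limit.\<close>

lemma L1_loc_measurable:
  fixes f :: "real^'n::finite \<Rightarrow> real^'n"
  assumes "L1_loc f"
  shows "f \<in> borel_measurable lebesgue"
proof (rule borel_measurable_LIMSEQ_metric)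
  show "(\<lambda>x. indicator (cball 0 (real m)) x *\<^sub>R f x) \<in> borel_measurable lebesgue" for m
    using assms unfolding L1_loc_def set_integrable_def by (auto dest!: spec[of _ "cball 0 (real m)"])
  fix x :: "real^'n"
  obtain m0 where m0: "norm x \<le> real m0" using real_arch_simple by blast
  have "eventually (\<lambda>m. indicator (cball 0 (real m)) x *\<^sub>R f x = f x) sequentially"
    using eventually_ge_at_top[of m0] by eventually_elim (use m0 in auto)
  then show "(\<lambda>m. indicator (cball 0 (real m)) x *\<^sub>R f x) \<longlonglongrightarrow> f x"
    by (rule tendsto_eventually)
qed

lemma loc_integrable_L2:
  assumes "L2_loc g" and g': "g' \<in> borel_measurable borel" and ae: "AE x in lborel. g x = (g' x :: real^'n::finite)"
  shows "loc_integrable (\<lambda>x. g' x $ j)"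
  unfolding loc_integrable_def
proof
  fix r :: real
  note [measurable] = g'
  have [measurable]: "(\<lambda>x. g' x $ j) \<in> borel_measurable borel" by (rule measurable_compose[OF g' borel_measurable_nth])
  have "integrable lebesgue (\<lambda>x. indicator (cball 0 r) x *\<^sub>R (norm (g x))\<^sup>2)"
    using assms(1) unfolding L2_loc_def set_integrable_def by auto
  moreover have e: "AE x in lborel. indicator (cball 0 r) x *\<^sub>R (norm (g x))\<^sup>2 = indicator (cball 0 r) x *\<^sub>R (norm (g' x))\<^sup>2"
    using ae by eventually_elim simp
  moreover have m: "(\<lambda>x. indicator (cball 0 r) x *\<^sub>R (norm (g' x))\<^sup>2) \<in> borel_measurable borel"
    by (intro borel_measurable_scaleR borel_measurable_indicator borel_closed closed_cball) measurable
  ultimately have i: "integrable lborel (\<lambda>x. indicator (cball 0 r) x *\<^sub>R (norm (g' x))\<^sup>2)"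
    using integrable_lebesgue_lborel[OF m e] by blast
  have i1: "integrable lborel (indicator (cball (0::real^'n) r) :: _ \<Rightarrow> real)"
    using emeasure_lborel_cball_finite[of "0::real^'n" r] by (intro integrable_real_indicator) auto
  show "integrable lborel (\<lambda>x. indicator (cball 0 r) x * g' x $ j)"
  proof (rule integral_le_bound(1))
    show "integrable lborel (\<lambda>x. indicator (cball 0 r) x + indicator (cball 0 r) x *\<^sub>R (norm (g' x))\<^sup>2)"
      by (intro Bochner_Integration.integrable_add i i1)
    have "\<bar>t\<bar> \<le> 1 + t\<^sup>2" for t :: real
      using zero_le_power2[of "\<bar>t\<bar> - 1"] unfolding power2_diff by simp
    then have "\<bar>g' x $ j\<bar> \<le> 1 + (norm (g' x))\<^sup>2" for x
      using component_le_norm_cart[of "g' x" j] by (metis abs_norm_cancel order_trans)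
    then show "AE x in lborel. \<bar>indicator (cball 0 r) x * g' x $ j\<bar> \<le> indicator (cball 0 r) x + indicator (cball 0 r) x *\<^sub>R (norm (g' x))\<^sup>2"
      by (intro AE_I2) (simp add: indicator_def)
    show "(\<lambda>x. indicator (cball 0 r) x * g' x $ j) \<in> borel_measurable lborel"
      unfolding measurable_lborel1 by (intro borel_measurable_times borel_measurable_indicator borel_closed closed_cball) measurable
  qed
qed

lemma integrable_vec:
  fixes g :: "'a \<Rightarrow> real^'n::finite"
  assumes "g \<in> borel_measurable M" "\<And>j. integrable M (\<lambda>x. g x $ j)"
  shows "integrable M g"
proof (rule Bochner_Integration.integrable_bound)
  show "integrable M (\<lambda>x. \<Sum>j\<in>UNIV. \<bar>g x $ j\<bar>)" using assms(2) by (intro Bochner_Integration.integrable_sum integrable_abs)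
  show "AE x in M. norm (g x) \<le> norm (\<Sum>j\<in>UNIV. \<bar>g x $ j\<bar>)"
    by (intro AE_I2) (use norm_le_l1_cart in \<open>auto intro: order_trans\<close>)
qed fact

lemma integral_vec_nth:
  fixes g :: "'a \<Rightarrow> real^'n::finite"
  assumes "integrable M g"
  shows "(\<integral>x. g x \<partial>M) $ j = (\<integral>x. g x $ j \<partial>M)"
  using integral_bounded_linear[OF bounded_linear_vec_nth assms, of j] by simp

text \<open>Subtracting c N N from every diagonal coefficient changes the full sum by c N N times
  the trace of t, which is 0, and it makes the (N, N) summand vanish.\<close>

lemma sum_offdiagonal_coeff:
  fixes N :: "'n::finite" and t c :: "'n \<Rightarrow> 'n \<Rightarrow> real"
  assumes tr: "(\<Sum>j\<in>UNIV. t j j) = 0"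
  shows "(\<Sum>(k, j)\<in>UNIV - {(N, N)}. t j k * (if j \<noteq> k then c j k else c j j - c N N)) = (\<Sum>j\<in>UNIV. \<Sum>k\<in>UNIV. t j k * c j k)"
proof -
  have "(\<Sum>(k, j)\<in>UNIV - {(N, N)}. t j k * (if j \<noteq> k then c j k else c j j - c N N)) =
    (\<Sum>(k, j)\<in>UNIV. t j k * (if j \<noteq> k then c j k else c j j - c N N))"
    by (rule sum.mono_neutral_left) auto
  also have "\<dots> = (\<Sum>k\<in>UNIV. \<Sum>j\<in>UNIV. t j k * (if j \<noteq> k then c j k else c j j - c N N))"
    by (simp add: UNIV_Times_UNIV[symmetric] sum.cartesian_product del: UNIV_Times_UNIV)
  also have "\<dots> = (\<Sum>j\<in>UNIV. \<Sum>k\<in>UNIV. t j k * (if j \<noteq> k then c j k else c j j - c N N))" by (rule sum.swap)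
  also have "\<dots> = (\<Sum>j\<in>UNIV. \<Sum>k\<in>UNIV. t j k * c j k - kd j k * (t j k * c N N))"
    by (intro sum.cong refl) (simp add: kd_def algebra_simps)
  also have "\<dots> = (\<Sum>j\<in>UNIV. \<Sum>k\<in>UNIV. t j k * c j k) - (\<Sum>j\<in>UNIV. t j j) * c N N"
    by (simp add: sum_subtractf sum_distrib_right)
  finally show ?thesis using tr by simp
qed

text \<open>The weak formulation is transported to the Borel representatives integral by integral,
  each integrand changing on a null set only; the locale then yields the representation.\<close>

lemma reduction_to_integral_equation:
  fixes u f :: "real^'n::finite \<Rightarrow> real^'n"
  assumes n: "3 \<le> CARD('n)" and a: "real CARD('n) + 1 < a" and \<epsilon>: "0 < \<epsilon>"
    and ws: "weak_solution f u"
    and um: "u' \<in> borel_measurable borel" and ue: "AE x in lborel. u x = u' x"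
    and fm: "f' \<in> borel_measurable borel" and fe: "AE x in lborel. f x = f' x"
    and ub: "\<And>x. norm (u' x) \<le> \<epsilon> * bracket x powr (1 - real CARD('n))"
    and fb: "\<And>x. norm (f' x) \<le> \<epsilon> * bracket x powr - a"
  shows "integral_solution f' u'"
proof -
  let ?n = "real CARD('n)"
  note [measurable] = um fm
  obtain D where W: "W12_loc_deriv u D" and div: "AE x in lebesgue. (\<Sum>k\<in>UNIV. D k x $ k) = 0"
    and weak: "\<And>\<phi> :: real^'n \<Rightarrow> real^'n. test_function \<phi> \<Longrightarrow> (\<forall>x. (\<Sum>k\<in>UNIV. partial_deriv k \<phi> x $ k) = 0) \<Longrightarrow>
         (LINT x|lebesgue. (\<Sum>k\<in>UNIV. D k x \<bullet> partial_deriv k \<phi> x))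
         + (LINT x|lebesgue. (\<Sum>k\<in>UNIV. u x $ k *\<^sub>R D k x) \<bullet> \<phi> x)
         = (LINT x|lebesgue. f x \<bullet> \<phi> x)"
    using ws unfolding weak_solution_def by blast
  have D2: "L2_loc (D k)" and wd: "weak_partial_deriv k u (D k)" for k
    using W unfolding W12_loc_deriv_def by auto
  have "\<forall>k. \<exists>D'. D' \<in> borel_measurable borel \<and> (AE x in lborel. D k x = D' x)"
    using borel_version D2 unfolding L2_loc_def by blast
  then obtain D' where D'm [measurable]: "\<And>k. D' k \<in> borel_measurable borel" and De: "\<And>k. AE x in lborel. D k x = D' k x" by metis
  have Dall: "AE x in lborel. \<forall>k. D k x = D' k x" using De by (simp add: AE_all_countable)
  have b1: "bracket x powr (1 - ?n) \<le> 1" "bracket x powr - a \<le> 1" for x :: "real^'n"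
    using bracket_ge_1[of x] n a powr_mono2'[of "1 - ?n" 1 "bracket x"] powr_mono2'[of "- a" 1 "bracket x"] by auto
  have ub1: "norm (u' x) \<le> \<epsilon>" for x
    using order_trans[OF ub[of x] mult_left_mono[OF b1(1), of \<epsilon>]] \<epsilon> by simp
  have fb1: "norm (f' x) \<le> \<epsilon>" for x
    using order_trans[OF fb[of x] mult_left_mono[OF b1(2), of \<epsilon>]] \<epsilon> by simp
  have f'i: "integrable lborel f'"
  proof (rule Bochner_Integration.integrable_bound)
    show "integrable lborel (\<lambda>x::real^'n. \<epsilon> * bracket x powr - a)"
      using a by (intro integrable_mult_right integrable_bracket_powr) auto
    show "AE x in lborel. norm (f' x) \<le> norm (\<epsilon> * bracket x powr - a)"
      using fb \<epsilon> by (intro AE_I2) (simp add: abs_mult)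
  qed measurable
  have Dloc: "loc_integrable (\<lambda>x. D' k x $ j)" for k j
    by (rule loc_integrable_L2[OF D2 D'm De])
  interpret S: weak_ns_decay u' f' D' \<epsilon> \<epsilon> \<epsilon> "(2 - ?n) / 2"
  proof unfold_locales
    show "CARD('n) \<ge> 3" by (rule n)
    show "u' \<in> borel_measurable borel" "\<And>k. D' k \<in> borel_measurable borel" by measurable
    show "norm (u' x) \<le> \<epsilon>" "norm (f' x) \<le> \<epsilon>" "norm (u' x) \<le> \<epsilon> * bracket x powr (1 - ?n)" for x
      by (rule ub1 fb1 ub)+
    show "integrable lborel f'" by (rule f'i)
    show "loc_integrable (\<lambda>x. D' k x $ j)" for k j by (rule Dloc)
    show "AE x in lborel. (\<Sum>k\<in>UNIV. D' k x $ k) = 0"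
      using div[unfolded AE_completion_iff] Dall by eventually_elim simp
    show "(LBINT x. partial_deriv k \<phi> x * u' x $ j) = - (LBINT x. \<phi> x * D' k x $ j)" if \<phi>: "test_fn r \<phi>" for r \<phi> k j
    proof -
      have [measurable]: "\<phi> \<in> borel_measurable borel" "partial_deriv k \<phi> \<in> borel_measurable borel"
        using test_fn_continuous[OF \<phi>] test_fn_continuous[OF test_fn_partial[OF \<phi>]] by (auto intro: borel_measurable_continuous_onI)
      have 1: "(LINT x|lebesgue. partial_deriv k \<phi> x *\<^sub>R u x) = (LBINT x. partial_deriv k \<phi> x *\<^sub>R u' x)"
        by (rule integral_lebesgue_lborel) (measurable, use ue in \<open>eventually_elim, simp\<close>)
      have 2: "(LINT x|lebesgue. \<phi> x *\<^sub>R D k x) = (LBINT x. \<phi> x *\<^sub>R D' k x)"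
        by (rule integral_lebesgue_lborel) (measurable, use De[of k] in \<open>eventually_elim, simp\<close>)
      have i1: "integrable lborel (\<lambda>x. partial_deriv k \<phi> x *\<^sub>R u' x)"
      proof (rule Bochner_Integration.integrable_bound)
        show "integrable lborel (\<lambda>x. partial_deriv k \<phi> x * \<epsilon>)"
          using test_fn_integrable[OF test_fn_partial[OF \<phi>, of k]] by simp
        show "AE x in lborel. norm (partial_deriv k \<phi> x *\<^sub>R u' x) \<le> norm (partial_deriv k \<phi> x * \<epsilon>)"
          using ub1 \<epsilon> by (intro AE_I2) (simp add: abs_mult mult_left_mono)
      qed measurable
      have i2: "integrable lborel (\<lambda>x. \<phi> x *\<^sub>R D' k x)"
      proof (rule integrable_vec)
        show "integrable lborel (\<lambda>x. (\<phi> x *\<^sub>R D' k x) $ j)" for j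
          using loc_integrable_mult[OF Dloc test_fn_continuous[OF \<phi>], of r] \<phi> by (simp add: test_fn_def)
      qed measurable
      have "(LBINT x. partial_deriv k \<phi> x *\<^sub>R u' x) = - (LBINT x. \<phi> x *\<^sub>R D' k x)"
        using wd[of k, unfolded weak_partial_deriv_def, rule_format, OF test_fn_test_function[OF \<phi>]] unfolding 1 2 .
      then have "(LBINT x. partial_deriv k \<phi> x *\<^sub>R u' x) $ j = - ((LBINT x. \<phi> x *\<^sub>R D' k x) $ j)" by simp
      then show ?thesis unfolding integral_vec_nth[OF i1] integral_vec_nth[OF i2] by simp
    qed
    show "(LBINT x. (\<Sum>k\<in>UNIV. D' k x \<bullet> partial_deriv k \<phi> x)) + (LBINT x. (\<Sum>k\<in>UNIV. u' x $ k *\<^sub>R D' k x) \<bullet> \<phi> x) = (LBINT x. f' x \<bullet> \<phi> x)"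
      if \<phi>: "\<And>j. test_fn r (\<lambda>x. \<phi> x $ j)" and dv: "\<forall>x. (\<Sum>k\<in>UNIV. partial_deriv k \<phi> x $ k) = 0" for r and \<phi> :: "real^'n \<Rightarrow> real^'n"
    proof -
      have tf: "test_function \<phi>"
      proof (rule test_function_vec[of _ r 0])
        show "smooth_alg (\<lambda>x. \<phi> x $ j)" for j using \<phi>[of j] by (simp add: test_fn_def)
        show "\<phi> x = 0" if "r < norm (x - 0)" for x
          using \<phi> that by (simp add: test_fn_def vec_eq_iff)
      qed
      have [measurable]: "\<phi> \<in> borel_measurable borel"
        using borel_measurable_vec_lambda[of "\<lambda>j x. \<phi> x $ j" borel] test_fn_continuous[OF \<phi>] by (auto intro: borel_measurable_continuous_onI)
      have [measurable]: "partial_deriv k \<phi> \<in> borel_measurable borel" for k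
      proof -
        have "\<phi> differentiable (at x)" for x
          using \<phi> by (intro differentiable_vec smooth_alg_differentiable) (simp add: test_fn_def)
        then have "partial_deriv k \<phi> = (\<lambda>x. \<chi> j. partial_deriv k (\<lambda>y. \<phi> y $ j) x)"
          by (simp add: fun_eq_iff vec_eq_iff partial_deriv_component)
        then show ?thesis
          using test_fn_continuous[OF test_fn_partial[OF \<phi>]]
          by (simp add: borel_measurable_vec_lambda borel_measurable_continuous_onI)
      qed
      have [measurable]: "(\<lambda>x. u' x $ k) \<in> borel_measurable borel" for k by (rule measurable_compose[OF um borel_measurable_nth])
      have 1: "(LINT x|lebesgue. (\<Sum>k\<in>UNIV. D k x \<bullet> partial_deriv k \<phi> x)) = (LBINT x. (\<Sum>k\<in>UNIV. D' k x \<bullet> partial_deriv k \<phi> x))"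
        by (rule integral_lebesgue_lborel) (measurable, use Dall in \<open>eventually_elim, simp\<close>)
      have 2: "(LINT x|lebesgue. (\<Sum>k\<in>UNIV. u x $ k *\<^sub>R D k x) \<bullet> \<phi> x) = (LBINT x. (\<Sum>k\<in>UNIV. u' x $ k *\<^sub>R D' k x) \<bullet> \<phi> x)"
        by (rule integral_lebesgue_lborel) (measurable, use Dall ue in \<open>eventually_elim, simp\<close>)
      have 3: "(LINT x|lebesgue. f x \<bullet> \<phi> x) = (LBINT x. f' x \<bullet> \<phi> x)"
        by (rule integral_lebesgue_lborel) (measurable, use fe in \<open>eventually_elim, simp\<close>)
      show ?thesis using weak[OF tf dv] unfolding 1 2 3 .
    qed
  qed
  show ?thesis
    unfolding integral_solution_def
  proof
    fix i
    \<comment> \<open>The representation has its kernels at y - x. Passing to x - y leaves the even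
      kernel alone and reverses the odd one, hence the minus sign of the quadratic term.\<close>
    have flip: "stokeslet i j (y - x) = stokeslet i j (x - y)" "stokeslet_deriv i j k (y - x) = - stokeslet_deriv i j k (x - y)" for j k and x y :: "real^'n"
      using stokeslet_even[of i j "x - y"] stokeslet_deriv_odd[of i j k "x - y"] by simp_all
    show "AE x in lborel. stokes_const TYPE('n) * u' x $ i =
      (\<Sum>j\<in>UNIV. LBINT y. stokeslet i j (x - y) * f' y $ j)
      - (\<Sum>j\<in>UNIV. \<Sum>k\<in>UNIV. LBINT y. stokeslet_deriv i j k (x - y) * (u' y $ k * u' y $ j))"
      using S.representation[of i, folded stokeslet_def stokeslet_deriv_def]
    proof eventually_elim
      case (elim x)
      then show ?case unfolding flip[where x = x] stokes_const_def by (simp add: sum_negf)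
    qed
  qed
qed

lemma weak_solution_expansion:
  fixes N :: "'n::finite"
  assumes n: "CARD('n) \<ge> 3" and a: "real CARD('n) + 1 < a"
  shows "\<exists>C. \<forall>\<epsilon> (u :: real^'n \<Rightarrow> real^'n) (f :: real^'n \<Rightarrow> real^'n).
    0 < \<epsilon> \<longrightarrow> \<epsilon> \<le> 1 \<longrightarrow>
    weak_solution f u \<longrightarrow>
    (AE x in lebesgue. norm (f x) \<le> \<epsilon> * bracket x powr (- a)) \<longrightarrow>
    (LINT x|lebesgue. f x) = 0 \<longrightarrow>
    (AE x in lebesgue. norm (u x) \<le> \<epsilon> * bracket x powr (1 - real CARD('n))) \<longrightarrow>
    (\<forall>i. AE x in lebesgue. norm x \<ge> 1 \<longrightarrow>
      \<bar>u x $ i - (\<Sum>(k, j) \<in> UNIV - {(N, N)}. Phi j k i x * coeff_a N f u j k)\<bar>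
        \<le> C * (\<epsilon> * decay a x))"
proof -
  let ?n = "real CARD('n)" and ?M = "stokes_const TYPE('n)"
  obtain C where C: "\<forall>\<epsilon> (u :: real^'n \<Rightarrow> real^'n) f. 0 < \<epsilon> \<longrightarrow> \<epsilon> \<le> 1 \<longrightarrow>
    u \<in> borel_measurable borel \<longrightarrow> f \<in> borel_measurable borel \<longrightarrow>
    (\<forall>x. norm (u x) \<le> \<epsilon> * bracket x powr (1 - ?n)) \<longrightarrow>
    (\<forall>x. norm (f x) \<le> \<epsilon> * bracket x powr - a) \<longrightarrow>
    (\<forall>j. (LBINT y. f y $ j) = 0) \<longrightarrow> integral_solution f u \<longrightarrow>
    (\<forall>i. AE x in lborel. 1 \<le> norm x \<longrightarrow> \<bar>u x $ i - profile f u i x\<bar> \<le> C * \<epsilon> * decay a x)"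
    using asymptotic_expansion[OF n a] by (elim exE)
  have main: "AE x in lebesgue. norm x \<ge> 1 \<longrightarrow>
      \<bar>u x $ i - (\<Sum>(k, j) \<in> UNIV - {(N, N)}. Phi j k i x * coeff_a N f u j k)\<bar> \<le> C * (\<epsilon> * decay a x)"
    if \<epsilon>: "0 < \<epsilon>" "\<epsilon> \<le> 1" and ws: "weak_solution f u"
      and fb: "AE x in lebesgue. norm (f x) \<le> \<epsilon> * bracket x powr (- a)" and f0: "(LINT x|lebesgue. f x) = 0"
      and ub: "AE x in lebesgue. norm (u x) \<le> \<epsilon> * bracket x powr (1 - ?n)" for \<epsilon> i and u f :: "real^'n \<Rightarrow> real^'n"
  proof -
    have um: "u \<in> borel_measurable lebesgue" and fm: "f \<in> borel_measurable lebesgue"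
      using ws L1_loc_measurable unfolding weak_solution_def W12_loc_deriv_def L2_loc_def by auto
    obtain u' where u': "u' \<in> borel_measurable borel" "AE x in lborel. u x = u' x" "\<And>x. norm (u' x) \<le> \<epsilon> * bracket x powr (1 - ?n)"
      by (rule bounded_borel_version[OF um _ _ ub]) (use \<epsilon> in auto)
    obtain f' where f': "f' \<in> borel_measurable borel" "AE x in lborel. f x = f' x" "\<And>x. norm (f' x) \<le> \<epsilon> * bracket x powr (- a)"
      by (rule bounded_borel_version[OF fm _ _ fb]) (use \<epsilon> in auto)
    have sol: "integral_solution f' u'"
      by (rule reduction_to_integral_equation[OF n a \<epsilon>(1) ws u'(1,2) f'(1,2) u'(3) f'(3)])
    have f'd: "decays (\<lambda>y. f' y $ j) \<epsilon> a" for j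
      unfolding decays_def using order_trans[OF component_le_norm_cart f'(3)] measurable_compose[OF f'(1) borel_measurable_nth] by auto
    have f'i: "integrable lborel f'"
      by (rule integrable_vec) (use f' a decays_integrable[OF f'd] in auto)
    have mean: "\<forall>j. (LBINT y. f' y $ j) = 0"
    proof
      fix j
      have "(LBINT y. f' y) = 0" using integral_lebesgue_lborel[OF f'(1,2)] f0 by simp
      then show "(LBINT y. f' y $ j) = 0" using integral_vec_nth[OF f'i, of j] by simp
    qed
    have [measurable]: "(\<lambda>x. u' x $ k) \<in> borel_measurable borel" "(\<lambda>x. f' x $ k) \<in> borel_measurable borel" "(\<lambda>x::real^'n. x $ k) \<in> borel_measurable borel" for k
      using measurable_compose[OF u'(1) borel_measurable_nth] measurable_compose[OF f'(1) borel_measurable_nth] borel_measurable_nth by auto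
    have uc: "\<bar>u' x $ k\<bar> \<le> \<epsilon> * bracket x powr (1 - ?n)" for x k using order_trans[OF component_le_norm_cart u'(3)] .
    have iuu: "integrable lborel (\<lambda>y. u' y $ k * u' y $ j)" for j k
    proof (rule decays_integrable)
      show "decays (\<lambda>y. u' y $ k * u' y $ j) (\<epsilon> * \<epsilon>) (2 * ?n - 2)"
        unfolding decays_def
      proof (intro conjI AE_I2)
        fix y :: "real^'n"
        have "\<bar>u' y $ k * u' y $ j\<bar> \<le> (\<epsilon> * bracket y powr (1 - ?n)) * (\<epsilon> * bracket y powr (1 - ?n))"
          unfolding abs_mult using \<epsilon> by (intro mult_mono uc) auto
        also have "\<dots> = (\<epsilon> * \<epsilon>) * bracket y powr ((1 - ?n) + (1 - ?n))" by (simp only: powr_add mult_ac)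
        finally show "\<bar>u' y $ k * u' y $ j\<bar> \<le> \<epsilon> * \<epsilon> * bracket y powr - (2 * ?n - 2)" by (simp add: algebra_simps)
      qed measurable
      show "?n < 2 * ?n - 2" using n by simp
    qed
    have iyf: "integrable lborel (\<lambda>y. y $ k * f' y $ j)" for j k
    proof (rule Bochner_Integration.integrable_bound)
      show "integrable lborel (\<lambda>y. norm y * f' y $ j)" using decays_moment_integrable[OF f'd, of 1 j] a by simp
      show "AE y in lborel. norm (y $ k * f' y $ j) \<le> norm (norm y * f' y $ j)"
        by (intro AE_I2) (simp add: abs_mult mult_right_mono component_le_norm_cart)
    qed measurable
    \<comment> \<open>Splitting the diagonal integrals into differences is legitimate because both
      products and first moments are integrable; the Bochner integral of a non-integrable function
      would be 0.\<close>
    have coeff: "coeff_a N f u j k = (if j \<noteq> k then full_coeff f' u' j k else full_coeff f' u' j j - full_coeff f' u' N N)" for j k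
    proof -
      have 1: "(LINT y|lebesgue. y $ k * f y $ j) = (LBINT y. y $ k * f' y $ j)" for j k
        by (rule integral_lebesgue_lborel) (measurable, use f'(2) in \<open>eventually_elim, simp\<close>)
      have 2: "(LINT y|lebesgue. u y $ j * u y $ k) = (LBINT y. u' y $ k * u' y $ j)" for j k
        by (rule integral_lebesgue_lborel) (measurable, use u'(2) in \<open>eventually_elim, simp\<close>)
      have 3: "(LINT y|lebesgue. y $ N * f y $ N - y $ j * f y $ j) = (LBINT y. y $ N * f' y $ N) - (LBINT y. y $ j * f' y $ j)" for j
        unfolding Bochner_Integration.integral_diff[OF iyf iyf, symmetric]
        by (rule integral_lebesgue_lborel) (measurable, use f'(2) in \<open>eventually_elim, simp\<close>)
      have 4: "(LINT y|lebesgue. (u y $ j)\<^sup>2 - (u y $ N)\<^sup>2) = (LBINT y. u' y $ j * u' y $ j) - (LBINT y. u' y $ N * u' y $ N)" for j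
        unfolding Bochner_Integration.integral_diff[OF iuu iuu, symmetric]
        by (rule integral_lebesgue_lborel) (measurable, use u'(2) in \<open>eventually_elim, simp add: power2_eq_square\<close>)
      show ?thesis unfolding coeff_a_def coeff_b_def full_coeff_def 1 2 3 4 by simp
    qed
    \<comment> \<open>At x = 0 the Lorentz tensor is not differentiated by the formula for
      \<open>Phi\<close>; the expansion is used for |x| \<ge> 1, so x \<noteq> 0 is
      harmless.\<close>
    have prof: "(\<Sum>(k, j) \<in> UNIV - {(N, N)}. Phi j k i x * coeff_a N f u j k) = profile f' u' i x" if "x \<noteq> 0" for x
    proof -
      have P: "Phi j k i x = stokeslet_deriv i j k x / ?M" for j k by (rule Phi_eq_stokeslet_deriv[OF n that])
      have "(\<Sum>j\<in>UNIV. stokeslet_deriv i j j x / ?M) = 0"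
        using stokeslet_deriv_div_free[of i x] by (simp add: sum_divide_distrib[symmetric])
      from sum_offdiagonal_coeff[where t = "\<lambda>j k. stokeslet_deriv i j k x / ?M" and c = "full_coeff f' u'" and N = N, OF this] show ?thesis
        unfolding P coeff profile_def by (simp add: sum_divide_distrib)
    qed
    have "AE x in lborel. 1 \<le> norm x \<longrightarrow> \<bar>u' x $ i - profile f' u' i x\<bar> \<le> C * \<epsilon> * decay a x"
      by (rule C[rule_format, OF \<epsilon> u'(1) f'(1) u'(3) f'(3) mean[rule_format] sol])
    then have "AE x in lborel. 1 \<le> norm x \<longrightarrow>
      \<bar>u x $ i - (\<Sum>(k, j) \<in> UNIV - {(N, N)}. Phi j k i x * coeff_a N f u j k)\<bar> \<le> C * (\<epsilon> * decay a x)"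
      using u'(2)
    proof eventually_elim
      case (elim x)
      then show ?case using prof[of x] by (cases "x = 0") (auto simp: mult.assoc)
    qed
    then show ?thesis by (rule AE_completion)
  qed
  show ?thesis
    by (rule exI[of _ C], intro allI impI) (rule main)
qed

theorem theorem4p8:
  fixes N :: "'n::finite"
  assumes "CARD('n) \<ge> 3"
  shows "\<exists>\<epsilon>0>0. \<forall>a>real CARD('n) + 1. \<exists>C R. \<forall>\<epsilon> (u :: real^'n \<Rightarrow> real^'n) (f :: real^'n \<Rightarrow> real^'n).
    0 < \<epsilon> \<longrightarrow> \<epsilon> \<le> \<epsilon>0 \<longrightarrow>
    weak_solution f u \<longrightarrow>
    (AE x in lebesgue. norm (f x) \<le> \<epsilon> * bracket x powr (- a)) \<longrightarrow>
    (LINT x|lebesgue. f x) = 0 \<longrightarrow>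
    (AE x in lebesgue. norm (u x) \<le> \<epsilon> * bracket x powr (1 - real CARD('n))) \<longrightarrow>
    (\<forall>i. AE x in lebesgue. norm x \<ge> R \<longrightarrow>
      \<bar>u x $ i - (\<Sum>(k, j) \<in> UNIV - {(N, N)}. Phi j k i x * coeff_a N f u j k)\<bar>
        \<le> C * (\<epsilon> * decay a x))"
\<comment> \<open>The value \<epsilon>0 = 1 serves every a; the radius R is 1 as well, while C
  depends on a.\<close>
proof (rule exI[of _ 1], rule conjI)
  show "(0::real) < 1" by simp
  show "\<forall>a>real CARD('n) + 1. \<exists>C R. \<forall>\<epsilon> (u :: real^'n \<Rightarrow> real^'n) (f :: real^'n \<Rightarrow> real^'n).
    0 < \<epsilon> \<longrightarrow> \<epsilon> \<le> 1 \<longrightarrow>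
    weak_solution f u \<longrightarrow>
    (AE x in lebesgue. norm (f x) \<le> \<epsilon> * bracket x powr (- a)) \<longrightarrow>
    (LINT x|lebesgue. f x) = 0 \<longrightarrow>
    (AE x in lebesgue. norm (u x) \<le> \<epsilon> * bracket x powr (1 - real CARD('n))) \<longrightarrow>
    (\<forall>i. AE x in lebesgue. norm x \<ge> R \<longrightarrow>
      \<bar>u x $ i - (\<Sum>(k, j) \<in> UNIV - {(N, N)}. Phi j k i x * coeff_a N f u j k)\<bar>
        \<le> C * (\<epsilon> * decay a x))"
    using weak_solution_expansion[OF assms, of _ N]
    by (intro allI impI) (drule meta_spec, drule meta_mp, assumption, elim exE, rule exI, rule exI[of _ 1], assumption)
qed

end
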